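(* Let $M\subset\mathbb{C}^3$ be a real-analytic hypersurface and $p_0\in M$. If $M$ is Levi degenerate at every point of an open neighborhood of $p_0$ in $M$ and $M$ is $2$-nondegenerate at $p_0$, then $(M,p_0)$ is biholomorphically equivalent to $(M',0)$, where $M'$ is a real-analytic hypersurface given near $0$, in coordinates $(z_1,z_2,w)$, by an equation of the form $$\operatorname{Im} w=|z_1|^2+(z_1^2\bar z_2+\bar z_1^2z_2)+O(|z|^4+|\operatorname{Re} w||z|^2).$$
   Context: Finite nondegeneracy: let $M\subset\mathbb{C}^N$ be a real-analytic hypersurface with local defining equation $\rho(Z,\bar Z)=0$ near $p_0\in M$, let $L_1,\dots,L_{N-1}$ be a basis of the CR (i.e. $(0,1)$) vector fields of $M$ near $p_0$, and write $L^\alpha=L_1^{\alpha_1}\cdots L_{N-1}^{\alpha_{N-1}}$ and $\rho_Z=\partial\rho/\partial Z$ (holomorphic gradient). $M$ is $k$-nondegenerate at $p_0$ if $k$ is the smallest positive integer with $\operatorname{span}\{L^\alpha\rho_Z(p_0,\bar p_0):|\alpha|\le k\}=\mathbb{C}^N$. $M$ is Levi degenerate at a point if its Levi form there has a zero eigenvalue (equivalently, $M$ is not $1$-nondegenerate there). $(M,p_0)$ and $(M',p_0')$ are biholomorphically equivalent if there is a germ at $p_0$ of a biholomorphic map $H$ with $H(p_0)=p_0'$ mapping $M$ into $M'$ near $p_0$. *)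

theory Defs
  imports "HOL-Analysis.Analysis" "HOL-Library.Landau_Symbols"
begin

section \<open>Real-analytic functions and hypersurfaces\<close>

text \<open>Expansion in the real coordinates given by \<^const>\<open>Basis\<close>; the series is indexed by
  multi-indices supported on \<^const>\<open>Basis\<close>, and \<^const>\<open>has_sum\<close> is unconditional convergence.\<close>

definition real_analytic_at ::
    "('a::euclidean_space \<Rightarrow> 'b::real_normed_vector) \<Rightarrow> 'a \<Rightarrow> bool" where
  "real_analytic_at f p \<longleftrightarrow>
     (\<exists>(c :: ('a \<Rightarrow> nat) \<Rightarrow> 'b) r. r > 0 \<and>
        (\<forall>x\<in>ball p r.
           ((\<lambda>\<alpha>. (\<Prod>b\<in>Basis. ((x - p) \<bullet> b) ^ \<alpha> b) *\<^sub>R c \<alpha>) has_sum f x)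
             {\<alpha>. \<forall>b. b \<notin> Basis \<longrightarrow> \<alpha> b = 0}))"

definition real_analytic_on ::
    "('a::euclidean_space \<Rightarrow> 'b::real_normed_vector) \<Rightarrow> 'a set \<Rightarrow> bool" where
  "real_analytic_on f S \<longleftrightarrow> (\<forall>p\<in>S. real_analytic_at f p)"

definition local_defining_function ::
    "(complex^'n) set \<Rightarrow> complex^'n \<Rightarrow> (complex^'n) set \<Rightarrow> (complex^'n \<Rightarrow> real) \<Rightarrow> bool" where
  "local_defining_function M p U \<rho> \<longleftrightarrow>
     open U \<and> p \<in> U \<and> real_analytic_on \<rho> U \<and>
     (\<forall>Z\<in>U. frechet_derivative \<rho> (at Z) \<noteq> (\<lambda>_. 0)) \<and>
     M \<inter> U = {Z\<in>U. \<rho> Z = 0}"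

definition real_analytic_hypersurface :: "(complex^'n) set \<Rightarrow> bool" where
  "real_analytic_hypersurface M \<longleftrightarrow> (\<forall>p\<in>M. \<exists>U \<rho>. local_defining_function M p U \<rho>)"

section \<open>Wirtinger derivatives\<close>

definition d_hol :: "'n \<Rightarrow> (complex^'n \<Rightarrow> complex) \<Rightarrow> complex^'n \<Rightarrow> complex" where
  "d_hol j f Z = (frechet_derivative f (at Z) (axis j 1)
                  - \<i> * frechet_derivative f (at Z) (axis j \<i>)) / 2"

definition d_bar :: "'n \<Rightarrow> (complex^'n \<Rightarrow> complex) \<Rightarrow> complex^'n \<Rightarrow> complex" where
  "d_bar j f Z = (frechet_derivative f (at Z) (axis j 1)
                  + \<i> * frechet_derivative f (at Z) (axis j \<i>)) / 2"

section \<open>Finite nondegeneracy\<close>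

text \<open>The vector field \<open>\<Sum>k. a\<^sub>k \<partial>/\<partial>Zbar\<^sub>k\<close> of type (0,1) is represented by its coefficient
  vector \<open>a\<close>.\<close>

definition field_apply ::
    "(complex^'n \<Rightarrow> complex^'n) \<Rightarrow> (complex^'n \<Rightarrow> complex) \<Rightarrow> complex^'n \<Rightarrow> complex" where
  "field_apply a f Z = (\<Sum>k\<in>UNIV. a Z $ k * d_bar k f Z)"

definition cr_space :: "(complex^'n \<Rightarrow> real) \<Rightarrow> complex^'n \<Rightarrow> (complex^'n) set" where
  "cr_space \<rho> Z = {v. (\<Sum>k\<in>UNIV. v $ k * d_bar k (\<lambda>Z. complex_of_real (\<rho> Z)) Z) = 0}"

definition cr_basis_near ::
    "(complex^'n) set \<Rightarrow> complex^'n \<Rightarrow> (complex^'n \<Rightarrow> real) \<Rightarrow>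
     (nat \<Rightarrow> complex^'n \<Rightarrow> complex^'n) \<Rightarrow> bool" where
  "cr_basis_near M p \<rho> L \<longleftrightarrow>
     (\<exists>V. open V \<and> p \<in> V \<and>
        (\<forall>j<CARD('n) - 1. real_analytic_on (L j) V) \<and>
        (\<forall>Z\<in>M \<inter> V.
           inj_on (\<lambda>j. L j Z) {..<CARD('n) - 1} \<and>
           vec.independent ((\<lambda>j. L j Z) ` {..<CARD('n) - 1}) \<and>
           vec.span ((\<lambda>j. L j Z) ` {..<CARD('n) - 1}) = cr_space \<rho> Z))"

text \<open>\<open>L\<^sub>0 ^ \<alpha>\<^sub>0 \<dots> L\<^sub>m ^ \<alpha>\<^sub>m\<close> with \<open>m = N - 2\<close>; the rightmost operator is applied first.\<close>

definition cr_monomial ::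
    "(nat \<Rightarrow> complex^'n \<Rightarrow> complex^'n) \<Rightarrow> (nat \<Rightarrow> nat) \<Rightarrow>
     (complex^'n \<Rightarrow> complex) \<Rightarrow> complex^'n \<Rightarrow> complex" where
  "cr_monomial L \<alpha> f = foldr (\<lambda>j. field_apply (L j) ^^ \<alpha> j) [0..<CARD('n) - 1] f"

definition gradients_span ::
    "(complex^'n \<Rightarrow> real) \<Rightarrow> (nat \<Rightarrow> complex^'n \<Rightarrow> complex^'n) \<Rightarrow> complex^'n \<Rightarrow> nat \<Rightarrow> bool" where
  "gradients_span \<rho> L p k \<longleftrightarrow>
     vec.span {\<chi> l. cr_monomial L \<alpha> (d_hol l (\<lambda>Z. complex_of_real (\<rho> Z))) p | \<alpha>.
                 (\<Sum>j<CARD('n) - 1. \<alpha> j) \<le> k} = UNIV"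

text \<open>The condition does not depend on the choice of \<open>\<rho>\<close> and \<open>L\<close>; the same holds for \<open>\<rho>\<close> in
  Levi degeneracy below.\<close>

definition nondegenerate_at :: "nat \<Rightarrow> (complex^'n) set \<Rightarrow> complex^'n \<Rightarrow> bool" where
  "nondegenerate_at k M p \<longleftrightarrow>
     (\<exists>U \<rho> L. local_defining_function M p U \<rho> \<and> cr_basis_near M p \<rho> L \<and>
        k > 0 \<and> gradients_span \<rho> L p k \<and>
        (\<forall>j. 0 < j \<and> j < k \<longrightarrow> \<not> gradients_span \<rho> L p j))"

section \<open>Levi form\<close>

definition hol_tangent_space :: "(complex^'n \<Rightarrow> real) \<Rightarrow> complex^'n \<Rightarrow> (complex^'n) set" where
  "hol_tangent_space \<rho> p = {v. (\<Sum>j\<in>UNIV. v $ j * d_hol j (\<lambda>Z. complex_of_real (\<rho> Z)) p) = 0}"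

definition levi_form ::
    "(complex^'n \<Rightarrow> real) \<Rightarrow> complex^'n \<Rightarrow> complex^'n \<Rightarrow> complex^'n \<Rightarrow> complex" where
  "levi_form \<rho> p v w =
     (\<Sum>j\<in>UNIV. \<Sum>k\<in>UNIV.
        d_hol j (d_bar k (\<lambda>Z. complex_of_real (\<rho> Z))) p * v $ j * cnj (w $ k))"

text \<open>Eigenvalues of the Levi form on the holomorphic tangent space, taken with respect to the
  standard Hermitian inner product.\<close>

definition levi_eigenvalue :: "(complex^'n \<Rightarrow> real) \<Rightarrow> complex^'n \<Rightarrow> complex \<Rightarrow> bool" where
  "levi_eigenvalue \<rho> p \<mu> \<longleftrightarrow>
     (\<exists>v\<in>hol_tangent_space \<rho> p. v \<noteq> 0 \<and>
        (\<forall>w\<in>hol_tangent_space \<rho> p.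
           levi_form \<rho> p v w = \<mu> * (\<Sum>j\<in>UNIV. v $ j * cnj (w $ j))))"

definition levi_degenerate_at :: "(complex^'n) set \<Rightarrow> complex^'n \<Rightarrow> bool" where
  "levi_degenerate_at M p \<longleftrightarrow>
     (\<exists>U \<rho>. local_defining_function M p U \<rho> \<and> levi_eigenvalue \<rho> p 0)"

section \<open>Biholomorphic equivalence\<close>

definition holomorphic_map_on :: "(complex^'n \<Rightarrow> complex^'m) \<Rightarrow> (complex^'n) set \<Rightarrow> bool" where
  "holomorphic_map_on H U \<longleftrightarrow>
     (\<forall>Z\<in>U. \<exists>D. (H has_derivative D) (at Z) \<and> (\<forall>c v. D (c *s v) = c *s D v))"

definition biholomorphically_equivalent ::
    "(complex^'n) set \<Rightarrow> complex^'n \<Rightarrow> (complex^'n) set \<Rightarrow> complex^'n \<Rightarrow> bool" where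
  "biholomorphically_equivalent M p M' p' \<longleftrightarrow>
     (\<exists>U V H G. open U \<and> open V \<and> p \<in> U \<and> homeomorphism U V H G \<and>
        holomorphic_map_on H U \<and> holomorphic_map_on G V \<and>
        H p = p' \<and> H ` (M \<inter> U) \<subseteq> M')"

end

theory Submission
  imports Defs "HOL-Complex_Analysis.Cauchy_Integral_Formula"
begin

text \<open>A holomorphic change of coordinates straightens a transversal real analytic curve of \<open>M\<close>
  through \<open>p0\<close> together with the complex tangent planes along it, so that \<open>M\<close> becomes a graph
  \<open>Im w = \<phi>(z, Re w)\<close> with \<open>\<phi> = O(|z|^2)\<close>. Let \<open>Q\<close> be the Hermitian part of \<open>\<phi>\<close> of order two and
  \<open>c(z; z', z'')\<close> the cubic part of type (1,2) at \<open>z = 0\<close>, \<open>Re w = 0\<close>. The determinant of the Levi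
  form vanishes identically on \<open>M\<close>. Its value at 0 and its first derivatives (its second ones if \<open>Q\<close>
  were 0) together with 2-nondegeneracy show that \<open>Q\<close> has rank one, that \<open>c(u; u, \<cdot>) = 0\<close> for a null
  vector \<open>u\<close> of \<open>Q\<close>, and that \<open>c(u; v, v) \<noteq> 0\<close> for \<open>v\<close> outside the null space. In the basis \<open>v, u\<close>,
  after rescaling, \<open>Q = \<plusminus>|z1|^2\<close> and \<open>c\<close> consists of the required term \<open>z2 cnj(z1)^2\<close> and of terms
  containing the factor \<open>z1\<close> of type (1,0). The latter are absorbed by a quadratic shift of \<open>z1\<close>, and the pure
  terms of order two and three by a change of \<open>w\<close>. The remainder is estimated by Taylor's formula
  and the mean value theorem in \<open>Re w\<close>.\<close>

section \<open>Holomorphic functions on complexified spaces\<close>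

text \<open>Analyticity is given by unordered power series, on which composition and implicit
  functions are awkward. It is translated at once into a holomorphic extension to the
  complexification, and back only for the new hypersurface and the remainder. The extension also
  makes the straightening possible: the curve and the slopes of its tangent planes depend on a real
  parameter, while a biholomorphic map needs them at complex \<open>w\<close>. The notions leave the
  defining function open. Levi degeneracy may use another one at each point, so it reaches the graph
  through the proportionality of gradients, and of Levi forms on tangent vectors, of two functions
  vanishing on \<open>M\<close>. Nondegeneracy is tested with arbitrary CR fields in the original
  coordinates; these fields are carried into the chart. The straightening kills the graph function
  and its gradient along the whole real \<open>w\<close>-axis and not only at 0. Hence no term
  linear in \<open>z\<close> with a factor \<open>Re w\<close> survives, which is the source of the
  error |Re w| |z|^2. A negative \<open>Q\<close> is harmless because \<open>w\<close> may be
  replaced by \<open>-w\<close>.\<close>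

definition dd :: "'a::real_normed_vector \<Rightarrow> ('a \<Rightarrow> complex) \<Rightarrow> 'a \<Rightarrow> complex" where
  "dd v F q = frechet_derivative F (at q) v"

text \<open>\<open>J\<close> is meant to be a complex structure, so that \<open>jhol J F S\<close> is holomorphy without coordinates.
  It is used with multiplication by \<open>\<i>\<close> on \<open>complex^'n\<close> and on complexifications of real spaces.\<close>

definition jhol :: "('a::real_normed_vector \<Rightarrow> 'a) \<Rightarrow> ('a \<Rightarrow> complex) \<Rightarrow> 'a set \<Rightarrow> bool" where
  "jhol J F S \<longleftrightarrow> (\<forall>q\<in>S. \<exists>D. (F has_derivative D) (at q) \<and> (\<forall>v. D (J v) = \<i> * D v))"

text \<open>The complex line through \<open>q\<close> in direction \<open>v\<close> for the
  structure \<open>J\<close>. Holomorphy in several variables is reduced to one variable along such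
  lines.\<close>

definition cline :: "('a::real_normed_vector \<Rightarrow> 'a) \<Rightarrow> 'a \<Rightarrow> 'a \<Rightarrow> complex \<Rightarrow> 'a" where
  "cline J q v \<zeta> = q + Re \<zeta> *\<^sub>R v + Im \<zeta> *\<^sub>R J v"

lemma dd_eqI: "(F has_derivative D) (at q) \<Longrightarrow> dd v F q = D v"
  unfolding dd_def using frechet_derivative_at by metis

lemma differentiable_dd:
  "F differentiable (at q) \<Longrightarrow> (F has_derivative (\<lambda>v. dd v F q)) (at q)"
  unfolding dd_def using frechet_derivative_works by metis

lemma jhol_has_derivative:
  assumes "jhol J F S" "q \<in> S"
  shows "(F has_derivative (\<lambda>v. dd v F q)) (at q)" "dd (J v) F q = \<i> * dd v F q"
proof -
  obtain D where D: "(F has_derivative D) (at q)" "\<And>v. D (J v) = \<i> * D v"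
    using assms unfolding jhol_def by blast
  have eq: "(\<lambda>v. dd v F q) = D" using dd_eqI[OF D(1)] by blast
  show "(F has_derivative (\<lambda>v. dd v F q)) (at q)" unfolding eq by (rule D(1))
  show "dd (J v) F q = \<i> * dd v F q" using D(2) dd_eqI[OF D(1)] by simp
qed

lemma jhol_subset: "jhol J F S \<Longrightarrow> T \<subseteq> S \<Longrightarrow> jhol J F T"
  unfolding jhol_def by blast

lemma jhol_continuous_on: "jhol J F S \<Longrightarrow> continuous_on S F"
  using jhol_has_derivative(1) has_derivative_continuous
  by (metis continuous_at_imp_continuous_on)

lemma cline_has_derivative:
  "(cline J q v has_derivative (\<lambda>h. Re h *\<^sub>R v + Im h *\<^sub>R J v)) (at \<zeta>)"
  unfolding cline_def by (auto intro!: derivative_eq_intros)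

lemma jhol_line:
  assumes "jhol J F S" "cline J q v \<zeta> \<in> S"
  shows "((\<lambda>\<zeta>. F (cline J q v \<zeta>)) has_field_derivative dd v F (cline J q v \<zeta>)) (at \<zeta>)"
proof -
  let ?p = "cline J q v \<zeta>"
  note d = jhol_has_derivative[OF assms]
  interpret bl: bounded_linear "\<lambda>v. dd v F ?p" using d(1) has_derivative_bounded_linear by blast
  have "((\<lambda>\<zeta>. F (cline J q v \<zeta>)) has_derivative (\<lambda>h. dd (Re h *\<^sub>R v + Im h *\<^sub>R J v) F ?p)) (at \<zeta>)"
    using has_derivative_compose[OF cline_has_derivative d(1)] by simp
  moreover have "dd (Re h *\<^sub>R v + Im h *\<^sub>R J v) F ?p = dd v F ?p * h" for h
    by (simp add: bl.add bl.scaleR d(2) scaleR_conv_of_real)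
       (metis complex_eq distrib_left mult.assoc mult.commute)
  ultimately show ?thesis by (simp add: has_field_derivative_def)
qed

section \<open>Cauchy's formula on complex lines\<close>

definition cwave :: "real \<Rightarrow> complex" where
  "cwave x = exp (2 * of_real pi * \<i> * of_real x)"

lemma norm_cwave [simp]: "norm (cwave x) = 1"
  by (simp add: cwave_def)

lemma cwave_nonzero [simp]: "cwave x \<noteq> 0"
  by (simp add: cwave_def)

lemma continuous_on_cwave [continuous_intros]:
  "continuous_on A f \<Longrightarrow> continuous_on A (\<lambda>x. cwave (f x))"
  unfolding cwave_def by (intro continuous_intros)

text \<open>\<open>jhol\<close> asks only for differentiability at each point. Writing a derivative
  as an average of values of \<open>F\<close> is what yields first the continuity and then the
  differentiability of that derivative.\<close>

lemma dd_Cauchy_integral: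
  assumes F: "jhol J F S" and \<rho>: "\<rho> > 0" and S: "\<And>\<zeta>. norm \<zeta> \<le> \<rho> \<Longrightarrow> cline J q v \<zeta> \<in> S"
  shows "dd v F q = integral {0..1} (\<lambda>x. F (cline J q v (of_real \<rho> * cwave x)) * inverse (cwave x)) / of_real \<rho>"
proof -
  let ?g = "\<lambda>\<zeta>. F (cline J q v \<zeta>)"
  have der: "(?g has_field_derivative dd v F (cline J q v \<zeta>)) (at \<zeta>)" if "norm \<zeta> \<le> \<rho>" for \<zeta>
    by (rule jhol_line[OF F S[OF that]])
  have cont: "continuous_on (cball 0 \<rho>) ?g"
    by (intro continuous_at_imp_continuous_on ballI DERIV_isCont[OF der]) auto
  have hol: "?g holomorphic_on ball 0 \<rho>"
    unfolding holomorphic_on_def field_differentiable_def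
    using der by (meson has_field_derivative_at_within less_imp_le mem_ball_0)
  have deriv: "deriv ?g 0 = dd v F q"
    using DERIV_imp_deriv[OF der[of 0]] \<rho> by (simp add: cline_def)
  have "contour_integral (circlepath 0 \<rho>) (\<lambda>u. ?g u / (u - 0)\<^sup>2) = (2 * pi * \<i>) * deriv ?g 0"
    by (rule Cauchy_contour_integral_circlepath_2[OF cont hol]) (use \<rho> in auto)
  moreover have "contour_integral (circlepath 0 \<rho>) (\<lambda>u. ?g u / (u - 0)\<^sup>2)
      = integral {0..1} (\<lambda>x. (2 * pi * \<i>) / of_real \<rho> * (?g (of_real \<rho> * cwave x) * inverse (cwave x)))"
    unfolding contour_integral_integral
  proof (rule integral_cong)
    fix x :: real assume "x \<in> {0..1}"
    show "?g (circlepath 0 \<rho> x) / (circlepath 0 \<rho> x - 0)\<^sup>2 * vector_derivative (circlepath 0 \<rho>) (at x)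
      = (2 * pi * \<i>) / of_real \<rho> * (?g (of_real \<rho> * cwave x) * inverse (cwave x))"
    proof -
      have c: "circlepath 0 \<rho> x = of_real \<rho> * cwave x"
        by (simp add: circlepath cwave_def)
      have d: "vector_derivative (circlepath 0 \<rho>) (at x) = 2 * pi * \<i> * \<rho> * cwave x"
        by (simp add: vector_derivative_circlepath cwave_def)
      show ?thesis unfolding c d using \<rho> by (simp add: field_simps power2_eq_square)
    qed
  qed
  ultimately have "(2 * pi * \<i>) * dd v F q
     = (2 * pi * \<i>) / of_real \<rho> * integral {0..1} (\<lambda>x. ?g (of_real \<rho> * cwave x) * inverse (cwave x))"
    using deriv by simp
  then show ?thesis using \<rho> by (simp add: field_simps)
qed

lemma cline_neighbourhood:
  assumes "open S" "q0 \<in> S"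
  obtains \<rho> d where "\<rho> > 0" "d > 0" "ball q0 d \<subseteq> S"
    "\<And>q \<zeta>. q \<in> ball q0 d \<Longrightarrow> norm \<zeta> \<le> \<rho> \<Longrightarrow> cline J q v \<zeta> \<in> S"
proof -
  obtain e where e: "e > 0" "ball q0 e \<subseteq> S" using assms open_contains_ball by blast
  define c where "c = norm v + norm (J v) + 1"
  have c: "c > 0" unfolding c_def by (simp add: add_nonneg_pos)
  show ?thesis
  proof (rule that[of "e / (2 * c)" "e / 2"])
    show "ball q0 (e/2) \<subseteq> S" using e by auto
    fix q \<zeta> assume q: "q \<in> ball q0 (e / 2)" and z: "norm (\<zeta>::complex) \<le> e / (2 * c)"
    have "norm (Re \<zeta> *\<^sub>R v + Im \<zeta> *\<^sub>R J v) \<le> \<bar>Re \<zeta>\<bar> * norm v + \<bar>Im \<zeta>\<bar> * norm (J v)"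
      by (rule order_trans[OF norm_triangle_ineq]) simp
    also have "\<dots> \<le> norm \<zeta> * norm v + norm \<zeta> * norm (J v)"
      by (intro add_mono mult_right_mono abs_Re_le_cmod abs_Im_le_cmod) auto
    also have "\<dots> \<le> norm \<zeta> * c" by (simp add: c_def algebra_simps)
    also have "\<dots> \<le> e / (2 * c) * c" by (rule mult_right_mono[OF z]) (use c in auto)
    also have "\<dots> = e / 2" using c by simp
    finally have le: "norm (Re \<zeta> *\<^sub>R v + Im \<zeta> *\<^sub>R J v) \<le> e / 2" .
    have "dist q0 (cline J q v \<zeta>) \<le> dist q0 q + dist q (cline J q v \<zeta>)" by (rule dist_triangle)
    also have "dist q (cline J q v \<zeta>) = norm (Re \<zeta> *\<^sub>R v + Im \<zeta> *\<^sub>R J v)"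
      unfolding cline_def by (metis add.assoc add_diff_cancel_left' dist_commute dist_norm)
    finally show "cline J q v \<zeta> \<in> S" using le q e by auto
  qed (use e c in auto)
qed

lemma continuous_on_cline:
  "continuous_on A f \<Longrightarrow> continuous_on A g \<Longrightarrow> continuous_on A (\<lambda>x. cline J (f x) v (g x))"
  unfolding cline_def by (intro continuous_intros)

lemma jhol_dd_isCont:
  fixes q0 :: "'a::euclidean_space"
  assumes F: "jhol J F S" and S: "open S" "q0 \<in> S"
  shows "isCont (dd v F) q0"
proof -
  obtain \<rho> d where \<rho>: "\<rho> > 0" "d > 0" "ball q0 d \<subseteq> S"
    and in_S: "\<And>q \<zeta>. q \<in> ball q0 d \<Longrightarrow> norm \<zeta> \<le> \<rho> \<Longrightarrow> cline J q v \<zeta> \<in> S"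
    using cline_neighbourhood[OF S] by metis
  let ?I = "\<lambda>q. integral (cbox 0 1) (\<lambda>x. F (cline J q v (of_real \<rho> * cwave x)) * inverse (cwave x)) / of_real \<rho>"
  have "continuous_on (ball q0 d \<times> cbox 0 1)
     (\<lambda>(q, x). F (cline J q v (of_real \<rho> * cwave x)) * inverse (cwave x))"
    unfolding split_beta
    apply (intro continuous_intros continuous_on_compose2[OF jhol_continuous_on[OF F]] continuous_on_cline)
    using \<rho> by (auto intro!: in_S simp: norm_mult)
  then have "continuous_on (ball q0 d) ?I"
    by (intro continuous_intros integral_continuous_on_param) (use \<rho> in auto)
  moreover have "?I q = dd v F q" if "q \<in> ball q0 d" for q
    using dd_Cauchy_integral[OF F \<rho>(1) in_S[OF that]] by (simp add: cbox_interval)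
  ultimately have "continuous_on (ball q0 d) (dd v F)"
    by (rule continuous_on_eq)
  then show ?thesis using \<rho> by (simp add: continuous_on_eq_continuous_at)
qed

lemma jhol_blinfun:
  fixes F :: "'a::euclidean_space \<Rightarrow> complex"
  assumes F: "jhol J F S" and S: "open S"
  obtains F' where "\<And>q. q \<in> S \<Longrightarrow> (F has_derivative blinfun_apply (F' q)) (at q)"
    "\<And>q v. q \<in> S \<Longrightarrow> blinfun_apply (F' q) v = dd v F q" "continuous_on S F'"
proof -
  define F' where "F' q = Blinfun (\<lambda>v. dd v F q)" for q
  have app: "blinfun_apply (F' q) = (\<lambda>v. dd v F q)" if "q \<in> S" for q
    unfolding F'_def
    by (rule bounded_linear_Blinfun_apply[OF has_derivative_bounded_linear[OF jhol_has_derivative(1)[OF F that]]])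
  show ?thesis
  proof (rule that[of F'])
    show "continuous_on S F'"
    proof (rule continuous_on_blinfun_componentwise)
      fix i :: 'a
      have "continuous_on S (\<lambda>q. dd i F q)"
        using jhol_dd_isCont[OF F S] by (intro continuous_at_imp_continuous_on) auto
      then show "continuous_on S (\<lambda>q. blinfun_apply (F' q) i)"
        by (rule continuous_on_eq) (use app in simp)
    qed
  qed (use app jhol_has_derivative(1)[OF F] in auto)
qed

lemma integral_blinfun_apply:
  assumes "f integrable_on S" shows "blinfun_apply (integral S f) h = integral S (\<lambda>x. blinfun_apply (f x) h)"
  using integral_linear[OF assms blinfun.bounded_linear_left, of h] by (simp add: o_def)

text \<open>Differentiation under the integral sign in Cauchy's formula; the continuous derivative
  that this requires comes from \<open>jhol_blinfun\<close>. The formula is kept explicit because it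
  shows both the complex linearity in \<open>h\<close> and the symmetry of second
  derivatives.\<close>

lemma jhol_dd_derivative:
  fixes F :: "'a::euclidean_space \<Rightarrow> complex"
  assumes F: "jhol J F S" and S: "open S" and q0: "q0 \<in> S"
  obtains \<rho> where "\<rho> > 0" "\<And>\<zeta>. norm \<zeta> \<le> \<rho> \<Longrightarrow> cline J q0 v \<zeta> \<in> S"
    "(dd v F has_derivative (\<lambda>h. integral {0..1}
        (\<lambda>x. dd h F (cline J q0 v (of_real \<rho> * cwave x)) * inverse (cwave x)) / of_real \<rho>)) (at q0)"
proof -
  obtain \<rho> d where \<rho>: "\<rho> > 0" "d > 0" "ball q0 d \<subseteq> S"
    and in_S: "\<And>q \<zeta>. q \<in> ball q0 d \<Longrightarrow> norm \<zeta> \<le> \<rho> \<Longrightarrow> cline J q v \<zeta> \<in> S"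
    using cline_neighbourhood[OF S q0] by metis
  obtain F' where F': "\<And>q. q \<in> S \<Longrightarrow> (F has_derivative blinfun_apply (F' q)) (at q)"
      "\<And>q v. q \<in> S \<Longrightarrow> blinfun_apply (F' q) v = dd v F q" "continuous_on S F'"
    using jhol_blinfun[OF F S] by metis
  define z where "z x = of_real \<rho> * cwave x" for x
  have nz: "norm (z x) \<le> \<rho>" for x using \<rho> by (simp add: z_def norm_mult)
  define f where "f q x = F (cline J q v (z x)) * inverse (cwave x)" for q x
  define fx where "fx q x = blinfun_mult_left (inverse (cwave x)) o\<^sub>L F' (cline J q v (z x))" for q x
  have fx_app: "blinfun_apply (fx q x) h = dd h F (cline J q v (z x)) * inverse (cwave x)"
    if "q \<in> ball q0 d" for q x h
    using F'(2)[OF in_S[OF that nz]] by (simp add: fx_def)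
  have cz: "continuous_on A g \<Longrightarrow> continuous_on A (\<lambda>y. z (g y))" for A and g :: "'a \<times> real \<Rightarrow> real"
    unfolding z_def by (intro continuous_intros)
  have cz': "continuous_on A z" for A
    unfolding z_def by (intro continuous_intros)
  have cont_fx: "continuous_on (ball q0 d \<times> cbox 0 1) (\<lambda>(q, x). fx q x)"
    unfolding fx_def split_beta
    by (intro bounded_bilinear.continuous_on[OF bounded_bilinear_blinfun_compose]
          bounded_linear.continuous_on[OF bounded_linear_blinfun_mult_left]
          continuous_on_compose2[OF F'(3)] continuous_on_cline continuous_intros cz)
       (auto intro!: in_S nz)
  have der: "((\<lambda>q. f q x) has_derivative blinfun_apply (fx q x)) (at q within ball q0 d)"
    if q: "q \<in> ball q0 d" for q x
  proof -
    have 1: "((\<lambda>q. cline J q v (z x)) has_derivative (\<lambda>h. h)) (at q within ball q0 d)"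
      unfolding cline_def by (auto intro!: derivative_eq_intros)
    have "((\<lambda>q. F (cline J q v (z x))) has_derivative (\<lambda>h. blinfun_apply (F' (cline J q v (z x))) h))
         (at q within ball q0 d)"
      using has_derivative_compose[OF 1 F'(1)[OF in_S[OF q nz]]] .
    then show ?thesis unfolding f_def fx_def
      by (auto intro!: derivative_eq_intros simp: fun_eq_iff)
  qed
  have int: "f q integrable_on cbox 0 1" if "q \<in> ball q0 d" for q
    unfolding f_def
    by (intro integrable_continuous continuous_intros continuous_on_compose2[OF jhol_continuous_on[OF F]]
          continuous_on_cline cz') (auto intro!: in_S nz that)
  have intx: "fx q0 integrable_on cbox 0 1"
    unfolding fx_def
    by (intro integrable_continuous bounded_bilinear.continuous_on[OF bounded_bilinear_blinfun_compose]
          bounded_linear.continuous_on[OF bounded_linear_blinfun_mult_left]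
          continuous_on_compose2[OF F'(3)] continuous_on_cline continuous_intros cz')
       (use \<rho> in \<open>auto intro!: in_S nz\<close>)
  have q0d: "q0 \<in> ball q0 d" using \<rho> by simp
  have "((\<lambda>q. integral (cbox 0 1) (f q)) has_derivative blinfun_apply (integral (cbox 0 1) (fx q0)))
      (at q0 within ball q0 d)"
    by (rule leibniz_rule[OF der int cont_fx q0d]) auto
  then have "((\<lambda>q. integral (cbox 0 1) (f q)) has_derivative blinfun_apply (integral (cbox 0 1) (fx q0))) (at q0)"
    using at_within_open[OF q0d] by simp
  moreover have "blinfun_apply (integral (cbox 0 1) (fx q0))
      = (\<lambda>h. integral {0..1} (\<lambda>x. dd h F (cline J q0 v (z x)) * inverse (cwave x)))"
    unfolding integral_blinfun_apply[OF intx] fx_app[OF q0d] by (simp add: cbox_interval)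
  ultimately have "((\<lambda>q. integral {0..1} (f q)) has_derivative
      (\<lambda>h. integral {0..1} (\<lambda>x. dd h F (cline J q0 v (z x)) * inverse (cwave x)))) (at q0)"
    by (simp add: cbox_interval)
  then have "((\<lambda>q. integral {0..1} (f q) / of_real \<rho>) has_derivative
      (\<lambda>h. integral {0..1} (\<lambda>x. dd h F (cline J q0 v (z x)) * inverse (cwave x)) / of_real \<rho>)) (at q0)"
    using \<rho> by (auto intro!: derivative_eq_intros)
  moreover have "integral {0..1} (f q) / of_real \<rho> = dd v F q" if "q \<in> ball q0 d" for q
    using dd_Cauchy_integral[OF F \<rho>(1) in_S[OF that]] by (simp add: f_def[abs_def] z_def)
  ultimately have "(dd v F has_derivative
      (\<lambda>h. integral {0..1} (\<lambda>x. dd h F (cline J q0 v (z x)) * inverse (cwave x)) / of_real \<rho>)) (at q0)"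
    by (rule has_derivative_transform_within_open[OF _ open_ball q0d])
  then show ?thesis
    using that[of \<rho>] \<rho>(1) in_S[OF q0d] unfolding z_def by blast
qed

lemma jhol_dd:
  fixes F :: "'a::euclidean_space \<Rightarrow> complex"
  assumes F: "jhol J F S" and S: "open S"
  shows "jhol J (dd v F) S"
  unfolding jhol_def
proof
  fix q0 assume "q0 \<in> S"
  then obtain \<rho> where \<rho>: "\<rho> > 0" and in_S: "\<And>\<zeta>. norm \<zeta> \<le> \<rho> \<Longrightarrow> cline J q0 v \<zeta> \<in> S"
    and D: "(dd v F has_derivative (\<lambda>h. integral {0..1}
        (\<lambda>x. dd h F (cline J q0 v (of_real \<rho> * cwave x)) * inverse (cwave x)) / of_real \<rho>)) (at q0)"
    using jhol_dd_derivative[OF F S] by blast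
  have "norm (of_real \<rho> * cwave x) \<le> \<rho>" for x using \<rho> by (simp add: norm_mult)
  then have "dd (J w) F (cline J q0 v (of_real \<rho> * cwave x)) = \<i> * dd w F (cline J q0 v (of_real \<rho> * cwave x))" for w x
    using jhol_has_derivative(2)[OF F in_S] by blast
  then show "\<exists>D. (dd v F has_derivative D) (at q0) \<and> (\<forall>w. D (J w) = \<i> * D w)"
    using D by (intro exI[of _ "\<lambda>h. integral {0..1}
        (\<lambda>x. dd h F (cline J q0 v (of_real \<rho> * cwave x)) * inverse (cwave x)) / of_real \<rho>"])
        (simp add: mult.assoc)
qed

text \<open>The derivative in direction \<open>w\<close> of the Cauchy integral for
  \<open>dd v F\<close> is the Cauchy integral of \<open>dd w F\<close> along \<open>v\<close>,
  which is the other iterated derivative.\<close>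

lemma dd_commute:
  fixes F :: "'a::euclidean_space \<Rightarrow> complex"
  assumes F: "jhol J F S" and S: "open S" and q: "q \<in> S"
  shows "dd w (dd v F) q = dd v (dd w F) q"
proof -
  obtain \<rho> where \<rho>: "\<rho> > 0" and in_S: "\<And>\<zeta>. norm \<zeta> \<le> \<rho> \<Longrightarrow> cline J q v \<zeta> \<in> S"
    and D: "(dd v F has_derivative (\<lambda>h. integral {0..1}
        (\<lambda>x. dd h F (cline J q v (of_real \<rho> * cwave x)) * inverse (cwave x)) / of_real \<rho>)) (at q)"
    using jhol_dd_derivative[OF F S q] by blast
  show ?thesis
    unfolding dd_eqI[OF D] using dd_Cauchy_integral[OF jhol_dd[OF F S] \<rho> in_S] by simp
qed

section \<open>Closure properties of holomorphy for a complex structure\<close>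

lemma jhol_const: "jhol J (\<lambda>_. c) S"
  unfolding jhol_def by (auto intro!: exI[of _ "\<lambda>_. 0"])

lemma jhol_add:
  assumes "jhol J F S" "jhol J G S" shows "jhol J (\<lambda>q. F q + G q) S"
  unfolding jhol_def
proof
  fix q assume q: "q \<in> S"
  show "\<exists>D. ((\<lambda>q. F q + G q) has_derivative D) (at q) \<and> (\<forall>v. D (J v) = \<i> * D v)"
    by (intro exI conjI allI,
        rule has_derivative_add[OF jhol_has_derivative(1)[OF assms(1) q] jhol_has_derivative(1)[OF assms(2) q]])
       (simp add: jhol_has_derivative(2)[OF assms(1) q] jhol_has_derivative(2)[OF assms(2) q] algebra_simps)
qed

lemma jhol_mult:
  assumes "jhol J F S" "jhol J G S" shows "jhol J (\<lambda>q. F q * G q) S"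
  unfolding jhol_def
proof
  fix q assume q: "q \<in> S"
  show "\<exists>D. ((\<lambda>q. F q * G q) has_derivative D) (at q) \<and> (\<forall>v. D (J v) = \<i> * D v)"
    by (intro exI conjI allI,
        rule has_derivative_mult[OF jhol_has_derivative(1)[OF assms(1) q] jhol_has_derivative(1)[OF assms(2) q]])
       (simp add: jhol_has_derivative(2)[OF assms(1) q] jhol_has_derivative(2)[OF assms(2) q] algebra_simps)
qed

lemma jhol_inverse:
  assumes "jhol J F S" "\<And>q. q \<in> S \<Longrightarrow> F q \<noteq> 0" shows "jhol J (\<lambda>q. inverse (F q)) S"
  unfolding jhol_def
proof
  fix q assume q: "q \<in> S"
  show "\<exists>D. ((\<lambda>q. inverse (F q)) has_derivative D) (at q) \<and> (\<forall>v. D (J v) = \<i> * D v)"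
    by (intro exI conjI allI,
        rule Deriv.has_derivative_inverse[OF assms(2)[OF q] jhol_has_derivative(1)[OF assms(1) q]])
       (simp add: jhol_has_derivative(2)[OF assms(1) q] algebra_simps)
qed

lemma jhol_compose:
  assumes F: "jhol J F S"
    and H: "\<And>q. q \<in> T \<Longrightarrow> H q \<in> S"
      "\<And>q. q \<in> T \<Longrightarrow> \<exists>D. (H has_derivative D) (at q) \<and> (\<forall>v. D (J' v) = J (D v))"
  shows "jhol J' (\<lambda>q. F (H q)) T"
  unfolding jhol_def
proof
  fix q assume q: "q \<in> T"
  obtain D where D: "(H has_derivative D) (at q)" "\<And>v. D (J' v) = J (D v)" using H(2)[OF q] by blast
  show "\<exists>D. ((\<lambda>q. F (H q)) has_derivative D) (at q) \<and> (\<forall>v. D (J' v) = \<i> * D v)"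
    by (intro exI conjI allI, rule has_derivative_compose[OF D(1) jhol_has_derivative(1)[OF F H(1)[OF q]]])
       (simp add: D(2) jhol_has_derivative(2)[OF F H(1)[OF q]])
qed

text \<open>The complexification of a real space \<open>'a\<close> is \<open>'a \<times> 'a\<close>, with \<open>(x, y)\<close> standing for
  \<open>x + \<i> y\<close>; \<open>cJ\<close> is multiplication by \<open>\<i>\<close>. Real analyticity is first handled as
  extendability to a holomorphic function of the complexification.\<close>

definition cJ :: "'a::real_normed_vector \<times> 'a \<Rightarrow> 'a \<times> 'a" where
  "cJ q = (- snd q, fst q)"

definition ranalytic :: "('a::euclidean_space \<Rightarrow> complex) \<Rightarrow> 'a \<Rightarrow> bool" where
  "ranalytic f p \<longleftrightarrow> (\<exists>F r. r > 0 \<and> jhol cJ F (ball (p, 0) r) \<and> (\<forall>x\<in>ball p r. F (x, 0) = f x))"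

lemma cJ_Pair [simp]: "cJ (x, y) = (- y, x)"
  by (simp add: cJ_def)

lemma dist_Pair0 [simp]: "dist (p, 0) (x, 0) = dist p x"
  by (simp add: dist_Pair_Pair)

lemma in_ball_Pair0: "(x, 0) \<in> ball (p, 0) r \<longleftrightarrow> x \<in> ball p r"
  by simp

lemma ranI:
  assumes "open S" "(p, 0) \<in> S" "jhol cJ F S" "\<And>x. (x, 0) \<in> S \<Longrightarrow> F (x, 0) = f x"
  shows "ranalytic f p"
proof -
  obtain r where r: "r > 0" "ball (p, 0) r \<subseteq> S" using assms(1,2) open_contains_ball by blast
  have "(x, 0) \<in> S" if "x \<in> ball p r" for x using that r in_ball_Pair0 by blast
  then show ?thesis unfolding ranalytic_def using r assms(4) jhol_subset[OF assms(3) r(2)] by blast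
qed

lemma ranalytic_extension:
  assumes "ranalytic f p"
  obtains F r where "r > 0" "jhol cJ F (ball (p, 0) r)" "\<And>x. x \<in> ball p r \<Longrightarrow> F (x, 0) = f x"
    "\<And>x. x \<in> ball p r \<Longrightarrow> (f has_derivative (\<lambda>v. dd v f x)) (at x)"
    "\<And>x v. x \<in> ball p r \<Longrightarrow> dd v f x = dd (v, 0) F (x, 0)"
proof -
  obtain F r where F: "r > 0" "jhol cJ F (ball (p, 0) r)" "\<And>x. x \<in> ball p r \<Longrightarrow> F (x, 0) = f x"
    using assms unfolding ranalytic_def by blast
  have *: "(f has_derivative (\<lambda>v. dd (v, 0) F (x, 0))) (at x)" if x: "x \<in> ball p r" for x
  proof -
    have "((\<lambda>x. F (x, 0)) has_derivative (\<lambda>v. dd (v, 0) F (x, 0))) (at x)"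
      by (rule has_derivative_compose[where f="\<lambda>x. (x, 0)", OF _ jhol_has_derivative(1)[OF F(2)]])
         (use x in \<open>auto intro!: derivative_eq_intros\<close>)
    then show ?thesis
      by (rule has_derivative_transform_within_open[OF _ open_ball x]) (use F in auto)
  qed
  have d: "dd v f x = dd (v, 0) F (x, 0)" if "x \<in> ball p r" for x v
    using dd_eqI[OF *[OF that]] .
  show ?thesis
    by (rule that[OF F _ d]) (use * d in simp_all)
qed

lemma ranalytic_has_derivative: "ranalytic f p \<Longrightarrow> (f has_derivative (\<lambda>v. dd v f p)) (at p)"
  by (elim ranalytic_extension) auto

lemma ranalytic_differentiable: "ranalytic f p \<Longrightarrow> f differentiable (at p)"
  using ranalytic_has_derivative differentiable_def by blast

lemma ranalytic_isCont: "ranalytic f p \<Longrightarrow> isCont f p"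
  using ranalytic_has_derivative has_derivative_continuous by blast

lemma ranalytic_nearby:
  assumes "ranalytic f p" obtains r where "r > 0" "\<And>x. x \<in> ball p r \<Longrightarrow> ranalytic f x"
proof -
  obtain F r where F: "r > 0" "jhol cJ F (ball (p, 0) r)" "\<And>x. x \<in> ball p r \<Longrightarrow> F (x, 0) = f x"
    using assms unfolding ranalytic_def by blast
  show ?thesis
    by (rule that[OF F(1)], rule ranI[OF open_ball _ F(2)]) (use F(3) in auto)
qed

lemma ranalytic_eventually:
  assumes "ranalytic f p" shows "eventually (ranalytic f) (nhds p)"
  using ranalytic_nearby[OF assms] unfolding eventually_nhds by (metis centre_in_ball open_ball)

lemma ranalytic_cong:
  assumes "ranalytic f p" "eventually (\<lambda>x. f x = g x) (nhds p)" shows "ranalytic g p"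
proof -
  obtain F r where F: "r > 0" "jhol cJ F (ball (p, 0) r)" "\<And>x. x \<in> ball p r \<Longrightarrow> F (x, 0) = f x"
    using assms unfolding ranalytic_def by blast
  obtain d where d: "d > 0" "\<And>x. x \<in> ball p d \<Longrightarrow> f x = g x"
    using assms(2) unfolding eventually_nhds_metric by (metis dist_commute mem_ball)
  show ?thesis
    by (rule ranI[of "ball (p, 0) (min r d)" _ F])
       (use F d in \<open>auto intro: jhol_subset\<close>)
qed

lemma dd_transform:
  assumes "eventually (\<lambda>x. f x = g x) (nhds p)" shows "dd v f p = dd v g p"
proof -
  obtain S where S: "open S" "p \<in> S" "\<And>x. x \<in> S \<Longrightarrow> f x = g x"
    using assms unfolding eventually_nhds by blast
  have "(f has_derivative D) (at p) \<longleftrightarrow> (g has_derivative D) (at p)" for D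
    using has_derivative_transform_within_open[OF _ S(1,2), of f D UNIV g]
      has_derivative_transform_within_open[OF _ S(1,2), of g D UNIV f] S(3) by auto
  then show ?thesis unfolding dd_def frechet_derivative_def by simp
qed

section \<open>Closure properties of real analyticity\<close>

lemma ranalytic_const [intro!, simp]: "ranalytic (\<lambda>_. c) p"
  by (rule ranI[of UNIV _ "\<lambda>_. c"]) (auto simp: jhol_const)

lemma ranalytic_bounded_linear:
  assumes "bounded_linear L" shows "ranalytic L p"
proof (rule ranI[of UNIV])
  interpret bounded_linear L by fact
  show "jhol cJ (\<lambda>q. L (fst q) + \<i> * L (snd q)) UNIV"
    unfolding jhol_def
  proof
    fix q :: "'a \<times> 'a"
    show "\<exists>D. ((\<lambda>q. L (fst q) + \<i> * L (snd q)) has_derivative D) (at q) \<and> (\<forall>v. D (cJ v) = \<i> * D v)"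
      by (intro exI[of _ "\<lambda>v. L (fst v) + \<i> * L (snd v)"])
         (auto intro!: derivative_eq_intros has_derivative simp: cJ_def neg algebra_simps)
  qed
  show "L (fst (x, 0)) + \<i> * L (snd (x, 0)) = L x" for x
    by (simp add: zero)
qed auto

lemma ranalytic_add [intro]: assumes "ranalytic f p" "ranalytic g p" shows "ranalytic (\<lambda>x. f x + g x) p"
proof -
  obtain F r where F: "r > 0" "jhol cJ F (ball (p, 0) r)" "\<And>x. x \<in> ball p r \<Longrightarrow> F (x, 0) = f x"
    using assms(1) unfolding ranalytic_def by blast
  obtain G s where G: "s > 0" "jhol cJ G (ball (p, 0) s)" "\<And>x. x \<in> ball p s \<Longrightarrow> G (x, 0) = g x"
    using assms(2) unfolding ranalytic_def by blast
  show ?thesis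
    by (rule ranI[of "ball (p, 0) r \<inter> ball (p, 0) s" _ "\<lambda>q. F q + G q"])
       (use F G in \<open>auto intro!: jhol_add intro: jhol_subset\<close>)
qed

lemma ranalytic_mult [intro]: assumes "ranalytic f p" "ranalytic g p" shows "ranalytic (\<lambda>x. f x * g x) p"
proof -
  obtain F r where F: "r > 0" "jhol cJ F (ball (p, 0) r)" "\<And>x. x \<in> ball p r \<Longrightarrow> F (x, 0) = f x"
    using assms(1) unfolding ranalytic_def by blast
  obtain G s where G: "s > 0" "jhol cJ G (ball (p, 0) s)" "\<And>x. x \<in> ball p s \<Longrightarrow> G (x, 0) = g x"
    using assms(2) unfolding ranalytic_def by blast
  show ?thesis
    by (rule ranI[of "ball (p, 0) r \<inter> ball (p, 0) s" _ "\<lambda>q. F q * G q"])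
       (use F G in \<open>auto intro!: jhol_mult intro: jhol_subset\<close>)
qed

lemma ranalytic_uminus [intro]: "ranalytic f p \<Longrightarrow> ranalytic (\<lambda>x. - f x) p"
  using ranalytic_mult[OF ranalytic_const[of "-1"]] by force

lemma ranalytic_diff [intro]: "ranalytic f p \<Longrightarrow> ranalytic g p \<Longrightarrow> ranalytic (\<lambda>x. f x - g x) p"
  using ranalytic_add[OF _ ranalytic_uminus, of f p g] by simp

lemma ranalytic_sum [intro]: "(\<And>i. i \<in> I \<Longrightarrow> ranalytic (f i) p) \<Longrightarrow> ranalytic (\<lambda>x. \<Sum>i\<in>I. f i x) p"
  by (induction I rule: infinite_finite_induct) auto

lemma ranalytic_power [intro]: "ranalytic f p \<Longrightarrow> ranalytic (\<lambda>x. f x ^ n) p"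
  by (induction n) auto

lemma ranalytic_inverse [intro]: assumes "ranalytic f p" "f p \<noteq> 0" shows "ranalytic (\<lambda>x. inverse (f x)) p"
proof -
  obtain F r where F: "r > 0" "jhol cJ F (ball (p, 0) r)" "\<And>x. x \<in> ball p r \<Longrightarrow> F (x, 0) = f x"
    using assms(1) unfolding ranalytic_def by blast
  define S where "S = {q \<in> ball (p, 0) r. F q \<in> - {0}}"
  have S: "open S" unfolding S_def
    using continuous_open_preimage[OF jhol_continuous_on[OF F(2)] open_ball, of "- {0}"]
    by (simp add: vimage_def Int_def open_Compl)
  show ?thesis
    by (rule ranI[OF S, of _ "\<lambda>q. inverse (F q)"])
       (use F assms(2) in \<open>auto intro!: jhol_inverse simp: S_def intro: jhol_subset\<close>)
qed

lemma ranalytic_divide [intro]: "ranalytic f p \<Longrightarrow> ranalytic g p \<Longrightarrow> g p \<noteq> 0 \<Longrightarrow> ranalytic (\<lambda>x. f x / g x) p"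
  using ranalytic_mult[OF _ ranalytic_inverse, of f p g] by (simp add: divide_inverse)

text \<open>The reflection (x, y) to (x, -y) anticommutes with \<open>cJ\<close> and conjugation of
  the value is antilinear, so the two cancel. On real points the new function is the conjugate of
  the old one.\<close>

lemma jhol_cnj:
  assumes F: "jhol cJ F (ball (p, 0) r)"
  shows "jhol cJ (\<lambda>q. cnj (F (fst q, - snd q))) (ball (p, 0) r)"
  unfolding jhol_def
proof
  fix q :: "'a \<times> 'a" assume q: "q \<in> ball (p, 0) r"
  have q': "(fst q, - snd q) \<in> ball (p, 0) r" using q
    by (cases q) (simp add: dist_norm norm_Pair)
  note d = jhol_has_derivative[OF F q']
  interpret bounded_linear "\<lambda>v. dd v F (fst q, - snd q)" using d(1) has_derivative_bounded_linear by blast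
  have 1: "((\<lambda>q. (fst q, - snd q)) has_derivative (\<lambda>v. (fst v, - snd v))) (at q)"
    by (auto intro!: derivative_eq_intros)
  have "((\<lambda>q. cnj (F (fst q, - snd q))) has_derivative (\<lambda>v. cnj (dd (fst v, - snd v) F (fst q, - snd q)))) (at q)"
    by (rule has_derivative_cnj[OF has_derivative_compose[OF 1 d(1)]])
  moreover have "cnj (dd (fst (cJ v), - snd (cJ v)) F (fst q, - snd q))
      = \<i> * cnj (dd (fst v, - snd v) F (fst q, - snd q))" for v
  proof -
    have "(fst (cJ v), - snd (cJ v)) = - cJ (fst v, - snd v)" by (simp add: cJ_def)
    then have "dd (fst (cJ v), - snd (cJ v)) F (fst q, - snd q) = - (\<i> * dd (fst v, - snd v) F (fst q, - snd q))"
      using d(2)[of "(fst v, - snd v)"] neg[of "cJ (fst v, - snd v)"] by metis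
    then show ?thesis by simp
  qed
  ultimately show "\<exists>D. ((\<lambda>q. cnj (F (fst q, - snd q))) has_derivative D) (at q) \<and> (\<forall>v. D (cJ v) = \<i> * D v)"
    by blast
qed

lemma ranalytic_cnj [intro]: assumes "ranalytic f p" shows "ranalytic (\<lambda>x. cnj (f x)) p"
proof -
  obtain F r where F: "r > 0" "jhol cJ F (ball (p, 0) r)" "\<And>x. x \<in> ball p r \<Longrightarrow> F (x, 0) = f x"
    using assms unfolding ranalytic_def by blast
  show ?thesis
    by (rule ranI[OF open_ball _ jhol_cnj[OF F(2)]]) (use F in auto)
qed

lemma ranalytic_of_real_Re [intro]: "ranalytic f p \<Longrightarrow> ranalytic (\<lambda>x. of_real (Re (f x))) p"
proof -
  have eq: "of_real (Re z) = (z + cnj z) / 2" for z by (simp add: complex_add_cnj)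
  show "ranalytic f p \<Longrightarrow> ?thesis" unfolding eq by (intro ranalytic_divide ranalytic_add ranalytic_cnj ranalytic_const) auto
qed

lemma ranalytic_of_real_Im [intro]: "ranalytic f p \<Longrightarrow> ranalytic (\<lambda>x. of_real (Im (f x))) p"
proof -
  have eq: "of_real (Im z) = of_real (Re (- \<i> * z))" for z by simp
  show "ranalytic f p \<Longrightarrow> ?thesis" unfolding eq by (intro ranalytic_of_real_Re ranalytic_mult ranalytic_const)
qed

lemma ranalytic_dd [intro]: assumes "ranalytic f p" shows "ranalytic (dd v f) p"
proof -
  obtain F r where F: "r > 0" "jhol cJ F (ball (p, 0) r)"
    "\<And>x v. x \<in> ball p r \<Longrightarrow> dd v f x = dd (v, 0) F (x, 0)"
    using ranalytic_extension[OF assms] by metis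
  show ?thesis
    by (rule ranI[OF open_ball _ jhol_dd[OF F(2) open_ball, of "(v, 0)"]]) (use F in auto)
qed

lemma ranalytic_dd_commute: assumes "ranalytic f p" shows "dd w (dd v f) p = dd v (dd w f) p"
proof -
  obtain F r where F: "r > 0" "jhol cJ F (ball (p, 0) r)"
    "\<And>x v. x \<in> ball p r \<Longrightarrow> dd v f x = dd (v, 0) F (x, 0)"
    using ranalytic_extension[OF assms] by metis
  have "dd w (dd v f) p = dd (w, 0) (dd (v, 0) F) (p, 0)" for v w
  proof -
    have 1: "((\<lambda>x. (x, 0)) has_derivative (\<lambda>v. (v, 0))) (at p)" by (auto intro!: derivative_eq_intros)
    have 2: "(dd (v, 0) F has_derivative (\<lambda>u. dd u (dd (v, 0) F) (p, 0))) (at (p, 0))"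
      by (rule jhol_has_derivative(1)[OF jhol_dd[OF F(2) open_ball]]) (use F in auto)
    have "((\<lambda>x. dd (v, 0) F (x, 0)) has_derivative (\<lambda>w. dd (w, 0) (dd (v, 0) F) (p, 0))) (at p)"
      by (rule has_derivative_compose[OF 1 2])
    then have "(dd v f has_derivative (\<lambda>w. dd (w, 0) (dd (v, 0) F) (p, 0))) (at p)"
      by (rule has_derivative_transform_within_open[OF _ open_ball[of p r]]) (use F in auto)
    then show ?thesis by (rule dd_eqI)
  qed
  then show ?thesis using dd_commute[OF F(2) open_ball, of "(p, 0)" "(w, 0)" "(v, 0)"] F(1) by simp
qed

lemma ranalytic_compose:
  fixes h :: "'a::euclidean_space \<Rightarrow> 'b::euclidean_space"
  assumes f: "ranalytic f (h p)" and h: "\<And>b. b \<in> Basis \<Longrightarrow> ranalytic (\<lambda>x. of_real (h x \<bullet> b)) p"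
  shows "ranalytic (\<lambda>x. f (h x)) p"
proof -
  obtain F R where F: "R > 0" "jhol cJ F (ball (h p, 0) R)" "\<And>x. x \<in> ball (h p) R \<Longrightarrow> F (x, 0) = f x"
    using f unfolding ranalytic_def by blast
  have "\<forall>b\<in>Basis. \<exists>F r. r > 0 \<and> jhol cJ F (ball (p, 0) r) \<and> (\<forall>x\<in>ball p r. F (x, 0) = of_real (h x \<bullet> b))"
    using h unfolding ranalytic_def by blast
  then obtain G r where G: "\<And>b. b \<in> Basis \<Longrightarrow> r b > 0" "\<And>b. b \<in> Basis \<Longrightarrow> jhol cJ (G b) (ball (p, 0) (r b))"
      "\<And>b x. b \<in> Basis \<Longrightarrow> x \<in> ball p (r b) \<Longrightarrow> G b (x, 0) = of_real (h x \<bullet> b)"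
    unfolding bchoice_iff by (metis (no_types, lifting))
  define d where "d = Min (r ` (Basis :: 'b set))"
  have d: "d > 0" unfolding d_def using G(1) by (subst Min_gr_iff) auto
  have dr: "d \<le> r b" if "b \<in> Basis" for b unfolding d_def using that by simp
  have GJ: "jhol cJ (G b) (ball (p, 0) d)" if "b \<in> Basis" for b
    using G(2)[OF that] dr[OF that] by (auto intro: jhol_subset)
  \<comment> \<open>The components of \<open>h\<close> are extended separately. The real and
    imaginary parts of the extensions are the two halves of a point of the complexified
    target.\<close>
  define H where "H q = (\<Sum>b\<in>Basis. Re (G b q) *\<^sub>R b, \<Sum>b\<in>Basis. Im (G b q) *\<^sub>R b)" for q
  have H: "\<exists>D. (H has_derivative D) (at q) \<and> (\<forall>v. D (cJ v) = cJ (D v))" if q: "q \<in> ball (p, 0) d" for q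
  proof (intro exI conjI allI)
    let ?D = "\<lambda>v. (\<Sum>b\<in>Basis. Re (dd v (G b) q) *\<^sub>R b, \<Sum>b\<in>Basis. Im (dd v (G b) q) *\<^sub>R b)"
    show "(H has_derivative ?D) (at q)" unfolding H_def
      by (intro has_derivative_Pair has_derivative_sum has_derivative_scaleR_left
            bounded_linear.has_derivative[OF bounded_linear_Re] bounded_linear.has_derivative[OF bounded_linear_Im]
            jhol_has_derivative(1)[OF GJ q])
    show "?D (cJ v) = cJ (?D v)" for v
      by (simp add: jhol_has_derivative(2)[OF GJ q] sum_negf)
  qed
  have H0: "H (x, 0) = (h x, 0)" if "x \<in> ball p d" for x
  proof -
    have "G b (x, 0) = of_real (h x \<bullet> b)" if "b \<in> Basis" for b
      using G(3)[OF that, of x] \<open>x \<in> ball p d\<close> dr[OF that] by auto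
    then show ?thesis by (simp add: H_def euclidean_representation)
  qed
  have contH: "continuous_on (ball (p, 0) d) H"
    using H has_derivative_continuous by (intro continuous_at_imp_continuous_on) blast
  define S where "S = {q \<in> ball (p, 0) d. H q \<in> ball (h p, 0) R}"
  have S: "open S" unfolding S_def
    using continuous_open_preimage[OF contH open_ball open_ball[of "(h p, 0)" R]]
    by (simp add: vimage_def Int_def)
  show ?thesis
  proof (rule ranI[OF S])
    show "(p, 0) \<in> S" using d H0[of p] F(1) by (simp add: S_def)
    show "jhol cJ (\<lambda>q. F (H q)) S"
      by (rule jhol_compose[OF F(2)]) (use H in \<open>auto simp: S_def\<close>)
    show "F (H (x, 0)) = f (h x)" if "(x, 0) \<in> S" for x
      using that H0[of x] F(3)[of "h x"] by (auto simp: S_def)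
  qed
qed

lemma ranalytic_compose_linear:
  fixes L :: "'a::euclidean_space \<Rightarrow> 'b::euclidean_space"
  assumes "ranalytic f (L p)" "bounded_linear L"
  shows "ranalytic (\<lambda>x. f (L x)) p"
proof (rule ranalytic_compose[where h=L, OF assms(1)])
  fix b :: 'b
  show "ranalytic (\<lambda>x. of_real (L x \<bullet> b)) p"
    by (intro ranalytic_bounded_linear bounded_linear_compose[OF bounded_linear_of_real]
          bounded_linear_compose[OF bounded_linear_inner_left] assms(2))
qed

text \<open>The extension is \<open>H (x + J y)\<close>: since \<open>J\<close> squares to -1, the
  map (x, y) to \<open>x + J y\<close> carries \<open>cJ\<close> to \<open>J\<close>, and it is the
  identity on real points.\<close>

lemma ranalytic_jhol:
  assumes H: "jhol J H S" and S: "open S" "p \<in> S" and J: "bounded_linear J" "\<And>y. J (J y) = - y"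
  shows "ranalytic H p"
proof -
  interpret J: bounded_linear J by fact
  have bl: "bounded_linear (\<lambda>q. fst q + J (snd q))"
    by (intro bounded_linear_add bounded_linear_fst bounded_linear_compose[OF J(1) bounded_linear_snd])
  define T where "T = (\<lambda>q. fst q + J (snd q)) -` S"
  have T: "open T" unfolding T_def
    by (intro open_vimage S linear_continuous_on[OF bl])
  show ?thesis
  proof (rule ranI[OF T])
    show "(p, 0) \<in> T" using S(2) by (simp add: T_def J.zero)
    show "jhol cJ (\<lambda>q. H (fst q + J (snd q))) T"
      by (rule jhol_compose[OF H])
         (auto simp: T_def cJ_def J.add J(2) J.neg intro!: exI[of _ "\<lambda>q. fst q + J (snd q)"]
            bounded_linear_imp_has_derivative[OF bl])
    show "H (fst (x, 0) + J (snd (x, 0))) = H x" for x by (simp add: J.zero)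
  qed
qed

text \<open>The complexification of the real line is the complex plane. In this form, functions of
  the real curve parameter are later evaluated at complex \<open>w\<close>.\<close>

lemma ranalytic_holomorphic_extension:
  fixes f :: "real \<Rightarrow> complex"
  assumes "ranalytic f 0"
  obtains g r where "r > 0" "g holomorphic_on ball 0 r" "\<And>s. \<bar>s\<bar> < r \<Longrightarrow> g (of_real s) = f s"
proof -
  obtain F r where F: "r > 0" "jhol cJ F (ball (0, 0) r)" "\<And>x. x \<in> ball 0 r \<Longrightarrow> F (x, 0) = f x"
    using assms unfolding ranalytic_def by blast
  show ?thesis
  proof (rule that[OF F(1)])
    have 1: "cline cJ (0, 0) (1, 0) \<zeta> = (Re \<zeta>, Im \<zeta>)" for \<zeta> by (simp add: cline_def)
    have "((\<lambda>\<zeta>. F (Re \<zeta>, Im \<zeta>)) has_field_derivative dd (1, 0) F (Re \<zeta>, Im \<zeta>)) (at \<zeta>)"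
      if "\<zeta> \<in> ball 0 r" for \<zeta>
      using jhol_line[OF F(2), of "(0,0)" "(1,0)" \<zeta>] that
      by (simp add: 1 norm_Pair[symmetric] dist_norm norm_complex_def[symmetric] norm_Pair)
    then show "(\<lambda>\<zeta>. F (Re \<zeta>, Im \<zeta>)) holomorphic_on ball 0 r"
      unfolding holomorphic_on_def field_differentiable_def
      by (meson has_field_derivative_at_within)
    show "F (Re (of_real s), Im (of_real s)) = f s" if "\<bar>s\<bar> < r" for s
      using F(3)[of s] that by simp
  qed
qed

section \<open>The implicit function theorem\<close>

text \<open>The inverse function theorem is applied to the map (q, t) to (q, F (q, t)), and the
  solution is the second component of the inverse at (q, 0). It is holomorphic because the inverse
  of a complex linear bijection is complex linear.\<close>

lemma jhol_implicit_function:
  fixes F :: "'a::euclidean_space \<times> complex \<Rightarrow> complex"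
  assumes F: "jhol (\<lambda>q. (J (fst q), \<i> * snd q)) F S" and S: "open S" "(q0, t0) \<in> S"
    and J: "bounded_linear J"
    and F0: "F (q0, t0) = 0" and c0: "dd (0, 1) F (q0, t0) \<noteq> 0"
  obtains N r \<tau> where "open N" "q0 \<in> N" "r > 0" "jhol J \<tau> N"
    "\<And>q. q \<in> N \<Longrightarrow> dist t0 (\<tau> q) < r"
    "\<And>q t. q \<in> N \<Longrightarrow> dist t0 t < r \<Longrightarrow> F (q, t) = 0 \<longleftrightarrow> t = \<tau> q"
proof -
  interpret J: bounded_linear J by fact
  define K where "K q = (J (fst q), \<i> * snd q)" for q :: "'a \<times> complex"
  have FK: "jhol K F S" using F unfolding K_def .
  define p0 where "p0 = (q0, t0)"
  have p0: "p0 \<in> S" using S by (simp add: p0_def)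
  obtain F' where F': "\<And>q. q \<in> S \<Longrightarrow> (F has_derivative blinfun_apply (F' q)) (at q)"
    "\<And>q v. q \<in> S \<Longrightarrow> blinfun_apply (F' q) v = dd v F q" "continuous_on S F'"
    using jhol_blinfun[OF FK S(1)] by metis
  define \<Psi> where "\<Psi> q = (fst q, F q)" for q
  define \<Psi>' where "\<Psi>' q = Blinfun (\<lambda>v. (fst v, blinfun_apply (F' q) v))" for q
  have \<Psi>'_app: "blinfun_apply (\<Psi>' q) = (\<lambda>v. (fst v, blinfun_apply (F' q) v))" for q
    unfolding \<Psi>'_def by (intro bounded_linear_Blinfun_apply bounded_linear_intros) 
  have cont: "continuous_on S \<Psi>'"
    by (rule continuous_on_blinfun_componentwise) (auto simp: \<Psi>'_app intro!: continuous_intros F'(3))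
  have der: "(\<Psi> has_derivative blinfun_apply (\<Psi>' q)) (at q)" if "q \<in> S" for q
    unfolding \<Psi>'_app \<Psi>_def by (auto intro!: derivative_eq_intros F'(1)[OF that])
  define c where "c = dd (0, 1) F p0"
  have c: "c \<noteq> 0" using c0 by (simp add: c_def p0_def)
  \<comment> \<open>Explicit inverse of the triangular map that sends (h, k) to (h, F'(h, 0) + c
    k).\<close>
  define inv0 where "inv0 = Blinfun (\<lambda>v. (fst v, (snd v - blinfun_apply (F' p0) (fst v, 0)) * inverse c))"
  have inv0_app: "blinfun_apply inv0 = (\<lambda>v. (fst v, (snd v - blinfun_apply (F' p0) (fst v, 0)) * inverse c))"
    unfolding inv0_def
    by (intro bounded_linear_Blinfun_apply bounded_linear_Pair bounded_linear_mult_const bounded_linear_sub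
         bounded_linear_fst bounded_linear_snd bounded_linear_compose[OF blinfun.bounded_linear_right]
         bounded_linear_zero)
  have second: "blinfun_apply (F' p0) (0, k) = k * c" for k
  proof -
    have "(0, k) = Re k *\<^sub>R (0::'a, 1) + Im k *\<^sub>R K (0, 1)"
      by (simp add: K_def J.zero complex_eq_iff)
    then have "blinfun_apply (F' p0) (0, k) = Re k *\<^sub>R dd (0, 1) F p0 + Im k *\<^sub>R dd (K (0, 1)) F p0"
      by (metis (no_types) F'(2)[OF p0] blinfun.add_right blinfun.scaleR_right)
    then show ?thesis
      using jhol_has_derivative(2)[OF FK p0] by (simp add: c_def complex_eq_iff algebra_simps)
  qed
  have inv: "inv0 o\<^sub>L \<Psi>' p0 = id_blinfun"
  proof (rule blinfun_eqI)
    fix v :: "'a \<times> complex"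
    obtain h k where v: "v = (h, k)" by (cases v)
    have "blinfun_apply (F' p0) (h, k) = blinfun_apply (F' p0) (h, 0) + blinfun_apply (F' p0) (0, k)"
      using blinfun.add_right[of "F' p0" "(h, 0)" "(0, k)"] by simp
    then show "blinfun_apply (inv0 o\<^sub>L \<Psi>' p0) v = blinfun_apply id_blinfun v"
      using c by (simp add: v inv0_app \<Psi>'_app second)
  qed
  obtain U V G G' where UV: "open U" "U \<subseteq> S" "p0 \<in> U" "open V" "\<Psi> p0 \<in> V" and hom: "homeomorphism U V \<Psi> G"
    and G: "\<And>y. y \<in> V \<Longrightarrow> (G has_derivative (G' y)) (at y)"
      "\<And>y. y \<in> V \<Longrightarrow> G' y = inv (blinfun_apply (\<Psi>' (G y)))"
      "\<And>y. y \<in> V \<Longrightarrow> bij (blinfun_apply (\<Psi>' (G y)))"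
    using inverse_function_theorem[OF S(1) der cont p0 inv] by metis
  define \<tau> where "\<tau> q = snd (G (q, 0))" for q
  have GU: "G y \<in> U" "\<Psi> (G y) = y" if "y \<in> V" for y using hom that by (auto simp: homeomorphism_def)
  have \<Psi>0: "\<Psi> p0 = (q0, 0)" by (simp add: \<Psi>_def p0_def F0)
  have Gp: "G (q, 0) = (q, \<tau> q)" "(q, \<tau> q) \<in> U" if "(q, 0) \<in> V" for q
    using GU[OF that] unfolding \<tau>_def \<Psi>_def by (metis fst_conv prod.collapse)+
  have unique: "F (q, t) = 0 \<longleftrightarrow> t = \<tau> q" if "(q, 0) \<in> V" "(q, t) \<in> U" for q t
  proof
    assume "F (q, t) = 0"
    then have "\<Psi> (q, t) = (q, 0)" by (simp add: \<Psi>_def)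
    then have "G (q, 0) = (q, t)" using hom that(2) unfolding homeomorphism_def by metis
    then show "t = \<tau> q" by (simp add: \<tau>_def)
  next
    assume "t = \<tau> q"
    then show "F (q, t) = 0" using GU(2)[OF that(1)] Gp[OF that(1)] by (simp add: \<Psi>_def)
  qed
  define N1 where "N1 = (\<lambda>q. (q, 0::complex)) -` V"
  have N1: "open N1" "q0 \<in> N1" using UV(4,5) \<Psi>0
    by (auto simp: N1_def intro!: open_vimage continuous_intros)
  have Jt: "jhol J \<tau> N1"
    unfolding jhol_def
  proof
    fix q assume "q \<in> N1"
    then have qV: "(q, 0) \<in> V" by (simp add: N1_def)
    have GS: "G (q, 0) \<in> S" using GU(1)[OF qV] UV(2) by blast
    have d: "(\<tau> has_derivative (\<lambda>h. snd (G' (q, 0) (h, 0)))) (at q)"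
      unfolding \<tau>_def
      by (intro has_derivative_snd has_derivative_compose[where f="\<lambda>q. (q, 0)", OF _ G(1)[OF qV]])
         (auto intro!: derivative_eq_intros)
    let ?A = "blinfun_apply (\<Psi>' (G (q, 0)))"
    have A: "?A (K v) = K (?A v)" for v
      using F'(2)[OF GS] jhol_has_derivative(2)[OF FK GS] by (simp add: \<Psi>'_app K_def)
    have "G' (q, 0) (K v) = K (G' (q, 0) v)" for v
    proof -
      have b: "bij ?A" by (rule G(3)[OF qV])
      have "?A (K (inv ?A v)) = K v" using A b by (simp add: bij_is_surj surj_f_inv_f)
      then have "inv ?A (K v) = K (inv ?A v)" using b by (metis bij_inv_eq_iff)
      then show ?thesis by (simp add: G(2)[OF qV])
    qed
    from this[of "(h, 0)" for h] have "snd (G' (q, 0) (J h, 0)) = \<i> * snd (G' (q, 0) (h, 0))" for h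
      by (simp add: K_def)
    then show "\<exists>D. (\<tau> has_derivative D) (at q) \<and> (\<forall>v. D (J v) = \<i> * D v)"
      using d by blast
  qed
  have \<tau>0: "\<tau> q0 = t0" using unique[of q0 t0] UV(3,5) \<Psi>0 F0 by (simp add: p0_def)
  \<comment> \<open>So far the solution is unique only inside the open set \<open>U\<close>.
    Shrinking to a product neighbourhood makes it unique in a fixed disc of values
    \<open>t\<close>.\<close>
  obtain e where e: "e > 0" "ball p0 e \<subseteq> U" using UV(1,3) open_contains_ball by blast
  have "isCont \<tau> q0" using jhol_has_derivative(1)[OF Jt N1(2)] has_derivative_continuous by blast
  then obtain d where d: "d > 0" "\<And>q. dist q q0 < d \<Longrightarrow> dist (\<tau> q) (\<tau> q0) < e/2"
    using e(1) unfolding continuous_at_eps_delta by (metis half_gt_zero)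
  define N where "N = N1 \<inter> ball q0 (min d (e/2))"
  show ?thesis
  proof (rule that[of N "e/2" \<tau>])
    show "open N" "q0 \<in> N" using N1 d e by (auto simp: N_def)
    show "jhol J \<tau> N" by (rule jhol_subset[OF Jt]) (auto simp: N_def)
    show "dist t0 (\<tau> q) < e/2" if "q \<in> N" for q
      using d(2)[of q] that \<tau>0 by (simp add: N_def dist_commute)
    show "F (q, t) = 0 \<longleftrightarrow> t = \<tau> q" if "q \<in> N" "dist t0 t < e/2" for q t
    proof (rule unique)
      show "(q, 0) \<in> V" using that by (simp add: N_def N1_def)
      have "dist p0 (q, t) \<le> dist q0 q + dist t0 t"
        unfolding p0_def dist_Pair_Pair by (rule sqrt_sum_squares_le_sum) auto
      then have "dist p0 (q, t) < e" using that by (auto simp: N_def)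
      then show "(q, t) \<in> U" using e by auto
    qed
  qed (use e in auto)
qed

text \<open>The complexified equation is solved with a complex \<open>t\<close>. The point is that
  the solution is real at real points: the equation is invariant under conjugation, so the conjugate
  of a solution is a solution in the same disc, and there is only one.\<close>

lemma ranalytic_implicit_function:
  fixes f :: "'a::euclidean_space \<times> real \<Rightarrow> real"
  assumes f: "ranalytic (\<lambda>q. of_real (f q)) (p, t0)" and f0: "f (p, t0) = 0"
    and c: "dd (0, 1) (\<lambda>q. of_real (f q)) (p, t0) \<noteq> 0"
  obtains N r \<phi> where "open N" "p \<in> N" "r > 0" "\<And>x. x \<in> N \<Longrightarrow> ranalytic (\<lambda>x. of_real (\<phi> x)) x"
    "\<And>x. x \<in> N \<Longrightarrow> \<bar>\<phi> x - t0\<bar> < r"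
    "\<And>x t. x \<in> N \<Longrightarrow> \<bar>t - t0\<bar> < r \<Longrightarrow> f (x, t) = 0 \<longleftrightarrow> t = \<phi> x"
proof -
  obtain F R where F: "R > 0" "jhol cJ F (ball ((p, t0), 0) R)"
      "\<And>x. x \<in> ball (p, t0) R \<Longrightarrow> F (x, 0) = of_real (f x)"
    and dF: "\<And>x v. x \<in> ball (p, t0) R \<Longrightarrow> dd v (\<lambda>q. of_real (f q)) x = dd (v, 0) F (x, 0)"
    using ranalytic_extension[OF f] by metis
  \<comment> \<open>Symmetrizes the extension under conjugation. As \<open>f\<close> is real, the
    values at real points do not change.\<close>
  define Fs where "Fs q = (F q + cnj (F (fst q, - snd q))) * (1/2)" for q
  have Fs: "jhol cJ Fs (ball ((p, t0), 0) R)" unfolding Fs_def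
    by (intro jhol_mult jhol_add jhol_const jhol_cnj F(2))
  have Fs_real: "Fs (x, 0) = of_real (f x)" if "x \<in> ball (p, t0) R" for x
    using F(3)[OF that] by (simp add: Fs_def)
  have Fs_sym: "Fs (x, - y) = cnj (Fs (x, y))" for x y
    by (simp add: Fs_def add.commute)
  \<comment> \<open>Reorders coordinates: a point of the complexification of \<open>'a\<close> and a
    complex \<open>t\<close> form a point of the complexification of
    \<open>'a \<times> real\<close>.\<close>
  define h where "h q = ((fst (fst q), Re (snd q)), (snd (fst q), Im (snd q)))" for q :: "('a \<times> 'a) \<times> complex"
  have hl: "bounded_linear h" unfolding h_def
    by (intro bounded_linear_Pair bounded_linear_compose[OF bounded_linear_fst] bounded_linear_compose[OF bounded_linear_snd]
          bounded_linear_compose[OF bounded_linear_Re] bounded_linear_compose[OF bounded_linear_Im]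
          bounded_linear_fst bounded_linear_snd)
  define S where "S = h -` (ball ((p, t0), 0) R)"
  have S: "open S" unfolding S_def by (intro open_vimage open_ball linear_continuous_on hl)
  define Fc where "Fc q = Fs (h q)" for q
  have Fc: "jhol (\<lambda>q. (cJ (fst q), \<i> * snd q)) Fc S"
    unfolding Fc_def
  proof (rule jhol_compose[OF Fs])
    fix q show "\<exists>D. (h has_derivative D) (at q) \<and> (\<forall>v. D (cJ (fst v), \<i> * snd v) = cJ (D v))"
      by (intro exI[of _ h] conjI allI bounded_linear_imp_has_derivative[OF hl]) (simp add: h_def cJ_def)
  qed (simp add: S_def)
  have pS: "((p, 0), of_real t0) \<in> S" using F(1) by (simp add: S_def h_def zero_prod_def)
  have cJl: "bounded_linear (cJ :: 'a \<times> 'a \<Rightarrow> _)" unfolding cJ_def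
    by (intro bounded_linear_Pair bounded_linear_minus bounded_linear_fst bounded_linear_snd)
  have d1: "dd (0, 1) Fc ((p, 0), of_real t0) \<noteq> 0"
  proof -
    have B: "((p, t0), 0) \<in> ball ((p, t0), 0) R" using F(1) by simp
    have "(Fc has_derivative (\<lambda>v. dd (h v) Fs (h ((p, 0), of_real t0)))) (at ((p, 0), of_real t0))"
      unfolding Fc_def
      by (rule has_derivative_compose[OF bounded_linear_imp_has_derivative[OF hl] jhol_has_derivative(1)[OF Fs]])
         (use pS in \<open>simp add: S_def\<close>)
    from dd_eqI[OF this] have "dd (0, 1) Fc ((p, 0), of_real t0) = dd ((0, 1), 0) Fs ((p, t0), 0)"
      by (simp add: h_def zero_prod_def)
    moreover have "((\<lambda>x. Fs (x, 0)) has_derivative (\<lambda>v. dd (v, 0) Fs ((p, t0), 0))) (at (p, t0))"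
      by (rule has_derivative_compose[where f="\<lambda>x. (x, 0)", OF _ jhol_has_derivative(1)[OF Fs B]])
         (auto intro!: derivative_eq_intros)
    then have "((\<lambda>x. of_real (f x)) has_derivative (\<lambda>v. dd (v, 0) Fs ((p, t0), 0))) (at (p, t0))"
      by (rule has_derivative_transform_within_open[OF _ open_ball[of "(p, t0)" R]]) (use F(1) Fs_real in auto)
    from dd_eqI[OF this] have "dd (0, 1) (\<lambda>q. of_real (f q)) (p, t0) = dd ((0, 1), 0) Fs ((p, t0), 0)" .
    ultimately show ?thesis using c by simp
  qed
  have Fc0: "Fc ((p, 0), of_real t0) = 0"
    using Fs_real[of "(p, t0)"] F(1) f0 by (simp add: Fc_def h_def zero_prod_def)
  obtain N r \<tau> where N: "open N" "(p, 0) \<in> N" "r > 0" "jhol cJ \<tau> N"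
      and \<tau>: "\<And>q. q \<in> N \<Longrightarrow> dist (of_real t0) (\<tau> q) < r"
      "\<And>q t. q \<in> N \<Longrightarrow> dist (of_real t0) t < r \<Longrightarrow> Fc (q, t) = 0 \<longleftrightarrow> t = \<tau> q"
    by (rule jhol_implicit_function[OF Fc S pS cJl Fc0 d1]) (rule that)
  have real: "\<tau> (x, 0) = of_real (Re (\<tau> (x, 0)))" if x: "(x, 0) \<in> N" for x
  proof -
    have "Fc ((x, 0), \<tau> (x, 0)) = 0" using \<tau> x by blast
    then have "Fc ((x, 0), cnj (\<tau> (x, 0))) = 0"
      using Fs_sym[of "(x, Re (\<tau> (x, 0)))" "(0, Im (\<tau> (x, 0)))"] by (simp add: Fc_def h_def)
    moreover have "dist (of_real t0) (cnj (\<tau> (x, 0))) < r"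
      using \<tau>(1)[OF x] by (metis complex_cnj_complex_of_real complex_cnj_diff complex_mod_cnj dist_norm)
    ultimately have "cnj (\<tau> (x, 0)) = \<tau> (x, 0)" using \<tau>(2)[OF x] by blast
    then show ?thesis by (simp add: complex_eq_iff)
  qed
  define \<phi> where "\<phi> x = Re (\<tau> (x, 0))" for x
  have small: "\<exists>M. open M \<and> p \<in> M \<and> M \<subseteq> (\<lambda>x. (x, 0)) -` N \<and> (\<forall>x\<in>M. \<bar>\<phi> x - t0\<bar> < min r (R/2) \<and> dist p x < R/2)"
  proof -
    have cont: "continuous_on ((\<lambda>x. (x, 0)) -` N) \<phi>" unfolding \<phi>_def
      by (intro continuous_intros continuous_on_compose2[OF jhol_continuous_on[OF N(4)]]) auto
    have o: "open ((\<lambda>x. (x, 0)) -` N)" using N(1) by (intro open_vimage continuous_intros)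
    have p0: "\<phi> p = t0" using \<tau>(2)[OF N(2), of "of_real t0"] Fc0 N(3) unfolding \<phi>_def by (metis Re_complex_of_real dist_self)
    let ?M = "(((\<lambda>x. (x, 0)) -` N) \<inter> \<phi> -` (ball t0 (min r (R/2)))) \<inter> ball p (R/2)"
    have "open ?M" using continuous_open_preimage[OF cont o open_ball] by blast
    then show ?thesis
      using N(2,3) F(1) p0 by (intro exI[of _ ?M]) (auto simp: dist_real_def abs_minus_commute)
  qed
  then obtain M where M: "open M" "p \<in> M" "M \<subseteq> (\<lambda>x. (x, 0)) -` N"
    "\<And>x. x \<in> M \<Longrightarrow> \<bar>\<phi> x - t0\<bar> < min r (R/2)" "\<And>x. x \<in> M \<Longrightarrow> dist p x < R/2" by blast
  show ?thesis
  proof (rule that[of M "min r (R/2)" \<phi>])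
    show "ranalytic (\<lambda>x. of_real (\<phi> x)) x" if "x \<in> M" for x
      by (rule ranI[OF N(1) _ N(4)]) (use M(3) that real in \<open>auto simp: \<phi>_def\<close>)
    show "f (x, t) = 0 \<longleftrightarrow> t = \<phi> x" if x: "x \<in> M" and t: "\<bar>t - t0\<bar> < min r (R/2)" for x t
    proof -
      have xN: "(x, 0) \<in> N" using M(3) x by blast
      have "dist (p, t0) (x, t) \<le> dist p x + dist t0 t"
        unfolding dist_Pair_Pair by (rule sqrt_sum_squares_le_sum) auto
      then have "(x, t) \<in> ball (p, t0) R" using M(5)[OF x] t by (auto simp: dist_real_def abs_minus_commute)
      then have "Fc ((x, 0), of_real t) = of_real (f (x, t))"
        using Fs_real[of "(x, t)"] by (simp add: Fc_def h_def zero_prod_def)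
      moreover have "dist (of_real t0) (of_real t :: complex) < r"
        using t by (simp add: dist_of_real dist_real_def abs_minus_commute)
      ultimately have "f (x, t) = 0 \<longleftrightarrow> of_real t = \<tau> (x, 0)"
        using \<tau>(2)[OF xN, of "of_real t"] of_real_eq_0_iff by metis
      then show ?thesis using real[OF xN] unfolding \<phi>_def by (metis Re_complex_of_real)
    qed
  qed (use M N F in auto)
qed

section \<open>Power series expansions\<close>

definition multi_index :: "'a set \<Rightarrow> ('a \<Rightarrow> nat) set" where
  "multi_index B = {\<alpha>. \<forall>b. b \<notin> B \<longrightarrow> \<alpha> b = 0}"

lemma countable_multi_index: "finite B \<Longrightarrow> countable (multi_index B)"
proof -
  assume "finite B"
  then have "countable (PiE B (\<lambda>_. UNIV :: nat set))" by (intro countable_PiE) auto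
  moreover have "multi_index B \<subseteq> (\<lambda>\<alpha> b. if b \<in> B then \<alpha> b else 0) ` PiE B (\<lambda>_. UNIV)"
  proof
    fix \<alpha> :: "'a \<Rightarrow> nat" assume "\<alpha> \<in> multi_index B"
    then show "\<alpha> \<in> (\<lambda>\<alpha> b. if b \<in> B then \<alpha> b else 0) ` PiE B (\<lambda>_. UNIV)"
      by (intro image_eqI[where x="restrict \<alpha> B"]) (auto simp: multi_index_def fun_eq_iff)
  qed
  ultimately show ?thesis by (rule countable_subset[OF _ countable_image, rotated])
qed

lemma infinite_multi_index: "B \<noteq> {} \<Longrightarrow> infinite (multi_index B)"
proof -
  assume "B \<noteq> {}"
  then obtain b0 where b0: "b0 \<in> B" by blast
  have "inj (\<lambda>k b. if b = b0 then k else (0::nat))" by (auto simp: inj_def fun_eq_iff)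
  moreover have "range (\<lambda>k b. if b = b0 then k else (0::nat)) \<subseteq> multi_index B"
    using b0 by (auto simp: multi_index_def)
  ultimately show ?thesis using range_inj_infinite finite_subset by blast
qed

text \<open>The extension is the same series in complex coordinates. Convergence at a single corner
  point gives a summable majorant \<open>A\<close>; on a smaller ball the series of derivatives is
  dominated by a multiple of \<open>A\<close>, so it may be differentiated term by term.\<close>

lemma power_series_imp_ranalytic:
  fixes c :: "('a::euclidean_space \<Rightarrow> nat) \<Rightarrow> complex"
  assumes r: "r > 0"
    and hs: "\<And>x. x \<in> ball p r \<Longrightarrow>
      ((\<lambda>\<alpha>. of_real (\<Prod>b\<in>Basis. ((x - p) \<bullet> b) ^ \<alpha> b) * c \<alpha>) has_sum f x) (multi_index Basis)"
  shows "ranalytic f p"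
proof -
  have "countable (multi_index (Basis :: 'a set))" "infinite (multi_index (Basis :: 'a set))"
    by (auto simp: countable_multi_index infinite_multi_index)
  then obtain a :: "nat \<Rightarrow> 'a \<Rightarrow> nat" where a: "bij_betw a UNIV (multi_index Basis)"
    using countable_infiniteE' by blast
  define n where "n = real DIM('a)"
  have n: "n > 0" by (simp add: n_def)
  \<comment> \<open>This size puts the corner of the cube of half side \<open>\<rho>\<close> into
    the ball of radius \<open>r\<close>. At the corner all coordinates equal \<open>\<rho>\<close>,
    so convergence there makes the terms \<open>A k\<close> summable.\<close>
  define \<rho> where "\<rho> = r / (2 * n)"
  have \<rho>: "\<rho> > 0" using r n by (simp add: \<rho>_def)
  define A where "A k = norm (c (a k)) * \<rho> ^ (sum (a k) Basis)" for k
  have A_summable: "summable A"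
  proof -
    define x where "x = p + (\<Sum>b\<in>Basis. \<rho> *\<^sub>R b)"
    have "norm (x - p) \<le> (\<Sum>b\<in>(Basis::'a set). norm (\<rho> *\<^sub>R b))"
      unfolding x_def by (simp add: norm_sum del: norm_scaleR)
    also have "\<dots> = n * \<rho>" using \<rho> by (simp add: n_def)
    also have "\<dots> < r" using r n by (simp add: \<rho>_def)
    finally have x: "x \<in> ball p r" by (simp add: dist_norm norm_minus_commute)
    have xb: "(x - p) \<bullet> b = \<rho>" if "b \<in> Basis" for b
    proof -
      have "(x - p) \<bullet> b = (\<Sum>b'\<in>Basis. \<rho> * (b' \<bullet> b))" by (simp add: x_def inner_sum_left)
      also have "\<dots> = (\<Sum>b'\<in>Basis. if b' = b then \<rho> else 0)"
        by (rule sum.cong) (use that in \<open>auto simp: inner_Basis\<close>)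
      finally show ?thesis using that by simp
    qed
    have "(\<lambda>\<alpha>. norm (of_real (\<Prod>b\<in>Basis. ((x - p) \<bullet> b) ^ \<alpha> b) * c \<alpha>)) summable_on (multi_index Basis)"
      by (rule iffD1[OF summable_on_iff_abs_summable_on_complex has_sum_imp_summable[OF hs[OF x]]])
    moreover have "norm (of_real (\<Prod>b\<in>Basis. ((x - p) \<bullet> b) ^ \<alpha> b) * c \<alpha>) = norm (c \<alpha>) * \<rho> ^ (sum \<alpha> Basis)" for \<alpha>
    proof -
      have "(\<Prod>b\<in>Basis. ((x - p) \<bullet> b) ^ \<alpha> b) = \<rho> ^ (sum \<alpha> Basis)" by (simp add: xb power_sum)
      then show ?thesis using \<rho> by (simp only: norm_mult norm_of_real) simp
    qed
    ultimately have "(\<lambda>\<alpha>. norm (c \<alpha>) * \<rho> ^ (sum \<alpha> Basis)) summable_on (multi_index Basis)" by simp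
    then have "A summable_on UNIV"
      unfolding A_def using summable_on_reindex_bij_betw[OF a, of "\<lambda>\<alpha>. norm (c \<alpha>) * \<rho> ^ (sum \<alpha> Basis)"] by simp
    then show ?thesis by (rule summable_on_imp_summable)
  qed
  have A_nonneg: "A k \<ge> 0" for k using \<rho> by (simp add: A_def)
  define X where "X b q = of_real (fst q \<bullet> b) + \<i> * of_real (snd q \<bullet> b)" for b :: 'a and q
  have X_bound: "norm (X b q) \<le> 2 * norm q" if "b \<in> Basis" for b q
  proof -
    have "norm (X b q) \<le> \<bar>fst q \<bullet> b\<bar> + \<bar>snd q \<bullet> b\<bar>"
      unfolding X_def by (rule order_trans[OF norm_triangle_ineq]) (simp add: norm_mult)
    also have "\<dots> \<le> norm (fst q) + norm (snd q)" using that by (intro add_mono Basis_le_norm)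
    also have "\<dots> \<le> norm q + norm q"
      using norm_fst_le[of "fst q" "snd q"] norm_snd_le[of "snd q" "fst q"] by simp
    finally show ?thesis by simp
  qed
  have X_J: "X b (cJ q) = \<i> * X b q" for b q
    by (simp add: X_def cJ_def algebra_simps)
  have X_der: "((\<lambda>q. X b (q - (p, 0))) has_derivative X b) (at q within T)" for b q T
    unfolding X_def[abs_def] by (auto intro!: derivative_eq_intros)
  \<comment> \<open>In this ball every complex coordinate is at most \<open>\<rho> / 2\<close>. The
    gain of 2 to the power of the total degree absorbs the exponent \<open>a k b\<close> that
    differentiation produces.\<close>
  define S where "S = ball (p, 0::'a) (\<rho>/4)"
  define F where "F k q = c (a k) * (\<Prod>b\<in>Basis. X b (q - (p, 0)) ^ a k b)" for k q
  define F' where "F' k q h = c (a k) * (\<Sum>b\<in>Basis. (of_nat (a k b) * X b h * X b (q - (p, 0)) ^ (a k b - 1))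
      * (\<Prod>j\<in>Basis - {b}. X j (q - (p, 0)) ^ a k j))" for k q h
  have F_der: "(F k has_derivative F' k q) (at q within S)" for k q
    unfolding F_def F'_def
    by (intro has_derivative_mult_right has_derivative_prod has_derivative_power X_der)
  have F'_J: "F' k q (cJ h) = \<i> * F' k q h" for k q h
    by (simp add: F'_def X_J sum_distrib_left mult_ac)
  define C where "C = 4 * n / \<rho>"
  have F'_bound: "norm (F' k q h) \<le> A k * (C * norm h)" if q: "q \<in> S" for k q h
  proof -
    have Xq: "norm (X b (q - (p, 0))) \<le> \<rho>/2" if "b \<in> Basis" for b
      using X_bound[OF that, of "q - (p, 0)"] q by (simp add: S_def dist_norm norm_minus_commute)
    have "norm ((of_nat (a k b) * X b h * X b (q - (p, 0)) ^ (a k b - 1))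
        * (\<Prod>j\<in>Basis - {b}. X j (q - (p, 0)) ^ a k j)) \<le> \<rho> ^ (sum (a k) Basis) * (4 / \<rho> * norm h)"
      if b: "b \<in> Basis" for b
    proof (cases "a k b = 0")
      case True
      then show ?thesis using \<rho> by simp
    next
      case False
      let ?s = "sum (a k) (Basis - {b})"
      have sum: "sum (a k) Basis = a k b + ?s" using b by (simp add: sum.remove)
      have p1: "norm (\<Prod>j\<in>Basis - {b}. X j (q - (p, 0)) ^ a k j) \<le> (\<rho>/2) ^ ?s"
        unfolding prod_norm[symmetric] power_sum
        by (rule prod_mono) (use Xq in \<open>auto simp: norm_power intro!: power_mono\<close>)
      have p2: "norm (X b (q - (p, 0)) ^ (a k b - 1)) \<le> (\<rho>/2) ^ (a k b - 1)"
        using Xq[OF b] by (simp add: norm_power power_mono)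
      have "norm ((of_nat (a k b) * X b h * X b (q - (p, 0)) ^ (a k b - 1))
        * (\<Prod>j\<in>Basis - {b}. X j (q - (p, 0)) ^ a k j))
        \<le> (real (a k b) * (2 * norm h) * (\<rho>/2) ^ (a k b - 1)) * (\<rho>/2) ^ ?s"
        unfolding norm_mult norm_of_nat
        by (intro mult_mono p1[unfolded prod_norm[symmetric]] p2 X_bound b order_refl)
           (use \<rho> p1 in \<open>auto simp: prod_norm\<close>)
      also have "\<dots> = real (a k b) * (\<rho>/2) ^ (sum (a k) Basis) * (4 / \<rho> * norm h)"
        using False \<rho> by (cases "a k b") (auto simp: sum power_add field_simps)
      also have "\<dots> \<le> 2 ^ (sum (a k) Basis) * (\<rho>/2) ^ (sum (a k) Basis) * (4 / \<rho> * norm h)"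
      proof (intro mult_right_mono)
        have "a k b \<le> 2 ^ a k b" by (simp add: less_imp_le)
        also have "\<dots> \<le> (2::nat) ^ (sum (a k) Basis)" using sum by (intro power_increasing) auto
        finally have "real (a k b) \<le> real (2 ^ (sum (a k) Basis))" by (simp only: of_nat_le_iff)
        then show "real (a k b) \<le> 2 ^ (sum (a k) Basis)" by simp
      qed (use \<rho> in auto)
      also have "\<dots> = \<rho> ^ (sum (a k) Basis) * (4 / \<rho> * norm h)"
        by (subst power_mult_distrib[symmetric]) simp
      finally show ?thesis .
    qed
    then have "norm (F' k q h) \<le> norm (c (a k)) * (\<Sum>b\<in>(Basis::'a set). \<rho> ^ (sum (a k) Basis) * (4 / \<rho> * norm h))"
      unfolding F'_def norm_mult by (intro mult_left_mono order_trans[OF norm_sum] sum_mono) (auto simp: norm_mult)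
    then show ?thesis by (simp add: A_def C_def n_def mult_ac)
  qed
  have C0: "C \<ge> 0" using n \<rho> by (simp add: C_def)
  have AC_summable: "summable (\<lambda>k. A k * (C * norm h))" for h :: "'a \<times> 'a"
    by (intro summable_mult2 A_summable)
  have F'_summable: "summable (\<lambda>k. F' k q h)" if "q \<in> S" for q h
    by (rule summable_comparison_test'[OF AC_summable[of h]]) (use F'_bound[OF that] in auto)
  have pS: "(p, 0) \<in> S" using \<rho> by (simp add: S_def)
  have sums: "(\<lambda>k. F k (x, 0)) sums f x" if "x \<in> ball p r" for x
  proof -
    have "F k (x, 0) = of_real (\<Prod>b\<in>Basis. ((x - p) \<bullet> b) ^ (a k) b) * c (a k)" for k
      by (simp add: F_def X_def mult.commute)
    then have "((\<lambda>k. F k (x, 0)) has_sum f x) UNIV"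
      using has_sum_reindex_bij_betw[OF a, of "\<lambda>\<alpha>. of_real (\<Prod>b\<in>Basis. ((x - p) \<bullet> b) ^ \<alpha> b) * c \<alpha>" "f x"] hs[OF that]
      by simp
    then show ?thesis by (rule has_sum_imp_sums)
  qed
  have "\<exists>G. \<forall>q\<in>S. (\<lambda>k. F k q) sums (G q) \<and> (G has_derivative (\<lambda>h. \<Sum>k. F' k q h)) (at q within S)"
  proof (rule has_derivative_series[where f=F and f'=F' and x="(p, 0)" and l="f p"])
    show "convex S" by (simp add: S_def)
    fix e :: real assume e: "e > 0"
    obtain N where N: "\<And>m. m \<ge> N \<Longrightarrow> norm (\<Sum>i. A (i + m)) < e / (C + 1)"
      using suminf_exist_split[OF _ A_summable, of "e / (C + 1)"] e C0 by auto
    show "\<forall>\<^sub>F m in sequentially. \<forall>q\<in>S. \<forall>h. norm ((\<Sum>i<m. F' i q h) - (\<Sum>k. F' k q h)) \<le> e * norm h"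
      unfolding eventually_sequentially
    proof (intro exI[of _ N] allI impI ballI)
      fix m q and h :: "'a \<times> 'a" assume m: "m \<ge> N" and q: "q \<in> S"
      have "norm ((\<Sum>i<m. F' i q h) - (\<Sum>k. F' k q h)) = norm (\<Sum>k. F' (k + m) q h)"
        using suminf_minus_initial_segment[OF F'_summable[OF q, of h], of m] by (simp add: norm_minus_commute)
      also have "\<dots> \<le> (\<Sum>k. A (k + m) * (C * norm h))"
        by (rule norm_suminf_le) (use F'_bound[OF q] summable_ignore_initial_segment[OF AC_summable] in auto)
      also have "\<dots> = (\<Sum>k. A (k + m)) * (C * norm h)"
        by (rule suminf_mult2[symmetric]) (rule summable_ignore_initial_segment[OF A_summable])
      also have "\<dots> \<le> e / (C + 1) * (C * norm h)"
        by (rule mult_right_mono) (use N[OF m] C0 in auto)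
      also have "\<dots> \<le> e * norm h"
        using e C0 by (simp add: field_simps mult_right_mono)
      finally show "norm ((\<Sum>i<m. F' i q h) - (\<Sum>k. F' k q h)) \<le> e * norm h" .
    qed
  qed (use F_der pS sums r in auto)
  then obtain G where G: "\<And>q. q \<in> S \<Longrightarrow> (\<lambda>k. F k q) sums (G q)"
    "\<And>q. q \<in> S \<Longrightarrow> (G has_derivative (\<lambda>h. \<Sum>k. F' k q h)) (at q within S)" by blast
  show ?thesis
  proof (rule ranI[of "S \<inter> ball (p, 0) r" _ G])
    show "jhol cJ G (S \<inter> ball (p, 0) r)"
      unfolding jhol_def
    proof (intro ballI exI conjI allI)
      fix q h assume "q \<in> S \<inter> ball (p, 0) r"
      then have q: "q \<in> S" by blast
      show "(G has_derivative (\<lambda>h. \<Sum>k. F' k q h)) (at q)"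
        using G(2)[OF q] at_within_open[OF q] by (simp add: S_def)
      show "(\<Sum>k. F' k q (cJ h)) = \<i> * (\<Sum>k. F' k q h)"
        using suminf_mult[OF F'_summable[OF q]] by (simp add: F'_J)
    qed
    show "G (x, 0) = f x" if "(x, 0) \<in> S \<inter> ball (p, 0) r" for x
      using sums_unique2[OF G(1) sums] that by simp
  qed (use r pS in \<open>auto simp: S_def\<close>)
qed

lemma real_analytic_at_imp_ranalytic:
  fixes f :: "'a::euclidean_space \<Rightarrow> 'b::real_normed_vector"
  assumes "real_analytic_at f p" "bounded_linear L"
  shows "ranalytic (\<lambda>x. L (f x)) p"
proof -
  interpret L: bounded_linear L by fact
  obtain c r where r: "r > 0" and c: "\<And>x. x \<in> ball p r \<Longrightarrow>
       ((\<lambda>\<alpha>. (\<Prod>b\<in>Basis. ((x - p) \<bullet> b) ^ \<alpha> b) *\<^sub>R c \<alpha>) has_sum f x) (multi_index Basis)"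
    using assms(1) unfolding real_analytic_at_def multi_index_def by blast
  show ?thesis
  proof (rule power_series_imp_ranalytic[OF r])
    fix x assume "x \<in> ball p r"
    from has_sum_bounded_linear[OF assms(2) c[OF this]]
    show "((\<lambda>\<alpha>. of_real (\<Prod>b\<in>Basis. ((x - p) \<bullet> b) ^ \<alpha> b) * L (c \<alpha>)) has_sum L (f x)) (multi_index Basis)"
      by (simp add: L.scaleR scaleR_conv_of_real)
  qed
qed


section \<open>Taylor series in several complex variables\<close>

lemma has_sum_multi_index_insert:
  fixes f :: "('a \<Rightarrow> nat) \<Rightarrow> 'b::{comm_monoid_add, topological_space}"
  assumes "b0 \<notin> B"
  shows "(f has_sum s) (multi_index (insert b0 B)) \<longleftrightarrow>
         ((\<lambda>(k, \<alpha>). f (\<alpha>(b0 := k))) has_sum s) (UNIV \<times> multi_index B)"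
  by (rule has_sum_reindex_bij_witness[of _ "\<lambda>(k, \<alpha>). \<alpha>(b0 := k)" "\<lambda>\<alpha>. (\<alpha> b0, \<alpha>(b0 := 0))"])
     (use assms in \<open>auto simp: multi_index_def fun_eq_iff\<close>)

lemma prod_insert_fun_upd:
  assumes "finite B" "b0 \<notin> B"
  shows "(\<Prod>b\<in>insert b0 B. u b ^ (\<alpha>(b0 := k)) b) = u b0 ^ k * (\<Prod>b\<in>B. u b ^ \<alpha> b)"
proof -
  have "(\<Prod>b\<in>B. u b ^ (\<alpha>(b0 := k)) b) = (\<Prod>b\<in>B. u b ^ \<alpha> b)"
    using assms by (intro prod.cong) auto
  then show ?thesis using assms by simp
qed

lemma summable_on_multi_geometric:
  fixes t :: "'a \<Rightarrow> real"
  assumes "finite B" "\<And>b. b \<in> B \<Longrightarrow> 0 \<le> t b" "\<And>b. b \<in> B \<Longrightarrow> t b < 1"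
  shows "(\<lambda>\<alpha>. \<Prod>b\<in>B. t b ^ \<alpha> b) summable_on multi_index B"
  using assms
proof (induction B rule: finite_induct)
  case empty
  have "multi_index ({} :: 'a set) = {\<lambda>_. 0}" by (auto simp: multi_index_def)
  then show ?case by simp
next
  case (insert b0 B)
  define s where "s = infsum (\<lambda>\<alpha>. \<Prod>b\<in>B. t b ^ \<alpha> b) (multi_index B)"
  have s: "((\<lambda>\<alpha>. \<Prod>b\<in>B. t b ^ \<alpha> b) has_sum s) (multi_index B)"
    unfolding s_def using insert by (intro has_sum_infsum) auto
  have "(\<lambda>(k, \<alpha>). \<Prod>b\<in>insert b0 B. t b ^ (\<alpha>(b0 := k)) b) summable_on (UNIV \<times> multi_index B)"
  proof (rule summable_on_SigmaI)
    show "((\<lambda>\<alpha>. (case (k, \<alpha>) of (k, \<alpha>) \<Rightarrow> \<Prod>b\<in>insert b0 B. t b ^ (\<alpha>(b0 := k)) b)) has_sum (t b0 ^ k * s)) (multi_index B)" for k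
      using has_sum_cmult_right[OF s, of "t b0 ^ k"] by (simp only: prod_insert_fun_upd[OF insert(1,2)] case_prod_conv)
    have "(\<lambda>k. t b0 ^ k) summable_on UNIV"
      using insert by (intro norm_summable_imp_summable_on) (simp add: summable_geometric)
    then show "(\<lambda>k. t b0 ^ k * s) summable_on UNIV" by (rule summable_on_cmult_left)
  qed (use insert in \<open>auto intro!: prod_nonneg mult_nonneg_nonneg\<close>)
  then show ?case
    using has_sum_multi_index_insert[OF insert(2), of "\<lambda>\<alpha>. \<Prod>b\<in>insert b0 B. t b ^ \<alpha> b"]
    unfolding summable_on_def by blast
qed

text \<open>The point of the complexification with complex coordinates \<open>u\<close> relative to
  \<open>p\<close>. The coordinates form a function so that an update changes one of them at a time,
  as the Taylor expansion requires.\<close>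

definition emb :: "'a::euclidean_space \<Rightarrow> ('a \<Rightarrow> complex) \<Rightarrow> 'a \<times> 'a" where
  "emb p u = (p + (\<Sum>b\<in>Basis. Re (u b) *\<^sub>R b), \<Sum>b\<in>Basis. Im (u b) *\<^sub>R b)"

lemma emb_fun_upd:
  assumes "b0 \<in> Basis" shows "emb p (u(b0 := \<zeta>)) = cline cJ (emb p (u(b0 := 0))) (b0, 0) \<zeta>"
proof -
  have "(\<Sum>b\<in>Basis. f ((u(b0 := \<zeta>)) b) *\<^sub>R b) = (\<Sum>b\<in>Basis. f ((u(b0 := 0)) b) *\<^sub>R b) + f \<zeta> *\<^sub>R b0"
    if "f 0 = 0" for f :: "complex \<Rightarrow> real"
    using assms that by (simp add: sum.remove[of Basis b0] add.commute)
  from this[of Re] this[of Im] show ?thesis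
    by (simp add: emb_def cline_def)
qed

lemma jhol_higher_deriv_line:
  fixes F :: "'a::euclidean_space \<Rightarrow> complex"
  assumes F: "jhol J F S" and S: "open S" and in_S: "\<And>\<zeta>. norm \<zeta> < r \<Longrightarrow> cline J q v \<zeta> \<in> S"
    and z: "norm \<zeta> < r"
  shows "(deriv ^^ k) (\<lambda>\<zeta>. F (cline J q v \<zeta>)) \<zeta> = (dd v ^^ k) F (cline J q v \<zeta>)"
  using z
proof (induction k arbitrary: \<zeta>)
  case (Suc k)
  have J: "jhol J ((dd v ^^ k) F) S" by (induction k) (use F jhol_dd[OF _ S] in auto)
  have "((\<lambda>\<zeta>. (dd v ^^ k) F (cline J q v \<zeta>)) has_field_derivative (dd v ^^ Suc k) F (cline J q v \<zeta>)) (at \<zeta>)"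
    using jhol_line[OF J in_S[OF Suc.prems]] by simp
  then have "((deriv ^^ k) (\<lambda>\<zeta>. F (cline J q v \<zeta>)) has_field_derivative (dd v ^^ Suc k) F (cline J q v \<zeta>)) (at \<zeta>)"
    by (rule has_field_derivative_transform_within_open[OF _ open_ball[of 0 r]]) (use Suc in auto)
  then show ?case by (simp add: DERIV_imp_deriv)
qed simp

text \<open>Induction on the set of active coordinates. In the new coordinate \<open>b0\<close> a
  one-variable Taylor series is taken, whose coefficients are holomorphic in the others. Cauchy's
  inequality bounds the \<open>k\<close>-th one by \<open>K / r' ^ k\<close>, which is the constant
  passed to the induction hypothesis. The bound on \<open>c\<close> is carried along because it
  makes the double series absolutely summable.\<close>

lemma jhol_multi_taylor:
  fixes F :: "'a::euclidean_space \<times> 'a \<Rightarrow> complex"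
  assumes "finite B" "B \<subseteq> Basis" "open S" "0 < r'" "r' < r"
    and "\<And>u. (\<And>b. norm (u b) < r) \<Longrightarrow> emb p u \<in> S"
    and "jhol cJ F S"
    and "\<And>u. (\<And>b. norm (u b) < r) \<Longrightarrow> (\<And>b. b \<notin> B \<Longrightarrow> u b = 0) \<Longrightarrow> norm (F (emb p u)) \<le> K"
  shows "\<exists>c. (\<forall>\<alpha>. norm (c \<alpha>) \<le> K / r' ^ sum \<alpha> B) \<and>
     (\<forall>u. (\<forall>b. norm (u b) < r') \<longrightarrow> (\<forall>b. b \<notin> B \<longrightarrow> u b = 0) \<longrightarrow>
        ((\<lambda>\<alpha>. (\<Prod>b\<in>B. u b ^ \<alpha> b) * c \<alpha>) has_sum F (emb p u)) (multi_index B))"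
  using assms(1,2,7,8)
proof (induction B arbitrary: F K rule: finite_induct)
  case empty
  have [simp]: "multi_index ({} :: 'a set) = {\<lambda>_. 0}" by (auto simp: multi_index_def)
  show ?case
  proof (intro exI[of _ "\<lambda>_. F (emb p (\<lambda>_. 0))"] conjI allI impI)
    show "norm (F (emb p (\<lambda>_. 0))) \<le> K / r' ^ sum \<alpha> {}" for \<alpha> using empty(3) assms(4,5) by simp
    show "((\<lambda>\<alpha>. (\<Prod>b\<in>{}. u b ^ \<alpha> b) * F (emb p (\<lambda>_. 0))) has_sum F (emb p u)) (multi_index {})"
      if "\<forall>b. b \<notin> {} \<longrightarrow> u b = 0" for u :: "'a \<Rightarrow> complex"
    proof -
      have "u = (\<lambda>_. 0)" using that by auto
      then show ?thesis by (simp add: has_sum_finite_iff)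
    qed
  qed
next
  case (insert b0 B)
  have b0: "b0 \<in> Basis" and BB: "B \<subseteq> Basis" using insert.prems(1) by auto
  define Fk where "Fk k q = inverse (fact k) * (dd (b0, 0) ^^ k) F q" for k q
  have ddJ: "jhol cJ ((dd (b0, 0) ^^ k) F) S" for k
    by (induction k) (use insert.prems(2) jhol_dd[OF _ assms(3)] in auto)
  have FkJ: "jhol cJ (Fk k) S" for k
    unfolding Fk_def by (intro jhol_mult jhol_const ddJ)
  have K0: "K \<ge> 0"
    using order_trans[OF norm_ge_zero insert.prems(3)[of "\<lambda>_. 0"]] assms(4,5) by simp
  have line: "cline cJ (emb p u) (b0, 0) \<zeta> \<in> S" "cline cJ (emb p u) (b0, 0) \<zeta> = emb p (u(b0 := \<zeta>))"
    if "\<And>b. norm (u b) < r" "\<And>b. b \<notin> B \<Longrightarrow> u b = 0" "norm \<zeta> < r" for u \<zeta>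
  proof -
    have "u(b0 := 0) = u" using that(2) insert(2) by auto
    then show eq: "cline cJ (emb p u) (b0, 0) \<zeta> = emb p (u(b0 := \<zeta>))"
      using emb_fun_upd[OF b0, of p u \<zeta>] by simp
    show "cline cJ (emb p u) (b0, 0) \<zeta> \<in> S"
      unfolding eq by (rule assms(6)) (use that in auto)
  qed
  have hol: "(\<lambda>\<zeta>. F (cline cJ (emb p u) (b0, 0) \<zeta>)) holomorphic_on ball 0 r"
    if "\<And>b. norm (u b) < r" "\<And>b. b \<notin> B \<Longrightarrow> u b = 0" for u
    unfolding holomorphic_on_def field_differentiable_def
    using jhol_line[OF insert.prems(2) line(1)[where u=u, OF that]] by (meson has_field_derivative_at_within mem_ball_0)
  have deriv: "(deriv ^^ k) (\<lambda>\<zeta>. F (cline cJ (emb p u) (b0, 0) \<zeta>)) 0 = fact k * Fk k (emb p u)"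
    if "\<And>b. norm (u b) < r" "\<And>b. b \<notin> B \<Longrightarrow> u b = 0" for u k
  proof -
    have "(deriv ^^ k) (\<lambda>\<zeta>. F (cline cJ (emb p u) (b0, 0) \<zeta>)) 0 = (dd (b0, 0) ^^ k) F (cline cJ (emb p u) (b0, 0) 0)"
      by (rule jhol_higher_deriv_line[OF insert.prems(2) assms(3) line(1)[where u=u, OF that]]) (use assms(4,5) in auto)
    then show ?thesis by (simp add: Fk_def cline_def zero_prod_def[symmetric])
  qed
  have bound: "norm (Fk k (emb p u)) \<le> K / r' ^ k"
    if u: "\<And>b. norm (u b) < r" "\<And>b. b \<notin> B \<Longrightarrow> u b = 0" for u k
  proof -
    have "norm ((deriv ^^ k) (\<lambda>\<zeta>. F (cline cJ (emb p u) (b0, 0) \<zeta>)) 0) \<le> fact k * K / r' ^ k"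
    proof (rule Cauchy_inequality[OF _ _ assms(4)])
      show "(\<lambda>\<zeta>. F (cline cJ (emb p u) (b0, 0) \<zeta>)) holomorphic_on ball 0 r'"
        by (rule holomorphic_on_subset[OF hol[where u=u, OF u]]) (use assms(5) in auto)
      show "continuous_on (cball 0 r') (\<lambda>\<zeta>. F (cline cJ (emb p u) (b0, 0) \<zeta>))"
        by (rule continuous_on_subset[OF holomorphic_on_imp_continuous_on[OF hol[where u=u, OF u]]]) (use assms(5) in auto)
      show "norm (F (cline cJ (emb p u) (b0, 0) \<zeta>)) \<le> K" if "norm (0 - \<zeta>) = r'" for \<zeta>
      proof -
        have z: "norm \<zeta> < r" using that assms(5) by simp
        have "norm (F (emb p (u(b0 := \<zeta>)))) \<le> K"
          by (rule insert.prems(3)) (use u z in auto)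
        then show ?thesis using line(2)[where u=u and \<zeta>=\<zeta>, OF u z] by simp
      qed
    qed
    then have "norm (fact k * Fk k (emb p u)) \<le> fact k * K / r' ^ k"
      using deriv[of u k] u by auto
    then have "fact k * norm (Fk k (emb p u)) \<le> fact k * (K / r' ^ k)" by (simp add: norm_mult)
    then show ?thesis by (subst (asm) mult_le_cancel_left_pos) auto
  qed
  have "\<exists>c. (\<forall>\<alpha>. norm (c \<alpha>) \<le> K / r' ^ k / r' ^ sum \<alpha> B) \<and>
     (\<forall>u. (\<forall>b. norm (u b) < r') \<longrightarrow> (\<forall>b. b \<notin> B \<longrightarrow> u b = 0) \<longrightarrow>
        ((\<lambda>\<alpha>. (\<Prod>b\<in>B. u b ^ \<alpha> b) * c \<alpha>) has_sum Fk k (emb p u)) (multi_index B))" for k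
    by (rule insert.IH[OF BB FkJ bound]) auto
  then obtain c where c: "\<And>k \<alpha>. norm (c k \<alpha>) \<le> K / r' ^ k / r' ^ sum \<alpha> B"
     "\<And>k u. (\<And>b. norm (u b) < r') \<Longrightarrow> (\<And>b. b \<notin> B \<Longrightarrow> u b = 0) \<Longrightarrow>
        ((\<lambda>\<alpha>. (\<Prod>b\<in>B. u b ^ \<alpha> b) * c k \<alpha>) has_sum Fk k (emb p u)) (multi_index B)"
    by metis
  define C where "C \<alpha> = c (\<alpha> b0) (\<alpha>(b0 := 0))" for \<alpha>
  show ?case
  proof (intro exI[of _ C] conjI allI impI)
    fix \<alpha> :: "'a \<Rightarrow> nat"
    have "sum (\<alpha>(b0 := 0)) B = sum \<alpha> B" using insert(2) by (intro sum.cong) auto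
    then show "norm (C \<alpha>) \<le> K / r' ^ sum \<alpha> (insert b0 B)"
      using c(1)[of "\<alpha> b0" "\<alpha>(b0 := 0)"] insert(1,2) by (simp add: C_def power_add field_simps)
  next
    fix u :: "'a \<Rightarrow> complex"
    assume u: "\<forall>b. norm (u b) < r'" "\<forall>b. b \<notin> insert b0 B \<longrightarrow> u b = 0"
    define u0 where "u0 = u(b0 := 0)"
    define \<zeta> where "\<zeta> = u b0"
    have u0': "norm (u0 b) < r'" for b using u assms(4) by (simp add: u0_def)
    have u0r: "norm (u0 b) < r" for b using u0'[of b] assms(5) by simp
    have u0B: "u0 b = 0" if "b \<notin> B" for b using u that by (simp add: u0_def)
    have z': "norm \<zeta> < r'" using u by (simp add: \<zeta>_def)
    have z: "norm \<zeta> < r" using z' assms(5) by simp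
    have u_eq: "F (cline cJ (emb p u0) (b0, 0) \<zeta>) = F (emb p u)"
      using line(2)[where u=u0 and \<zeta>=\<zeta>, OF u0r u0B z] by (simp add: u0_def \<zeta>_def)
    have "(\<lambda>k. (deriv ^^ k) (\<lambda>\<zeta>. F (cline cJ (emb p u0) (b0, 0) \<zeta>)) 0 / fact k * (\<zeta> - 0) ^ k)
        sums F (cline cJ (emb p u0) (b0, 0) \<zeta>)"
      by (rule holomorphic_power_series[OF hol[where u=u0, OF u0r u0B]]) (use z in auto)
    then have sums: "(\<lambda>k. \<zeta> ^ k * Fk k (emb p u0)) sums F (emb p u)"
      by (simp add: u_eq deriv[where u=u0, OF u0r u0B] mult.commute)
    have geo: "summable (\<lambda>k. K * (norm \<zeta> / r') ^ k)"
      using z' assms(4) by (intro summable_mult summable_geometric) auto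
    have "norm (\<zeta> ^ k * Fk k (emb p u0)) \<le> K * (norm \<zeta> / r') ^ k" for k
      using mult_left_mono[OF bound[where u=u0 and k=k, OF u0r u0B], of "norm \<zeta> ^ k"]
      by (simp add: norm_mult norm_power power_divide mult.commute)
    then have "summable (\<lambda>k. norm (\<zeta> ^ k * Fk k (emb p u0)))"
      by (intro summable_comparison_test'[OF geo]) auto
    then have outer: "((\<lambda>k. \<zeta> ^ k * Fk k (emb p u0)) has_sum F (emb p u)) UNIV"
      using sums by (rule norm_summable_imp_has_sum)
    let ?f = "\<lambda>(k, \<alpha>). \<zeta> ^ k * ((\<Prod>b\<in>B. u b ^ \<alpha> b) * c k \<alpha>)"
    have pr: "(\<Prod>b\<in>B. u0 b ^ \<alpha> b) = (\<Prod>b\<in>B. u b ^ \<alpha> b)" for \<alpha>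
      using insert(2) by (intro prod.cong) (auto simp: u0_def)
    have inner: "((\<lambda>\<alpha>. ?f (k, \<alpha>)) has_sum \<zeta> ^ k * Fk k (emb p u0)) (multi_index B)" for k
      using has_sum_cmult_right[OF c(2)[where u=u0 and k=k, OF u0' u0B], of "\<zeta> ^ k"] by (simp add: pr)
    \<comment> \<open>Absolute summability allows the iterated sums to be merged. The majorant is
      \<open>K\<close> times the multi-geometric series with ratios
      \<open>norm (u b) / r'\<close>.\<close>
    have "?f summable_on (UNIV \<times> multi_index B)"
    proof (rule Infinite_Sum.abs_summable_summable, rule Infinite_Sum.abs_summable_on_comparison_test')
      let ?t = "\<lambda>b. norm (u b) / r'"
      have t: "0 \<le> ?t b" "?t b < 1" for b using u(1) assms(4) by auto
      have "(\<lambda>\<alpha>. K * (\<Prod>b\<in>insert b0 B. ?t b ^ \<alpha> b)) summable_on multi_index (insert b0 B)"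
        by (intro summable_on_cmult_right summable_on_multi_geometric t) (use insert in auto)
      then show "(\<lambda>(k, \<alpha>). K * (\<Prod>b\<in>insert b0 B. ?t b ^ (\<alpha>(b0 := k)) b)) summable_on (UNIV \<times> multi_index B)"
        using has_sum_multi_index_insert[OF insert(2), of "\<lambda>\<alpha>. K * (\<Prod>b\<in>insert b0 B. ?t b ^ \<alpha> b)"]
        unfolding summable_on_def by blast
      fix x :: "nat \<times> ('a \<Rightarrow> nat)"
      obtain k \<alpha> where x: "x = (k, \<alpha>)" by (cases x)
      have "norm (?f (k, \<alpha>)) \<le> norm \<zeta> ^ k * ((\<Prod>b\<in>B. norm (u b) ^ \<alpha> b) * (K / r' ^ k / r' ^ sum \<alpha> B))"
        unfolding norm_mult norm_power prod_norm[symmetric] case_prod_conv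
        by (intro mult_left_mono c(1)) (auto intro: prod_nonneg)
      also have "\<dots> = K * (\<Prod>b\<in>insert b0 B. ?t b ^ (\<alpha>(b0 := k)) b)"
        unfolding prod_insert_fun_upd[OF insert(1,2)]
        by (simp add: \<zeta>_def power_divide prod_dividef power_sum)
      finally show "norm (?f x) \<le> (case x of (k, \<alpha>) \<Rightarrow> K * (\<Prod>b\<in>insert b0 B. ?t b ^ (\<alpha>(b0 := k)) b))"
        by (simp add: x)
    qed
    then have "(?f has_sum F (emb p u)) (UNIV \<times> multi_index B)"
      by (rule has_sum_SigmaI[OF inner outer])
    then show "((\<lambda>\<alpha>. (\<Prod>b\<in>insert b0 B. u b ^ \<alpha> b) * C \<alpha>) has_sum F (emb p u)) (multi_index (insert b0 B))"
      unfolding has_sum_multi_index_insert[OF insert(2)]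
    proof (rule has_sum_cong[THEN iffD1, rotated])
      fix x :: "nat \<times> ('a \<Rightarrow> nat)" assume "x \<in> UNIV \<times> multi_index B"
      then obtain k \<alpha> where x: "x = (k, \<alpha>)" "\<alpha> b0 = 0" using insert(2) by (auto simp: multi_index_def)
      then have "(\<alpha>(b0 := k))(b0 := 0) = \<alpha>" by auto
      then show "?f x = (case x of (k, \<alpha>) \<Rightarrow> (\<Prod>b\<in>insert b0 B. u b ^ (\<alpha>(b0 := k)) b) * C (\<alpha>(b0 := k)))"
        unfolding x case_prod_conv prod_insert_fun_upd[OF insert(1,2)] C_def
        by (simp add: \<zeta>_def mult.assoc)
    qed
  qed
qed

lemma ranalytic_imp_real_analytic_at:
  fixes f :: "'a::euclidean_space \<Rightarrow> real"
  assumes "ranalytic (\<lambda>x. of_real (f x)) p"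
  shows "real_analytic_at f p"
proof -
  obtain F R where F: "R > 0" "jhol cJ F (ball (p, 0) R)" "\<And>x. x \<in> ball p R \<Longrightarrow> F (x, 0) = of_real (f x)"
    using assms unfolding ranalytic_def by blast
  define n where "n = real DIM('a)"
  have n: "n > 0" by (simp add: n_def)
  \<comment> \<open>The real and the imaginary coordinates each contribute at most
    \<open>n * r\<close>, so the polydisc lies in the closed ball of radius \<open>R / 2\<close>,
    where compactness bounds \<open>F\<close>.\<close>
  define r where "r = R / (4 * n)"
  have r: "r > 0" using F(1) n by (simp add: r_def)
  have small: "emb p u \<in> cball (p, 0) (R/2)" if u: "\<And>b. norm (u b) < r" for u
  proof -
    have *: "norm (\<Sum>b\<in>(Basis::'a set). g (u b) *\<^sub>R b) \<le> n * r"
      if "\<And>z. \<bar>g z\<bar> \<le> norm z" for g :: "complex \<Rightarrow> real"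
    proof -
      have "norm (\<Sum>b\<in>(Basis::'a set). g (u b) *\<^sub>R b) \<le> (\<Sum>b\<in>(Basis::'a set). r)"
        by (rule sum_norm_le) (use order_trans[OF that less_imp_le[OF u]] in auto)
      then show ?thesis by (simp add: n_def)
    qed
    have "dist (p, 0) (emb p u) \<le> norm (\<Sum>b\<in>(Basis::'a set). Re (u b) *\<^sub>R b) + norm (\<Sum>b\<in>(Basis::'a set). Im (u b) *\<^sub>R b)"
      unfolding emb_def dist_Pair_Pair
      by (rule order_trans[OF sqrt_sum_squares_le_sum]) (auto simp: dist_norm)
    also have "\<dots> \<le> n * r + n * r" by (intro add_mono * abs_Re_le_cmod abs_Im_le_cmod)
    also have "\<dots> = R / 2" using n by (simp add: r_def)
    finally show ?thesis by simp
  qed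
  have sub: "cball (p, 0) (R/2) \<subseteq> ball (p, 0::'a) R" using F(1) by auto
  have "compact (F ` cball (p, 0) (R/2))"
    by (intro compact_continuous_image continuous_on_subset[OF jhol_continuous_on[OF F(2)] sub]) auto
  then obtain K where K: "\<And>q. q \<in> cball (p, 0) (R/2) \<Longrightarrow> norm (F q) \<le> K"
    using compact_imp_bounded bounded_iff by (metis imageI)
  obtain c where c: "\<And>u. (\<And>b. norm (u b) < r / 2) \<Longrightarrow> (\<And>b. b \<notin> Basis \<Longrightarrow> u b = 0) \<Longrightarrow>
        ((\<lambda>\<alpha>. (\<Prod>b\<in>Basis. u b ^ \<alpha> b) * c \<alpha>) has_sum F (emb p u)) (multi_index Basis)"
  proof -
    have "\<exists>c. (\<forall>\<alpha>. norm (c \<alpha>) \<le> K / (r/2) ^ sum \<alpha> Basis) \<and>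
     (\<forall>u. (\<forall>b. norm (u b) < r/2) \<longrightarrow> (\<forall>b. b \<notin> Basis \<longrightarrow> u b = 0) \<longrightarrow>
        ((\<lambda>\<alpha>. (\<Prod>b\<in>Basis. u b ^ \<alpha> b) * c \<alpha>) has_sum F (emb p u)) (multi_index Basis))"
    proof (rule jhol_multi_taylor[OF finite_Basis order_refl open_ball])
      show "emb p u \<in> ball (p, 0) R" if "\<And>b. norm (u b) < r" for u using small[where u=u, OF that] sub by blast
      show "norm (F (emb p u)) \<le> K" if "\<And>b. norm (u b) < r" for u using K[OF small[where u=u, OF that]] .
    qed (use r F(2) in auto)
    then show ?thesis using that by blast
  qed
  show ?thesis unfolding real_analytic_at_def multi_index_def[symmetric]
  proof (intro exI conjI ballI)
    show "min R (r/2) > 0" using F(1) r by simp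
    fix x assume x: "x \<in> ball p (min R (r/2))"
    define u where "u b = (if b \<in> Basis then of_real ((x - p) \<bullet> b) else (0::complex))" for b
    have "norm (u b) < r / 2" for b
    proof (cases "b \<in> Basis")
      case True
      then have "norm (u b) \<le> norm (x - p)" by (simp add: u_def Basis_le_norm del: of_real_diff of_real_inner_1)
      then show ?thesis using x by (auto simp: dist_norm norm_minus_commute)
    qed (use r in \<open>simp add: u_def\<close>)
    then have "((\<lambda>\<alpha>. (\<Prod>b\<in>Basis. u b ^ \<alpha> b) * c \<alpha>) has_sum F (emb p u)) (multi_index Basis)"
      by (rule c) (simp add: u_def)
    moreover have "emb p u = (x, 0)"
    proof -
      have "(\<Sum>b\<in>Basis. Re (u b) *\<^sub>R b) = (\<Sum>b\<in>Basis. ((x - p) \<bullet> b) *\<^sub>R b)"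
        by (rule sum.cong) (auto simp: u_def)
      also have "\<dots> = x - p" by (rule euclidean_representation)
      finally show ?thesis by (simp add: emb_def u_def)
    qed
    ultimately have "((\<lambda>\<alpha>. (\<Prod>b\<in>Basis. u b ^ \<alpha> b) * c \<alpha>) has_sum of_real (f x)) (multi_index Basis)"
      using F(3) x by auto
    from has_sum_Re[OF this]
    have "((\<lambda>\<alpha>. Re ((\<Prod>b\<in>Basis. u b ^ \<alpha> b) * c \<alpha>)) has_sum f x) (multi_index Basis)" by simp
    moreover have "(\<Prod>b\<in>Basis. u b ^ \<alpha> b) = of_real (\<Prod>b\<in>Basis. ((x - p) \<bullet> b) ^ \<alpha> b)" for \<alpha>
      unfolding of_real_prod of_real_power by (rule prod.cong) (auto simp: u_def)
    then have "Re ((\<Prod>b\<in>Basis. u b ^ \<alpha> b) * c \<alpha>) = (\<Prod>b\<in>Basis. ((x - p) \<bullet> b) ^ \<alpha> b) *\<^sub>R Re (c \<alpha>)" for \<alpha>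
      by (simp del: of_real_prod of_real_power)
    ultimately show "((\<lambda>\<alpha>. (\<Prod>b\<in>Basis. ((x - p) \<bullet> b) ^ \<alpha> b) *\<^sub>R Re (c \<alpha>)) has_sum f x) (multi_index Basis)"
      by (simp only:)
  qed
qed

section \<open>Wirtinger calculus\<close>

lemma d_hol_dd: "d_hol j f Z = (dd (axis j 1) f Z - \<i> * dd (axis j \<i>) f Z) / 2"
  by (simp add: d_hol_def dd_def)

lemma d_bar_dd: "d_bar j f Z = (dd (axis j 1) f Z + \<i> * dd (axis j \<i>) f Z) / 2"
  by (simp add: d_bar_def dd_def)

lemma vec_as_axis_sum: "(v :: complex^'n) = (\<Sum>j\<in>UNIV. Re (v $ j) *\<^sub>R axis j 1 + Im (v $ j) *\<^sub>R axis j \<i>)"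
proof (rule vec_eq_iff[THEN iffD2], rule allI)
  fix k
  have "(\<Sum>j\<in>UNIV. Re (v $ j) *\<^sub>R axis j 1 + Im (v $ j) *\<^sub>R axis j \<i>) $ k
      = (\<Sum>j\<in>UNIV. if j = k then v $ k else 0)"
    unfolding sum_component
    by (rule sum.cong) (auto simp: axis_def complex_eq_iff)
  then show "v $ k = (\<Sum>j\<in>UNIV. Re (v $ j) *\<^sub>R axis j 1 + Im (v $ j) *\<^sub>R axis j \<i>) $ k" by simp
qed

lemma dd_wirtinger:
  fixes f :: "complex^'n \<Rightarrow> complex"
  assumes "f differentiable (at Z)"
  shows "dd v f Z = (\<Sum>j\<in>UNIV. v $ j * d_hol j f Z + cnj (v $ j) * d_bar j f Z)"
proof -
  interpret bl: bounded_linear "\<lambda>v. dd v f Z"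
    using differentiable_dd[OF assms] has_derivative_bounded_linear by blast
  have "dd v f Z = (\<Sum>j\<in>UNIV. Re (v $ j) *\<^sub>R dd (axis j 1) f Z + Im (v $ j) *\<^sub>R dd (axis j \<i>) f Z)"
    by (subst vec_as_axis_sum[of v]) (simp only: bl.sum bl.add bl.scaleR)
  also have "\<dots> = (\<Sum>j\<in>UNIV. v $ j * d_hol j f Z + cnj (v $ j) * d_bar j f Z)"
  proof (rule sum.cong[OF refl])
    fix j
    show "Re (v $ j) *\<^sub>R dd (axis j 1) f Z + Im (v $ j) *\<^sub>R dd (axis j \<i>) f Z
        = v $ j * d_hol j f Z + cnj (v $ j) * d_bar j f Z"
      by (simp add: d_hol_dd d_bar_dd complex_eq_iff field_simps)
  qed
  finally show ?thesis .
qed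

lemma dd_add: "f differentiable (at Z) \<Longrightarrow> g differentiable (at Z) \<Longrightarrow>
    dd v (\<lambda>Z. f Z + g Z) Z = dd v f Z + dd v g Z"
  by (rule dd_eqI[OF has_derivative_add[OF differentiable_dd differentiable_dd]])

lemma dd_diff: "f differentiable (at Z) \<Longrightarrow> g differentiable (at Z) \<Longrightarrow>
    dd v (\<lambda>Z. f Z - g Z) Z = dd v f Z - dd v g Z"
  by (rule dd_eqI[OF has_derivative_diff[OF differentiable_dd differentiable_dd]])

lemma dd_mult: "f differentiable (at Z) \<Longrightarrow> g differentiable (at Z) \<Longrightarrow>
    dd v (\<lambda>Z. f Z * g Z) Z = f Z * dd v g Z + dd v f Z * g Z"
  by (rule dd_eqI[OF has_derivative_mult[OF differentiable_dd differentiable_dd]])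

lemma dd_const [simp]: "dd v (\<lambda>_. c) Z = 0"
  by (rule dd_eqI[OF has_derivative_const])

lemma dd_cnj: "f differentiable (at Z) \<Longrightarrow> dd v (\<lambda>Z. cnj (f Z)) Z = cnj (dd v f Z)"
  by (rule dd_eqI[OF has_derivative_cnj[OF differentiable_dd]])

lemma dd_compose:
  assumes "(G has_derivative D) (at Z)" "f differentiable (at (G Z))"
  shows "dd v (\<lambda>Z. f (G Z)) Z = dd (D v) f (G Z)"
  by (rule dd_eqI[OF has_derivative_compose[OF assms(1) differentiable_dd[OF assms(2)]]])

lemma dd_linear:
  assumes "f differentiable (at Z)"
  shows "dd (u + v) f Z = dd u f Z + dd v f Z" "dd (c *\<^sub>R v) f Z = of_real c * dd v f Z" "dd 0 f Z = 0"
proof -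
  interpret bl: bounded_linear "\<lambda>v. dd v f Z"
    using differentiable_dd[OF assms] has_derivative_bounded_linear by blast
  show "dd (u + v) f Z = dd u f Z + dd v f Z" "dd (c *\<^sub>R v) f Z = of_real c * dd v f Z" "dd 0 f Z = 0"
    by (simp_all add: bl.add bl.scaleR bl.zero scaleR_conv_of_real)
qed

text \<open>The (1,0) and (0,1) directional derivatives; in \<open>anti_dd v\<close> the direction is not conjugated.\<close>

definition hol_dd :: "complex^'n \<Rightarrow> (complex^'n \<Rightarrow> complex) \<Rightarrow> complex^'n \<Rightarrow> complex" where
  "hol_dd v f Z = (\<Sum>k\<in>UNIV. v $ k * d_hol k f Z)"

definition anti_dd :: "complex^'n \<Rightarrow> (complex^'n \<Rightarrow> complex) \<Rightarrow> complex^'n \<Rightarrow> complex" where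
  "anti_dd v f Z = (\<Sum>k\<in>UNIV. v $ k * d_bar k f Z)"

definition vcnj :: "complex^'n \<Rightarrow> complex^'n" where
  "vcnj v = (\<chi> k. cnj (v $ k))"

lemma vcnj_component [simp]: "vcnj v $ k = cnj (v $ k)"
  by (simp add: vcnj_def)

lemma vcnj_vcnj [simp]: "vcnj (vcnj v) = v"
  by (simp add: vec_eq_iff)

lemma field_apply_anti_dd: "field_apply a f Z = anti_dd (a Z) f Z"
  by (simp add: field_apply_def anti_dd_def)

lemma cr_space_anti_dd: "v \<in> cr_space \<rho> Z \<longleftrightarrow> anti_dd v (\<lambda>Z. complex_of_real (\<rho> Z)) Z = 0"
  by (simp add: cr_space_def anti_dd_def)

lemma hol_tangent_space_hol_dd: "v \<in> hol_tangent_space \<rho> Z \<longleftrightarrow> hol_dd v (\<lambda>Z. complex_of_real (\<rho> Z)) Z = 0"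
  by (simp add: hol_tangent_space_def hol_dd_def)

lemma hol_dd_axis [simp]: "hol_dd (axis j 1) f Z = d_hol j f Z"
  by (simp add: hol_dd_def axis_def if_distrib[of "\<lambda>x. x * _"] cong: if_cong)

lemma anti_dd_axis [simp]: "anti_dd (axis j 1) f Z = d_bar j f Z"
  by (simp add: anti_dd_def axis_def if_distrib[of "\<lambda>x. x * _"] cong: if_cong)

lemma hol_dd_add_vec: "hol_dd (u + v) f Z = hol_dd u f Z + hol_dd v f Z"
  by (simp add: hol_dd_def sum.distrib algebra_simps)

lemma hol_dd_smult_vec: "hol_dd (c *s v) f Z = c * hol_dd v f Z"
  by (simp add: hol_dd_def sum_distrib_left algebra_simps)

lemma hol_dd_diff_vec: "hol_dd (u - v) f Z = hol_dd u f Z - hol_dd v f Z"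
  by (simp add: hol_dd_def sum_subtractf algebra_simps)

lemma dd_hol_dd_anti_dd: "f differentiable (at Z) \<Longrightarrow> dd v f Z = hol_dd v f Z + anti_dd (vcnj v) f Z"
  by (simp add: dd_wirtinger hol_dd_def anti_dd_def sum.distrib)

lemma dd_i_hol_dd_anti_dd: "f differentiable (at Z) \<Longrightarrow> dd (\<i> *s v) f Z = \<i> * hol_dd v f Z - \<i> * anti_dd (vcnj v) f Z"
  by (simp add: dd_wirtinger hol_dd_def anti_dd_def sum.distrib sum_distrib_left sum_subtractf mult.assoc)

lemma hol_dd_dd: "f differentiable (at Z) \<Longrightarrow> hol_dd v f Z = (dd v f Z - \<i> * dd (\<i> *s v) f Z) / 2"
  by (simp only: dd_i_hol_dd_anti_dd dd_hol_dd_anti_dd[of f Z v]) (simp add: algebra_simps)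

lemma anti_dd_dd: "f differentiable (at Z) \<Longrightarrow> anti_dd v f Z = (dd (vcnj v) f Z + \<i> * dd (\<i> *s vcnj v) f Z) / 2"
  by (simp only: dd_i_hol_dd_anti_dd dd_hol_dd_anti_dd[of f Z "vcnj v"]) (simp add: algebra_simps)

lemma vcnj_i_smult [simp]: "vcnj (\<i> *s v) = - \<i> *s vcnj v"
  by (simp add: vec_eq_iff)

lemma differentiable_cnj: "f differentiable (at Z) \<Longrightarrow> (\<lambda>Z. cnj (f Z)) differentiable (at Z)"
  using has_derivative_cnj[OF differentiable_dd] differentiable_def by blast

context
  fixes f g :: "complex^'n \<Rightarrow> complex" and Z
  assumes f: "f differentiable (at Z)" and g: "g differentiable (at Z)"
begin

lemma hol_dd_add: "hol_dd v (\<lambda>Z. f Z + g Z) Z = hol_dd v f Z + hol_dd v g Z"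
  and anti_dd_add: "anti_dd v (\<lambda>Z. f Z + g Z) Z = anti_dd v f Z + anti_dd v g Z"
  using f g by (simp_all add: hol_dd_dd anti_dd_dd dd_add add_divide_distrib algebra_simps diff_divide_distrib)

lemma hol_dd_diff: "hol_dd v (\<lambda>Z. f Z - g Z) Z = hol_dd v f Z - hol_dd v g Z"
  and anti_dd_diff: "anti_dd v (\<lambda>Z. f Z - g Z) Z = anti_dd v f Z - anti_dd v g Z"
  using f g by (simp_all add: hol_dd_dd anti_dd_dd dd_diff add_divide_distrib algebra_simps diff_divide_distrib)

lemma hol_dd_mult: "hol_dd v (\<lambda>Z. f Z * g Z) Z = f Z * hol_dd v g Z + hol_dd v f Z * g Z"
  and anti_dd_mult: "anti_dd v (\<lambda>Z. f Z * g Z) Z = f Z * anti_dd v g Z + anti_dd v f Z * g Z"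
  using f g by (simp_all add: hol_dd_dd anti_dd_dd dd_mult field_simps)

end

lemma
  assumes f: "f differentiable (at Z)"
  shows hol_dd_cnj: "hol_dd v (\<lambda>Z. cnj (f Z)) Z = cnj (anti_dd (vcnj v) f Z)"
    and anti_dd_cnj: "anti_dd v (\<lambda>Z. cnj (f Z)) Z = cnj (hol_dd (vcnj v) f Z)"
  using f differentiable_cnj[OF f] by (simp_all add: hol_dd_dd anti_dd_dd dd_cnj field_simps)

lemma hol_dd_const [simp]: "hol_dd v (\<lambda>_. c) Z = 0" and anti_dd_const [simp]: "anti_dd v (\<lambda>_. c) Z = 0"
  by (simp_all add: hol_dd_dd anti_dd_dd)

lemma hol_dd_cmult: "f differentiable (at Z) \<Longrightarrow> hol_dd v (\<lambda>Z. c * f Z) Z = c * hol_dd v f Z"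
  and anti_dd_cmult: "f differentiable (at Z) \<Longrightarrow> anti_dd v (\<lambda>Z. c * f Z) Z = c * anti_dd v f Z"
  by (simp_all add: hol_dd_mult anti_dd_mult)

lemma hol_dd_sum: "(\<And>i. i \<in> I \<Longrightarrow> f i differentiable (at Z)) \<Longrightarrow> hol_dd v (\<lambda>Z. \<Sum>i\<in>I. f i Z) Z = (\<Sum>i\<in>I. hol_dd v (f i) Z)"
  and anti_dd_sum: "(\<And>i. i \<in> I \<Longrightarrow> f i differentiable (at Z)) \<Longrightarrow> anti_dd v (\<lambda>Z. \<Sum>i\<in>I. f i Z) Z = (\<Sum>i\<in>I. anti_dd v (f i) Z)"
   by (induction I rule: infinite_finite_induct) (simp_all add: hol_dd_add anti_dd_add)

lemma hol_dd_real:
  fixes f :: "complex^'n \<Rightarrow> real"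
  assumes "(\<lambda>Z. complex_of_real (f Z)) differentiable (at Z)"
  shows "cnj (hol_dd v (\<lambda>Z. complex_of_real (f Z)) Z) = anti_dd (vcnj v) (\<lambda>Z. complex_of_real (f Z)) Z"
  using anti_dd_cnj[OF assms, of "vcnj v"] by simp

lemma
  assumes "eventually (\<lambda>x. f x = g x) (nhds p)"
  shows hol_dd_transform: "hol_dd v f p = hol_dd v g p" and anti_dd_transform: "anti_dd v f p = anti_dd v g p"
  unfolding hol_dd_def anti_dd_def d_hol_dd d_bar_dd by (simp_all add: dd_transform[OF assms])

section \<open>Commuting Wirtinger derivatives\<close>

lemma ranalytic_d_hol [intro]: "ranalytic f p \<Longrightarrow> ranalytic (d_hol j f) p"
  unfolding d_hol_dd[abs_def] by (intro ranalytic_divide ranalytic_diff ranalytic_mult ranalytic_dd ranalytic_const) auto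

lemma ranalytic_d_bar [intro]: "ranalytic f p \<Longrightarrow> ranalytic (d_bar j f) p"
  unfolding d_bar_dd[abs_def] by (intro ranalytic_divide ranalytic_add ranalytic_mult ranalytic_dd ranalytic_const) auto

lemma ranalytic_hol_dd [intro]: "ranalytic f p \<Longrightarrow> ranalytic (hol_dd v f) p"
  unfolding hol_dd_def[abs_def] by (intro ranalytic_sum ranalytic_mult ranalytic_d_hol ranalytic_const)

lemma ranalytic_anti_dd [intro]: "ranalytic f p \<Longrightarrow> ranalytic (anti_dd v f) p"
  unfolding anti_dd_def[abs_def] by (intro ranalytic_sum ranalytic_mult ranalytic_d_bar ranalytic_const)

lemma dd_lincomb:
  assumes "ranalytic f p" "ranalytic g p"
  shows "dd u (\<lambda>Z. (f Z + c * g Z) / 2) p = (dd u f p + c * dd u g p) / 2"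
  using assms[THEN ranalytic_has_derivative]
  by (intro dd_eqI) (auto intro!: derivative_eq_intros)

lemma d_hol_alt: "d_hol j f = (\<lambda>Z. (dd (axis j 1) f Z + (-\<i>) * dd (axis j \<i>) f Z) / 2)"
  and d_bar_alt: "d_bar j f = (\<lambda>Z. (dd (axis j 1) f Z + \<i> * dd (axis j \<i>) f Z) / 2)"
  by (auto simp: d_hol_dd d_bar_dd fun_eq_iff)

lemma
  assumes f: "ranalytic f p"
  shows d_hol_d_bar_commute: "d_hol j (d_bar k f) p = d_bar k (d_hol j f) p"
    and d_hol_d_hol_commute: "d_hol j (d_hol k f) p = d_hol k (d_hol j f) p"
    and d_bar_d_bar_commute: "d_bar j (d_bar k f) p = d_bar k (d_bar j f) p"
proof -
  have d: "dd u (d_hol j f) p = (dd u (dd (axis j 1) f) p + (-\<i>) * dd u (dd (axis j \<i>) f) p) / 2"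
    "dd u (d_bar j f) p = (dd u (dd (axis j 1) f) p + \<i> * dd u (dd (axis j \<i>) f) p) / 2" for u j
    unfolding d_hol_alt d_bar_alt by (rule dd_lincomb; intro ranalytic_dd f)+
  note c = ranalytic_dd_commute[OF f]
  show "d_hol j (d_bar k f) p = d_bar k (d_hol j f) p"
    unfolding d_hol_dd[of _ "d_bar k f"] d_bar_dd[of _ "d_hol j f"] d
    by (simp add: c[of _ "axis j _"] field_simps)
  show "d_hol j (d_hol k f) p = d_hol k (d_hol j f) p"
    unfolding d_hol_dd[of _ "d_hol _ f"] d
    by (simp add: c[of _ "axis j _"] field_simps)
  show "d_bar j (d_bar k f) p = d_bar k (d_bar j f) p"
    unfolding d_bar_dd[of _ "d_bar _ f"] d
    by (simp add: c[of _ "axis j _"] field_simps)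
qed

lemma hol_dd_anti_dd_expand:
  assumes f: "ranalytic f p"
  shows "hol_dd v (anti_dd w f) p = (\<Sum>j\<in>UNIV. \<Sum>k\<in>UNIV. d_hol j (d_bar k f) p * v $ j * w $ k)"
proof -
  have "hol_dd v (anti_dd w f) p = (\<Sum>k\<in>UNIV. w $ k * hol_dd v (d_bar k f) p)"
    unfolding anti_dd_def[abs_def]
    by (subst hol_dd_sum) (auto intro!: ranalytic_differentiable ranalytic_mult ranalytic_d_bar f sum.cong hol_dd_cmult)
  also have "\<dots> = (\<Sum>k\<in>UNIV. \<Sum>j\<in>UNIV. d_hol j (d_bar k f) p * v $ j * w $ k)"
    by (simp add: hol_dd_def sum_distrib_left mult_ac)
  also have "\<dots> = (\<Sum>j\<in>UNIV. \<Sum>k\<in>UNIV. d_hol j (d_bar k f) p * v $ j * w $ k)"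
    by (rule sum.swap)
  finally show ?thesis .
qed

lemma anti_dd_hol_dd_expand:
  assumes f: "ranalytic f p"
  shows "anti_dd w (hol_dd v f) p = (\<Sum>j\<in>UNIV. \<Sum>k\<in>UNIV. d_hol j (d_bar k f) p * v $ j * w $ k)"
proof -
  have "anti_dd w (hol_dd v f) p = (\<Sum>j\<in>UNIV. v $ j * anti_dd w (d_hol j f) p)"
    unfolding hol_dd_def[abs_def]
    by (subst anti_dd_sum) (auto intro!: ranalytic_differentiable ranalytic_mult ranalytic_d_hol f sum.cong anti_dd_cmult)
  also have "\<dots> = (\<Sum>j\<in>UNIV. \<Sum>k\<in>UNIV. d_hol j (d_bar k f) p * v $ j * w $ k)"
    by (simp add: anti_dd_def sum_distrib_left mult_ac d_hol_d_bar_commute[OF f])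
  finally show ?thesis .
qed

section \<open>Functions vanishing on a hypersurface and the change of defining function\<close>

lemma levi_form_anti_dd_hol_dd:
  assumes "ranalytic (\<lambda>Z. complex_of_real (\<rho> Z)) p"
  shows "levi_form \<rho> p v w = anti_dd (vcnj w) (hol_dd v (\<lambda>Z. complex_of_real (\<rho> Z))) p"
  by (simp add: levi_form_def anti_dd_hol_dd_expand[OF assms])

text \<open>After a small step in the tangent direction \<open>v\<close>, the intermediate value
  theorem supplies a correction along the transversal vector \<open>m\<close>, at most \<epsilon>
  times the step, that returns to the zero set of \<open>\<rho>\<close>. There \<open>e\<close> is
  0, so \<open>E v\<close> is bounded by a fixed multiple of \<epsilon>.\<close>

lemma tangent_derivative_zero:
  fixes \<rho> :: "'a::real_normed_vector \<Rightarrow> real" and e :: "'a \<Rightarrow> 'b::real_normed_vector"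
  assumes D: "(\<rho> has_derivative D) (at q)" and E: "(e has_derivative E) (at q)"
    and n: "D n \<noteq> 0" and v: "D v = 0" and q: "\<rho> q = 0"
    and cont: "eventually (isCont \<rho>) (nhds q)"
    and e: "eventually (\<lambda>x. \<rho> x = 0 \<longrightarrow> e x = 0) (nhds q)"
  shows "E v = 0"
proof -
  interpret D: bounded_linear D using D has_derivative_bounded_linear by blast
  interpret E: bounded_linear E using E has_derivative_bounded_linear by blast
  define m where "m = (1 / D n) *\<^sub>R n"
  have m: "D m = 1" using n by (simp add: m_def D.scaleR)
  define K where "K = norm v + norm m + 1"
  have K: "K > 0" by (simp add: K_def add_nonneg_pos)
  have le: "norm (E v) \<le> \<epsilon> * (norm (E m) + 1)" if \<epsilon>: "0 < \<epsilon>" "\<epsilon> \<le> 1" for \<epsilon>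
  proof -
    \<comment> \<open>With this accuracy the linearization error at the points considered is at most
      \<open>\<epsilon> * \<tau> / 2\<close>, whereas the linear part of \<open>\<rho>\<close> at
      \<sigma> = \<epsilon> and \<sigma> = -\<epsilon> has size \<open>\<epsilon> * \<tau>\<close>.
      Hence \<open>\<rho>\<close> changes sign.\<close>
    define \<eta> where "\<eta> = \<epsilon> / (2 * K)"
    have \<eta>: "\<eta> > 0" using \<epsilon> K by (simp add: \<eta>_def)
    obtain d1 where d1: "d1 > 0" "\<And>x. norm (x - q) < d1 \<Longrightarrow> norm (\<rho> x - \<rho> q - D (x - q)) \<le> \<eta> * norm (x - q)"
      using D \<eta> unfolding has_derivative_at_alt by blast
    obtain d2 where d2: "d2 > 0" "\<And>x. norm (x - q) < d2 \<Longrightarrow> norm (e x - e q - E (x - q)) \<le> \<eta> * norm (x - q)"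
      using E \<eta> unfolding has_derivative_at_alt by blast
    obtain d3 where d3: "d3 > 0" "\<And>x. dist x q < d3 \<Longrightarrow> isCont \<rho> x"
      using cont unfolding eventually_nhds_metric by blast
    obtain d4 where d4: "d4 > 0" "\<And>x. dist x q < d4 \<Longrightarrow> \<rho> x = 0 \<longrightarrow> e x = 0"
      using e unfolding eventually_nhds_metric by blast
    define \<tau> where "\<tau> = min (min d1 d2) (min d3 d4) / (2 * K)"
    have \<tau>: "\<tau> > 0" using d1 d2 d3 d4 K by (simp add: \<tau>_def)
    define x where "x \<sigma> = q + \<tau> *\<^sub>R (v + \<sigma> *\<^sub>R m)" for \<sigma>
    have nx: "norm (x \<sigma> - q) \<le> \<tau> * K" if "\<bar>\<sigma>\<bar> \<le> \<epsilon>" for \<sigma>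
    proof -
      have "norm (v + \<sigma> *\<^sub>R m) \<le> norm v + \<bar>\<sigma>\<bar> * norm m"
        by (rule order_trans[OF norm_triangle_ineq]) simp
      also have "\<dots> \<le> norm v + 1 * norm m"
        using that \<epsilon> by (intro add_left_mono mult_right_mono) auto
      also have "\<dots> \<le> K" by (simp add: K_def)
      finally show ?thesis using \<tau> by (simp add: x_def)
    qed
    have \<tau>K: "\<tau> * K < d1" "\<tau> * K < d2" "\<tau> * K < d3" "\<tau> * K < d4"
      using K d1 d2 d3 d4 by (simp_all add: \<tau>_def)
    have near: "norm (x \<sigma> - q) < d1" "norm (x \<sigma> - q) < d2" "dist (x \<sigma>) q < d3" "dist (x \<sigma>) q < d4" if "\<bar>\<sigma>\<bar> \<le> \<epsilon>" for \<sigma>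
      using nx[OF that] \<tau>K by (auto simp: dist_norm)
    have \<eta>\<tau>: "\<eta> * (\<tau> * K) = \<epsilon> * \<tau> / 2" using K by (simp add: \<eta>_def)
    have small: "\<eta> * norm (x \<sigma> - q) \<le> \<epsilon> * \<tau> / 2" if "\<bar>\<sigma>\<bar> \<le> \<epsilon>" for \<sigma>
      using mult_left_mono[OF nx[OF that], of \<eta>] \<eta> \<eta>\<tau> by simp
    have \<rho>x: "\<bar>\<rho> (x \<sigma>) - \<tau> * \<sigma>\<bar> \<le> \<epsilon> * \<tau> / 2" if "\<bar>\<sigma>\<bar> \<le> \<epsilon>" for \<sigma>
    proof -
      have "D (x \<sigma> - q) = \<tau> * \<sigma>" by (simp add: x_def D.add D.scaleR v m)
      then show ?thesis using d1(2)[OF near(1)[OF that]] small[OF that] q by simp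
    qed
    have "\<exists>\<sigma>\<ge>-\<epsilon>. \<sigma> \<le> \<epsilon> \<and> \<rho> (x \<sigma>) = 0"
    proof (rule IVT')
      show "\<rho> (x (- \<epsilon>)) \<le> 0" "0 \<le> \<rho> (x \<epsilon>)"
      proof -
        have "\<epsilon> * \<tau> > 0" "\<bar>\<rho> (x (- \<epsilon>)) + \<epsilon> * \<tau>\<bar> \<le> \<epsilon> * \<tau> / 2" "\<bar>\<rho> (x \<epsilon>) - \<epsilon> * \<tau>\<bar> \<le> \<epsilon> * \<tau> / 2"
          using \<rho>x[of "-\<epsilon>"] \<rho>x[of \<epsilon>] \<epsilon> \<tau> by (simp_all add: mult.commute)
        then show "\<rho> (x (- \<epsilon>)) \<le> 0" "0 \<le> \<rho> (x \<epsilon>)" by linarith+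
      qed
      show "continuous_on {-\<epsilon>..\<epsilon>} (\<lambda>\<sigma>. \<rho> (x \<sigma>))"
      proof (intro continuous_at_imp_continuous_on ballI)
        fix \<sigma> assume "\<sigma> \<in> {-\<epsilon>..\<epsilon>}"
        then have "isCont \<rho> (x \<sigma>)" using near(3)[of \<sigma>] d3(2) by auto
        moreover have "isCont x \<sigma>" unfolding x_def by (intro continuous_intros)
        ultimately show "isCont (\<lambda>\<sigma>. \<rho> (x \<sigma>)) \<sigma>" by (rule isCont_o2[rotated])
      qed
    qed (use \<epsilon> in auto)
    then obtain \<sigma> where \<sigma>': "- \<epsilon> \<le> \<sigma>" "\<sigma> \<le> \<epsilon>" and "\<rho> (x \<sigma>) = 0" by blast
    then have \<sigma>: "\<bar>\<sigma>\<bar> \<le> \<epsilon>" "\<rho> (x \<sigma>) = 0" by auto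
    have e0: "e (x \<sigma>) = 0" "e q = 0" using d4(2) near(4)[OF \<sigma>(1)] \<sigma>(2) q d4(1) by auto
    have "norm (E (x \<sigma> - q)) \<le> \<epsilon> * \<tau> / 2"
      using d2(2)[OF near(2)[OF \<sigma>(1)]] small[OF \<sigma>(1)] e0 by simp
    moreover have "E (x \<sigma> - q) = \<tau> *\<^sub>R (E v + \<sigma> *\<^sub>R E m)" by (simp add: x_def E.add E.scaleR)
    ultimately have "\<tau> * norm (E v + \<sigma> *\<^sub>R E m) \<le> \<tau> * (\<epsilon> / 2)" using \<tau> by (simp add: mult.commute)
    then have "norm (E v + \<sigma> *\<^sub>R E m) \<le> \<epsilon> / 2" using \<tau> by (subst (asm) mult_le_cancel_left_pos)
    moreover have "norm (E v) \<le> norm (E v + \<sigma> *\<^sub>R E m) + norm (\<sigma> *\<^sub>R E m)"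
      by (metis add_diff_cancel_right' norm_triangle_ineq4)
    moreover have "norm (\<sigma> *\<^sub>R E m) \<le> \<epsilon> * norm (E m)" using \<sigma>(1) by (simp add: mult_right_mono)
    ultimately show ?thesis using \<epsilon> by (simp add: algebra_simps)
  qed
  have "norm (E v) \<le> 0"
  proof (rule ccontr)
    assume "\<not> norm (E v) \<le> 0"
    then have pos: "norm (E v) > 0" by simp
    define c where "c = norm (E m) + 1"
    have c: "c \<ge> 1" by (simp add: c_def)
    define \<epsilon> where "\<epsilon> = min 1 (norm (E v) / (2 * c))"
    have "\<epsilon> > 0" "\<epsilon> \<le> 1" using pos c by (auto simp: \<epsilon>_def)
    from le[OF this] have "norm (E v) \<le> \<epsilon> * c" by (simp add: c_def)
    also have "\<dots> \<le> norm (E v) / (2 * c) * c" using c by (intro mult_right_mono) (auto simp: \<epsilon>_def)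
    finally show False using pos c by (simp add: field_simps)
  qed
  then show ?thesis by simp
qed

lemma ranalytic_eventually_isCont: "ranalytic f p \<Longrightarrow> eventually (isCont f) (nhds p)"
  using ranalytic_eventually ranalytic_isCont by (metis (mono_tags, lifting) eventually_mono)

lemma has_derivative_of_real_iff:
  assumes "((\<lambda>x. complex_of_real (f x)) has_derivative D) (at p)"
  shows "(f has_derivative (\<lambda>v. Re (D v))) (at p)" "D v = of_real (Re (D v))"
proof -
  show d: "(f has_derivative (\<lambda>v. Re (D v))) (at p)"
    using bounded_linear.has_derivative[OF bounded_linear_Re assms] by simp
  have "((\<lambda>x. complex_of_real (f x)) has_derivative (\<lambda>v. of_real (Re (D v)))) (at p)"
    using bounded_linear.has_derivative[OF bounded_linear_of_real d] .
  then have "D = (\<lambda>v. of_real (Re (D v)))" using has_derivative_unique assms by blast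
  then show "D v = of_real (Re (D v))" by metis
qed

lemma dd_tangent_zero:
  fixes \<rho> :: "'a::euclidean_space \<Rightarrow> real"
  assumes \<rho>: "ranalytic (\<lambda>x. complex_of_real (\<rho> x)) q" and e: "e differentiable (at q)"
    and q: "\<rho> q = 0" and n: "dd n (\<lambda>x. complex_of_real (\<rho> x)) q \<noteq> 0"
    and v: "dd v (\<lambda>x. complex_of_real (\<rho> x)) q = 0"
    and van: "eventually (\<lambda>x. \<rho> x = 0 \<longrightarrow> e x = 0) (nhds q)"
  shows "dd v e q = 0"
proof (rule tangent_derivative_zero[OF _ differentiable_dd[OF e] _ _ q _ van])
  note d = has_derivative_of_real_iff[OF ranalytic_has_derivative[OF \<rho>]]
  show "(\<rho> has_derivative (\<lambda>v. Re (dd v (\<lambda>x. complex_of_real (\<rho> x)) q))) (at q)" by (rule d(1))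
  show "Re (dd n (\<lambda>x. complex_of_real (\<rho> x)) q) \<noteq> 0" using n d(2)[of n] by auto
  show "Re (dd v (\<lambda>x. complex_of_real (\<rho> x)) q) = 0" using v by simp
  have "isCont \<rho> x" if "isCont (\<lambda>x. complex_of_real (\<rho> x)) x" for x
    using continuous_Re[OF that] by simp
  then show "eventually (isCont \<rho>) (nhds q)"
    using ranalytic_eventually_isCont[OF \<rho>] by (auto elim: eventually_mono)
qed

text \<open>A (0,1) vector that annihilates the real function \<open>\<rho>\<close> gives two real
  tangent vectors, \<open>vcnj a\<close> and its multiple by the imaginary unit. Both annihilate
  \<open>e\<close>, and \<open>anti_dd a e\<close> is a combination of the two derivatives.\<close>

lemma anti_dd_tangent_zero:
  fixes \<rho> :: "complex^'n \<Rightarrow> real"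
  assumes \<rho>: "ranalytic (\<lambda>x. complex_of_real (\<rho> x)) q" and e: "e differentiable (at q)"
    and q: "\<rho> q = 0" and n: "hol_dd n (\<lambda>x. complex_of_real (\<rho> x)) q \<noteq> 0"
    and a: "anti_dd a (\<lambda>x. complex_of_real (\<rho> x)) q = 0"
    and van: "eventually (\<lambda>x. \<rho> x = 0 \<longrightarrow> e x = 0) (nhds q)"
  shows "anti_dd a e q = 0"
proof -
  note d\<rho> = ranalytic_differentiable[OF \<rho>]
  obtain m where m: "dd m (\<lambda>x. complex_of_real (\<rho> x)) q \<noteq> 0"
    using n hol_dd_dd[OF d\<rho>, of n] by fastforce
  have h: "hol_dd (vcnj a) (\<lambda>x. complex_of_real (\<rho> x)) q = 0"
    using hol_dd_real[OF d\<rho>, of "vcnj a"] a by simp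
  have "dd (vcnj a) e q = 0"
    by (rule dd_tangent_zero[OF \<rho> e q m _ van]) (simp add: dd_hol_dd_anti_dd[OF d\<rho>] h a)
  moreover have "dd (\<i> *s vcnj a) e q = 0"
    by (rule dd_tangent_zero[OF \<rho> e q m _ van]) (simp add: dd_i_hol_dd_anti_dd[OF d\<rho>] h a)
  ultimately show ?thesis by (simp add: anti_dd_dd[OF e])
qed

lemma hol_dd_tangent_zero:
  fixes \<rho> :: "complex^'n \<Rightarrow> real"
  assumes \<rho>: "ranalytic (\<lambda>x. complex_of_real (\<rho> x)) q" and e: "e differentiable (at q)"
    and q: "\<rho> q = 0" and n: "hol_dd n (\<lambda>x. complex_of_real (\<rho> x)) q \<noteq> 0"
    and a: "hol_dd a (\<lambda>x. complex_of_real (\<rho> x)) q = 0"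
    and van: "eventually (\<lambda>x. \<rho> x = 0 \<longrightarrow> e x = 0) (nhds q)"
  shows "hol_dd a e q = 0"
proof -
  have "anti_dd (vcnj a) (\<lambda>x. cnj (e x)) q = 0"
  proof (rule anti_dd_tangent_zero[OF \<rho> _ q n])
    show "(\<lambda>x. cnj (e x)) differentiable (at q)"
      by (rule differentiable_cnj[OF e])
    show "anti_dd (vcnj a) (\<lambda>x. complex_of_real (\<rho> x)) q = 0"
      using hol_dd_real[OF ranalytic_differentiable[OF \<rho>], of a] a by simp
  qed (use van in \<open>auto elim: eventually_mono\<close>)
  then show ?thesis using anti_dd_cnj[OF e, of "vcnj a"] by simp
qed

text \<open>The combination of \<open>v\<close> and \<open>n\<close> that annihilates
  \<open>\<rho>\<close> must annihilate \<open>\<sigma>\<close>. This is the comparison of defining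
  functions at first order.\<close>

lemma hol_dd_proportional:
  fixes \<rho> \<sigma> :: "complex^'n \<Rightarrow> real"
  assumes \<rho>: "ranalytic (\<lambda>x. complex_of_real (\<rho> x)) q" and \<sigma>: "ranalytic (\<lambda>x. complex_of_real (\<sigma> x)) q"
    and q: "\<rho> q = 0" and n: "hol_dd n (\<lambda>x. complex_of_real (\<rho> x)) q \<noteq> 0"
    and van: "eventually (\<lambda>x. \<rho> x = 0 \<longrightarrow> \<sigma> x = 0) (nhds q)"
  shows "hol_dd v (\<lambda>x. complex_of_real (\<sigma> x)) q * hol_dd n (\<lambda>x. complex_of_real (\<rho> x)) q
       = hol_dd n (\<lambda>x. complex_of_real (\<sigma> x)) q * hol_dd v (\<lambda>x. complex_of_real (\<rho> x)) q"
proof -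
  let ?\<rho> = "\<lambda>x. complex_of_real (\<rho> x)" and ?\<sigma> = "\<lambda>x. complex_of_real (\<sigma> x)"
  define w where "w = hol_dd n ?\<rho> q *s v - hol_dd v ?\<rho> q *s n"
  have "hol_dd w ?\<rho> q = 0" by (simp add: w_def hol_dd_diff_vec hol_dd_smult_vec)
  then have "hol_dd w ?\<sigma> q = 0"
    by (intro hol_dd_tangent_zero[OF \<rho> ranalytic_differentiable[OF \<sigma>] q n]) (use van in \<open>auto elim: eventually_mono\<close>)
  then show ?thesis by (simp add: w_def hol_dd_diff_vec hol_dd_smult_vec mult.commute)
qed

text \<open>The identity of \<open>hol_dd_proportional\<close> holds along the zero set near
  \<open>q\<close> and may be differentiated in a (0,1) tangent direction. The terms in which the
  first derivatives along \<open>v\<close> stay undifferentiated drop out, because \<open>v\<close>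
  is tangent for both functions.\<close>

lemma levi_form_proportional:
  fixes \<rho> \<sigma> :: "complex^'n \<Rightarrow> real"
  assumes \<rho>: "ranalytic (\<lambda>x. complex_of_real (\<rho> x)) q" and \<sigma>: "ranalytic (\<lambda>x. complex_of_real (\<sigma> x)) q"
    and q: "\<rho> q = 0" and n: "hol_dd n (\<lambda>x. complex_of_real (\<rho> x)) q \<noteq> 0"
    and van: "eventually (\<lambda>x. \<rho> x = 0 \<longrightarrow> \<sigma> x = 0) (nhds q)"
    and v: "v \<in> hol_tangent_space \<rho> q" and w: "w \<in> hol_tangent_space \<rho> q"
  shows "levi_form \<sigma> q v w * hol_dd n (\<lambda>x. complex_of_real (\<rho> x)) q
       = hol_dd n (\<lambda>x. complex_of_real (\<sigma> x)) q * levi_form \<rho> q v w"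
proof -
  let ?\<rho> = "\<lambda>x. complex_of_real (\<rho> x)" and ?\<sigma> = "\<lambda>x. complex_of_real (\<sigma> x)"
  define e where "e x = hol_dd v ?\<sigma> x * hol_dd n ?\<rho> x - hol_dd n ?\<sigma> x * hol_dd v ?\<rho> x" for x
  have re: "ranalytic e q" unfolding e_def using \<rho> \<sigma> by (intro ranalytic_diff ranalytic_mult ranalytic_hol_dd)
  have "isCont (hol_dd n ?\<rho>) q" using \<rho> by (intro ranalytic_isCont ranalytic_hol_dd)
  then have "eventually (\<lambda>x. hol_dd n ?\<rho> x \<noteq> 0) (nhds q)"
    using n by (metis eventually_nhds_conv_at t1_space_nhds tendsto_imp_eventually_ne isCont_def)
  moreover have "eventually (\<lambda>x. eventually (\<lambda>x. \<rho> x = 0 \<longrightarrow> \<sigma> x = 0) (nhds x)) (nhds q)"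
    using van by (simp add: eventually_eventually)
  ultimately have "eventually (\<lambda>x. \<rho> x = 0 \<longrightarrow> e x = 0) (nhds q)"
    using ranalytic_eventually[OF \<rho>] ranalytic_eventually[OF \<sigma>]
  proof eventually_elim
    case (elim x)
    then show ?case using hol_dd_proportional[of \<rho> x \<sigma> n v] by (auto simp: e_def)
  qed
  then have "anti_dd (vcnj w) e q = 0"
    by (intro anti_dd_tangent_zero[OF \<rho> ranalytic_differentiable[OF re] q n])
       (use w hol_dd_real[OF ranalytic_differentiable[OF \<rho>], of w] in \<open>auto simp: hol_tangent_space_hol_dd\<close>)
  moreover have "hol_dd v ?\<rho> q = 0" using v by (simp add: hol_tangent_space_hol_dd)
  moreover have "hol_dd v ?\<sigma> q = 0"
    by (rule hol_dd_tangent_zero[OF \<rho> ranalytic_differentiable[OF \<sigma>] q n \<open>hol_dd v ?\<rho> q = 0\<close>])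
       (use van in \<open>auto elim: eventually_mono\<close>)
  ultimately show ?thesis
    unfolding e_def levi_form_anti_dd_hol_dd[OF \<rho>] levi_form_anti_dd_hol_dd[OF \<sigma>]
    using \<rho> \<sigma> by (simp add: anti_dd_diff anti_dd_mult ranalytic_differentiable ranalytic_mult ranalytic_hol_dd mult.commute)
qed

section \<open>Holomorphic maps\<close>

lemma bounded_linear_smult_vec: "bounded_linear (\<lambda>v::complex^'n. c *s v)"
  unfolding linear_conv_bounded_linear[symmetric]
  by (rule linearI) (auto simp: vec_eq_iff algebra_simps)

abbreviation vi :: "complex^'n \<Rightarrow> complex^'n" where "vi \<equiv> (*s) \<i>"

lemma vi_vi: "vi (vi y) = - y"
  by (simp add: vec_eq_iff)

lemma smult_vec_vi: "c *s v = Re c *\<^sub>R v + Im c *\<^sub>R vi v"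
  by (simp add: vec_eq_iff complex_eq_iff)

lemma jhol_vi_smult:
  assumes "jhol vi f S" "Z \<in> S" shows "dd (c *s v) f Z = c * dd v f Z"
proof -
  note d = jhol_has_derivative[OF assms]
  have diff: "f differentiable (at Z)" by (rule differentiableI[OF d(1)])
  have "dd (c *s v) f Z = of_real (Re c) * dd v f Z + of_real (Im c) * (\<i> * dd v f Z)"
    by (subst smult_vec_vi) (simp only: dd_linear[OF diff] d(2))
  then show ?thesis by (simp add: complex_eq_iff algebra_simps)
qed

lemma
  assumes "jhol vi f S" "Z \<in> S"
  shows jhol_hol_dd: "hol_dd v f Z = dd v f Z" and jhol_anti_dd: "anti_dd v f Z = 0"
proof -
  note d = jhol_has_derivative[OF assms]
  have diff: "f differentiable (at Z)" by (rule differentiableI[OF d(1)])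
  show "hol_dd v f Z = dd v f Z" "anti_dd v f Z = 0" by (simp_all add: hol_dd_dd[OF diff] anti_dd_dd[OF diff] d(2))
qed

lemma jhol_vi_ranalytic: "jhol vi f S \<Longrightarrow> open S \<Longrightarrow> Z \<in> S \<Longrightarrow> ranalytic f Z"
  by (rule ranalytic_jhol[where S=S and J=vi]) (simp_all add: vi_vi bounded_linear_smult_vec del: vector_smult_assoc)

lemma jhol_coord:
  assumes "f holomorphic_on A" "open A"
  shows "jhol vi (\<lambda>Z. f (Z $ k)) {Z. Z $ k \<in> A}"
    and "Z $ k \<in> A \<Longrightarrow> dd v (\<lambda>Z. f (Z $ k)) Z = deriv f (Z $ k) * v $ k"
proof -
  have *: "((\<lambda>Z. f (Z $ k)) has_derivative (\<lambda>v. deriv f (Z $ k) * v $ k)) (at Z)" if "Z $ k \<in> A" for Z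
  proof -
    have "(f has_derivative (*) (deriv f (Z $ k))) (at (Z $ k))"
      using holomorphic_derivI[OF assms that] by (simp add: has_field_derivative_def)
    then show ?thesis
      by (rule has_derivative_compose[rotated]) (rule bounded_linear_imp_has_derivative[OF bounded_linear_vec_nth])
  qed
  show "jhol vi (\<lambda>Z. f (Z $ k)) {Z. Z $ k \<in> A}"
    unfolding jhol_def using * by (fastforce intro: exI conjI)
  show "Z $ k \<in> A \<Longrightarrow> dd v (\<lambda>Z. f (Z $ k)) Z = deriv f (Z $ k) * v $ k" using dd_eqI[OF *] .
qed

lemma jhol_coord_id: "jhol vi (\<lambda>Z. Z $ k) (S :: (complex^'n) set)"
  by (rule jhol_subset[OF jhol_coord(1)[OF holomorphic_on_ident open_UNIV]]) simp

lemma has_derivative_vec: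
  fixes H :: "complex^'n \<Rightarrow> complex^'m"
  assumes "\<And>k. ((\<lambda>x. H x $ k) has_derivative (\<lambda>v. D v $ k)) (at x)"
  shows "(H has_derivative D) (at x)"
  unfolding has_derivative_componentwise_within[of H]
proof
  fix i :: "complex^'m" assume "i \<in> Basis"
  then obtain k b where i: "i = axis k b" by (auto simp: Basis_vec_def)
  show "((\<lambda>x. H x \<bullet> i) has_derivative (\<lambda>x. D x \<bullet> i)) (at x)"
    unfolding i inner_axis by (intro has_derivative_inner_left assms)
qed

definition hD :: "(complex^'n \<Rightarrow> complex^'m) \<Rightarrow> complex^'n \<Rightarrow> complex^'n \<Rightarrow> complex^'m" where
  "hD H Z v = (\<chi> l. dd v (\<lambda>Z. H Z $ l) Z)"

lemma holomorphic_map_on_iff_jhol: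
  fixes H :: "complex^'n \<Rightarrow> complex^'m"
  shows
  "holomorphic_map_on H U \<longleftrightarrow> (\<forall>l. jhol vi (\<lambda>Z. H Z $ l) U)"
proof
  assume H: "holomorphic_map_on H U"
  show "\<forall>l. jhol vi (\<lambda>Z. H Z $ l) U"
    unfolding jhol_def
  proof (intro allI ballI)
    fix l Z assume "Z \<in> U"
    then obtain D where D: "(H has_derivative D) (at Z)" "\<And>c v. D (c *s v) = c *s D v"
      using H unfolding holomorphic_map_on_def by blast
    show "\<exists>D. ((\<lambda>Z. H Z $ l) has_derivative D) (at Z) \<and> (\<forall>v. D (vi v) = \<i> * D v)"
      using bounded_linear.has_derivative[OF bounded_linear_vec_nth D(1), of l] D(2) by fastforce
  qed
next
  assume H: "\<forall>l. jhol vi (\<lambda>Z. H Z $ l) U"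
  show "holomorphic_map_on H U"
    unfolding holomorphic_map_on_def
  proof (intro ballI exI conjI allI)
    fix Z c v assume Z: "Z \<in> U"
    show "(H has_derivative hD H Z) (at Z)"
      by (rule has_derivative_vec) (simp add: hD_def jhol_has_derivative(1)[OF H[rule_format] Z])
    show "hD H Z (c *s v) = c *s hD H Z v"
      by (simp add: hD_def vec_eq_iff jhol_vi_smult[OF H[rule_format] Z])
  qed
qed

lemma
  fixes H :: "complex^'n \<Rightarrow> complex^'m"
  assumes H: "holomorphic_map_on H U" and Z: "Z \<in> U"
  shows hD_has_derivative: "(H has_derivative hD H Z) (at Z)"
    and hD_smult: "hD H Z (c *s v) = c *s hD H Z v"
    and hD_hol_dd: "hol_dd v (\<lambda>Z. H Z $ l) Z = hD H Z v $ l"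
    and hD_anti_dd: "anti_dd v (\<lambda>Z. H Z $ l) Z = 0"
proof -
  have J: "jhol vi (\<lambda>Z. H Z $ l) U" for l using H by (simp add: holomorphic_map_on_iff_jhol)
  show "(H has_derivative hD H Z) (at Z)"
    by (rule has_derivative_vec) (simp add: hD_def jhol_has_derivative(1)[OF J Z])
  show "hD H Z (c *s v) = c *s hD H Z v"
    by (simp add: hD_def vec_eq_iff jhol_vi_smult[OF J Z])
  show "hol_dd v (\<lambda>Z. H Z $ l) Z = hD H Z v $ l" "anti_dd v (\<lambda>Z. H Z $ l) Z = 0"
    by (simp_all add: jhol_hol_dd[OF J Z] jhol_anti_dd[OF J Z] hD_def)
qed

lemma hD_bounded_linear:
  assumes "holomorphic_map_on H U" "Z \<in> U" shows "bounded_linear (hD H Z)"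
  by (rule has_derivative_bounded_linear[OF hD_has_derivative[OF assms]])

lemma holomorphic_map_ranalytic:
  fixes H :: "complex^'n \<Rightarrow> complex^'m"
  shows
  "holomorphic_map_on H U \<Longrightarrow> open U \<Longrightarrow> Z \<in> U \<Longrightarrow> ranalytic (\<lambda>Z. H Z $ l) Z"
  by (rule jhol_vi_ranalytic[where S=U]) (simp_all add: holomorphic_map_on_iff_jhol)

lemma holomorphic_map_isCont: "holomorphic_map_on H U \<Longrightarrow> Z \<in> U \<Longrightarrow> isCont H Z"
  by (rule has_derivative_continuous[OF hD_has_derivative[where U=U]])

lemma ranalytic_compose_vec:
  fixes h :: "'a::euclidean_space \<Rightarrow> complex^'n"
  assumes "ranalytic f (h p)" "\<And>l. ranalytic (\<lambda>x. h x $ l) p"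
  shows "ranalytic (\<lambda>x. f (h x)) p"
proof (rule ranalytic_compose[where h=h, OF assms(1)])
  fix b :: "complex^'n" assume "b \<in> Basis"
  then obtain k where "b = axis k 1 \<or> b = axis k \<i>" by (auto simp: Basis_vec_def Basis_complex_def)
  then have "(\<lambda>x. complex_of_real (h x \<bullet> b)) = (\<lambda>x. of_real (Re (h x $ k)))
     \<or> (\<lambda>x. complex_of_real (h x \<bullet> b)) = (\<lambda>x. of_real (Im (h x $ k)))"
    by (auto simp: inner_axis)
  then show "ranalytic (\<lambda>x. complex_of_real (h x \<bullet> b)) p"
    using ranalytic_of_real_Re[OF assms(2)[of k]] ranalytic_of_real_Im[OF assms(2)[of k]] by auto
qed

lemma ranalytic_compose_holomorphic:
  assumes "ranalytic f (H Z)" "holomorphic_map_on H U" "open U" "Z \<in> U"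
  shows "ranalytic (\<lambda>Z. f (H Z)) Z"
  by (rule ranalytic_compose_vec[where h=H, OF assms(1) holomorphic_map_ranalytic[OF assms(2-4)]])

text \<open>A complex linear derivative does not mix types. Since \<open>anti_dd\<close> takes its
  direction unconjugated, (0,1) vectors are transported by the conjugate of
  \<open>hD\<close>.\<close>

lemma
  assumes H: "holomorphic_map_on H U" and Z: "Z \<in> U" and f: "f differentiable (at (H Z))"
  shows hol_dd_compose: "hol_dd v (\<lambda>Z. f (H Z)) Z = hol_dd (hD H Z v) f (H Z)"
    and anti_dd_compose: "anti_dd v (\<lambda>Z. f (H Z)) Z = anti_dd (vcnj (hD H Z (vcnj v))) f (H Z)"
    and dd_compose_hD: "dd v (\<lambda>Z. f (H Z)) Z = dd (hD H Z v) f (H Z)"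
proof -
  have d: "dd v (\<lambda>Z. f (H Z)) Z = dd (hD H Z v) f (H Z)" for v
    by (rule dd_compose[OF hD_has_derivative[OF H Z] f])
  have diff: "(\<lambda>Z. f (H Z)) differentiable (at Z)"
    by (rule differentiableI[OF has_derivative_compose[OF hD_has_derivative[OF H Z] differentiable_dd[OF f]]])
  show "hol_dd v (\<lambda>Z. f (H Z)) Z = hol_dd (hD H Z v) f (H Z)"
    by (simp add: hol_dd_dd[OF diff] hol_dd_dd[OF f] d hD_smult[OF H Z])
  show "anti_dd v (\<lambda>Z. f (H Z)) Z = anti_dd (vcnj (hD H Z (vcnj v))) f (H Z)"
    by (simp add: anti_dd_dd[OF diff] anti_dd_dd[OF f] d hD_smult[OF H Z])
  show "dd v (\<lambda>Z. f (H Z)) Z = dd (hD H Z v) f (H Z)" by (rule d)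
qed

lemma hD_compose:
  fixes H :: "complex^'n \<Rightarrow> complex^'m"
    and G :: "complex^'m \<Rightarrow> complex^'k"
  assumes H: "holomorphic_map_on H U" and Z: "Z \<in> U" and G: "holomorphic_map_on G V" "H Z \<in> V"
  shows "hD (\<lambda>Z. G (H Z)) Z v = hD G (H Z) (hD H Z v)"
proof -
  have diff: "(\<lambda>Z. G Z $ l) differentiable (at (H Z))" for l
  proof -
    have J: "jhol vi (\<lambda>Z. G Z $ l) V" using G(1) by (simp add: holomorphic_map_on_iff_jhol)
    show ?thesis by (rule differentiableI[OF jhol_has_derivative(1)[OF J G(2)]])
  qed
  show ?thesis
    unfolding hD_def[of "\<lambda>Z. G (H Z)"] hD_def[of G] vec_eq_iff
    using dd_compose_hD[OF H Z diff] by simp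
qed

lemma holomorphic_map_compose:
  fixes H :: "complex^'n \<Rightarrow> complex^'m"
    and G :: "complex^'m \<Rightarrow> complex^'k"
  assumes H: "holomorphic_map_on H U" and G: "holomorphic_map_on G V" "\<And>Z. Z \<in> U \<Longrightarrow> H Z \<in> V"
  shows "holomorphic_map_on (\<lambda>Z. G (H Z)) U"
  unfolding holomorphic_map_on_iff_jhol
proof
  fix l
  show "jhol vi (\<lambda>Z. G (H Z) $ l) U"
  proof (rule jhol_compose[where S=V and J=vi])
    show "jhol vi (\<lambda>Z. G Z $ l) V" using G(1) by (simp add: holomorphic_map_on_iff_jhol)
    show "\<exists>D. (H has_derivative D) (at q) \<and> (\<forall>v. D (vi v) = vi (D v))" if "q \<in> U" for q
      using hD_has_derivative[OF H that] hD_smult[OF H that] by blast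
  qed (rule G(2))
qed

lemma holomorphic_map_subset: "holomorphic_map_on H U \<Longrightarrow> V \<subseteq> U \<Longrightarrow> holomorphic_map_on H V"
  unfolding holomorphic_map_on_def by blast

text \<open>In finite dimension an injective derivative has a linear left inverse, as the inverse
  function theorem wants. The inverse map is holomorphic because the inverse of a complex linear
  bijection is complex linear.\<close>

lemma holomorphic_local_inverse:
  fixes H :: "complex^'n \<Rightarrow> complex^'n"
  assumes H: "holomorphic_map_on H U" and U: "open U" "p \<in> U"
    and inj: "\<And>v. hD H p v = 0 \<Longrightarrow> v = 0"
  obtains U' V G where "open U'" "p \<in> U'" "U' \<subseteq> U" "open V" "homeomorphism U' V H G" "holomorphic_map_on G V"
proof -
  define H' where "H' Z = Blinfun (hD H Z)" for Z
  have app: "blinfun_apply (H' Z) = hD H Z" if "Z \<in> U" for Z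
    unfolding H'_def by (rule bounded_linear_Blinfun_apply[OF hD_bounded_linear[OF H that]])
  have cont: "continuous_on U H'"
  proof (rule continuous_on_blinfun_componentwise)
    fix i :: "complex^'n"
    have "continuous_on U (\<lambda>Z. hD H Z i)" unfolding hD_def
    proof (intro continuous_on_vec_lambda continuous_at_imp_continuous_on ballI)
      fix l Z assume "Z \<in> U"
      then show "isCont (dd i (\<lambda>Z. H Z $ l)) Z"
        by (intro ranalytic_isCont ranalytic_dd holomorphic_map_ranalytic[OF H U(1)])
    qed
    then show "continuous_on U (\<lambda>Z. blinfun_apply (H' Z) i)"
      by (rule continuous_on_eq) (simp add: app)
  qed
  have "linear (hD H p)" using hD_bounded_linear[OF H U(2)] bounded_linear.linear by blast
  moreover have "inj (hD H p)"
    using inj linear_injective_0[OF \<open>linear (hD H p)\<close>] by blast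
  ultimately obtain g where g: "linear g" "g \<circ> hD H p = id" using linear_injective_left_inverse by blast
  have gapp: "blinfun_apply (Blinfun g) = g"
    using g(1) by (intro bounded_linear_Blinfun_apply) (simp add: linear_conv_bounded_linear)
  have inv: "Blinfun g o\<^sub>L H' p = id_blinfun"
    by (rule blinfun_eqI) (use g(2) in \<open>simp add: gapp app[OF U(2)] fun_eq_iff\<close>)
  have der: "(H has_derivative blinfun_apply (H' Z)) (at Z)" if "Z \<in> U" for Z
    unfolding app[OF that] by (rule hD_has_derivative[OF H that])
  obtain U' V G G' where UV: "open U'" "U' \<subseteq> U" "p \<in> U'" "open V" "homeomorphism U' V H G"
    and G: "\<And>y. y \<in> V \<Longrightarrow> (G has_derivative (G' y)) (at y)"
      "\<And>y. y \<in> V \<Longrightarrow> G' y = inv (blinfun_apply (H' (G y)))"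
      "\<And>y. y \<in> V \<Longrightarrow> bij (blinfun_apply (H' (G y)))"
    using inverse_function_theorem[OF U(1) der cont U(2) inv] by metis
  have "holomorphic_map_on G V"
    unfolding holomorphic_map_on_def
  proof (intro ballI exI conjI allI)
    fix y c v assume y: "y \<in> V"
    show "(G has_derivative (G' y)) (at y)" by (rule G(1)[OF y])
    have Gy: "G y \<in> U" using UV y by (auto simp: homeomorphism_def)
    have b: "bij (hD H (G y))" using G(3)[OF y] by (simp add: app[OF Gy])
    have "hD H (G y) (c *s inv (hD H (G y)) v) = c *s v"
      using b by (simp add: hD_smult[OF H Gy] bij_is_surj surj_f_inv_f)
    then show "G' y (c *s v) = c *s G' y v"
      unfolding G(2)[OF y] app[OF Gy] using b by (metis bij_inv_eq_iff)
  qed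
  then show ?thesis using that UV by blast
qed

lemma ranalytic_real_part_dd:
  fixes f :: "complex^'n \<Rightarrow> real"
  assumes "(\<lambda>Z. complex_of_real (f Z)) differentiable (at Z)"
  shows "dd v (\<lambda>Z. complex_of_real (f Z)) Z = of_real (2 * Re (hol_dd v (\<lambda>Z. complex_of_real (f Z)) Z))"
  unfolding dd_hol_dd_anti_dd[OF assms] hol_dd_real[OF assms, symmetric] by (simp add: complex_add_cnj)

lemma ranalytic_coord [intro]: "ranalytic (\<lambda>Z. Z $ k) (Z :: complex^'n)"
  by (rule ranalytic_bounded_linear[OF bounded_linear_vec_nth])

section \<open>Straightening a transversal curve\<close>

text \<open>A function of \<open>z\<close> and \<open>Re w\<close> is represented on the whole of
  \<open>complex^3\<close> by invariance under \<open>embed3 _ 0\<close>; the Wirtinger calculus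
  then applies to it directly.\<close>

definition embed3 :: "complex^3 \<Rightarrow> real \<Rightarrow> complex^3" where
  "embed3 Z t = (\<chi> k. if k = 3 then of_real (Re (Z $ 3)) + \<i> * of_real t else Z $ k)"

lemma embed3_Im [simp]: "embed3 Z (Im (Z $ 3)) = Z"
  by (simp add: embed3_def vec_eq_iff complex_eq_iff)

lemma embed3_embed3 [simp]: "embed3 (embed3 Z s) t = embed3 Z t"
  by (simp add: embed3_def vec_eq_iff)

lemma embed3_bounded_linear: "bounded_linear (\<lambda>q. embed3 (fst q) (snd q))"
  unfolding linear_conv_bounded_linear[symmetric]
  by (rule linearI) (auto simp: embed3_def vec_eq_iff algebra_simps complex_eq_iff)

lemma embed3_bounded_linear0: "bounded_linear (\<lambda>Z. embed3 Z 0)"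
  using bounded_linear_compose[OF embed3_bounded_linear bounded_linear_Pair[OF bounded_linear_ident bounded_linear_zero]]
  by simp

lemma d_hol_transversal:
  fixes \<phi> :: "complex^3 \<Rightarrow> real"
  assumes d: "(\<lambda>Z. complex_of_real (\<phi> Z)) differentiable (at Z)"
    and inv: "\<And>Z. \<phi> (embed3 Z 0) = \<phi> Z"
  shows "dd (axis 3 \<i>) (\<lambda>Z. complex_of_real (\<phi> Z)) Z = 0"
    and "d_hol 3 (\<lambda>Z. complex_of_real (\<phi> Z)) Z = of_real (Re (d_hol 3 (\<lambda>Z. complex_of_real (\<phi> Z)) Z))"
proof -
  let ?f = "\<lambda>Z. complex_of_real (\<phi> Z)"
  have c: "\<phi> (Z + t *\<^sub>R axis 3 \<i>) = \<phi> Z" for t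
  proof -
    have "embed3 (Z + t *\<^sub>R axis 3 \<i>) 0 = embed3 Z 0"
      by (simp add: embed3_def vec_eq_iff axis_def)
    then show ?thesis using inv by metis
  qed
  have 1: "((\<lambda>t. Z + t *\<^sub>R axis 3 \<i>) has_derivative (\<lambda>t. t *\<^sub>R axis 3 \<i>)) (at (0::real))"
    by (auto intro!: derivative_eq_intros)
  have "((\<lambda>t. ?f (Z + t *\<^sub>R axis 3 \<i>)) has_derivative (\<lambda>t. dd (t *\<^sub>R axis 3 \<i>) ?f Z)) (at (0::real))"
    using has_derivative_compose[OF 1, of ?f] differentiable_dd[OF d] by simp
  then have "((\<lambda>t::real. ?f Z) has_derivative (\<lambda>t. dd (t *\<^sub>R axis 3 \<i>) ?f Z)) (at 0)"
    by (simp only: c)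
  then have "(\<lambda>t::real. dd (t *\<^sub>R axis 3 \<i>) ?f Z) = (\<lambda>t. 0)"
    by (rule has_derivative_unique) (rule has_derivative_const)
  then show *: "dd (axis 3 \<i>) ?f Z = 0" by (metis scaleR_one)
  have "dd (axis 3 1) ?f Z = of_real (2 * Re (hol_dd (axis 3 1) ?f Z))"
    by (rule ranalytic_real_part_dd[OF d])
  then show "d_hol 3 ?f Z = of_real (Re (d_hol 3 ?f Z))"
    by (simp add: d_hol_dd *)
qed

lemma ranalytic_of_real_affine: "ranalytic (\<lambda>q. of_real (a * fst q + b * snd q)) (q :: real \<times> real)"
  by (intro ranalytic_bounded_linear bounded_linear_compose[OF bounded_linear_of_real]
      bounded_linear_add bounded_linear_const_mult bounded_linear_fst bounded_linear_snd)

lemma d_hol_Im3: "d_hol j (\<lambda>Z::complex^3. complex_of_real (Im (Z $ 3))) Z = (if j = 3 then - \<i> / 2 else 0)"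
proof -
  have "dd v (\<lambda>Z::complex^3. complex_of_real (Im (Z $ 3))) Z = of_real (Im (v $ 3))" for v
    by (intro dd_eqI bounded_linear_imp_has_derivative bounded_linear_compose[OF bounded_linear_of_real]
        bounded_linear_compose[OF bounded_linear_Im] bounded_linear_vec_nth)
  then show ?thesis by (auto simp: d_hol_dd axis_def)
qed

lemma ranalytic_Im3: "ranalytic (\<lambda>Z::complex^3. complex_of_real (Im (Z $ 3))) Z"
  by (intro ranalytic_of_real_Im ranalytic_coord)

lemma ranalytic_graph:
  "ranalytic (\<lambda>Z. complex_of_real (\<phi> Z)) Z \<Longrightarrow> ranalytic (\<lambda>Z::complex^3. complex_of_real (\<phi> Z - Im (Z $ 3))) Z"
  using ranalytic_diff[OF _ ranalytic_Im3, of "\<lambda>Z. complex_of_real (\<phi> Z)" Z] by simp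

lemma d_hol_graph:
  assumes "ranalytic (\<lambda>Z. complex_of_real (\<phi> Z)) (Z :: complex^3)"
  shows "d_hol j (\<lambda>Z. complex_of_real (\<phi> Z - Im (Z $ 3))) Z
    = d_hol j (\<lambda>Z. complex_of_real (\<phi> Z)) Z + (if j = 3 then \<i> / 2 else 0)"
  using hol_dd_diff[OF ranalytic_differentiable[OF assms] ranalytic_differentiable[OF ranalytic_Im3], of "axis j 1"]
  by (simp add: d_hol_Im3)

lemma d_hol_3_graph_nonzero:
  assumes "ranalytic (\<lambda>Z. complex_of_real (\<phi> Z)) Z" "\<And>Z. \<phi> (embed3 Z 0) = \<phi> Z"
  shows "d_hol 3 (\<lambda>Z. complex_of_real (\<phi> Z - Im (Z $ 3))) Z \<noteq> 0"
  using d_hol_transversal(2)[OF ranalytic_differentiable[OF assms(1)] assms(2)]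
  by (simp add: d_hol_graph[OF assms(1)] complex_eq_iff del: of_real_diff)

text \<open>\<open>G\<close> straightens a real analytic transversal curve of the hypersurface together with its
  complex tangent planes: in the new coordinates, the curve is the real \<open>w\<close>-axis and the complex
  tangent plane along it is \<open>w = const\<close>.\<close>

lemma adapted_chart:
  fixes \<rho> :: "complex^3 \<Rightarrow> real"
  assumes \<rho>: "ranalytic (\<lambda>Z. complex_of_real (\<rho> Z)) p0" and \<rho>0: "\<rho> p0 = 0"
    and l: "d_hol l (\<lambda>Z. complex_of_real (\<rho> Z)) p0 \<noteq> 0"
  obtains A B :: "(complex^3) set" and G H :: "complex^3 \<Rightarrow> complex^3" and \<phi> :: "complex^3 \<Rightarrow> real"
  where "open A" "0 \<in> A" "open B" "G 0 = p0" "homeomorphism A B G H"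
    "holomorphic_map_on G A" "holomorphic_map_on H B"
    "\<And>Z. Z \<in> A \<Longrightarrow> ranalytic (\<lambda>Z. complex_of_real (\<phi> Z)) Z"
    "\<And>Z. Z \<in> A \<Longrightarrow> ranalytic (\<lambda>Z. complex_of_real (\<rho> Z)) (G Z)"
    "\<And>Z. Z \<in> A \<Longrightarrow> \<rho> (G Z) = 0 \<longleftrightarrow> Im (Z $ 3) = \<phi> Z"
    "\<And>Z. Z \<in> A \<Longrightarrow> d_hol 3 (\<lambda>Z. complex_of_real (\<rho> (G Z))) Z \<noteq> 0"
    "\<And>Z. \<phi> (embed3 Z 0) = \<phi> Z"
    "\<And>s. axis 3 (of_real s) \<in> A \<Longrightarrow> \<phi> (axis 3 (of_real s)) = 0"
    "\<And>s j. axis 3 (of_real s) \<in> A \<Longrightarrow> j \<noteq> 3 \<Longrightarrow> d_hol j (\<lambda>Z. complex_of_real (\<phi> Z)) (axis 3 (of_real s)) = 0"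
proof -
  let ?\<rho> = "\<lambda>Z. complex_of_real (\<rho> Z)"
  obtain j1 j2 where j: "j1 \<noteq> j2" "j1 \<noteq> l" "j2 \<noteq> l" "\<And>k::3. k = j1 \<or> k = j2 \<or> k = l"
  proof -
    have k: "k = 1 \<or> k = 2 \<or> k = 3" for k :: 3 by (rule exhaust_3)
    consider "l = 1" | "l = 2" | "l = 3" using k by blast
    then show ?thesis
    proof cases
      case 1
      show ?thesis by (rule that[of 2 3]) (use 1 k in auto)
    next
      case 2
      show ?thesis by (rule that[of 1 3]) (use 2 k in auto)
    next
      case 3
      show ?thesis by (rule that[of 1 2]) (use 3 k in auto)
    qed
  qed
  \<comment> \<open>With this scaling, real multiples of \<open>\<i> / g\<close> in coordinate
    \<open>l\<close> are tangent to the hypersurface at \<open>p0\<close>, and a further factor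
    \<open>\<i>\<close> gives derivative -1. So \<open>s\<close> runs along the hypersurface and
    \<open>t\<close> across it.\<close>
  define g where "g = 2 * d_hol l ?\<rho> p0"
  have g: "g \<noteq> 0" using l by (simp add: g_def)
  note d\<rho> = ranalytic_differentiable[OF \<rho>]
  text \<open>The curve: solve \<open>\<rho> (p0 + (\<i>/g) (s + \<i> t) e\<^sub>l) = 0\<close> for \<open>t\<close>.\<close>
  define e where "e q = p0 + axis l (\<i> / g * (of_real (fst q) + \<i> * of_real (snd q)))" for q :: "real \<times> real"
  have ranalytic_e: "ranalytic (\<lambda>q. e q $ k) q" for k q
  proof -
    have eq: "(\<lambda>q. e q $ k) = (\<lambda>q. p0 $ k + (if k = l then \<i> / g else 0) * (of_real (1 * fst q + 0 * snd q) + \<i> * of_real (0 * fst q + 1 * snd q)))"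
      by (auto simp: e_def axis_def)
    show ?thesis unfolding eq by (intro ranalytic_add ranalytic_mult ranalytic_const ranalytic_of_real_affine)
  qed
  have e0: "e (0, 0) = p0" by (simp add: e_def vec_eq_iff axis_def)
  have ranalytic_f: "ranalytic (\<lambda>q. ?\<rho> (e q)) (0, 0)"
    by (rule ranalytic_compose_vec[where h=e and f="?\<rho>"]) (simp_all add: e0 \<rho> ranalytic_e)
  have der_e: "(e has_derivative (\<lambda>q. axis l (\<i> / g * (of_real (fst q) + \<i> * of_real (snd q))))) (at q)" for q
  proof -
    have "linear (\<lambda>q :: real \<times> real. axis l (\<i> / g * (of_real (fst q) + \<i> * of_real (snd q))) :: complex^3)"
      by (rule linearI) (auto simp: vec_eq_iff axis_def algebra_simps scaleR_conv_of_real[where 'a=complex])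
    then show ?thesis unfolding e_def[abs_def]
      by (auto intro!: derivative_eq_intros bounded_linear_imp_has_derivative simp: linear_conv_bounded_linear)
  qed
  have cder: "dd (0, 1) (\<lambda>q. ?\<rho> (e q)) (0, 0) \<noteq> 0"
  proof -
    have "dd (0, 1) (\<lambda>q. ?\<rho> (e q)) (0, 0) = dd (axis l (\<i> / g * \<i>)) ?\<rho> p0"
      using dd_compose[OF der_e, of ?\<rho> "(0, 0)" "(0, 1)"] d\<rho> by (simp add: e0)
    also have "\<dots> = of_real (2 * Re (hol_dd (axis l (\<i> / g * \<i>)) ?\<rho> p0))"
      by (rule ranalytic_real_part_dd[OF d\<rho>])
    also have "hol_dd (axis l (\<i> / g * \<i>)) ?\<rho> p0 = (\<i> / g * \<i>) * d_hol l ?\<rho> p0"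
      by (simp add: hol_dd_def axis_def if_distrib[of "\<lambda>x. x * _"] cong: if_cong)
    also have "\<dots> = - 1 / 2" using l by (simp add: g_def)
    finally show ?thesis by simp
  qed
  obtain N r0 \<tau> where N: "open N" "0 \<in> N" "r0 > 0" and \<tau>_ranalytic: "\<And>x. x \<in> N \<Longrightarrow> ranalytic (\<lambda>x. complex_of_real (\<tau> x)) x"
    and \<tau>_small: "\<And>x. x \<in> N \<Longrightarrow> \<bar>\<tau> x - 0\<bar> < r0"
    and \<tau>_iff: "\<And>x t. x \<in> N \<Longrightarrow> \<bar>t - 0\<bar> < r0 \<Longrightarrow> \<rho> (e (x, t)) = 0 \<longleftrightarrow> t = \<tau> x"
    by (rule ranalytic_implicit_function[OF ranalytic_f _ cder]) (simp add: e0 \<rho>0, rule that)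
  have \<tau>0: "\<tau> 0 = 0" using \<tau>_iff[OF N(2), of 0] N(3) by (simp add: e0 \<rho>0)
  define \<gamma> where "\<gamma> s = e (s, \<tau> s)" for s
  have \<gamma>_M: "\<rho> (\<gamma> s) = 0" if "s \<in> N" for s
    using \<tau>_iff[OF that \<tau>_small[OF that]] by (simp add: \<gamma>_def)
  have \<gamma>0: "\<gamma> 0 = p0" by (simp add: \<gamma>_def \<tau>0 e0)
  have \<gamma>_comp: "\<gamma> s $ k = p0 $ k + (if k = l then \<i> / g else 0) * (of_real s + \<i> * of_real (\<tau> s))" for s k
    by (simp add: \<gamma>_def e_def axis_def)
  have ranalytic_id: "ranalytic (\<lambda>s. complex_of_real s) (s::real)" for s
    by (intro ranalytic_bounded_linear bounded_linear_of_real)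
  have ranalytic_\<gamma>: "ranalytic (\<lambda>s. \<gamma> s $ k) 0" for k
    unfolding \<gamma>_comp by (intro ranalytic_add ranalytic_mult ranalytic_const ranalytic_id \<tau>_ranalytic N(2))
  text \<open>The slopes of the complex tangent planes along the curve.\<close>
  define b where "b j s = d_hol j ?\<rho> (\<gamma> s) / d_hol l ?\<rho> (\<gamma> s)" for j s
  have ranalytic_b: "ranalytic (b j) 0" for j unfolding b_def
    by (intro ranalytic_divide ranalytic_compose_vec[where h=\<gamma>, OF _ ranalytic_\<gamma>]) (use \<rho> l in \<open>auto simp: \<gamma>0\<close>)
  obtain T r1 where T: "r1 > 0" "T holomorphic_on ball 0 r1" "\<And>s. \<bar>s\<bar> < r1 \<Longrightarrow> T (of_real s) = of_real (\<tau> s)"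
    using ranalytic_holomorphic_extension[OF \<tau>_ranalytic[OF N(2)]] by metis
  obtain B1 r2 where B1: "r2 > 0" "B1 holomorphic_on ball 0 r2" "\<And>s. \<bar>s\<bar> < r2 \<Longrightarrow> B1 (of_real s) = b j1 s"
    using ranalytic_holomorphic_extension[OF ranalytic_b] by metis
  obtain B2 r3 where B2: "r3 > 0" "B2 holomorphic_on ball 0 r3" "\<And>s. \<bar>s\<bar> < r3 \<Longrightarrow> B2 (of_real s) = b j2 s"
    using ranalytic_holomorphic_extension[OF ranalytic_b] by metis
  obtain r4 where r4: "r4 > 0" "\<And>s. \<bar>s\<bar> < r4 \<Longrightarrow> s \<in> N"
    using N(1,2) unfolding open_dist by (metis dist_0_norm dist_commute real_norm_def)
  define r where "r = min (min r1 r2) (min r3 r4)"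
  have r: "r > 0" "r \<le> r1" "r \<le> r2" "r \<le> r3" "r \<le> r4"
    using T B1 B2 r4 by (auto simp: r_def)
  have hol: "T holomorphic_on ball 0 r" "B1 holomorphic_on ball 0 r" "B2 holomorphic_on ball 0 r"
    using T(2) B1(2) B2(2) r by (auto intro: holomorphic_on_subset)
  define D where "D = {Z :: complex^3. Z $ 3 \<in> ball 0 r}"
  have D_vimage: "D = (\<lambda>Z. Z $ 3) -` ball 0 r" by (auto simp: D_def)
  have D: "open D" unfolding D_vimage
    by (intro open_vimage open_ball linear_continuous_on bounded_linear_vec_nth)
  have D0: "0 \<in> D" using r by (simp add: D_def)
  \<comment> \<open>On the axis this is the curve with its parameter made complex. The last two
    terms tilt the \<open>z\<close>-directions into the complex tangent planes: subtracting
    \<open>b j\<close> times the \<open>l\<close>-th unit vector from the \<open>j\<close>-th one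
    gives a vector annihilated by the gradient of \<open>\<rho>\<close>.\<close>
  define G where "G Z = (\<chi> k. p0 $ k + (if k = l then \<i> / g * (Z $ 3 + \<i> * T (Z $ 3)) - Z $ 1 * B1 (Z $ 3) - Z $ 2 * B2 (Z $ 3)
      else if k = j1 then Z $ 1 else Z $ 2))" for Z :: "complex^3"
  have hc: "jhol vi (\<lambda>Z :: complex^3. T (Z $ 3)) D" "jhol vi (\<lambda>Z :: complex^3. B1 (Z $ 3)) D" "jhol vi (\<lambda>Z :: complex^3. B2 (Z $ 3)) D"
    unfolding D_def by (intro jhol_coord hol open_ball)+
  have hdiff: "jhol vi (\<lambda>Z. f Z - h Z) D" if "jhol vi f D" "jhol vi h D" for f h :: "complex^3 \<Rightarrow> complex"
    using jhol_add[OF that(1) jhol_mult[OF jhol_const[of vi "-1"] that(2)]] by simp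
  have holG: "holomorphic_map_on G D"
    unfolding holomorphic_map_on_iff_jhol G_def vec_lambda_beta
  proof
    fix k
    have "jhol vi (\<lambda>Z. p0 $ k + (\<i> / g * (Z $ 3 + \<i> * T (Z $ 3)) - Z $ 1 * B1 (Z $ 3) - Z $ 2 * B2 (Z $ 3))) D"
      "jhol vi (\<lambda>Z. p0 $ k + Z $ 1) D" "jhol vi (\<lambda>Z. p0 $ k + Z $ 2) D"
      by (intro jhol_add hdiff jhol_mult jhol_const jhol_coord_id hc)+
    then show "jhol vi (\<lambda>Z :: complex^3. p0 $ k + (if k = l then \<i> / g * (Z $ 3 + \<i> * T (Z $ 3)) - Z $ 1 * B1 (Z $ 3) - Z $ 2 * B2 (Z $ 3)
      else if k = j1 then Z $ 1 else Z $ 2)) D"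
      by (cases "k = l"; cases "k = j1") simp_all
  qed
  have G0: "G 0 = p0"
    using T(3)[of 0] r T(1) by (simp add: G_def vec_eq_iff \<tau>0)
  have G_real: "G (axis 3 (of_real s)) = \<gamma> s" if "\<bar>s\<bar> < r" for s
    using T(3)[of s] that r by (auto simp: G_def vec_eq_iff \<gamma>_comp axis_def)
  have hDG: "hD G Z v $ k = (if k = l then \<i> / g * (v $ 3 + \<i> * (deriv T (Z $ 3) * v $ 3))
      - (Z $ 1 * (deriv B1 (Z $ 3) * v $ 3) + v $ 1 * B1 (Z $ 3)) - (Z $ 2 * (deriv B2 (Z $ 3) * v $ 3) + v $ 2 * B2 (Z $ 3))
      else if k = j1 then v $ 1 else v $ 2)" if Z: "Z \<in> D" for Z v k
  proof -
    have c: "((\<lambda>Z :: complex^3. f (Z $ 3)) has_derivative (\<lambda>v. deriv f (Z $ 3) * v $ 3)) (at Z)"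
      if f: "f holomorphic_on ball 0 r" for f
      using jhol_has_derivative(1)[OF jhol_coord(1)[OF f open_ball, of 3], of Z] jhol_coord(2)[OF f open_ball, of Z 3] Z
      by (simp add: D_def)
    have n: "((\<lambda>Z :: complex^3. Z $ i) has_derivative (\<lambda>v. v $ i)) (at Z)" for i
      by (rule bounded_linear_imp_has_derivative[OF bounded_linear_vec_nth])
    have "((\<lambda>Z. p0 $ k + (\<i> / g * (Z $ 3 + \<i> * T (Z $ 3)) - Z $ 1 * B1 (Z $ 3) - Z $ 2 * B2 (Z $ 3)))
        has_derivative (\<lambda>v. \<i> / g * (v $ 3 + \<i> * (deriv T (Z $ 3) * v $ 3))
      - (Z $ 1 * (deriv B1 (Z $ 3) * v $ 3) + v $ 1 * B1 (Z $ 3)) - (Z $ 2 * (deriv B2 (Z $ 3) * v $ 3) + v $ 2 * B2 (Z $ 3)))) (at Z)"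
      "((\<lambda>Z. p0 $ k + Z $ 1) has_derivative (\<lambda>v. v $ 1)) (at Z)"
      "((\<lambda>Z. p0 $ k + Z $ 2) has_derivative (\<lambda>v. v $ 2)) (at Z)"
      by (rule derivative_eq_intros refl c hol n | simp)+
    then have "((\<lambda>Z. G Z $ k) has_derivative (\<lambda>v. if k = l then \<i> / g * (v $ 3 + \<i> * (deriv T (Z $ 3) * v $ 3))
      - (Z $ 1 * (deriv B1 (Z $ 3) * v $ 3) + v $ 1 * B1 (Z $ 3)) - (Z $ 2 * (deriv B2 (Z $ 3) * v $ 3) + v $ 2 * B2 (Z $ 3))
      else if k = j1 then v $ 1 else v $ 2)) (at Z)"
      unfolding G_def vec_lambda_beta by (cases "k = l"; cases "k = j1") simp_all
    then show ?thesis unfolding hD_def vec_lambda_beta by (rule dd_eqI)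
  qed
  \<comment> \<open>\<open>T\<close> is real on the real axis, so its derivative at 0 is real and
    \<open>1 + \<i> * deriv T 0\<close> is nonzero. This gives both the invertibility of
    \<open>G\<close> and the transversality in \<open>w\<close>.\<close>
  have ImT: "Im (deriv T 0) = 0"
  proof -
    have "(T has_derivative (*) (deriv T 0)) (at (of_real 0))"
      using holomorphic_derivI[OF T(2) open_ball, of 0] T(1) by (simp add: has_field_derivative_def)
    from has_derivative_compose[OF bounded_linear_imp_has_derivative[OF bounded_linear_of_real] this]
    have "((\<lambda>s::real. T (of_real s)) has_derivative (\<lambda>h. deriv T 0 * of_real h)) (at 0)" by simp
    then have "((\<lambda>s::real. complex_of_real (\<tau> s)) has_derivative (\<lambda>h. deriv T 0 * of_real h)) (at 0)"
      by (rule has_derivative_transform_within_open[OF _ open_ball[of 0 r1]]) (use T in auto)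
    from has_derivative_of_real_iff(2)[OF this, of 1] show ?thesis by (simp add: complex_eq_iff)
  qed
  then have c0: "1 + \<i> * deriv T 0 \<noteq> 0" by (auto simp: complex_eq_iff)
  have inj: "v = 0" if v: "hD G 0 v = 0" for v
  proof -
    have *: "hD G 0 v $ k = 0" for k using v by simp
    have "v $ 1 = 0" "v $ 2 = 0" using *[of j1] *[of j2] j hDG[OF D0] by auto
    moreover from this have "\<i> / g * (v $ 3 * (1 + \<i> * deriv T 0)) = 0"
      using *[of l] hDG[OF D0] by (simp add: algebra_simps)
    then have "v $ 3 = 0" using g c0 by simp
    ultimately show "v = 0" by (simp add: vec_eq_iff forall_3)
  qed
  have ranalytic_\<rho>G0: "ranalytic (\<lambda>Z. ?\<rho> (G Z)) 0"
    by (rule ranalytic_compose_holomorphic[where H=G and f="?\<rho>", OF _ holG D D0]) (simp add: G0 \<rho>)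
  have d3: "hol_dd (axis 3 c) (\<lambda>Z. ?\<rho> (G Z)) 0 = c * (\<i> / 2 * (1 + \<i> * deriv T 0))" for c
  proof -
    have "hD G 0 (axis 3 c) = axis l (\<i> / g * (c * (1 + \<i> * deriv T 0)))"
      using hDG[OF D0] by (simp add: vec_eq_iff axis_def algebra_simps)
    then have "hol_dd (axis 3 c) (\<lambda>Z. ?\<rho> (G Z)) 0 = hol_dd (axis l (\<i> / g * (c * (1 + \<i> * deriv T 0)))) ?\<rho> p0"
      using hol_dd_compose[where H=G and f="?\<rho>", OF holG D0] d\<rho> by (simp add: G0)
    also have "\<dots> = \<i> / g * (c * (1 + \<i> * deriv T 0)) * d_hol l ?\<rho> p0"
      by (simp add: hol_dd_def axis_def if_distrib[of "\<lambda>x. x * _"] cong: if_cong)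
    also have "\<dots> = c * (\<i> / 2 * (1 + \<i> * deriv T 0))" using l by (simp add: g_def field_simps)
    finally show ?thesis .
  qed
  have ranalytic_F: "ranalytic (\<lambda>q. ?\<rho> (G (embed3 (fst q) (snd q)))) (0, 0)"
    by (rule ranalytic_compose_linear[where L="\<lambda>q. embed3 (fst q) (snd q)" and f="\<lambda>Z. ?\<rho> (G Z)", OF _ embed3_bounded_linear])
       (simp add: ranalytic_\<rho>G0 embed3_def zero_vec_def[symmetric] cong: if_cong)
  have cder2: "dd (0, 1) (\<lambda>q. ?\<rho> (G (embed3 (fst q) (snd q)))) (0, 0) \<noteq> 0"
  proof -
    have e1: "embed3 0 1 = axis 3 \<i>" "embed3 0 0 = 0" by (simp_all add: embed3_def vec_eq_iff axis_def)
    have "dd (0, 1) (\<lambda>q. ?\<rho> (G (embed3 (fst q) (snd q)))) (0, 0) = dd (axis 3 \<i>) (\<lambda>Z. ?\<rho> (G Z)) 0"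
      using dd_compose[OF bounded_linear_imp_has_derivative[OF embed3_bounded_linear], of "\<lambda>Z. ?\<rho> (G Z)" "(0, 0)" "(0, 1)"]
        ranalytic_differentiable[OF ranalytic_\<rho>G0] by (simp add: e1)
    also have "\<dots> = of_real (2 * Re (hol_dd (axis 3 \<i>) (\<lambda>Z. ?\<rho> (G Z)) 0))"
      by (rule ranalytic_real_part_dd[OF ranalytic_differentiable[OF ranalytic_\<rho>G0]])
    also have "\<dots> \<noteq> 0" unfolding d3 using ImT by simp
    finally show ?thesis .
  qed
  obtain N2 r5 \<psi> where N2: "open N2" "0 \<in> N2" "r5 > 0" and \<psi>_ranalytic: "\<And>x. x \<in> N2 \<Longrightarrow> ranalytic (\<lambda>x. complex_of_real (\<psi> x)) x"
    and \<psi>_small: "\<And>x. x \<in> N2 \<Longrightarrow> \<bar>\<psi> x - 0\<bar> < r5"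
    and \<psi>_iff: "\<And>x t. x \<in> N2 \<Longrightarrow> \<bar>t - 0\<bar> < r5 \<Longrightarrow> \<rho> (G (embed3 (fst (x, t)) (snd (x, t)))) = 0 \<longleftrightarrow> t = \<psi> x"
  proof (rule ranalytic_implicit_function[OF ranalytic_F _ cder2])
    show "\<rho> (G (embed3 (fst (0, 0)) (snd (0, 0)))) = 0"
      by (simp add: embed3_def G0 \<rho>0 zero_vec_def[symmetric] cong: if_cong)
  qed (rule that)
  \<comment> \<open>The solution \<open>\<psi>\<close> may depend on the full point; inserting
    \<open>embed3 _ 0\<close> leaves a dependence on \<open>Re w\<close> alone.\<close>
  define \<phi> where "\<phi> Z = \<psi> (embed3 Z 0)" for Z
  obtain r6 where r6: "r6 > 0" "\<And>x. x \<in> ball p0 r6 \<Longrightarrow> ranalytic ?\<rho> x" using ranalytic_nearby[OF \<rho>] by metis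
  have contG: "continuous_on D G"
    by (intro continuous_at_imp_continuous_on ballI holomorphic_map_isCont[OF holG])
  define W1 where "W1 = D \<inter> G -` ball p0 r6"
  have W1: "open W1" "0 \<in> W1" "W1 \<subseteq> D"
    using continuous_open_preimage[OF contG D open_ball] D0 r6 by (auto simp: W1_def G0)
  have ranalytic_\<rho>: "ranalytic ?\<rho> (G Z)" if "Z \<in> W1" for Z using that r6 by (auto simp: W1_def)
  have ranalytic_\<rho>G: "ranalytic (\<lambda>Z. ?\<rho> (G Z)) Z" if "Z \<in> W1" for Z
    by (rule ranalytic_compose_holomorphic[where H=G and f="?\<rho>", OF ranalytic_\<rho>[OF that] holG D]) (use that W1 in auto)
  define W2 where "W2 = W1 \<inter> d_hol 3 (\<lambda>Z. ?\<rho> (G Z)) -` (- {0})"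
  have W2: "open W2" unfolding W2_def
    by (rule continuous_open_preimage[OF _ W1(1)])
       (auto intro!: continuous_at_imp_continuous_on ranalytic_isCont ranalytic_d_hol ranalytic_\<rho>G)
  have W2_0: "0 \<in> W2"
  proof -
    have "d_hol 3 (\<lambda>Z. ?\<rho> (G Z)) 0 = \<i> / 2 * (1 + \<i> * deriv T 0)" using d3[of 1] by simp
    then have "d_hol 3 (\<lambda>Z. ?\<rho> (G Z)) 0 \<noteq> 0" using c0 by (simp only: mult_eq_0_iff) simp
    then show ?thesis using W1(2) by (simp add: W2_def)
  qed
  define W3 where "W3 = (\<lambda>Z. embed3 Z 0) -` N2 \<inter> (\<lambda>Z. Im (Z $ 3)) -` ball 0 r5"
  have W3: "open W3" unfolding W3_def
    by (intro open_Int open_vimage N2 open_ball linear_continuous_on embed3_bounded_linear0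
        bounded_linear_compose[OF bounded_linear_Im] bounded_linear_vec_nth)
  have W3_0: "0 \<in> W3" using N2 by (simp add: W3_def embed3_def zero_vec_def[symmetric] cong: if_cong)
  have sub: "W2 \<inter> W3 \<subseteq> D" using W1(3) by (auto simp: W2_def)
  obtain A B H where AB: "open A" "0 \<in> A" "A \<subseteq> W2 \<inter> W3" "open B" "homeomorphism A B G H" "holomorphic_map_on H B"
    using holomorphic_local_inverse[OF holomorphic_map_subset[OF holG sub] open_Int[OF W2 W3], of 0] W2_0 W3_0 inj
    by blast
  have AD: "A \<subseteq> D" and AW1: "A \<subseteq> W1" using AB(3) sub by (auto simp: W2_def)
  have \<phi>_ranalytic: "ranalytic (\<lambda>Z. complex_of_real (\<phi> Z)) Z" if "Z \<in> A" for Z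
    unfolding \<phi>_def
    by (rule ranalytic_compose_linear[where L="\<lambda>Z. embed3 Z 0" and f="\<lambda>Z. complex_of_real (\<psi> Z)", OF _ embed3_bounded_linear0])
       (use that AB(3) in \<open>auto intro!: \<psi>_ranalytic simp: W3_def\<close>)
  have iff: "\<rho> (G Z) = 0 \<longleftrightarrow> Im (Z $ 3) = \<phi> Z" if "Z \<in> A" for Z
  proof -
    have "Z \<in> W3" using that AB(3) by blast
    then have "embed3 Z 0 \<in> N2" "\<bar>Im (Z $ 3) - 0\<bar> < r5" by (simp_all add: W3_def)
    from \<psi>_iff[OF this] show ?thesis by (simp add: \<phi>_def)
  qed
  have \<phi>_inv: "\<phi> (embed3 Z 0) = \<phi> Z" for Z by (simp add: \<phi>_def)
  have curve: "\<bar>s\<bar> < r" "s \<in> N" "G (axis 3 (of_real s)) = \<gamma> s" if "axis 3 (of_real s) \<in> A" for s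
  proof -
    show sr: "\<bar>s\<bar> < r" using that AD by (auto simp: D_def axis_def)
    show "s \<in> N" using r4 r sr by simp
    show "G (axis 3 (of_real s)) = \<gamma> s" by (rule G_real[OF sr])
  qed
  have \<phi>_axis: "\<phi> (axis 3 (of_real s)) = 0" if "axis 3 (of_real s) \<in> A" for s
    using iff[OF that] curve[OF that] \<gamma>_M by (simp add: axis_def)
  have "d_hol j (\<lambda>Z. complex_of_real (\<phi> Z)) (axis 3 (of_real s)) = 0"
    if q: "axis 3 (of_real s) \<in> A" and j3: "j \<noteq> 3" for s j
  proof -
    let ?q = "axis 3 (of_real s) :: complex^3"
    let ?r = "\<lambda>Z. \<phi> Z - Im (Z $ 3)"
    have qD: "?q \<in> D" using q AD by blast
    have UN: "(UNIV :: 3 set) = {j1, j2, l}" using j by blast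
    have hd3: "hol_dd w f p = w $ j1 * d_hol j1 f p + w $ j2 * d_hol j2 f p + w $ l * d_hol l f p" for w f p
      unfolding hol_dd_def UN using j by simp
    have hol_dd_\<rho>G: "hol_dd v (\<lambda>Z. ?\<rho> (G Z)) ?q = hol_dd (hD G ?q v) ?\<rho> (\<gamma> s)" for v
      using hol_dd_compose[where H=G and f="?\<rho>", OF holG qD] ranalytic_differentiable[OF ranalytic_\<rho>, of ?q] q AW1 curve(3)[OF q] by auto
    have ax: "axis k x $ i = (if i = k then x else 0)" for k i :: 3 and x :: complex by (simp add: axis_def)
    have full: "hol_dd v (\<lambda>Z. ?\<rho> (G Z)) ?q = v $ 1 * d_hol j1 ?\<rho> (\<gamma> s) + v $ 2 * d_hol j2 ?\<rho> (\<gamma> s)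
      + (\<i> / g * (v $ 3 + \<i> * (deriv T (of_real s) * v $ 3)) - v $ 1 * B1 (of_real s) - v $ 2 * B2 (of_real s)) * d_hol l ?\<rho> (\<gamma> s)" for v
    proof -
      have "hD G ?q v $ j1 = v $ 1" "hD G ?q v $ j2 = v $ 2"
        "hD G ?q v $ l = \<i> / g * (v $ 3 + \<i> * (deriv T (of_real s) * v $ 3)) - v $ 1 * B1 (of_real s) - v $ 2 * B2 (of_real s)"
        using j by (simp_all add: hDG[OF qD] ax)
      then show ?thesis using hol_dd_\<rho>G[of v] hd3[of "hD G ?q v" ?\<rho> "\<gamma> s"] by (simp only:)
    qed
    have nz: "d_hol 3 (\<lambda>Z. ?\<rho> (G Z)) ?q \<noteq> 0" using q AB(3) by (auto simp: W2_def)
    \<comment> \<open>The slopes were defined by division by this derivative. On the axis the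
      \<open>w\<close>-direction is mapped into coordinate \<open>l\<close> alone, so the nonzero
      \<open>w\<close>-derivative of \<open>\<rho>\<close> composed with \<open>G\<close> is a
      multiple of it.\<close>
    have l_nz: "d_hol l ?\<rho> (\<gamma> s) \<noteq> 0"
    proof
      assume "d_hol l ?\<rho> (\<gamma> s) = 0"
      then have "hol_dd (axis 3 1) (\<lambda>Z. ?\<rho> (G Z)) ?q = 0"
        unfolding full by (simp add: ax)
      then show False using nz by simp
    qed
    have Bs: "B1 (of_real s) * d_hol l ?\<rho> (\<gamma> s) = d_hol j1 ?\<rho> (\<gamma> s)" "B2 (of_real s) * d_hol l ?\<rho> (\<gamma> s) = d_hol j2 ?\<rho> (\<gamma> s)"
      using B1(3)[of s] B2(3)[of s] curve(1)[OF q] r l_nz by (simp_all add: b_def)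
    have "hol_dd (axis j 1) (\<lambda>Z. ?\<rho> (G Z)) ?q = 0"
      using Bs exhaust_3[of j] j3 unfolding full by (auto simp: ax algebra_simps)
    \<comment> \<open>The \<open>z\<close>-gradient is known to vanish for \<open>\<rho>\<close>
      composed with \<open>G\<close>; proportionality of gradients transfers this to the graph
      function.\<close>
    moreover have "hol_dd (axis j 1) (\<lambda>Z. ?\<rho> (G Z)) ?q * hol_dd (axis 3 1) (\<lambda>Z. complex_of_real (?r Z)) ?q
       = hol_dd (axis 3 1) (\<lambda>Z. ?\<rho> (G Z)) ?q * hol_dd (axis j 1) (\<lambda>Z. complex_of_real (?r Z)) ?q"
    proof (rule hol_dd_proportional)
      show "ranalytic (\<lambda>Z. complex_of_real (?r Z)) ?q" by (rule ranalytic_graph[OF \<phi>_ranalytic[OF q]])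
      show "ranalytic (\<lambda>Z. ?\<rho> (G Z)) ?q" using q AW1 by (intro ranalytic_\<rho>G) auto
      show "?r ?q = 0" using \<phi>_axis[OF q] by (simp add: axis_def)
      show "hol_dd (axis 3 1) (\<lambda>Z. complex_of_real (?r Z)) ?q \<noteq> 0"
        using d_hol_3_graph_nonzero[OF \<phi>_ranalytic[OF q] \<phi>_inv] by simp
      show "\<forall>\<^sub>F Z in nhds ?q. ?r Z = 0 \<longrightarrow> \<rho> (G Z) = 0"
        using eventually_nhds_in_open[OF AB(1) q] by eventually_elim (simp add: iff)
    qed
    ultimately have "d_hol j (\<lambda>Z. complex_of_real (?r Z)) ?q = 0" using nz by simp
    then show ?thesis using j3 by (simp add: d_hol_graph[OF \<phi>_ranalytic[OF q]] del: of_real_diff)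
  qed
  moreover have "d_hol 3 (\<lambda>Z. ?\<rho> (G Z)) Z \<noteq> 0" if "Z \<in> A" for Z using that AB(3) by (auto simp: W2_def)
  ultimately show ?thesis
    using that[OF AB(1,2,4) G0 AB(5) holomorphic_map_subset[OF holG AD] AB(6) \<phi>_ranalytic ranalytic_\<rho> iff _ \<phi>_inv \<phi>_axis] AW1 by blast
qed

section \<open>Levi degeneracy in an adapted chart\<close>

lemma isCont_eventually_in:
  assumes "isCont f x" "open S" "f x \<in> S" shows "eventually (\<lambda>y. f y \<in> S) (nhds x)"
  using assms(1) unfolding isCont_def tendsto_at_iff_tendsto_nhds by (rule topological_tendstoD[OF _ assms(2,3)])

lemma levi_form_linear:
  "levi_form \<rho> p (u + c *s v) w = levi_form \<rho> p u w + c * levi_form \<rho> p v w"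
  "levi_form \<rho> p u (w + c *s x) = levi_form \<rho> p u w + cnj c * levi_form \<rho> p u x"
  by (simp_all add: levi_form_def sum.distrib sum_distrib_left algebra_simps)

lemma levi_form_axis:
  "levi_form \<rho> p (axis j 1) (axis k 1) = d_hol j (d_bar k (\<lambda>Z. complex_of_real (\<rho> Z))) p"
  unfolding levi_form_def axis_def
  by (simp add: if_distrib[of cnj] if_distrib[of "\<lambda>x. _ * x"] if_distrib[of "\<lambda>x. x * _"] cong: if_cong)

lemma anti_dd_hD_component:
  fixes G :: "complex^'n \<Rightarrow> complex^'m"
  assumes "holomorphic_map_on G A" "open A" "Z \<in> A"
  shows "anti_dd a (\<lambda>Z. hD G Z v $ l) Z = 0" "ranalytic (\<lambda>Z. hD G Z v $ l) Z"
proof -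
  have "jhol vi (\<lambda>Z. G Z $ l) A" using assms(1) by (simp add: holomorphic_map_on_iff_jhol)
  from jhol_dd[OF this assms(2), of v] have J: "jhol vi (\<lambda>Z. hD G Z v $ l) A"
    by (simp add: hD_def[abs_def])
  show "anti_dd a (\<lambda>Z. hD G Z v $ l) Z = 0" by (rule jhol_anti_dd[OF J assms(3)])
  show "ranalytic (\<lambda>Z. hD G Z v $ l) Z" by (rule jhol_vi_ranalytic[OF J assms(2,3)])
qed

text \<open>The components of the derivative of a holomorphic map are again holomorphic. The outer
  (0,1) derivative therefore passes through them, and no second derivative of \<open>G\<close>
  appears.\<close>

lemma levi_form_compose:
  fixes G :: "complex^'n \<Rightarrow> complex^'m" and \<rho> :: "complex^'m \<Rightarrow> real"
  assumes G: "holomorphic_map_on G A" "open A" "Z \<in> A"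
    and \<rho>: "ranalytic (\<lambda>p. complex_of_real (\<rho> p)) (G Z)"
  shows "levi_form (\<lambda>Z. \<rho> (G Z)) Z V W = levi_form \<rho> (G Z) (hD G Z V) (hD G Z W)"
proof -
  let ?\<rho> = "\<lambda>p. complex_of_real (\<rho> p)"
  have ranalytic: "ranalytic (\<lambda>Z. ?\<rho> (G Z)) Z"
    by (rule ranalytic_compose_holomorphic[where H=G and f="?\<rho>", OF \<rho> G])
  obtain R where R: "R > 0" "\<And>p. p \<in> ball (G Z) R \<Longrightarrow> ranalytic ?\<rho> p" using ranalytic_nearby[OF \<rho>] by metis
  have "continuous_on A G" using holomorphic_map_isCont[OF G(1)] by (intro continuous_at_imp_continuous_on) auto
  then have o: "open (A \<inter> G -` ball (G Z) R)" using continuous_open_preimage G(2) by blast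
  have Zo: "Z \<in> A \<inter> G -` ball (G Z) R" using G(3) R(1) by simp
  have "eventually (\<lambda>Z'. hol_dd V (\<lambda>Z. ?\<rho> (G Z)) Z' = (\<Sum>l\<in>UNIV. hD G Z' V $ l * d_hol l ?\<rho> (G Z'))) (nhds Z)"
    using eventually_nhds_in_open[OF o Zo]
  proof eventually_elim
    case (elim Z')
    then show ?case
      using hol_dd_compose[where H=G and f="?\<rho>", OF G(1), of Z'] ranalytic_differentiable[OF R(2)] by (simp add: hol_dd_def)
  qed
  then have "anti_dd (vcnj W) (hol_dd V (\<lambda>Z. ?\<rho> (G Z))) Z
      = anti_dd (vcnj W) (\<lambda>Z'. \<Sum>l\<in>UNIV. hD G Z' V $ l * d_hol l ?\<rho> (G Z')) Z"
    by (rule anti_dd_transform)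
  also have "\<dots> = (\<Sum>l\<in>UNIV. hD G Z V $ l * anti_dd (vcnj (hD G Z W)) (d_hol l ?\<rho>) (G Z))"
  proof -
    have ranalytic_l: "ranalytic (\<lambda>Z'. d_hol l ?\<rho> (G Z')) Z" for l
      by (rule ranalytic_compose_holomorphic[where H=G and f="d_hol l ?\<rho>", OF _ G]) (intro ranalytic_d_hol \<rho>)
    have "anti_dd (vcnj W) (\<lambda>Z'. hD G Z' V $ l * d_hol l ?\<rho> (G Z')) Z
        = hD G Z V $ l * anti_dd (vcnj (hD G Z W)) (d_hol l ?\<rho>) (G Z)" for l
      using anti_dd_mult[OF ranalytic_differentiable[OF anti_dd_hD_component(2)[OF G]] ranalytic_differentiable[OF ranalytic_l]]
        anti_dd_compose[where H=G and f="d_hol l ?\<rho>", OF G(1,3)] ranalytic_differentiable[OF ranalytic_d_hol[OF \<rho>]]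
      by (simp add: anti_dd_hD_component(1)[OF G])
    then show ?thesis
      by (subst anti_dd_sum) (auto intro!: ranalytic_differentiable ranalytic_mult anti_dd_hD_component(2)[OF G] ranalytic_l)
  qed
  also have "\<dots> = anti_dd (vcnj (hD G Z W)) (hol_dd (hD G Z V) ?\<rho>) (G Z)"
    unfolding hol_dd_def[abs_def]
    by (subst anti_dd_sum) (auto intro!: ranalytic_differentiable ranalytic_mult ranalytic_d_hol \<rho> sum.cong anti_dd_cmult[symmetric])
  finally show ?thesis
    unfolding levi_form_anti_dd_hol_dd[OF \<rho>] using levi_form_anti_dd_hol_dd[of "\<lambda>Z. \<rho> (G Z)" Z V W] ranalytic by simp
qed

text \<open>The last consequence comes from dividing the determinant by t^2 and passing to the
  limit. In this way first derivatives of the entries suffice even at a zero of the whole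
  matrix.\<close>

lemma det2_derivative:
  fixes a b c d :: "real \<Rightarrow> complex"
  assumes der: "(a has_vector_derivative a') (at 0)" "(b has_vector_derivative b') (at 0)"
      "(c has_vector_derivative c') (at 0)" "(d has_vector_derivative d') (at 0)"
    and det: "eventually (\<lambda>t. a t * d t = b t * c t) (nhds 0)"
  shows "a 0 * d 0 = b 0 * c 0"
    and "a 0 * d' + a' * d 0 = b 0 * c' + b' * c 0"
    and "a 0 = 0 \<Longrightarrow> b 0 = 0 \<Longrightarrow> c 0 = 0 \<Longrightarrow> d 0 = 0 \<Longrightarrow> a' * d' = b' * c'"
proof -
  show "a 0 * d 0 = b 0 * c 0" using det eventually_nhds_x_imp_x by fast
  obtain S where S: "open S" "0 \<in> S" "\<And>t. t \<in> S \<Longrightarrow> a t * d t = b t * c t"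
    using det unfolding eventually_nhds by blast
  have "((\<lambda>t. a t * d t) has_vector_derivative (a 0 * d' + a' * d 0)) (at 0)"
    by (rule has_vector_derivative_mult[OF der(1,4)])
  moreover have "((\<lambda>t. b t * c t) has_vector_derivative (b 0 * c' + b' * c 0)) (at 0)"
    by (rule has_vector_derivative_mult[OF der(2,3)])
  then have "((\<lambda>t. a t * d t) has_vector_derivative (b 0 * c' + b' * c 0)) (at 0)"
    by (rule has_vector_derivative_transform_within_open[OF _ S(1,2)]) (use S(3) in auto)
  ultimately show "a 0 * d' + a' * d 0 = b 0 * c' + b' * c 0"
    by (rule vector_derivative_unique_at)
  show "a' * d' = b' * c'" if z: "a 0 = 0" "b 0 = 0" "c 0 = 0" "d 0 = 0"
  proof -
    have lim: "((\<lambda>t. f t /\<^sub>R t) \<longlongrightarrow> f') (at 0)" if "(f has_vector_derivative f') (at 0)" "f 0 = 0" for f :: "real \<Rightarrow> complex" and f'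
    proof -
      have "((\<lambda>t. norm (f t - t *\<^sub>R f') / \<bar>t\<bar>) \<longlongrightarrow> 0) (at 0)"
        using that by (simp add: has_vector_derivative_def has_derivative_iff_norm)
      moreover have "eventually (\<lambda>t. norm (f t - t *\<^sub>R f') / \<bar>t\<bar> = norm (f t /\<^sub>R t - f')) (at (0::real))"
        unfolding eventually_at_filter
      proof (intro always_eventually allI impI)
        fix t :: real assume t: "t \<noteq> 0"
        have "f t /\<^sub>R t - f' = (f t - t *\<^sub>R f') /\<^sub>R t" using t by (simp add: scaleR_diff_right)
        then show "norm (f t - t *\<^sub>R f') / \<bar>t\<bar> = norm (f t /\<^sub>R t - f')" by (simp add: divide_inverse mult.commute)
      qed
      ultimately have "((\<lambda>t. norm (f t /\<^sub>R t - f')) \<longlongrightarrow> 0) (at 0)" by (rule Lim_transform_eventually)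
      then show ?thesis by (subst LIM_zero_iff[symmetric]) (rule tendsto_norm_zero_cancel)
    qed
    have l1: "((\<lambda>t. (a t /\<^sub>R t) * (d t /\<^sub>R t)) \<longlongrightarrow> a' * d') (at 0)"
      by (intro tendsto_mult lim der z)
    have l2: "((\<lambda>t. (b t /\<^sub>R t) * (c t /\<^sub>R t)) \<longlongrightarrow> b' * c') (at 0)"
      by (intro tendsto_mult lim der z)
    have "eventually (\<lambda>t. t \<in> S) (at 0)" using eventually_at_in_open'[OF S(1,2)] .
    then have "eventually (\<lambda>t. (a t /\<^sub>R t) * (d t /\<^sub>R t) = (b t /\<^sub>R t) * (c t /\<^sub>R t)) (at 0)"
    proof eventually_elim
      case (elim t)
      then show ?case using S(3)[of t] by (simp add: scaleR_conv_of_real mult_ac)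
    qed
    then have "((\<lambda>t. (b t /\<^sub>R t) * (c t /\<^sub>R t)) \<longlongrightarrow> a' * d') (at 0)"
      by (rule Lim_transform_eventually[OF l1])
    then show ?thesis using l2 LIM_unique by blast
  qed
qed

section \<open>Jets of the graph function in an adapted chart\<close>

locale adapted =
  fixes \<rho> :: "complex^3 \<Rightarrow> real" and p0 :: "complex^3" and A B :: "(complex^3) set"
    and G H :: "complex^3 \<Rightarrow> complex^3" and \<phi> :: "complex^3 \<Rightarrow> real"
  assumes open_A: "open A" and A0: "0 \<in> A" and open_B: "open B" and G0: "G 0 = p0"
    and hom: "homeomorphism A B G H" and holG: "holomorphic_map_on G A" and holH: "holomorphic_map_on H B"
    and \<phi>_ranalytic: "\<And>Z. Z \<in> A \<Longrightarrow> ranalytic (\<lambda>Z. complex_of_real (\<phi> Z)) Z"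
    and \<rho>_ranalytic: "\<And>Z. Z \<in> A \<Longrightarrow> ranalytic (\<lambda>Z. complex_of_real (\<rho> Z)) (G Z)"
    and iff: "\<And>Z. Z \<in> A \<Longrightarrow> \<rho> (G Z) = 0 \<longleftrightarrow> Im (Z $ 3) = \<phi> Z"
    and \<sigma>3: "\<And>Z. Z \<in> A \<Longrightarrow> d_hol 3 (\<lambda>Z. complex_of_real (\<rho> (G Z))) Z \<noteq> 0"
    and \<phi>_inv: "\<And>Z. \<phi> (embed3 Z 0) = \<phi> Z"
    and \<phi>_axis: "\<And>s. axis 3 (of_real s) \<in> A \<Longrightarrow> \<phi> (axis 3 (of_real s)) = 0"
    and \<phi>_axis_d: "\<And>s j. axis 3 (of_real s) \<in> A \<Longrightarrow> j \<noteq> 3 \<Longrightarrow>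
        d_hol j (\<lambda>Z. complex_of_real (\<phi> Z)) (axis 3 (of_real s)) = 0"
begin

abbreviation \<Phi> :: "complex^3 \<Rightarrow> complex" where "\<Phi> \<equiv> \<lambda>Z. complex_of_real (\<phi> Z)"
definition r :: "complex^3 \<Rightarrow> real" where "r Z = \<phi> Z - Im (Z $ 3)"
abbreviation rc :: "complex^3 \<Rightarrow> complex" where "rc \<equiv> \<lambda>Z. complex_of_real (r Z)"
abbreviation \<sigma> :: "complex^3 \<Rightarrow> complex" where "\<sigma> \<equiv> \<lambda>Z. complex_of_real (\<rho> (G Z))"

lemma r_zero_iff: "Z \<in> A \<Longrightarrow> r Z = 0 \<longleftrightarrow> \<rho> (G Z) = 0"
  using iff by (auto simp: r_def)

lemma HG: "Z \<in> A \<Longrightarrow> H (G Z) = Z" "Z \<in> A \<Longrightarrow> G Z \<in> B" "p \<in> B \<Longrightarrow> G (H p) = p" "p \<in> B \<Longrightarrow> H p \<in> A"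
  using hom by (auto simp: homeomorphism_def)

lemma p0_B: "p0 \<in> B" "H p0 = 0"
  using HG[of 0] A0 G0 by auto

lemma ranalytic_rc: "Z \<in> A \<Longrightarrow> ranalytic rc Z"
  unfolding r_def by (rule ranalytic_graph[OF \<phi>_ranalytic])

lemma d_hol_rc: "Z \<in> A \<Longrightarrow> d_hol j rc Z = d_hol j \<Phi> Z + (if j = 3 then \<i> / 2 else 0)"
  unfolding r_def by (rule d_hol_graph[OF \<phi>_ranalytic])

lemma r3: "Z \<in> A \<Longrightarrow> d_hol 3 rc Z \<noteq> 0"
  unfolding r_def by (rule d_hol_3_graph_nonzero[OF \<phi>_ranalytic \<phi>_inv])

lemma ranalytic_\<sigma>: "Z \<in> A \<Longrightarrow> ranalytic \<sigma> Z"
  by (rule ranalytic_compose_holomorphic[where H=G and f="\<lambda>Z. complex_of_real (\<rho> Z)", OF \<rho>_ranalytic holG open_A])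

lemma d_bar_real: "Z \<in> A \<Longrightarrow> d_bar j \<Phi> Z = cnj (d_hol j \<Phi> Z)"
  using hol_dd_real[OF ranalytic_differentiable[OF \<phi>_ranalytic], of Z "axis j 1"] 
  by (simp add: vcnj_def axis_def anti_dd_def hol_dd_def if_distrib[of cnj] if_distrib[of "\<lambda>x. x * _"] cong: if_cong)

lemma hD_inverse:
  assumes "Z \<in> A" shows "hD H (G Z) (hD G Z v) = v" "hD G Z (hD H (G Z) v) = v"
proof -
  have id: "hD F Z v = v" if "eventually (\<lambda>Z'. F Z' = Z') (nhds Z)" for F and Z v :: "complex^3"
  proof -
    have "dd v (\<lambda>Z'. F Z' $ l) Z = dd v (\<lambda>Z'. Z' $ l) Z" for l
      by (rule dd_transform) (use that in \<open>auto elim: eventually_mono\<close>)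
    also have "dd v (\<lambda>Z'. Z' $ l) Z = v $ l" for l
      by (rule dd_eqI[OF bounded_linear_imp_has_derivative[OF bounded_linear_vec_nth]])
    finally show ?thesis by (simp add: hD_def vec_eq_iff)
  qed
  have "hD (\<lambda>Z. H (G Z)) Z v = v" for v
    by (rule id) (use eventually_nhds_in_open[OF open_A assms] HG(1) in \<open>auto elim: eventually_mono\<close>)
  then show "hD H (G Z) (hD G Z v) = v" using hD_compose[OF holG assms holH HG(2)[OF assms]] by simp
  have "hD (\<lambda>Z. G (H Z)) (G Z) v = v" for v
    by (rule id) (use eventually_nhds_in_open[OF open_B HG(2)[OF assms]] HG(3) in \<open>auto elim: eventually_mono\<close>)
  then show "hD G Z (hD H (G Z) v) = v"
    using hD_compose[OF holH HG(2)[OF assms] holG] assms by (simp add: HG(1))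
qed

lemma axis_curve:
  fixes f :: "complex^3 \<Rightarrow> complex"
  assumes f: "f differentiable (at (axis 3 (of_real s)))" and s: "axis 3 (of_real s) \<in> A"
    and zero: "\<And>t. axis 3 (of_real t) \<in> A \<Longrightarrow> f (axis 3 (of_real t)) = 0"
  shows "dd (axis 3 1) f (axis 3 (of_real s)) = 0"
proof -
  have eq: "axis 3 (of_real t) = t *\<^sub>R axis 3 (1::complex)" for t
    by (simp add: vec_eq_iff axis_def scaleR_conv_of_real[where 'a=complex])
  have 1: "((\<lambda>t. axis 3 (of_real t) :: complex^3) has_derivative (\<lambda>t. t *\<^sub>R axis 3 1)) (at s)"
    unfolding eq by (auto intro!: derivative_eq_intros)
  have d: "((\<lambda>t. f (axis 3 (of_real t))) has_derivative (\<lambda>t. dd (t *\<^sub>R axis 3 1) f (axis 3 (of_real s)))) (at s)"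
    by (rule has_derivative_compose[OF 1 differentiable_dd[OF f]])
  have "open ((\<lambda>t::real. axis 3 (of_real t) :: complex^3) -` A)"
    unfolding eq by (intro open_vimage open_A continuous_intros)
  then have "((\<lambda>t::real. 0::complex) has_derivative (\<lambda>t. dd (t *\<^sub>R axis 3 1) f (axis 3 (of_real s)))) (at s)"
    using has_derivative_transform_within_open[OF d, of _ "\<lambda>_. 0"] s zero by auto
  then have "(\<lambda>t. dd (t *\<^sub>R axis 3 1) f (axis 3 (of_real s))) = (\<lambda>t. 0)"
    by (rule has_derivative_unique) (rule has_derivative_const)
  then show ?thesis by (metis scaleR_one)
qed

lemma d_hol_\<Phi>_axis: "axis 3 (of_real s) \<in> A \<Longrightarrow> d_hol j \<Phi> (axis 3 (of_real s)) = 0"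
proof (cases "j = 3")
  case True
  assume s: "axis 3 (of_real s) \<in> A"
  have "dd (axis 3 1) \<Phi> (axis 3 (of_real s)) = 0"
    by (rule axis_curve[OF ranalytic_differentiable[OF \<phi>_ranalytic[OF s]] s]) (simp add: \<phi>_axis)
  moreover have "dd (axis 3 \<i>) \<Phi> (axis 3 (of_real s)) = 0"
    by (rule d_hol_transversal(1)[OF ranalytic_differentiable[OF \<phi>_ranalytic[OF s]] \<phi>_inv])
  ultimately show ?thesis unfolding d_hol_dd True by simp
qed (rule \<phi>_axis_d)

lemma axis_zero: "axis 3 (0::complex) = (0 :: complex^3)"
  by (simp add: vec_eq_iff axis_def)

lemma d_hol_\<Phi>_0: "d_hol j \<Phi> 0 = 0" and d_bar_\<Phi>_0: "d_bar j \<Phi> 0 = 0"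
  using d_hol_\<Phi>_axis[of 0 j] A0 d_bar_real[OF A0, of j] by (simp_all add: axis_zero)

lemma \<phi>_0: "\<phi> 0 = 0"
  using \<phi>_axis[of 0] A0 by (simp add: axis_zero)

lemma dd_i_d_hol: "dd (axis 3 \<i>) (d_hol j \<Phi>) 0 = 0"
proof -
  have "eventually (\<lambda>Z. dd (axis 3 \<i>) \<Phi> Z = 0) (nhds 0)"
    using eventually_nhds_in_open[OF open_A A0]
    by eventually_elim (rule d_hol_transversal(1)[OF ranalytic_differentiable[OF \<phi>_ranalytic] \<phi>_inv])
  then have "dd v (dd (axis 3 \<i>) \<Phi>) 0 = 0" for v
    using dd_transform[of "dd (axis 3 \<i>) \<Phi>" "\<lambda>_. 0" 0 v] by simp
  then have z: "dd (axis 3 \<i>) (dd v \<Phi>) 0 = 0" for v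
    using ranalytic_dd_commute[OF \<phi>_ranalytic[OF A0], of "axis 3 \<i>" v] by simp
  show ?thesis
    unfolding d_hol_alt by (subst dd_lincomb) (auto simp: z intro!: ranalytic_dd \<phi>_ranalytic A0)
qed

text \<open>The gradient of \<open>\<phi>\<close> vanishes along the real \<open>w\<close>-axis and
  is independent of \<open>Im w\<close>, so both real directions of the third coordinate annihilate
  it at 0.\<close>

lemma d3_d_hol: "d_hol 3 (d_hol j \<Phi>) 0 = 0" "d_bar 3 (d_hol j \<Phi>) 0 = 0"
proof -
  have "dd (axis 3 1) (d_hol j \<Phi>) (axis 3 (of_real 0)) = 0"
    by (rule axis_curve) (use A0 in \<open>auto simp: axis_zero d_hol_\<Phi>_axis intro!: ranalytic_differentiable ranalytic_d_hol \<phi>_ranalytic\<close>)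
  then have "dd (axis 3 1) (d_hol j \<Phi>) 0 = 0" by (simp add: axis_zero)
  then show "d_hol 3 (d_hol j \<Phi>) 0 = 0" "d_bar 3 (d_hol j \<Phi>) 0 = 0"
    using dd_i_d_hol[of j] by (simp_all add: d_hol_dd[of 3 "d_hol j \<Phi>"] d_bar_dd[of 3 "d_hol j \<Phi>"])
qed

lemma d_bar_\<Phi>_eventually: "Z \<in> A \<Longrightarrow> eventually (\<lambda>Z. d_bar k \<Phi> Z = cnj (d_hol k \<Phi> Z)) (nhds Z)"
  using eventually_nhds_in_open[OF open_A] by (rule eventually_mono) (auto intro: d_bar_real)

lemma d3_d_bar: "d_hol 3 (d_bar k \<Phi>) 0 = 0"
proof -
  have "d_hol 3 (d_bar k \<Phi>) 0 = hol_dd (axis 3 1) (\<lambda>Z. cnj (d_hol k \<Phi> Z)) 0"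
    using hol_dd_transform[OF d_bar_\<Phi>_eventually[OF A0], of "axis 3 1"] by simp
  also have "\<dots> = cnj (anti_dd (vcnj (axis 3 1)) (d_hol k \<Phi>) 0)"
    by (rule hol_dd_cnj) (intro ranalytic_differentiable ranalytic_d_hol \<phi>_ranalytic A0)+
  also have "vcnj (axis 3 1) = axis 3 1" by (simp add: vec_eq_iff axis_def)
  finally show ?thesis by (simp add: d3_d_hol)
qed

section \<open>The Levi matrix of the graph\<close>

definition Q :: "3 \<Rightarrow> 3 \<Rightarrow> complex" where "Q j k = d_hol j (d_bar k \<Phi>) 0"
definition \<Lambda> :: "3 \<Rightarrow> 3 \<Rightarrow> complex^3 \<Rightarrow> complex" where "\<Lambda> j k z = dd z (d_hol j (d_bar k \<Phi>)) 0"

text \<open>The correction by \<open>lam\<close> in the \<open>w\<close>-direction makes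
  \<open>E 1\<close> and \<open>E 2\<close> a frame of (1,0) tangent vectors of \<open>r\<close>,
  and \<open>ell\<close> is the Levi matrix in this frame.\<close>

definition lam :: "3 \<Rightarrow> complex^3 \<Rightarrow> complex" where "lam j Z = - d_hol j rc Z / d_hol 3 rc Z"
definition E :: "3 \<Rightarrow> complex^3 \<Rightarrow> complex^3" where "E j Z = axis j 1 + lam j Z *s axis 3 1"
definition ell :: "3 \<Rightarrow> 3 \<Rightarrow> complex^3 \<Rightarrow> complex" where "ell j k Z = levi_form r Z (E j Z) (E k Z)"

lemma d_hol_d_bar_rc: "Z \<in> A \<Longrightarrow> d_hol j (d_bar k rc) Z = d_hol j (d_bar k \<Phi>) Z"
proof -
  assume Z: "Z \<in> A"
  have "eventually (\<lambda>Z. d_bar k rc Z = d_bar k \<Phi> Z + (if k = 3 then - \<i> / 2 else 0)) (nhds Z)"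
    using eventually_nhds_in_open[OF open_A Z]
  proof eventually_elim
    case (elim Z)
    have "d_bar k rc Z = cnj (d_hol k rc Z)"
      using hol_dd_real[OF ranalytic_differentiable[OF ranalytic_rc[OF elim]], of "axis k 1"]
      by (simp add: vcnj_def axis_def anti_dd_def hol_dd_def if_distrib[of cnj] if_distrib[of "\<lambda>x. x * _"] cong: if_cong)
    then show ?case using d_hol_rc[OF elim] d_bar_real[OF elim] by simp
  qed
  from hol_dd_transform[OF this, of "axis j 1"]
  have "d_hol j (d_bar k rc) Z = hol_dd (axis j 1) (\<lambda>Z. d_bar k \<Phi> Z + (if k = 3 then - \<i> / 2 else 0)) Z" by simp
  also have "\<dots> = d_hol j (d_bar k \<Phi>) Z"
    using hol_dd_add[OF ranalytic_differentiable[OF ranalytic_d_bar[OF \<phi>_ranalytic[OF Z]]] ranalytic_differentiable[OF ranalytic_const], where v="axis j 1"] by simp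
  finally show ?thesis .
qed

lemma ell_eq:
  assumes "Z \<in> A"
  shows "ell j k Z = d_hol j (d_bar k \<Phi>) Z + lam j Z * d_hol 3 (d_bar k \<Phi>) Z
     + cnj (lam k Z) * (d_hol j (d_bar 3 \<Phi>) Z + lam j Z * d_hol 3 (d_bar 3 \<Phi>) Z)"
  by (simp add: ell_def E_def levi_form_linear levi_form_axis d_hol_d_bar_rc[OF assms])

lemma lam_0: "j \<noteq> 3 \<Longrightarrow> lam j 0 = 0"
  by (simp add: lam_def d_hol_rc[OF A0] d_hol_\<Phi>_0)

lemma ranalytic_lam: "Z \<in> A \<Longrightarrow> ranalytic (lam j) Z"
  unfolding lam_def by (intro ranalytic_divide ranalytic_uminus ranalytic_d_hol ranalytic_rc r3)

lemma ell_0: "j \<noteq> 3 \<Longrightarrow> k \<noteq> 3 \<Longrightarrow> ell j k 0 = Q j k"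
  by (simp add: ell_eq[OF A0] lam_0 Q_def)

lemma d_hol_d_bar3: "d_hol j (d_bar 3 \<Phi>) 0 = 0"
  using d_hol_d_bar_commute[OF \<phi>_ranalytic[OF A0], of j 3] d3_d_hol by simp

lemma dd_mult_0:
  assumes "ranalytic f p" "ranalytic g p" "f p = 0" "g p = 0"
  shows "dd v (\<lambda>Z. f Z * g Z) p = 0"
  using dd_mult[OF ranalytic_differentiable[OF assms(1)] ranalytic_differentiable[OF assms(2)]] assms(3,4) by simp

text \<open>Each correction term in \<open>ell_eq\<close> is a product of two factors that vanish at
  0, so the Levi matrix and the mixed Hessian of \<open>\<phi>\<close> have the same first
  derivatives there.\<close>

lemma dd_ell:
  assumes j: "j \<noteq> 3" and k: "k \<noteq> 3" shows "dd z (ell j k) 0 = \<Lambda> j k z"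
proof -
  have S: "ranalytic (\<lambda>Z. d_hol a (d_bar b \<Phi>) Z) 0" for a b by (intro ranalytic_d_hol ranalytic_d_bar \<phi>_ranalytic A0)
  have l: "ranalytic (\<lambda>Z. lam j Z) 0" "ranalytic (\<lambda>Z. cnj (lam k Z)) 0" using ranalytic_lam[OF A0] by auto
  have eq: "eventually (\<lambda>Z. ell j k Z = (d_hol j (d_bar k \<Phi>) Z + lam j Z * d_hol 3 (d_bar k \<Phi>) Z)
     + cnj (lam k Z) * (d_hol j (d_bar 3 \<Phi>) Z + lam j Z * d_hol 3 (d_bar 3 \<Phi>) Z)) (nhds 0)"
    using eventually_nhds_in_open[OF open_A A0] by eventually_elim (rule ell_eq)
  have "dd z (ell j k) 0 = dd z (\<lambda>Z. d_hol j (d_bar k \<Phi>) Z) 0 + dd z (\<lambda>Z. lam j Z * d_hol 3 (d_bar k \<Phi>) Z) 0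
     + dd z (\<lambda>Z. cnj (lam k Z) * (d_hol j (d_bar 3 \<Phi>) Z + lam j Z * d_hol 3 (d_bar 3 \<Phi>) Z)) 0"
    unfolding dd_transform[OF eq]
    by (subst dd_add; (subst dd_add)?) (auto intro!: ranalytic_differentiable ranalytic_add ranalytic_mult S l)
  moreover have "dd z (\<lambda>Z. lam j Z * d_hol 3 (d_bar k \<Phi>) Z) 0 = 0"
    by (rule dd_mult_0[OF l(1) S]) (simp_all add: lam_0 j d3_d_bar)
  moreover have "dd z (\<lambda>Z. cnj (lam k Z) * (d_hol j (d_bar 3 \<Phi>) Z + lam j Z * d_hol 3 (d_bar 3 \<Phi>) Z)) 0 = 0"
    by (rule dd_mult_0[OF l(2)]) (auto intro!: ranalytic_add ranalytic_mult S l simp: lam_0 j k d_hol_d_bar3)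
  ultimately show ?thesis by (simp add: \<Lambda>_def)
qed

lemma ranalytic_ell: "ranalytic (ell j k) 0"
proof (rule ranalytic_cong)
  have S: "ranalytic (\<lambda>Z. d_hol a (d_bar b \<Phi>) Z) 0" for a b by (intro ranalytic_d_hol ranalytic_d_bar \<phi>_ranalytic A0)
  show "ranalytic (\<lambda>Z. d_hol j (d_bar k \<Phi>) Z + lam j Z * d_hol 3 (d_bar k \<Phi>) Z
     + cnj (lam k Z) * (d_hol j (d_bar 3 \<Phi>) Z + lam j Z * d_hol 3 (d_bar 3 \<Phi>) Z)) 0"
    by (intro ranalytic_add ranalytic_mult ranalytic_cnj S ranalytic_lam A0)
  show "\<forall>\<^sub>F Z in nhds 0. d_hol j (d_bar k \<Phi>) Z + lam j Z * d_hol 3 (d_bar k \<Phi>) Z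
     + cnj (lam k Z) * (d_hol j (d_bar 3 \<Phi>) Z + lam j Z * d_hol 3 (d_bar 3 \<Phi>) Z) = ell j k Z"
    using eventually_nhds_in_open[OF open_A A0] by eventually_elim (simp add: ell_eq)
qed

text \<open>\<open>levi_degenerate_at\<close> supplies a defining function of its own at each point.
  It is pulled back by \<open>G\<close> and compared with \<open>r\<close>; its null vector becomes
  a nonzero combination of \<open>E 1\<close> and \<open>E 2\<close> that is null for the Levi form
  of \<open>r\<close>.\<close>

lemma levi_degenerate_det:
  assumes Z: "Z \<in> A" "r Z = 0" and deg: "levi_degenerate_at M (G Z)"
    and U: "open U" "G Z \<in> U" "\<And>p. p \<in> U \<Longrightarrow> \<rho> p = 0 \<Longrightarrow> p \<in> M"
  shows "ell 1 1 Z * ell 2 2 Z = ell 1 2 Z * ell 2 1 Z"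
proof -
  obtain U' \<rho>' where ldf: "local_defining_function M (G Z) U' \<rho>'" and eig: "levi_eigenvalue \<rho>' (G Z) 0"
    using deg unfolding levi_degenerate_at_def by blast
  let ?\<rho>' = "\<lambda>p. complex_of_real (\<rho>' p)" and ?\<sigma>' = "\<lambda>Z. complex_of_real (\<rho>' (G Z))"
  have \<rho>': "ranalytic ?\<rho>' (G Z)"
    using ldf real_analytic_at_imp_ranalytic[OF _ bounded_linear_of_real] unfolding local_defining_function_def real_analytic_on_def by blast
  have \<sigma>': "ranalytic ?\<sigma>' Z"
    by (rule ranalytic_compose_holomorphic[where H=G and f="?\<rho>'", OF \<rho>' holG open_A Z(1)])
  note d\<rho>' = ranalytic_differentiable[OF \<rho>']
  have van: "eventually (\<lambda>Z. r Z = 0 \<longrightarrow> \<rho>' (G Z) = 0) (nhds Z)"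
  proof -
    have "eventually (\<lambda>Z. G Z \<in> U \<inter> U') (nhds Z)"
      by (rule isCont_eventually_in[OF holomorphic_map_isCont[OF holG Z(1)]])
         (use U ldf in \<open>auto simp: local_defining_function_def\<close>)
    then show ?thesis using eventually_nhds_in_open[OF open_A Z(1)]
    proof eventually_elim
      case (elim Z')
      then show ?case using r_zero_iff[of Z'] U(3)[of "G Z'"] ldf by (auto simp: local_defining_function_def)
    qed
  qed
  have hol_dd\<sigma>': "hol_dd v ?\<sigma>' Z = hol_dd (hD G Z v) ?\<rho>' (G Z)" for v
    by (rule hol_dd_compose[where H=G and f="?\<rho>'", OF holG Z(1) d\<rho>'])
  note propo = hol_dd_proportional[OF ranalytic_rc[OF Z(1)] \<sigma>' Z(2) _ van]
  have n: "hol_dd (axis 3 1) rc Z \<noteq> 0" using r3[OF Z(1)] by simp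
  \<comment> \<open>Otherwise proportionality would annihilate the whole gradient of
    \<open>\<rho>'\<close> at \<open>G Z\<close>, which is nonzero for a defining function.\<close>
  have n': "hol_dd (axis 3 1) ?\<sigma>' Z \<noteq> 0"
  proof
    assume 0: "hol_dd (axis 3 1) ?\<sigma>' Z = 0"
    have "hol_dd m ?\<rho>' (G Z) = 0" for m
      using propo[OF n, of "hD H (G Z) m"] 0 n by (simp add: hol_dd\<sigma>' hD_inverse[OF Z(1)])
    then have "dd m ?\<rho>' (G Z) = 0" for m using ranalytic_real_part_dd[OF d\<rho>', of m] by simp
    then have "(?\<rho>' has_derivative (\<lambda>_. 0)) (at (G Z))" using ranalytic_has_derivative[OF \<rho>'] by simp
    from has_derivative_of_real_iff(1)[OF this] have "(\<rho>' has_derivative (\<lambda>_. 0)) (at (G Z))" by simp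
    then have "frechet_derivative \<rho>' (at (G Z)) = (\<lambda>_. 0)" using frechet_derivative_at by metis
    then show False using ldf unfolding local_defining_function_def by (metis)
  qed
  obtain v where v: "hol_dd v ?\<rho>' (G Z) = 0" "v \<noteq> 0" "\<And>w. hol_dd w ?\<rho>' (G Z) = 0 \<Longrightarrow> levi_form \<rho>' (G Z) v w = 0"
    using eig unfolding levi_eigenvalue_def by (auto simp: hol_tangent_space_hol_dd)
  define V where "V = hD H (G Z) v"
  have GV: "hD G Z V = v" by (simp add: V_def hD_inverse[OF Z(1)])
  have V0: "V \<noteq> 0"
    using v(2) GV hD_smult[OF holG Z(1), of 0 0] by auto
  have hdV: "hol_dd V rc Z = 0"
    using propo[OF n, of V] n' v(1) by (simp add: hol_dd\<sigma>' GV)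
  have levi0: "levi_form r Z V W = 0" if W: "hol_dd W rc Z = 0" for W
  proof -
    have "hol_dd W ?\<sigma>' Z = 0" using propo[OF n, of W] n W by simp
    then have "levi_form (\<lambda>Z. \<rho>' (G Z)) Z V W = 0"
      using v(3)[of "hD G Z W"] levi_form_compose[OF holG open_A Z(1) \<rho>', of V W] by (simp add: hol_dd\<sigma>' GV)
    then show ?thesis
      using levi_form_proportional[OF ranalytic_rc[OF Z(1)] \<sigma>' Z(2) n van, of V W] n' hdV W
      by (simp add: hol_tangent_space_hol_dd)
  qed
  have lam3: "lam k Z * d_hol 3 rc Z = - d_hol k rc Z" for k
    using r3[OF Z(1)] by (simp add: lam_def)
  have hdE: "hol_dd (E k Z) rc Z = 0" for k
    unfolding E_def hol_dd_add_vec hol_dd_smult_vec hol_dd_axis by (simp add: lam3)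
  have "V = V $ 1 *s E 1 Z + V $ 2 *s E 2 Z"
  proof -
    have "V $ 1 * d_hol 1 rc Z + V $ 2 * d_hol 2 rc Z + V $ 3 * d_hol 3 rc Z = 0"
      using hdV by (simp add: hol_dd_def sum_3)
    then have "(V $ 3 - (V $ 1 * lam 1 Z + V $ 2 * lam 2 Z)) * d_hol 3 rc Z = 0"
      using lam3[of 1] lam3[of 2] by algebra
    then have "V $ 3 = V $ 1 * lam 1 Z + V $ 2 * lam 2 Z"
      using r3[OF Z(1)] by simp
    then show ?thesis by (simp add: vec_eq_iff forall_3 E_def axis_def)
  qed
  then have "levi_form r Z V W = V $ 1 * levi_form r Z (E 1 Z) W + V $ 2 * levi_form r Z (E 2 Z) W" for W
    using levi_form_linear(1)[of r Z 0 "V $ 1" "E 1 Z" W] levi_form_linear(1)[of r Z "V $ 1 *s E 1 Z" "V $ 2" "E 2 Z" W]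
    by (simp add: levi_form_def[of r Z 0])
  then have e: "V $ 1 * ell 1 k Z + V $ 2 * ell 2 k Z = 0" for k
    using levi0[OF hdE[of k]] by (simp add: ell_def)
  have "V $ 1 \<noteq> 0 \<or> V $ 2 \<noteq> 0"
  proof (rule ccontr)
    assume "\<not> ?thesis"
    then have "V = 0" using \<open>V = V $ 1 *s E 1 Z + V $ 2 *s E 2 Z\<close> by (metis add.right_neutral vector_smult_lzero)
    then show False using V0 by simp
  qed
  moreover have "V $ 1 * (ell 1 1 Z * ell 2 2 Z - ell 1 2 Z * ell 2 1 Z) = 0"
    "V $ 2 * (ell 1 1 Z * ell 2 2 Z - ell 1 2 Z * ell 2 1 Z) = 0"
    using e[of 1] e[of 2] by algebra+
  ultimately show ?thesis by auto
qed

lemma levi_degenerate_jets: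
  assumes deg: "open W" "p0 \<in> W" "\<And>p. p \<in> M \<inter> W \<Longrightarrow> levi_degenerate_at M p"
    and U: "open U" "p0 \<in> U" "\<And>p. p \<in> U \<Longrightarrow> \<rho> p = 0 \<Longrightarrow> p \<in> M"
    and z: "z $ 3 = 0"
  shows "Q 1 1 * Q 2 2 = Q 1 2 * Q 2 1"
    and "Q 1 1 * \<Lambda> 2 2 z + \<Lambda> 1 1 z * Q 2 2 = Q 1 2 * \<Lambda> 2 1 z + \<Lambda> 1 2 z * Q 2 1"
    and "Q 1 1 = 0 \<Longrightarrow> Q 1 2 = 0 \<Longrightarrow> Q 2 1 = 0 \<Longrightarrow> Q 2 2 = 0 \<Longrightarrow> \<Lambda> 1 1 z * \<Lambda> 2 2 z = \<Lambda> 1 2 z * \<Lambda> 2 1 z"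
proof -
  \<comment> \<open>A curve inside the graph with velocity \<open>z\<close> at 0: the lift in the
    imaginary \<open>w\<close>-direction does not change \<open>\<phi>\<close>, and its derivative
    at 0 is 0.\<close>
  define c where "c t = t *\<^sub>R z + \<phi> (t *\<^sub>R z) *\<^sub>R axis 3 \<i>" for t :: real
  have c0: "c 0 = 0" by (simp add: c_def \<phi>_0)
  have d\<phi>: "(\<phi> has_derivative (\<lambda>v. 0)) (at 0)"
  proof -
    have "dd v \<Phi> 0 = 0" for v
      using dd_wirtinger[OF ranalytic_differentiable[OF \<phi>_ranalytic[OF A0]], of v] by (simp add: d_hol_\<Phi>_0 d_bar_\<Phi>_0)
    then show ?thesis using has_derivative_of_real_iff(1)[OF ranalytic_has_derivative[OF \<phi>_ranalytic[OF A0]]] by simp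
  qed
  have dc: "(c has_derivative (\<lambda>t. t *\<^sub>R z)) (at 0)"
  proof -
    have 1: "((\<lambda>t::real. t *\<^sub>R z) has_derivative (\<lambda>t. t *\<^sub>R z)) (at 0)" by (auto intro!: derivative_eq_intros)
    have "((\<lambda>t::real. \<phi> (t *\<^sub>R z)) has_derivative (\<lambda>t. 0)) (at 0)"
      using has_derivative_compose[OF 1, of \<phi> "\<lambda>v. 0"] d\<phi> by simp
    then show ?thesis unfolding c_def by (auto intro!: derivative_eq_intros 1)
  qed
  have rc0: "r (c t) = 0" for t
  proof -
    have "embed3 (c t) 0 = embed3 (t *\<^sub>R z) 0"
      by (simp add: c_def embed3_def vec_eq_iff axis_def)
    then have "\<phi> (c t) = \<phi> (t *\<^sub>R z)" using \<phi>_inv by metis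
    then show ?thesis using z by (simp add: r_def c_def axis_def)
  qed
  have "isCont c 0" using dc has_derivative_continuous by blast
  have o: "open (A \<inter> G -` (U \<inter> W))"
    by (rule continuous_open_preimage)
       (use open_A U deg holomorphic_map_isCont[OF holG] in \<open>auto intro: continuous_at_imp_continuous_on\<close>)
  have "c 0 \<in> A \<inter> G -` (U \<inter> W)" using A0 U deg by (simp add: c0 G0)
  then have "eventually (\<lambda>t. c t \<in> A \<inter> G -` (U \<inter> W)) (nhds 0)"
    by (rule isCont_eventually_in[OF \<open>isCont c 0\<close> o])
  then have det: "eventually (\<lambda>t. ell 1 1 (c t) * ell 2 2 (c t) = ell 1 2 (c t) * ell 2 1 (c t)) (nhds 0)"
  proof eventually_elim
    case (elim t)
    have "G (c t) \<in> M" using U(3) r_zero_iff[of "c t"] rc0 elim by auto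
    then show ?case
      using levi_degenerate_det[of "c t" M U] elim rc0 U deg(3) by auto
  qed
  have vd: "((\<lambda>t. ell j k (c t)) has_vector_derivative \<Lambda> j k z) (at 0)" if "j \<noteq> 3" "k \<noteq> 3" for j k
  proof -
    have "((\<lambda>t. ell j k (c t)) has_derivative (\<lambda>t. dd (t *\<^sub>R z) (ell j k) 0)) (at 0)"
      using has_derivative_compose[OF dc, of "ell j k" "\<lambda>v. dd v (ell j k) 0"] ranalytic_has_derivative[OF ranalytic_ell]
      by (simp add: c0)
    moreover have "dd (t *\<^sub>R z) (ell j k) 0 = t *\<^sub>R \<Lambda> j k z" for t
    proof -
      have "dd (t *\<^sub>R z) (ell j k) 0 = of_real t * dd z (ell j k) 0"
        by (rule dd_linear(2)[OF ranalytic_differentiable[OF ranalytic_ell]])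
      then show ?thesis by (simp add: dd_ell[OF that, of z] scaleR_conv_of_real[where 'a=complex])
    qed
    ultimately show ?thesis by (simp only: has_vector_derivative_def)
  qed
  have n3: "(1::3) \<noteq> 3" "(2::3) \<noteq> 3" by simp_all
  note d = det2_derivative[OF vd[OF n3(1) n3(1)] vd[OF n3(1) n3(2)] vd[OF n3(2) n3(1)] vd[OF n3(2) n3(2)] det]
  show "Q 1 1 * Q 2 2 = Q 1 2 * Q 2 1" using d(1) by (simp add: c0 ell_0)
  show "Q 1 1 * \<Lambda> 2 2 z + \<Lambda> 1 1 z * Q 2 2 = Q 1 2 * \<Lambda> 2 1 z + \<Lambda> 1 2 z * Q 2 1" using d(2) by (simp add: c0 ell_0)
  show "\<Lambda> 1 1 z * \<Lambda> 2 2 z = \<Lambda> 1 2 z * \<Lambda> 2 1 z" if "Q 1 1 = 0" "Q 1 2 = 0" "Q 2 1 = 0" "Q 2 2 = 0"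
    using d(3) that by (simp add: c0 ell_0)
qed

end

section \<open>2-nondegeneracy in an adapted chart\<close>

lemma cr_monomial_cases:
  fixes L :: "nat \<Rightarrow> complex^3 \<Rightarrow> complex^3"
  assumes "(\<Sum>j<CARD(3) - 1. \<alpha> j) \<le> 2"
  shows "(\<forall>g. cr_monomial L \<alpha> g = g) \<or> (\<exists>i<2. \<forall>g. cr_monomial L \<alpha> g = field_apply (L i) g) \<or>
    (\<exists>i<2. \<exists>j<2. \<forall>g. cr_monomial L \<alpha> g = field_apply (L j) (field_apply (L i) g))"
proof -
  have "[0..<2] = [0, Suc 0]" by (simp add: upt_rec)
  then have m: "cr_monomial L \<alpha> g = (field_apply (L 0) ^^ \<alpha> 0) ((field_apply (L 1) ^^ \<alpha> 1) g)" for g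
    by (simp add: cr_monomial_def)
  have "{..<2} = {0, Suc 0}" by auto
  then have "\<alpha> 0 + \<alpha> 1 \<le> 2" using assms by simp
  then have "(\<alpha> 0 = 0 \<and> \<alpha> 1 = 0) \<or> (\<alpha> 0 = 0 \<and> \<alpha> 1 = 1) \<or> (\<alpha> 0 = 1 \<and> \<alpha> 1 = 0) \<or>
      (\<alpha> 0 = 0 \<and> \<alpha> 1 = Suc 1) \<or> (\<alpha> 0 = 1 \<and> \<alpha> 1 = 1) \<or> (\<alpha> 0 = Suc 1 \<and> \<alpha> 1 = 0)"
    by arith
  moreover have n: "(0::nat) < 2" "(1::nat) < 2" by simp_all
  ultimately show ?thesis
  proof (elim disjE conjE)
    assume "\<alpha> 0 = 0" "\<alpha> 1 = 1" then show ?thesis unfolding m by (intro disjI2 disjI1 exI[of _ 1]) simp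
  next
    assume "\<alpha> 0 = 1" "\<alpha> 1 = 0" then show ?thesis unfolding m by (intro disjI2 disjI1 exI[of _ 0]) simp
  next
    assume "\<alpha> 0 = 0" "\<alpha> 1 = Suc 1" then show ?thesis unfolding m
      by (intro disjI2 exI[of _ 1] conjI n) simp
  next
    assume "\<alpha> 0 = 1" "\<alpha> 1 = 1" then show ?thesis unfolding m
      by (intro disjI2 exI[of _ 1] conjI n exI[of _ 0]) simp
  next
    assume "\<alpha> 0 = Suc 1" "\<alpha> 1 = 0" then show ?thesis unfolding m
      by (intro disjI2 exI[of _ 0] conjI n) simp
  qed (simp add: m)
qed

context adapted
begin

text \<open>Such a \<open>u\<close> would produce a nonzero vector annihilating all gradients in
  \<open>gradients_span\<close>. On the hypersurface the \<open>u\<close>-derivative of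
  \<open>\<rho>\<close> composed with \<open>G\<close> is a multiple \<open>K * f\<close> of the
  \<open>u\<close>-derivative \<open>f\<close> of \<open>\<phi>\<close>. CR fields are tangential,
  so they may be applied to \<open>K * f\<close> instead, and the hypotheses kill all derivatives of
  \<open>f\<close> that arise up to order two.\<close>

lemma nondegenerate_jets:
  assumes ldf: "local_defining_function M p0 U \<rho>" and basis: "cr_basis_near M p0 \<rho> L"
    and span: "gradients_span \<rho> L p0 2"
    and u3: "u $ 3 = 0" and u0: "u \<noteq> 0"
    and null: "\<And>k. k \<noteq> 3 \<Longrightarrow> u $ 1 * Q 1 k + u $ 2 * Q 2 k = 0"
    and third: "\<And>m n. m \<noteq> 3 \<Longrightarrow> n \<noteq> 3 \<Longrightarrow> d_bar m (d_bar n (hol_dd u \<Phi>)) 0 = 0"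
  shows False
proof -
  let ?\<rho> = "\<lambda>p. complex_of_real (\<rho> p)"
  define f where "f = hol_dd u \<Phi>"
  have ranalytic_f: "ranalytic f Z" if "Z \<in> A" for Z unfolding f_def by (intro ranalytic_hol_dd \<phi>_ranalytic that)
  have f0: "f 0 = 0" by (simp add: f_def hol_dd_def d_hol_\<Phi>_0)
  have f1: "d_bar k f 0 = 0" for k
  proof -
    have "d_bar k f 0 = (\<Sum>j\<in>UNIV. d_hol j (d_bar k \<Phi>) 0 * u $ j)"
    proof -
      have "d_bar k f 0 = anti_dd (axis k 1) (hol_dd u \<Phi>) 0" by (simp add: f_def)
      also have "\<dots> = (\<Sum>j\<in>UNIV. \<Sum>k'\<in>UNIV. d_hol j (d_bar k' \<Phi>) 0 * u $ j * axis k 1 $ k')"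
        by (rule anti_dd_hol_dd_expand[OF \<phi>_ranalytic[OF A0]])
      also have "\<dots> = (\<Sum>j\<in>UNIV. d_hol j (d_bar k \<Phi>) 0 * u $ j)"
        by (simp add: axis_def if_distrib[of "\<lambda>x. _ * x"] cong: if_cong)
      finally show ?thesis .
    qed
    then show ?thesis using null[of k] u3 d_hol_d_bar3 by (cases "k = 3") (simp_all add: sum_3 Q_def mult.commute)
  qed
  \<comment> \<open>The proportionality factor between the gradients of \<open>\<sigma>\<close> and
    \<open>rc\<close>. The error \<open>e\<close> below vanishes on the hypersurface only, which is
    enough for tangential fields.\<close>
  define K where "K Z = d_hol 3 \<sigma> Z / d_hol 3 rc Z" for Z
  have ranalytic_K: "ranalytic K Z" if "Z \<in> A" for Z unfolding K_def
    by (intro ranalytic_divide ranalytic_d_hol ranalytic_\<sigma> ranalytic_rc r3 that)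
  define F where "F = hol_dd u \<sigma>"
  have ranalytic_F: "ranalytic F Z" if "Z \<in> A" for Z unfolding F_def by (intro ranalytic_hol_dd ranalytic_\<sigma> that)
  define e where "e Z = F Z - K Z * f Z" for Z
  have ranalytic_e: "ranalytic e Z" if "Z \<in> A" for Z unfolding e_def by (intro ranalytic_diff ranalytic_mult ranalytic_F ranalytic_K ranalytic_f that)
  have near0: "eventually (\<lambda>Z'. r Z' = 0 \<longrightarrow> \<rho> (G Z') = 0) (nhds Z)" if "Z \<in> A" for Z
    using eventually_nhds_in_open[OF open_A that] by eventually_elim (simp add: r_zero_iff)
  have propo: "hol_dd v \<sigma> Z * d_hol 3 rc Z = d_hol 3 \<sigma> Z * hol_dd v rc Z" if "Z \<in> A" "r Z = 0" for Z v
    using hol_dd_proportional[of r Z "\<lambda>Z. \<rho> (G Z)" "axis 3 1" v] ranalytic_rc[OF that(1)] ranalytic_\<sigma>[OF that(1)] that(2) r3[OF that(1)] near0[OF that(1)]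
    by simp
  have e_zero: "e Z = 0" if "Z \<in> A" "r Z = 0" for Z
  proof -
    have "hol_dd u rc Z = f Z" using u3 by (simp add: f_def hol_dd_def sum_3 d_hol_rc[OF that(1)])
    then have "F Z * d_hol 3 rc Z = d_hol 3 \<sigma> Z * f Z" using propo[OF that, of u] by (simp add: F_def)
    then show ?thesis using r3[OF that(1)] by (simp add: e_def K_def field_simps)
  qed
  have U: "open U" "p0 \<in> U" "M \<inter> U = {p \<in> U. \<rho> p = 0}"
    using ldf by (auto simp: local_defining_function_def)
  obtain V where V: "open V" "p0 \<in> V" "\<And>j. j < 2 \<Longrightarrow> real_analytic_on (L j) V"
    "\<And>p. p \<in> M \<inter> V \<Longrightarrow> vec.span ((\<lambda>j. L j p) ` {..<2}) = cr_space \<rho> p"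
    using basis unfolding cr_basis_near_def by auto
  have ranalytic_L: "ranalytic (\<lambda>p. L j p $ k) p" if "j < 2" "p \<in> V" for j k p
    using real_analytic_at_imp_ranalytic[OF _ bounded_linear_vec_nth] V(3)[OF that(1)] that(2)
    unfolding real_analytic_on_def by blast
  define A1 where "A1 = A \<inter> G -` (U \<inter> V)"
  have A1: "open A1" "0 \<in> A1" "A1 \<subseteq> A"
    using continuous_open_preimage[OF continuous_at_imp_continuous_on open_A open_Int[OF U(1) V(1)]]
      holomorphic_map_isCont[OF holG] A0 U V by (auto simp: A1_def G0)
  \<comment> \<open>Coefficients of the CR field \<open>L j\<close> in the chart; a (0,1) vector is
    transported by the conjugate of \<open>hD H\<close>.\<close>
  define \<beta> where "\<beta> j Z = vcnj (hD H (G Z) (vcnj (L j (G Z))))" for j Z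
  have ranalytic_\<beta>: "ranalytic (\<lambda>Z. \<beta> j Z $ k) Z" if j: "j < 2" and Z: "Z \<in> A1" for j k Z
  proof -
    have ZA: "Z \<in> A" using Z A1 by blast
    have eq: "eventually (\<lambda>Z. (\<Sum>m\<in>UNIV. L j (G Z) $ m * cnj (d_hol m (\<lambda>p. H p $ k) (G Z))) = \<beta> j Z $ k) (nhds Z)"
      using eventually_nhds_in_open[OF A1(1) Z]
    proof eventually_elim
      case (elim Z')
      then have "G Z' \<in> B" using A1 HG by blast
      from hD_hol_dd[OF holH this, of "vcnj (L j (G Z'))" k, symmetric]
      show ?case by (simp add: \<beta>_def hol_dd_def)
    qed
    have "ranalytic (\<lambda>Z. L j (G Z) $ m) Z" for m
      by (rule ranalytic_compose_holomorphic[where H=G and f="\<lambda>p. L j p $ m", OF _ holG open_A ZA])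
         (use Z j in \<open>auto intro!: ranalytic_L simp: A1_def\<close>)
    moreover have "ranalytic (\<lambda>Z. d_hol m (\<lambda>p. H p $ k) (G Z)) Z" for m
      by (rule ranalytic_compose_holomorphic[where H=G and f="d_hol m (\<lambda>p. H p $ k)", OF _ holG open_A ZA])
         (intro ranalytic_d_hol holomorphic_map_ranalytic[OF holH open_B] HG ZA)
    ultimately show ?thesis by (intro ranalytic_cong[OF _ eq] ranalytic_sum ranalytic_mult ranalytic_cnj)
  qed
  define T where "T j g Z = anti_dd (\<beta> j Z) g Z" for j g Z
  have ranalytic_T: "ranalytic (T j g) Z" if "j < 2" "Z \<in> A1" "ranalytic g Z" for j g Z
    unfolding T_def anti_dd_def by (intro ranalytic_sum ranalytic_mult ranalytic_\<beta> ranalytic_d_bar that)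
  have key: "field_apply (L j) (\<lambda>p. g (H p)) p = T j g (H p)" if "p \<in> B" "g differentiable (at (H p))" for j g p
    using anti_dd_compose[where H=H and f=g, OF holH that] by (simp add: field_apply_anti_dd T_def \<beta>_def HG(3)[OF that(1)])
  have tang: "anti_dd (\<beta> j Z) rc Z = 0" if j: "j < 2" and Z: "Z \<in> A1" "r Z = 0" for j Z
  proof -
    have ZA: "Z \<in> A" using Z A1 by blast
    have "\<rho> (G Z) = 0" using r_zero_iff[OF ZA] Z(2) by simp
    then have "G Z \<in> M \<inter> V" using Z(1) U(3) by (auto simp: A1_def)
    then have "L j (G Z) \<in> cr_space \<rho> (G Z)"
      using V(4)[of "G Z"] j vec.span_base[of "L j (G Z)" "(\<lambda>j. L j (G Z)) ` {..<2}"] by auto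
    then have "hol_dd (vcnj (L j (G Z))) ?\<rho> (G Z) = 0"
      using hol_dd_real[OF ranalytic_differentiable[OF \<rho>_ranalytic[OF ZA]], of "vcnj (L j (G Z))"] by (simp add: cr_space_anti_dd)
    then have "hol_dd (vcnj (\<beta> j Z)) \<sigma> Z = 0"
      using hol_dd_compose[where H=G and f="?\<rho>", OF holG ZA ranalytic_differentiable[OF \<rho>_ranalytic[OF ZA]]]
      by (simp add: \<beta>_def hD_inverse[OF ZA])
    then have "hol_dd (vcnj (\<beta> j Z)) rc Z = 0" using propo[OF ZA Z(2), of "vcnj (\<beta> j Z)"] \<sigma>3[OF ZA] by simp
    then show ?thesis using hol_dd_real[OF ranalytic_differentiable[OF ranalytic_rc[OF ZA]], of "vcnj (\<beta> j Z)"] by simp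
  qed
  have T_zero: "T j g Z = 0" if j: "j < 2" and Z: "Z \<in> A1" "r Z = 0" and g: "ranalytic g Z"
    and van: "eventually (\<lambda>Z. r Z = 0 \<longrightarrow> g Z = 0) (nhds Z)" for j g Z
    unfolding T_def
  proof (rule anti_dd_tangent_zero[OF ranalytic_rc ranalytic_differentiable[OF g] Z(2) _ tang[OF j Z] van])
    show "Z \<in> A" using Z A1 by blast
    then show "hol_dd (axis 3 1) rc Z \<noteq> 0" using r3 by simp
  qed
  have r0: "r 0 = 0" by (simp add: r_def \<phi>_0)
  have Te: "T i e Z = 0" if "i < 2" "Z \<in> A1" "r Z = 0" for i Z
  proof (rule T_zero[OF that])
    show "ranalytic e Z" using that A1 by (intro ranalytic_e) blast
    show "\<forall>\<^sub>F Z in nhds Z. r Z = 0 \<longrightarrow> e Z = 0"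
      using eventually_nhds_in_open[OF A1(1) that(2)] by eventually_elim (use A1 e_zero in blast)
  qed
  have TTe: "T j (T i e) 0 = 0" if "i < 2" "j < 2" for i j
  proof (rule T_zero[OF that(2) A1(2) r0])
    show "ranalytic (T i e) 0" by (rule ranalytic_T[OF that(1) A1(2) ranalytic_e[OF A0]])
    show "\<forall>\<^sub>F Z in nhds 0. r Z = 0 \<longrightarrow> T i e Z = 0"
      using eventually_nhds_in_open[OF A1(1,2)] by eventually_elim (use Te that in blast)
  qed
  \<comment> \<open>At 0 tangency removes the \<open>w\<close>-component. Second derivatives then
    involve the indices 1 and 2 only, where \<open>third\<close> is available.\<close>
  have \<beta>3: "\<beta> j 0 $ 3 = 0" if "j < 2" for j
  proof -
    have "d_bar k rc 0 = (if k = 3 then - \<i> / 2 else 0)" for k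
    proof -
      have "cnj (d_hol k rc 0) = d_bar k rc 0"
        using hol_dd_real[OF ranalytic_differentiable[OF ranalytic_rc[OF A0]], of "axis k 1"]
        by (simp add: vcnj_def axis_def anti_dd_def hol_dd_def if_distrib[of cnj] if_distrib[of "\<lambda>x. x * _"] cong: if_cong)
      then show ?thesis by (auto simp: d_hol_rc[OF A0] d_hol_\<Phi>_0 dest: sym)
    qed
    then show ?thesis using tang[OF that A1(2) r0] by (simp add: anti_dd_def sum_3)
  qed
  define g where "g Z = K Z * f Z" for Z
  have ranalytic_g: "ranalytic g Z" if "Z \<in> A" for Z unfolding g_def by (intro ranalytic_mult ranalytic_K ranalytic_f that)
  have g_bar: "d_bar k g Z = K Z * d_bar k f Z + d_bar k K Z * f Z" if "Z \<in> A" for k Z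
    using anti_dd_mult[OF ranalytic_differentiable[OF ranalytic_K[OF that]] ranalytic_differentiable[OF ranalytic_f[OF that]], of "axis k 1"]
    by (simp add: g_def[abs_def])
  have g1: "d_bar k g 0 = 0" for k by (simp add: g_bar[OF A0] f1 f0)
  have g2: "d_bar m (d_bar k g) 0 = 0" if "m \<noteq> 3" "k \<noteq> 3" for m k
  proof -
    have "d_bar m (d_bar k g) 0 = d_bar m (\<lambda>Z. K Z * d_bar k f Z + d_bar k K Z * f Z) 0"
      using anti_dd_transform[of "d_bar k g" "\<lambda>Z. K Z * d_bar k f Z + d_bar k K Z * f Z" 0 "axis m 1"]
        eventually_nhds_in_open[OF open_A A0] g_bar by (simp add: eventually_mono)
    also have "\<dots> = d_bar m (\<lambda>Z. K Z * d_bar k f Z) 0 + d_bar m (\<lambda>Z. d_bar k K Z * f Z) 0"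
      using anti_dd_add[of "\<lambda>Z. K Z * d_bar k f Z" 0 "\<lambda>Z. d_bar k K Z * f Z" "axis m 1"]
      by (simp add: ranalytic_differentiable ranalytic_mult ranalytic_d_bar ranalytic_K ranalytic_f A0)
    also have "\<dots> = 0"
      using anti_dd_mult[of K 0 "d_bar k f" "axis m 1"] anti_dd_mult[of "d_bar k K" 0 f "axis m 1"] third[OF that]
      by (simp add: ranalytic_differentiable ranalytic_d_bar ranalytic_K ranalytic_f A0 f0 f1) (simp add: f_def)
    finally show ?thesis .
  qed
  have Tg: "T i g 0 = 0" for i by (simp add: T_def anti_dd_def g1)
  have TTg: "T j (T i g) 0 = 0" if "i < 2" "j < 2" for i j
  proof -
    have "T j (T i g) 0 = (\<Sum>k\<in>UNIV. anti_dd (\<beta> j 0) (\<lambda>Z. \<beta> i Z $ k * d_bar k g Z) 0)"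
      unfolding T_def[of j] T_def[of i, abs_def] anti_dd_def[of "\<beta> i _"]
      by (rule anti_dd_sum) (intro ranalytic_differentiable ranalytic_mult ranalytic_\<beta> that A1 ranalytic_d_bar ranalytic_g A0)
    also have "\<dots> = (\<Sum>k\<in>UNIV. \<beta> i 0 $ k * anti_dd (\<beta> j 0) (d_bar k g) 0)"
    proof (rule sum.cong[OF refl])
      fix k
      show "anti_dd (\<beta> j 0) (\<lambda>Z. \<beta> i Z $ k * d_bar k g Z) 0 = \<beta> i 0 $ k * anti_dd (\<beta> j 0) (d_bar k g) 0"
        using anti_dd_mult[OF ranalytic_differentiable[OF ranalytic_\<beta>[OF that(1) A1(2)]] ranalytic_differentiable[OF ranalytic_d_bar[OF ranalytic_g[OF A0]]]]
        by (simp add: g1)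
    qed
    also have "\<dots> = 0"
      using \<beta>3[OF that(1)] \<beta>3[OF that(2)] by (simp add: sum_3 anti_dd_def g2)
    finally show ?thesis .
  qed
  have FT: "T i F Z = T i e Z + T i g Z" if "Z \<in> A" for i Z
  proof -
    have "F = (\<lambda>Z. e Z + g Z)" by (simp add: e_def g_def fun_eq_iff)
    then show ?thesis
      unfolding T_def using anti_dd_add[OF ranalytic_differentiable[OF ranalytic_e[OF that]] ranalytic_differentiable[OF ranalytic_g[OF that]]] by simp
  qed
  have F0: "F 0 = 0" using e_zero[OF A0 r0] by (simp add: e_def f0)
  have TF: "T i F 0 = 0" if "i < 2" for i using FT[OF A0] Te[OF that A1(2) r0] Tg by simp
  have TTF: "T j (T i F) 0 = 0" if "i < 2" "j < 2" for i j
  proof -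
    have "T j (T i F) 0 = anti_dd (\<beta> j 0) (\<lambda>Z. T i e Z + T i g Z) 0"
      unfolding T_def[of j]
      by (rule anti_dd_transform) (use eventually_nhds_in_open[OF open_A A0] FT in \<open>auto elim: eventually_mono\<close>)
    also have "\<dots> = T j (T i e) 0 + T j (T i g) 0"
      unfolding T_def[of j]
      by (rule anti_dd_add) (intro ranalytic_differentiable ranalytic_T that A1 ranalytic_e ranalytic_g A0)+
    finally show ?thesis using TTe TTg that by simp
  qed
  \<comment> \<open>The constant field \<open>u\<close> seen in the original coordinates. Its
    coefficients are holomorphic, so CR fields pass through them and act on the gradient of
    \<open>\<rho>\<close> alone.\<close>
  define Uf where "Uf l p = hD G (H p) u $ l" for l p
  have Uf: "jhol vi (Uf l) B" for l
    unfolding Uf_def hD_def vec_lambda_beta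
  proof (rule jhol_compose[where S=A and J=vi])
    show "jhol vi (dd u (\<lambda>Z. G Z $ l)) A"
      by (rule jhol_dd[OF _ open_A]) (use holG in \<open>simp add: holomorphic_map_on_iff_jhol\<close>)
    show "H p \<in> A" if "p \<in> B" for p using HG(4)[OF that] .
    show "\<exists>D. (H has_derivative D) (at p) \<and> (\<forall>v. D (vi v) = vi (D v))" if "p \<in> B" for p
      using hD_has_derivative[OF holH that] hD_smult[OF holH that] by blast
  qed
  have Uf_diff: "Uf l differentiable (at p)" "anti_dd a (Uf l) p = 0" if "p \<in> B" for l p a
    by (rule ranalytic_differentiable[OF jhol_vi_ranalytic[OF Uf open_B that]], rule jhol_anti_dd[OF Uf that])
  have \<rho>_ranB: "ranalytic ?\<rho> p" if "p \<in> B" for p using \<rho>_ranalytic[OF HG(4)[OF that]] HG(3)[OF that] by simp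
  have X: "F (H p) = (\<Sum>l\<in>UNIV. Uf l p * d_hol l ?\<rho> p)" if "p \<in> B" for p
    unfolding F_def using hol_dd_compose[where H=G and f="?\<rho>", OF holG HG(4)[OF that]] \<rho>_ranB[OF that]
    by (simp add: HG(3)[OF that] ranalytic_differentiable Uf_def hol_dd_def)
  have pull: "field_apply a (\<lambda>p. \<Sum>l\<in>UNIV. Uf l p * h l p) p = (\<Sum>l\<in>UNIV. Uf l p * field_apply a (h l) p)"
    if p: "p \<in> B" and h: "\<And>l. ranalytic (h l) p" for a h p
  proof -
    have "field_apply a (\<lambda>p. \<Sum>l\<in>UNIV. Uf l p * h l p) p = (\<Sum>l\<in>UNIV. anti_dd (a p) (\<lambda>p. Uf l p * h l p) p)"
      unfolding field_apply_anti_dd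
      by (rule anti_dd_sum) (intro differentiable_mult Uf_diff p ranalytic_differentiable h)
    then show ?thesis
      by (simp add: field_apply_anti_dd anti_dd_mult[OF Uf_diff(1)[OF p] ranalytic_differentiable[OF h]] Uf_diff(2)[OF p])
  qed
  have diffF: "F differentiable (at (H p))" if "p \<in> B" for p using ranalytic_F HG(4)[OF that] ranalytic_differentiable by blast
  have first: "T i F (H p) = (\<Sum>l\<in>UNIV. Uf l p * field_apply (L i) (d_hol l ?\<rho>) p)" if "p \<in> B" for i p
  proof -
    have "T i F (H p) = field_apply (L i) (\<lambda>p. F (H p)) p" using key[OF that diffF[OF that]] by simp
    also have "\<dots> = field_apply (L i) (\<lambda>p. \<Sum>l\<in>UNIV. Uf l p * d_hol l ?\<rho> p) p"
      unfolding field_apply_anti_dd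
      by (rule anti_dd_transform) (use eventually_nhds_in_open[OF open_B that] X in \<open>auto elim: eventually_mono\<close>)
    also have "\<dots> = (\<Sum>l\<in>UNIV. Uf l p * field_apply (L i) (d_hol l ?\<rho>) p)"
      by (rule pull[OF that]) (intro ranalytic_d_hol \<rho>_ranB that)
    finally show ?thesis .
  qed
  have second: "T j (T i F) 0 = (\<Sum>l\<in>UNIV. Uf l p0 * field_apply (L j) (field_apply (L i) (d_hol l ?\<rho>)) p0)" if "i < 2" for i j
  proof -
    have "T j (T i F) 0 = field_apply (L j) (\<lambda>p. T i F (H p)) p0"
      using key[OF p0_B(1), of "T i F" j] ranalytic_differentiable[OF ranalytic_T[OF that A1(2) ranalytic_F[OF A0]]] by (simp add: p0_B(2))
    also have "\<dots> = field_apply (L j) (\<lambda>p. \<Sum>l\<in>UNIV. Uf l p * field_apply (L i) (d_hol l ?\<rho>) p) p0"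
      unfolding field_apply_anti_dd[of "L j"]
      by (rule anti_dd_transform) (use eventually_nhds_in_open[OF open_B p0_B(1)] first in \<open>auto elim: eventually_mono\<close>)
    also have "\<dots> = (\<Sum>l\<in>UNIV. Uf l p0 * field_apply (L j) (field_apply (L i) (d_hol l ?\<rho>)) p0)"
      by (rule pull[OF p0_B(1)])
         (unfold field_apply_def, intro ranalytic_sum ranalytic_mult ranalytic_L that V(2) ranalytic_d_bar ranalytic_d_hol \<rho>_ranB p0_B(1))
    finally show ?thesis .
  qed
  define U0 where "U0 = hD G 0 u"
  have Uf0: "Uf l p0 = U0 $ l" for l by (simp add: Uf_def U0_def p0_B(2))
  have ann: "(\<Sum>l\<in>UNIV. U0 $ l * cr_monomial L \<alpha> (d_hol l ?\<rho>) p0) = 0"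
    if \<alpha>: "(\<Sum>j<CARD(3) - 1. \<alpha> j) \<le> 2" for \<alpha>
    using cr_monomial_cases[OF \<alpha>, of L]
  proof (elim disjE exE conjE)
    assume "\<forall>g. cr_monomial L \<alpha> g = g"
    then show ?thesis using X[OF p0_B(1)] F0 by (simp add: p0_B(2) Uf0)
  next
    fix i :: nat assume "i < 2" "\<forall>g. cr_monomial L \<alpha> g = field_apply (L i) g"
    then show ?thesis using first[OF p0_B(1), of i] TF by (simp add: p0_B(2) Uf0)
  next
    fix i j :: nat assume "i < 2" "j < 2" "\<forall>g. cr_monomial L \<alpha> g = field_apply (L j) (field_apply (L i) g)"
    then show ?thesis using second[of i j] TTF by (simp add: Uf0)
  qed
  have "(\<Sum>l\<in>UNIV. U0 $ l * x $ l) = 0"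
    if "x \<in> vec.span {\<chi> l. cr_monomial L \<alpha> (d_hol l ?\<rho>) p0 | \<alpha>. (\<Sum>j<CARD(3) - 1. \<alpha> j) \<le> 2}" for x
    using that
  proof (induction rule: vec.span_induct_alt)
    case (step c x y)
    then obtain \<alpha> where \<alpha>: "(\<Sum>j<CARD(3) - 1. \<alpha> j) \<le> 2" "\<And>l. x $ l = cr_monomial L \<alpha> (d_hol l ?\<rho>) p0"
      by auto
    have "(\<Sum>l\<in>UNIV. U0 $ l * (c *s x + y) $ l) = c * (\<Sum>l\<in>UNIV. U0 $ l * x $ l) + (\<Sum>l\<in>UNIV. U0 $ l * y $ l)"
      by (simp add: sum.distrib sum_distrib_left algebra_simps)
    then show ?case using step ann[OF \<alpha>(1)] by (simp add: \<alpha>(2))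
  qed simp
  \<comment> \<open>The span is the whole space, so the conjugate of \<open>U0\<close> may be
    tested, which turns the pairing into the squared norm of \<open>U0\<close>.\<close>
  then have "(\<Sum>l\<in>UNIV. U0 $ l * vcnj U0 $ l) = 0"
    using span unfolding gradients_span_def by blast
  then have "(\<Sum>l\<in>UNIV. (cmod (U0 $ l))\<^sup>2) = 0"
    by (simp add: complex_norm_square[symmetric] flip: of_real_power of_real_sum of_real_add)
  then have "U0 = 0" by (simp add: sum_nonneg_eq_0_iff vec_eq_iff)
  then have "u = 0" using hD_inverse(1)[OF A0, of u] hD_smult[OF holH HG(2)[OF A0], of 0 0] by (simp add: U0_def)
  then show False using u0 by simp
qed

end

section \<open>Normalization of the cubic terms\<close>

text \<open>Here \<open>a\<close>, \<open>b\<close>, \<open>d\<close> are the entries of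
  \<open>Q\<close>; \<open>p\<close>, \<open>q\<close>, \<open>s\<close> and \<open>p'\<close>,
  \<open>q'\<close>, \<open>s'\<close> are the coefficients of c(e1; ., .) and c(e2; ., .); the
  \<open>L\<close> are the derivatives of the Levi matrix. If \<open>Q\<close> is nonzero, the
  differentiated determinant forces c(u; u, .) = 0 for its null vector \<open>u\<close>, and
  \<open>nondeg\<close> then forces c(u; v, v) to be nonzero. If \<open>Q = 0\<close>, the two
  coefficient rows turn out to be dependent, contrary to \<open>nondeg\<close>.\<close>

lemma degenerate_cubic_algebra:
  fixes a d :: real and b p q s p' q' s' :: complex
  defines "L11 \<equiv> \<lambda>z w. z * cnj p + w * cnj q + cnj z * p + cnj w * q"
    and "L12 \<equiv> \<lambda>z w. z * cnj p' + w * cnj q' + cnj z * q + cnj w * s"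
    and "L21 \<equiv> \<lambda>z w. z * cnj q + w * cnj s + cnj z * p' + cnj w * q'"
    and "L22 \<equiv> \<lambda>z w. z * cnj q' + w * cnj s' + cnj z * q' + cnj w * s'"
  assumes det: "of_real a * of_real d = b * cnj b"
    and det1: "\<And>z w. of_real a * L22 z w + L11 z w * of_real d = b * L21 z w + L12 z w * cnj b"
    and det2: "\<And>z w. a = 0 \<Longrightarrow> b = 0 \<Longrightarrow> d = 0 \<Longrightarrow> L11 z w * L22 z w = L12 z w * L21 z w"
    and nondeg: "\<And>u1 u2. u1 \<noteq> 0 \<or> u2 \<noteq> 0 \<Longrightarrow> u1 * of_real a + u2 * cnj b = 0 \<Longrightarrow> u1 * b + u2 * of_real d = 0 \<Longrightarrow>
        u1 * p + u2 * p' \<noteq> 0 \<or> u1 * q + u2 * q' \<noteq> 0 \<or> u1 * s + u2 * s' \<noteq> 0"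
  obtains \<epsilon> :: real and v1 v2 u1 u2 :: complex where "\<epsilon> = 1 \<or> \<epsilon> = -1" "v1 * u2 - v2 * u1 \<noteq> 0"
    "u1 * of_real a + u2 * cnj b = 0" "u1 * b + u2 * of_real d = 0"
    "v1 * cnj v1 * of_real a + v1 * cnj v2 * b + v2 * cnj v1 * cnj b + v2 * cnj v2 * of_real d = of_real \<epsilon>"
    "u1 * cnj u1 * p + u1 * cnj u2 * q + u2 * cnj u1 * p' + u2 * cnj u2 * q' = 0"
    "u1 * cnj u1 * q + u1 * cnj u2 * s + u2 * cnj u1 * q' + u2 * cnj u2 * s' = 0"
    "(u1 * p + u2 * p') * (cnj v1)\<^sup>2 + 2 * (u1 * q + u2 * q') * cnj v1 * cnj v2 + (u1 * s + u2 * s') * (cnj v2)\<^sup>2 = 2 * of_real \<epsilon>"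
proof -
  text \<open>The antiholomorphic part of an \<open>\<real>\<close>-linear form \<open>X\<close> vanishing identically is
    \<open>(X z + \<i> X (\<i> z)) / 2\<close>.\<close>
  have c1: "of_real a * q' + p * of_real d = b * p' + q * cnj b"
  proof -
    define n m where "n = of_real a * cnj q' + cnj p * of_real d - b * cnj q - cnj p' * cnj b"
      and "m = of_real a * q' + p * of_real d - b * p' - q * cnj b"
    have "n + m = 0" "\<i> * (n - m) = 0"
      using det1[of 1 0] det1[of \<i> 0] unfolding L11_def L12_def L21_def L22_def n_def m_def
      by (simp_all add: algebra_simps)
    then have "m = 0" by simp
    then show ?thesis by (simp add: m_def algebra_simps)
  qed
  have c2: "of_real a * s' + q * of_real d = b * q' + s * cnj b"
  proof -
    define n m where "n = of_real a * cnj s' + cnj q * of_real d - b * cnj s - cnj q' * cnj b"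
      and "m = of_real a * s' + q * of_real d - b * q' - s * cnj b"
    have "n + m = 0" "\<i> * (n - m) = 0"
      using det1[of 0 1] det1[of 0 \<i>] unfolding L11_def L12_def L21_def L22_def n_def m_def
      by (simp_all add: algebra_simps)
    then have "m = 0" by simp
    then show ?thesis by (simp add: m_def algebra_simps)
  qed
  consider "a \<noteq> 0" | "a = 0" "d \<noteq> 0" | "a = 0" "d = 0" by blast
  then show ?thesis
  proof cases
    case 1
    \<comment> \<open>The vector \<open>v = (t, 0)\<close> satisfies Q(v, v) =
      \<open>sgn a\<close>.\<close>
    define t where "t = 1 / sqrt \<bar>a\<bar>"
    have t: "t \<noteq> 0" "t * t * a = sgn a"
      using 1 by (simp_all add: t_def sgn_if field_simps flip: real_sqrt_mult) 
    \<comment> \<open>The value c(u; v, v) for the unscaled null vector u = (cnj b, -a). Below,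
      \<open>\<mu>\<close> rescales \<open>u\<close> so that the value becomes 2 \<epsilon>; the
      factor 2 compensates for taking real parts, and \<epsilon> for the later sign change of
      \<open>w\<close>.\<close>
    define \<kappa> where "\<kappa> = (cnj b * p - of_real a * p') * of_real t * of_real t"
    have \<kappa>: "\<kappa> \<noteq> 0"
    proof
      assume "\<kappa> = 0"
      then have C11: "cnj b * p - of_real a * p' = 0" using t by (simp add: \<kappa>_def)
      have n1: "cnj b * of_real a + (- of_real a) * cnj b = 0" by simp
      have n2: "cnj b * b + (- of_real a) * of_real d = 0" using det by (simp add: mult.commute)
      have "of_real a * (cnj b * q - of_real a * q') = 0" using C11 c1 det by algebra
      then have C12: "cnj b * q - of_real a * q' = 0" using 1 by simp
      have "of_real a * (cnj b * s - of_real a * s') = 0" using C12 c2 det by algebra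
      then have C22: "cnj b * s - of_real a * s' = 0" using 1 by simp
      show False using nondeg[OF _ n1 n2] 1 C11 C12 C22 by simp
    qed
    define \<mu> where "\<mu> = 2 * of_real (sgn a) / \<kappa>"
    have \<mu>: "\<mu> \<noteq> 0" "\<mu> * \<kappa> = 2 * of_real (sgn a)" using \<kappa> 1 by (simp_all add: \<mu>_def sgn_if)
    show ?thesis
    \<comment> \<open>The instances are listed in the order of occurrence in the conclusion:
      \<open>\<epsilon>\<close>, \<open>v1\<close>, \<open>u2\<close>, \<open>v2\<close>,
      \<open>u1\<close>.\<close>
    proof (rule that[of "sgn a" "of_real t" "\<mu> * (- of_real a)" 0 "\<mu> * cnj b"])
      show "sgn a = 1 \<or> sgn a = -1" using 1 by (simp add: sgn_if)
      show "of_real t * (\<mu> * - of_real a) - 0 * (\<mu> * cnj b) \<noteq> 0" using t \<mu> 1 by simp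
      show "\<mu> * cnj b * of_real a + \<mu> * - of_real a * cnj b = 0" by simp
      show "\<mu> * cnj b * b + \<mu> * - of_real a * of_real d = 0" using det by algebra
      have "of_real t * of_real t * complex_of_real a = of_real (sgn a)"
        unfolding t(2)[symmetric] by simp
      then show "of_real t * cnj (of_real t) * of_real a + of_real t * cnj 0 * b + 0 * cnj (of_real t) * cnj b + 0 * cnj 0 * of_real d = of_real (sgn a)"
        by simp
      have "cnj b * b * p - cnj b * of_real a * q - of_real a * b * p' + of_real a * of_real a * q' = 0"
        using det c1 by algebra
      then have "(\<mu> * cnj \<mu>) * (cnj b * b * p - cnj b * of_real a * q - of_real a * b * p' + of_real a * of_real a * q') = 0" by simp
      then show "\<mu> * cnj b * cnj (\<mu> * cnj b) * p + \<mu> * cnj b * cnj (\<mu> * - of_real a) * q +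
        \<mu> * - of_real a * cnj (\<mu> * cnj b) * p' + \<mu> * - of_real a * cnj (\<mu> * - of_real a) * q' = 0"
        by (simp add: algebra_simps)
      have "cnj b * b * q - cnj b * of_real a * s - of_real a * b * q' + of_real a * of_real a * s' = 0"
        using det c2 by algebra
      then have "(\<mu> * cnj \<mu>) * (cnj b * b * q - cnj b * of_real a * s - of_real a * b * q' + of_real a * of_real a * s') = 0" by simp
      then show "\<mu> * cnj b * cnj (\<mu> * cnj b) * q + \<mu> * cnj b * cnj (\<mu> * - of_real a) * s +
        \<mu> * - of_real a * cnj (\<mu> * cnj b) * q' + \<mu> * - of_real a * cnj (\<mu> * - of_real a) * s' = 0"
        by (simp add: algebra_simps)
      have "(\<mu> * cnj b * p + \<mu> * - of_real a * p') * (of_real t)\<^sup>2 = \<mu> * \<kappa>"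
        by (simp add: \<kappa>_def power2_eq_square algebra_simps)
      then show "(\<mu> * cnj b * p + \<mu> * - of_real a * p') * (cnj (of_real t))\<^sup>2 +
        2 * (\<mu> * cnj b * q + \<mu> * - of_real a * q') * cnj (of_real t) * cnj 0 +
        (\<mu> * cnj b * s + \<mu> * - of_real a * s') * (cnj 0)\<^sup>2 = 2 * of_real (sgn a)"
        using \<mu>(2) by simp
    qed
  next
    case 2
    have b: "b = 0" using det 2 by simp
    have pq: "p = 0" "q = 0" using c1 c2 2 b by simp_all
    have s: "s \<noteq> 0" using nondeg[of 1 0] 2 b pq by simp
    define t where "t = 1 / sqrt \<bar>d\<bar>"
    have t: "t \<noteq> 0" "t * t * d = sgn d"
      using 2 by (simp_all add: t_def sgn_if field_simps flip: real_sqrt_mult) 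
    define \<kappa> where "\<kappa> = s * of_real t * of_real t"
    have \<kappa>: "\<kappa> \<noteq> 0" using s t by (simp add: \<kappa>_def)
    define \<mu> where "\<mu> = 2 * of_real (sgn d) / \<kappa>"
    have \<mu>: "\<mu> \<noteq> 0" "\<mu> * \<kappa> = 2 * of_real (sgn d)" using \<kappa> 2 by (simp_all add: \<mu>_def sgn_if)
    have td: "of_real t * of_real t * complex_of_real d = of_real (sgn d)"
      unfolding t(2)[symmetric] by simp
    show ?thesis
      by (rule that[of "sgn d" 0 0 "of_real t" \<mu>])
         (use 2 b pq t \<mu> td in \<open>auto simp: sgn_if \<kappa>_def power2_eq_square mult_ac\<close>)
  next
    case 3
    have b: "b = 0" using det 3 by simp
    have D: "L11 z w * L22 z w = L12 z w * L21 z w" for z w using det2 3 b by simp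
    text \<open>Extracting the part of \<open>L11 L22 - L12 L21\<close> that is quadratic in \<open>cnj z, cnj w\<close>.\<close>
    have X: "(cnj z * p + cnj w * q) * (cnj z * q' + cnj w * s') = (cnj z * q + cnj w * s) * (cnj z * p' + cnj w * q')" for z w
    proof -
      define m11 m12 m21 m22 n11 n12 n21 n22 where m: "m11 = cnj z * p + cnj w * q" "m12 = cnj z * q + cnj w * s"
        "m21 = cnj z * p' + cnj w * q'" "m22 = cnj z * q' + cnj w * s'"
        "n11 = z * cnj p + w * cnj q" "n12 = z * cnj p' + w * cnj q'" "n21 = z * cnj q + w * cnj s" "n22 = z * cnj q' + w * cnj s'"
      have l: "L11 (c * z) (c * w) = c * n11 + cnj c * m11" "L12 (c * z) (c * w) = c * n12 + cnj c * m12"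
        "L21 (c * z) (c * w) = c * n21 + cnj c * m21" "L22 (c * z) (c * w) = c * n22 + cnj c * m22" for c
        unfolding L11_def L12_def L21_def L22_def m by (simp_all add: algebra_simps)
      have e: "(c * n11 + cnj c * m11) * (c * n22 + cnj c * m22) = (c * n12 + cnj c * m12) * (c * n21 + cnj c * m21)" for c
        using D[of "c * z" "c * w"] unfolding l .
      define x where "x = m11 * m22 - m12 * m21"
      define y where "y = n11 * m22 + m11 * n22 - n12 * m21 - m12 * n21"
      define y' where "y' = n11 * n22 - n12 * n21"
      \<comment> \<open>Scaling the point by \<open>c\<close> separates the types. The values 1,
        \<open>\<i>\<close> and \<open>1 + \<i>\<close> of \<open>c\<close> suffice to isolate the
        part \<open>x\<close>.\<close>
      have e': "c * c * y' + c * cnj c * y + cnj c * cnj c * x = 0" for c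
        using e[of c] unfolding x_def y_def y'_def by algebra
      have 1: "y' + y + x = 0" using e'[of 1] by simp
      have 2: "- y' + y - x = 0" using e'[of \<i>] by simp
      have 3: "2 * \<i> * y' + 2 * y - 2 * \<i> * x = 0"
      proof -
        have "(1 + \<i>) * (1 + \<i>) = 2 * \<i>" "(1 + \<i>) * cnj (1 + \<i>) = 2" "cnj (1 + \<i>) * cnj (1 + \<i>) = - 2 * \<i>"
          by (simp_all add: complex_eq_iff)
        then show ?thesis using e'[of "1 + \<i>"] by (simp only:) simp
      qed
      have y0: "y = 0" using 1 2 by algebra
      have "y' = - x" using 1 y0 by algebra
      then have "\<i> * x = 0" using 3 y0 by simp
      then show ?thesis by (simp add: x_def m)
    qed
    \<comment> \<open>The three 2 by 2 minors of the matrix with rows (p, q, s) and (p', q',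
      s').\<close>
    have m1: "p * q' = q * p'" and m2: "q * s' = s * q'" and m3: "p * s' = s * p'"
      using X[of 1 0] X[of 0 1] X[of 1 1] by (simp_all add: algebra_simps)
    have "\<exists>u1 u2. (u1 \<noteq> 0 \<or> u2 \<noteq> 0) \<and> u1 * p + u2 * p' = 0 \<and> u1 * q + u2 * q' = 0 \<and> u1 * s + u2 * s' = 0"
    proof -
      consider "p \<noteq> 0" | "q \<noteq> 0" | "s \<noteq> 0" | "p = 0" "q = 0" "s = 0" by blast
      then show ?thesis
      proof cases
        case 1 then show ?thesis using m1 m2 m3 by (intro exI[of _ p'] exI[of _ "-p"]) (simp add: mult.commute)
      next
        case 2 then show ?thesis using m1 m2 m3 by (intro exI[of _ q'] exI[of _ "-q"]) (simp add: mult.commute)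
      next
        case 3 then show ?thesis using m1 m2 m3 by (intro exI[of _ s'] exI[of _ "-s"]) (simp add: mult.commute)
      next
        case 4 then show ?thesis by (intro exI[of _ 1] exI[of _ 0]) simp
      qed
    qed
    then show ?thesis using nondeg 3 b by auto
  qed
qed

section \<open>Taylor expansion of the graph\<close>

text \<open>On the complex line through \<open>x\<close> in direction \<open>v\<close> the function
  is holomorphic in a disc whose radius is comparable to \<open>1 / norm v\<close>, uniformly in
  \<open>x\<close>. Cauchy's inequality then bounds the tail by a geometric series.\<close>

lemma ranalytic_taylor:
  fixes f :: "'a::euclidean_space \<Rightarrow> complex"
  assumes "ranalytic f p"
  obtains C d where "d > 0" "C \<ge> 0"
    "\<And>x v. dist p x < d \<Longrightarrow> norm v < d \<Longrightarrow> v \<noteq> 0 \<Longrightarrow>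
      norm (f (x + v) - (\<Sum>k<n. (dd v ^^ k) f x / fact k)) \<le> C * norm v ^ n"
proof -
  obtain F R where F: "R > 0" "jhol cJ F (ball (p, 0) R)" "\<And>x. x \<in> ball p R \<Longrightarrow> F (x, 0) = f x"
    "\<And>x v. x \<in> ball p R \<Longrightarrow> dd v f x = dd (v, 0) F (x, 0)"
    using ranalytic_extension[OF assms] by metis
  have J: "jhol cJ ((dd v ^^ k) F) (ball (p, 0) R)" for v k
    by (induction k) (use F(2) jhol_dd[OF _ open_ball] in auto)
  have iter: "(dd v ^^ k) f x = (dd (v, 0) ^^ k) F (x, 0)" if "x \<in> ball p R" for v k x
    using that
  proof (induction k arbitrary: x)
    case (Suc k)
    have 1: "((\<lambda>x. (x, 0)) has_derivative (\<lambda>h. (h, 0))) (at x)" by (auto intro!: derivative_eq_intros)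
    have B: "(x, 0) \<in> ball (p, 0) R" using Suc.prems by simp
    have "dd v ((dd v ^^ k) f) x = dd v (\<lambda>x. (dd (v, 0) ^^ k) F (x, 0)) x"
      by (rule dd_transform) (use eventually_nhds_in_open[OF open_ball Suc.prems] Suc.IH in \<open>auto elim: eventually_mono\<close>)
    also have "\<dots> = dd (v, 0) ((dd (v, 0) ^^ k) F) (x, 0)"
      by (rule dd_compose[OF 1 differentiableI[OF jhol_has_derivative(1)[OF J B]]])
    finally show ?case by simp
  qed (use F in simp)
  have sub: "cball (p, 0) (R/2) \<subseteq> ball (p, 0::'a) R" using F(1) by auto
  have "compact (F ` cball (p, 0) (R/2))"
    by (intro compact_continuous_image continuous_on_subset[OF jhol_continuous_on[OF F(2)] sub]) auto
  then obtain K where K: "\<And>q. q \<in> cball (p, 0) (R/2) \<Longrightarrow> norm (F q) \<le> K"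
    using compact_imp_bounded bounded_iff by (metis imageI)
  have K0: "K \<ge> 0" using order_trans[OF norm_ge_zero K[of "(p, 0)"]] F(1) by simp
  show ?thesis
  proof (rule that[of "R/32" "2 * K * (16 / R) ^ n"])
    fix x v :: 'a assume x: "dist p x < R/32" and v: "norm v < R/32" "v \<noteq> 0"
    \<comment> \<open>With this radius the disc of radius \<open>2 * r\<close> moves
      \<open>x\<close> by at most \<open>R / 4\<close>, so the line stays in the closed ball of
      radius \<open>R / 2\<close>. As \<open>r > 2\<close>, the ratio \<open>1 / r\<close> is at
      most 1/2.\<close>
    define r where "r = R / (16 * norm v)"
    have r: "r > 2" using v F(1) by (simp add: r_def field_simps)
    have in_cball: "cline cJ (x, 0) (v, 0) \<zeta> \<in> cball (p, 0) (R/2)" if "norm \<zeta> < 2 * r" for \<zeta>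
    proof -
      have "cline cJ (x, 0) (v, 0) \<zeta> - (x, 0) = Re \<zeta> *\<^sub>R (v, 0) + Im \<zeta> *\<^sub>R (0, v)" by (simp add: cline_def)
      then have "dist (x, 0) (cline cJ (x, 0) (v, 0) \<zeta>) = norm (Re \<zeta> *\<^sub>R (v, 0::'a) + Im \<zeta> *\<^sub>R (0::'a, v))"
        by (metis dist_commute dist_norm)
      also have "\<dots> \<le> \<bar>Re \<zeta>\<bar> * norm v + \<bar>Im \<zeta>\<bar> * norm v"
        by (rule order_trans[OF norm_triangle_ineq]) (simp add: norm_Pair1 norm_Pair2)
      also have "\<dots> \<le> norm \<zeta> * norm v + norm \<zeta> * norm v"
        by (intro add_mono mult_right_mono abs_Re_le_cmod abs_Im_le_cmod) auto
      also have "\<dots> \<le> (2 * r) * norm v + (2 * r) * norm v"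
        by (intro add_mono mult_right_mono) (use that in auto)
      also have "\<dots> = R / 4" using v by (simp add: r_def)
      finally have "dist (p, 0) (cline cJ (x, 0) (v, 0) \<zeta>) \<le> R/32 + R/4"
        using x dist_triangle[of "(p, 0)" "cline cJ (x, 0) (v, 0) \<zeta>" "(x, 0)"] by simp
      then show ?thesis using F(1) by simp
    qed
    let ?g = "\<lambda>\<zeta>. F (cline cJ (x, 0) (v, 0) \<zeta>)"
    have in_ball: "cline cJ (x, 0) (v, 0) \<zeta> \<in> ball (p, 0) R" if "norm \<zeta> < 2 * r" for \<zeta>
      using in_cball[OF that] sub by blast
    have hol: "?g holomorphic_on ball 0 (2 * r)"
      unfolding holomorphic_on_def field_differentiable_def
      using jhol_line[OF F(2) in_ball] by (meson has_field_derivative_at_within mem_ball_0)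
    define a where "a k = (deriv ^^ k) ?g 0 / fact k" for k
    have a_bound: "norm (a k) \<le> K * (1 / r) ^ k" for k
    proof -
      have "norm ((deriv ^^ k) ?g 0) \<le> fact k * K / r ^ k"
      proof (rule Cauchy_inequality)
        show "?g holomorphic_on ball 0 r" by (rule holomorphic_on_subset[OF hol]) (use r in auto)
        show "continuous_on (cball 0 r) ?g"
          by (rule continuous_on_subset[OF holomorphic_on_imp_continuous_on[OF hol]]) (use r in auto)
        show "norm (?g \<zeta>) \<le> K" if "norm (0 - \<zeta>) = r" for \<zeta> by (rule K[OF in_cball]) (use that r in auto)
      qed (use r in auto)
      then have "norm ((deriv ^^ k) ?g 0) / fact k \<le> (fact k * K / r ^ k) / fact k"
        by (rule divide_right_mono) simp
      then show ?thesis by (simp add: a_def norm_divide power_divide)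
    qed
    have a_eq: "a k = (dd v ^^ k) f x / fact k" for k
    proof -
      have "(deriv ^^ k) ?g 0 = (dd (v, 0) ^^ k) F (cline cJ (x, 0) (v, 0) 0)"
        by (rule jhol_higher_deriv_line[OF F(2) open_ball in_ball]) (use r in auto)
      moreover have "cline cJ (x, 0) (v, 0) 0 = (x, 0)" by (simp add: cline_def)
      moreover have "x \<in> ball p R" using x F(1) by simp
      ultimately show ?thesis using iter[where x=x and v=v and k=k] by (simp add: a_def)
    qed
    have "(\<lambda>k. (deriv ^^ k) ?g 0 / fact k * (1 - 0) ^ k) sums ?g 1"
      by (rule holomorphic_power_series[OF hol]) (use r in auto)
    moreover have "?g 1 = f (x + v)"
    proof -
      have "cline cJ (x, 0) (v, 0) 1 = (x + v, 0)" by (simp add: cline_def)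
      moreover have "dist p (x + v) \<le> dist p x + norm v"
        using dist_triangle[of p "x + v" x] by (simp add: dist_norm)
      then have "x + v \<in> ball p R" using x v F(1) by simp
      ultimately show ?thesis using F(3) by simp
    qed
    ultimately have sums: "a sums f (x + v)" by (simp add: a_def[abs_def])
    define t where "t = 1 / r"
    have t: "0 \<le> t" "t \<le> 1/2" using r by (auto simp: t_def field_simps)
    have geo: "summable (\<lambda>k. K * t ^ (k + n))"
      using t by (intro summable_mult summable_ignore_initial_segment summable_geometric) auto
    have "f (x + v) - (\<Sum>k<n. a k) = (\<Sum>k. a (k + n))"
      using suminf_minus_initial_segment[OF sums_summable[OF sums], of n] sums_unique[OF sums] by simp
    also have "norm \<dots> \<le> (\<Sum>k. K * t ^ (k + n))"
      by (rule norm_suminf_le[OF _ geo]) (use a_bound in \<open>simp add: t_def\<close>)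
    also have "\<dots> = K * t ^ n * (\<Sum>k. t ^ k)"
      using t by (subst suminf_mult[symmetric]) (auto simp: power_add mult_ac intro!: summable_geometric)
    also have "(\<Sum>k. t ^ k) = 1 / (1 - t)" using t by (intro suminf_geometric) auto
    also have "K * t ^ n * (1 / (1 - t)) \<le> K * t ^ n * 2"
      using t K0 by (intro mult_left_mono) (auto simp: field_simps)
    also have "\<dots> = 2 * K * (16 / R) ^ n * norm v ^ n"
      by (simp add: t_def r_def power_divide power_mult_distrib)
    finally show "norm (f (x + v) - (\<Sum>k<n. (dd v ^^ k) f x / fact k)) \<le> 2 * K * (16 / R) ^ n * norm v ^ n"
      by (simp add: a_eq)
  qed (use F K0 in auto)
qed

lemma hol_dd_anti_dd_commute: "ranalytic f p \<Longrightarrow> hol_dd v (anti_dd w f) p = anti_dd w (hol_dd v f) p"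
  by (simp add: hol_dd_anti_dd_expand anti_dd_hol_dd_expand)

lemma hol_dd_expand:
  assumes "\<And>k. ranalytic (f k) p" shows "hol_dd v (\<lambda>Z. \<Sum>k\<in>UNIV. c k * f k Z) p = (\<Sum>k\<in>UNIV. c k * hol_dd v (f k) p)"
  by (subst hol_dd_sum) (auto intro!: ranalytic_differentiable ranalytic_mult assms sum.cong hol_dd_cmult)

lemma anti_dd_expand:
  assumes "\<And>k. ranalytic (f k) p" shows "anti_dd v (\<lambda>Z. \<Sum>k\<in>UNIV. c k * f k Z) p = (\<Sum>k\<in>UNIV. c k * anti_dd v (f k) p)"
  by (subst anti_dd_sum) (auto intro!: ranalytic_differentiable ranalytic_mult assms sum.cong anti_dd_cmult)

context adapted
begin

text \<open>Parts of the second and third derivative by type: \<open>q2\<close> is of type (2,0),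
  \<open>q3\<close> of type (3,0), \<open>Herm\<close> of type (1,1) and \<open>Y\<close> of type
  (1,2). No factorials are divided out, so in the Taylor polynomial their real parts get the weights
  1, 1/3, 1 and 1.\<close>

definition q2 :: "complex^3 \<Rightarrow> complex" where
  "q2 z = (\<Sum>k\<in>UNIV. \<Sum>j\<in>UNIV. z $ k * (z $ j * d_hol j (d_hol k \<Phi>) 0))"

definition q3 :: "complex^3 \<Rightarrow> complex" where
  "q3 z = (\<Sum>k\<in>UNIV. \<Sum>j\<in>UNIV. \<Sum>l\<in>UNIV. z $ k * (z $ j * (z $ l * d_hol l (d_hol j (d_hol k \<Phi>)) 0)))"

definition c3 :: "3 \<Rightarrow> 3 \<Rightarrow> 3 \<Rightarrow> complex" where "c3 l m n = d_bar m (d_bar n (d_hol l \<Phi>)) 0"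

definition Herm :: "complex^3 \<Rightarrow> complex" where
  "Herm z = (\<Sum>j\<in>UNIV. \<Sum>k\<in>UNIV. Q j k * z $ j * cnj (z $ k))"

definition Y :: "complex^3 \<Rightarrow> complex" where
  "Y z = (\<Sum>l\<in>UNIV. \<Sum>n\<in>UNIV. \<Sum>m\<in>UNIV. z $ l * (cnj (z $ n) * (cnj (z $ m) * c3 l m n)))"

lemma c3_sym: "c3 l m n = c3 l n m"
  unfolding c3_def by (rule d_bar_d_bar_commute) (intro ranalytic_d_hol \<phi>_ranalytic A0)

lemma ranalytic_\<Phi>_0 [intro]: "ranalytic \<Phi> 0" by (rule \<phi>_ranalytic[OF A0])

lemma near_A: "(\<And>Z. Z \<in> A \<Longrightarrow> P Z) \<Longrightarrow> eventually P (nhds 0)"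
  using eventually_nhds_in_open[OF open_A A0] by (rule eventually_mono) auto

lemma hol_dd_hol_dd_q2: "hol_dd z (hol_dd z \<Phi>) 0 = q2 z"
proof -
  have "hol_dd z (hol_dd z \<Phi>) 0 = (\<Sum>k\<in>UNIV. z $ k * hol_dd z (d_hol k \<Phi>) 0)"
    unfolding hol_dd_def[of z \<Phi>, abs_def] by (rule hol_dd_expand) auto
  then show ?thesis by (simp add: q2_def hol_dd_def sum_distrib_left)
qed

lemma hol_dd_hol_dd_hol_dd_q3: "hol_dd z (hol_dd z (hol_dd z \<Phi>)) 0 = q3 z"
proof -
  have "hol_dd z (hol_dd z (hol_dd z \<Phi>)) 0 = hol_dd z (\<lambda>Z. \<Sum>k\<in>UNIV. z $ k * hol_dd z (d_hol k \<Phi>) Z) 0"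
  proof (rule hol_dd_transform[OF near_A])
    fix Z assume Z: "Z \<in> A"
    show "hol_dd z (hol_dd z \<Phi>) Z = (\<Sum>k\<in>UNIV. z $ k * hol_dd z (d_hol k \<Phi>) Z)"
      unfolding hol_dd_def[of z \<Phi>, abs_def] by (rule hol_dd_expand) (intro ranalytic_d_hol \<phi>_ranalytic Z)
  qed
  also have "\<dots> = (\<Sum>k\<in>UNIV. z $ k * hol_dd z (hol_dd z (d_hol k \<Phi>)) 0)" by (rule hol_dd_expand) auto
  finally have outer: "hol_dd z (hol_dd z (hol_dd z \<Phi>)) 0 = (\<Sum>k\<in>UNIV. z $ k * hol_dd z (hol_dd z (d_hol k \<Phi>)) 0)" .
  have step: "hol_dd z (hol_dd z (d_hol k \<Phi>)) 0 = (\<Sum>j\<in>UNIV. z $ j * hol_dd z (d_hol j (d_hol k \<Phi>)) 0)" for k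
    unfolding hol_dd_def[of z "d_hol k \<Phi>", abs_def] by (rule hol_dd_expand) auto
  show ?thesis unfolding outer step by (simp add: q3_def hol_dd_def sum_distrib_left)
qed

lemma hol_dd_anti_dd_Herm: "hol_dd z (anti_dd (vcnj z) \<Phi>) 0 = Herm z"
  by (simp add: hol_dd_anti_dd_expand[OF ranalytic_\<Phi>_0] Herm_def Q_def)

lemma anti_dd_anti_dd_hol_dd_expand: "anti_dd (vcnj z) (anti_dd (vcnj z) (hol_dd w \<Phi>)) 0
   = (\<Sum>l\<in>UNIV. \<Sum>n\<in>UNIV. \<Sum>m\<in>UNIV. w $ l * (cnj (z $ n) * (cnj (z $ m) * c3 l m n)))"
proof -
  have "anti_dd (vcnj z) (anti_dd (vcnj z) (hol_dd w \<Phi>)) 0 = anti_dd (vcnj z) (\<lambda>Z. \<Sum>l\<in>UNIV. w $ l * anti_dd (vcnj z) (d_hol l \<Phi>) Z) 0"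
  proof (rule anti_dd_transform[OF near_A])
    fix Z assume Z: "Z \<in> A"
    show "anti_dd (vcnj z) (hol_dd w \<Phi>) Z = (\<Sum>l\<in>UNIV. w $ l * anti_dd (vcnj z) (d_hol l \<Phi>) Z)"
      unfolding hol_dd_def[of w \<Phi>, abs_def] by (rule anti_dd_expand) (intro ranalytic_d_hol \<phi>_ranalytic Z)
  qed
  also have "\<dots> = (\<Sum>l\<in>UNIV. w $ l * anti_dd (vcnj z) (anti_dd (vcnj z) (d_hol l \<Phi>)) 0)" by (rule anti_dd_expand) auto
  finally have outer: "anti_dd (vcnj z) (anti_dd (vcnj z) (hol_dd w \<Phi>)) 0
      = (\<Sum>l\<in>UNIV. w $ l * anti_dd (vcnj z) (anti_dd (vcnj z) (d_hol l \<Phi>)) 0)" .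
  have step: "anti_dd (vcnj z) (anti_dd (vcnj z) (d_hol l \<Phi>)) 0 = (\<Sum>n\<in>UNIV. vcnj z $ n * anti_dd (vcnj z) (d_bar n (d_hol l \<Phi>)) 0)" for l
    unfolding anti_dd_def[of "vcnj z" "d_hol l \<Phi>", abs_def] by (rule anti_dd_expand) auto
  show ?thesis unfolding outer step by (simp add: c3_def anti_dd_def sum_distrib_left)
qed

lemma d_bar_d_bar_hol_dd: "d_bar m (d_bar n (hol_dd u \<Phi>)) 0 = (\<Sum>l\<in>UNIV. u $ l * c3 l m n)"
proof -
  have "d_bar m (d_bar n (hol_dd u \<Phi>)) 0 = anti_dd (axis m 1) (\<lambda>Z. \<Sum>l\<in>UNIV. u $ l * anti_dd (axis n 1) (d_hol l \<Phi>) Z) 0"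
    unfolding anti_dd_axis[symmetric, of m]
  proof (rule anti_dd_transform[OF near_A])
    fix Z assume Z: "Z \<in> A"
    show "d_bar n (hol_dd u \<Phi>) Z = (\<Sum>l\<in>UNIV. u $ l * anti_dd (axis n 1) (d_hol l \<Phi>) Z)"
      unfolding hol_dd_def[of u \<Phi>, abs_def] anti_dd_axis[symmetric, of n "\<lambda>Z. \<Sum>k\<in>UNIV. u $ k * d_hol k \<Phi> Z"]
      by (rule anti_dd_expand) (intro ranalytic_d_hol \<phi>_ranalytic Z)
  qed
  also have "\<dots> = (\<Sum>l\<in>UNIV. u $ l * anti_dd (axis m 1) (anti_dd (axis n 1) (d_hol l \<Phi>)) 0)" by (rule anti_dd_expand) auto
  finally show ?thesis by (simp add: c3_def anti_dd_axis[abs_def])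
qed

lemma real_\<Phi>: "Z \<in> A \<Longrightarrow> anti_dd (vcnj z) \<Phi> Z = cnj (hol_dd z \<Phi> Z)"
  using hol_dd_real[OF ranalytic_differentiable[OF \<phi>_ranalytic]] by simp

lemma Q_herm: "Q k j = cnj (Q j k)"
proof -
  have "d_hol k (d_bar j \<Phi>) 0 = hol_dd (axis k 1) (\<lambda>Z. cnj (d_hol j \<Phi> Z)) 0"
    using hol_dd_transform[OF d_bar_\<Phi>_eventually[OF A0], of "axis k 1"] by simp
  also have "\<dots> = cnj (anti_dd (vcnj (axis k 1)) (d_hol j \<Phi>) 0)"
    by (rule hol_dd_cnj) (intro ranalytic_differentiable ranalytic_d_hol ranalytic_\<Phi>_0)
  also have "vcnj (axis k 1) = axis k 1" by (simp add: vec_eq_iff axis_def)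
  finally show ?thesis by (simp add: Q_def d_hol_d_bar_commute[OF ranalytic_\<Phi>_0])
qed

text \<open>As \<open>\<phi>\<close> is real, the third derivatives with two holomorphic indices are
  conjugates of the \<open>c3\<close>.\<close>

lemma \<Lambda>_c3: "\<Lambda> j k z = (\<Sum>l\<in>UNIV. z $ l * cnj (c3 k l j) + cnj (z $ l) * c3 j l k)"
proof -
  have b: "d_bar l (d_hol j (d_bar k \<Phi>)) 0 = c3 j l k" for l
  proof -
    have "anti_dd (axis l 1) (d_hol j (d_bar k \<Phi>)) 0 = anti_dd (axis l 1) (d_bar k (d_hol j \<Phi>)) 0"
      by (rule anti_dd_transform[OF near_A]) (rule d_hol_d_bar_commute[OF \<phi>_ranalytic])
    then show ?thesis by (simp add: c3_def)
  qed
  have h: "d_hol l (d_hol j (d_bar k \<Phi>)) 0 = cnj (c3 k l j)" for l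
  proof -
    have ax: "vcnj (axis i 1) = axis i 1" for i :: 3 by (simp add: vec_eq_iff axis_def)
    have "hol_dd (axis l 1) (d_hol j (d_bar k \<Phi>)) 0 = hol_dd (axis l 1) (\<lambda>Z. cnj (d_bar j (d_hol k \<Phi>) Z)) 0"
    proof (rule hol_dd_transform[OF near_A])
      fix Z assume Z: "Z \<in> A"
      have "hol_dd (axis j 1) (d_bar k \<Phi>) Z = hol_dd (axis j 1) (\<lambda>Z. cnj (d_hol k \<Phi> Z)) Z"
        by (rule hol_dd_transform[OF d_bar_\<Phi>_eventually[OF Z]])
      also have "\<dots> = cnj (anti_dd (vcnj (axis j 1)) (d_hol k \<Phi>) Z)"
        by (rule hol_dd_cnj) (intro ranalytic_differentiable ranalytic_d_hol \<phi>_ranalytic Z)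
      finally show "d_hol j (d_bar k \<Phi>) Z = cnj (d_bar j (d_hol k \<Phi>) Z)" by (simp add: ax)
    qed
    also have "\<dots> = cnj (anti_dd (vcnj (axis l 1)) (d_bar j (d_hol k \<Phi>)) 0)"
      by (rule hol_dd_cnj) (intro ranalytic_differentiable ranalytic_d_bar ranalytic_d_hol ranalytic_\<Phi>_0)
    finally show ?thesis by (simp add: ax c3_def)
  qed
  have "(\<lambda>Z. d_hol j (d_bar k \<Phi>) Z) differentiable (at 0)"
    by (intro ranalytic_differentiable ranalytic_d_hol ranalytic_d_bar ranalytic_\<Phi>_0)
  then show ?thesis by (simp add: \<Lambda>_def dd_wirtinger b h)
qed

text \<open>\<open>dd z\<close> is the sum of a (1,0) and a (0,1) part that commute, so its powers
  expand binomially. Since \<open>\<phi>\<close> is real, the terms come in conjugate pairs; three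
  terms of type (1,2) and three of type (2,1) add up to 6 Re Y.\<close>

lemma second_third:
  "dd z (dd z \<Phi>) 0 = of_real (2 * Re (q2 z)) + 2 * Herm z"
  "dd z (dd z (dd z \<Phi>)) 0 = of_real (2 * Re (q3 z) + 6 * Re (Y z))"
proof -
  let ?a = "hol_dd z" and ?b = "anti_dd (vcnj z)"
  have sp: "dd z f Z = ?a f Z + ?b f Z" if "ranalytic f Z" for f Z
    by (rule dd_hol_dd_anti_dd[OF ranalytic_differentiable[OF that]])
  have add: "dd z (\<lambda>Z. f Z + g Z) Z = dd z f Z + dd z g Z" if "ranalytic f Z" "ranalytic g Z" for f g Z
    by (rule dd_add[OF that[THEN ranalytic_differentiable]])
  have d2: "dd z (dd z \<Phi>) Z = ((?a (?a \<Phi>) Z + ?b (?a \<Phi>) Z) + (?a (?b \<Phi>) Z + ?b (?b \<Phi>) Z))" if Z: "Z \<in> A" for Z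
  proof -
    have "dd z (dd z \<Phi>) Z = dd z (\<lambda>Z. ?a \<Phi> Z + ?b \<Phi> Z) Z"
      by (rule dd_transform) (use eventually_nhds_in_open[OF open_A Z] sp \<phi>_ranalytic in \<open>auto elim: eventually_mono\<close>)
    also have "\<dots> = dd z (?a \<Phi>) Z + dd z (?b \<Phi>) Z" by (rule add) (intro ranalytic_hol_dd ranalytic_anti_dd \<phi>_ranalytic Z)+
    finally show ?thesis using Z by (simp add: sp ranalytic_hol_dd ranalytic_anti_dd \<phi>_ranalytic)
  qed
  have conj_a: "?a (\<lambda>Z. cnj (f Z)) Z = cnj (?b f Z)" "?b (\<lambda>Z. cnj (f Z)) Z = cnj (?a f Z)" if "ranalytic f Z" for f Z
    using hol_dd_cnj[OF ranalytic_differentiable[OF that], of z] anti_dd_cnj[OF ranalytic_differentiable[OF that], of "vcnj z"] by simp_all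
  have bP: "eventually (\<lambda>Z. ?b \<Phi> Z = cnj (?a \<Phi> Z)) (nhds Z)" if "Z \<in> A" for Z
    using eventually_nhds_in_open[OF open_A that] by (rule eventually_mono) (rule real_\<Phi>)
  have bb: "?b (?b \<Phi>) Z = cnj (?a (?a \<Phi>) Z)" and ab: "?a (?b \<Phi>) Z = cnj (?b (?a \<Phi>) Z)" if "Z \<in> A" for Z
    using anti_dd_transform[OF bP[OF that], of "vcnj z"] hol_dd_transform[OF bP[OF that], of z] conj_a[OF ranalytic_hol_dd[OF \<phi>_ranalytic[OF that]]] by simp_all
  have ab': "?b (?a \<Phi>) Z = ?a (?b \<Phi>) Z" if "Z \<in> A" for Z using hol_dd_anti_dd_commute[OF \<phi>_ranalytic[OF that]] by simp
  show "dd z (dd z \<Phi>) 0 = of_real (2 * Re (q2 z)) + 2 * Herm z"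
    using d2[OF A0] bb[OF A0] ab'[OF A0] by (simp add: hol_dd_hol_dd_q2 hol_dd_anti_dd_Herm complex_add_cnj)
  define P where "P = ?a (?a \<Phi>)"
  define R where "R = ?b (?a \<Phi>)"
  have rP: "ranalytic P 0" "ranalytic R 0" unfolding P_def R_def by auto
  have "dd z (dd z (dd z \<Phi>)) 0 = dd z (\<lambda>Z. (P Z + R Z) + cnj (P Z + R Z)) 0"
  proof (rule dd_transform[OF near_A])
    fix Z assume "Z \<in> A"
    then show "dd z (dd z \<Phi>) Z = (P Z + R Z) + cnj (P Z + R Z)"
      using d2 bb ab by (simp add: P_def R_def)
  qed
  also have "\<dots> = dd z (\<lambda>Z. P Z + R Z) 0 + dd z (\<lambda>Z. cnj (P Z + R Z)) 0"
    by (rule add) (intro ranalytic_add ranalytic_cnj rP)+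
  also have "dd z (\<lambda>Z. cnj (P Z + R Z)) 0 = cnj (dd z (\<lambda>Z. P Z + R Z) 0)"
    by (rule dd_cnj) (intro ranalytic_differentiable ranalytic_add rP)
  also have "dd z (\<lambda>Z. P Z + R Z) 0 = (?a P 0 + ?b P 0) + (?a R 0 + ?b R 0)"
    by (simp only: add[OF rP] sp[OF rP(1)] sp[OF rP(2)])
  also have "?a P 0 = q3 z" by (simp add: P_def hol_dd_hol_dd_hol_dd_q3)
  also have "?b R 0 = Y z" unfolding R_def Y_def by (rule anti_dd_anti_dd_hol_dd_expand)
  also have "?a R 0 = cnj (Y z)"
  proof -
    have "?a R 0 = ?a (\<lambda>Z. cnj (R Z)) 0"
      by (rule hol_dd_transform[OF near_A]) (use ab ab' in \<open>simp add: R_def\<close>)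
    then show ?thesis using conj_a(1)[OF rP(2)] \<open>?b R 0 = Y z\<close> by simp
  qed
  also have "?b P 0 = ?a R 0"
    unfolding P_def R_def using hol_dd_anti_dd_commute[OF ranalytic_hol_dd[OF ranalytic_\<Phi>_0], of z "vcnj z" z] by simp
  also have "?a R 0 = cnj (Y z)" by fact
  finally show "dd z (dd z (dd z \<Phi>)) 0 = of_real (2 * Re (q3 z) + 6 * Re (Y z))"
    by (simp add: complex_eq_iff)
qed

lemma taylor_at_0:
  obtains C d where "d > 0" "C \<ge> 0"
    "\<And>z. norm z < d \<Longrightarrow> \<bar>\<phi> z - (Re (q2 z) + Re (Herm z) + Re (q3 z) / 3 + Re (Y z))\<bar> \<le> C * norm z ^ 4"
proof -
  obtain C d where C: "d > 0" "C \<ge> 0" "\<And>x v. dist 0 x < d \<Longrightarrow> norm v < d \<Longrightarrow> v \<noteq> 0 \<Longrightarrow>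
      norm (\<Phi> (x + v) - (\<Sum>k<4. (dd v ^^ k) \<Phi> x / fact k)) \<le> C * norm v ^ 4"
    by (rule ranalytic_taylor[OF ranalytic_\<Phi>_0, where n=4]) (rule that)
  show ?thesis
  proof (rule that[OF C(1,2)])
    fix z :: "complex^3" assume z: "norm z < d"
    show "\<bar>\<phi> z - (Re (q2 z) + Re (Herm z) + Re (q3 z) / 3 + Re (Y z))\<bar> \<le> C * norm z ^ 4"
    proof (cases "z = 0")
      case True
      then show ?thesis by (simp add: \<phi>_0 q2_def q3_def Herm_def Y_def)
    next
      case False
      have "dd z \<Phi> 0 = 0"
        using dd_wirtinger[OF ranalytic_differentiable[OF ranalytic_\<Phi>_0], of z] by (simp add: d_hol_\<Phi>_0 d_bar_\<Phi>_0)
      moreover have "{..<4} = {0, 1, 2, 3 :: nat}" by auto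
      moreover have "(dd z ^^ 2) \<Phi> 0 = dd z (dd z \<Phi>) 0" "(dd z ^^ 3) \<Phi> 0 = dd z (dd z (dd z \<Phi>)) 0"
        by (simp_all add: numeral_2_eq_2 numeral_3_eq_3)
      ultimately have "(\<Sum>k<4. (dd z ^^ k) \<Phi> 0 / fact k)
          = (of_real (2 * Re (q2 z)) + 2 * Herm z) / 2 + of_real (2 * Re (q3 z) + 6 * Re (Y z)) / 6"
        by (simp add: \<phi>_0 second_third fact_numeral)
      then have "norm (\<Phi> z - ((of_real (2 * Re (q2 z)) + 2 * Herm z) / 2 + of_real (2 * Re (q3 z) + 6 * Re (Y z)) / 6)) \<le> C * norm z ^ 4"
        using C(3)[of 0 z] C(1) z False by simp
      from order_trans[OF abs_Re_le_cmod this]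
      have "\<bar>Re (\<Phi> z - ((of_real (2 * Re (q2 z)) + 2 * Herm z) / 2 + of_real (2 * Re (q3 z) + 6 * Re (Y z)) / 6))\<bar> \<le> C * norm z ^ 4" .
      moreover have "Re (\<Phi> z - ((of_real (2 * Re (q2 z)) + 2 * Herm z) / 2 + of_real (2 * Re (q3 z) + 6 * Re (Y z)) / 6))
          = \<phi> z - (Re (q2 z) + Re (Herm z) + Re (q3 z) / 3 + Re (Y z))"
        by (simp add: field_simps)
      ultimately show ?thesis by metis
    qed
  qed
qed

text \<open>The derivative of \<open>\<phi>\<close> in \<open>Re w\<close> vanishes on the axis
  together with its first derivatives in the \<open>z\<close>-directions, so it is O(|z|^2)
  uniformly in \<open>Re w\<close>. Moving from 0 to \<open>s\<close> contributes the factor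
  |s|.\<close>

lemma transversal_estimate:
  obtains C d where "d > 0" "C \<ge> 0"
    "\<And>z s. norm z < d \<Longrightarrow> \<bar>s\<bar> < d \<Longrightarrow> z $ 3 = 0 \<Longrightarrow> \<bar>\<phi> (axis 3 (of_real s) + z) - \<phi> z\<bar> \<le> C * \<bar>s\<bar> * norm z ^ 2"
proof -
  let ?e = "axis 3 1 :: complex^3"
  define \<Psi> where "\<Psi> = dd ?e \<Phi>"
  have ranalytic_\<Psi>: "ranalytic \<Psi> 0" unfolding \<Psi>_def by (intro ranalytic_dd ranalytic_\<Phi>_0)
  obtain C d where C: "d > 0" "C \<ge> 0" "\<And>x v. dist 0 x < d \<Longrightarrow> norm v < d \<Longrightarrow> v \<noteq> 0 \<Longrightarrow>
      norm (\<Psi> (x + v) - (\<Sum>k<2. (dd v ^^ k) \<Psi> x / fact k)) \<le> C * norm v ^ 2"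
    by (rule ranalytic_taylor[OF ranalytic_\<Psi>, where n=2]) (rule that)
  obtain d' where d': "d' > 0" "ball 0 d' \<subseteq> A" using open_A A0 open_contains_ball by blast
  define \<delta> where "\<delta> = min d d' / 2"
  have \<delta>: "\<delta> > 0" "\<delta> \<le> d" "2 * \<delta> \<le> d'" using C(1) d'(1) by (auto simp: \<delta>_def)
  have nax: "norm (axis 3 (of_real s) :: complex^3) = \<bar>s\<bar>" for s by (simp add: norm_vec_def L2_set_def sum_3 axis_def)
  have dd0: "dd v \<Phi> (axis 3 (of_real s)) = 0" if "axis 3 (of_real s) \<in> A" for v s
    using dd_wirtinger[OF ranalytic_differentiable[OF \<phi>_ranalytic[OF that]], of v] d_bar_real[OF that] d_hol_\<Phi>_axis[OF that] by simp
  show ?thesis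
  proof (rule that[OF \<delta>(1) C(2)])
    fix z :: "complex^3" and s :: real
    assume z: "norm z < \<delta>" "z $ 3 = 0" and s: "\<bar>s\<bar> < \<delta>"
    show "\<bar>\<phi> (axis 3 (of_real s) + z) - \<phi> z\<bar> \<le> C * \<bar>s\<bar> * norm z ^ 2"
    proof (cases "z = 0")
      case True
      have "axis 3 (of_real s) \<in> A" using s \<delta> d'(2) nax[of s] by (auto simp: dist_norm)
      then show ?thesis using True \<phi>_axis[of s] C(2) by (simp add: \<phi>_0)
    next
      case False
      have inA: "axis 3 (of_real t) \<in> A" "axis 3 (of_real t) + z \<in> A" if "\<bar>t\<bar> < \<delta>" for t
      proof -
        have "norm (axis 3 (of_real t) + z) \<le> \<bar>t\<bar> + norm z" using norm_triangle_ineq nax by metis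
        then have "norm (axis 3 (of_real t) + z) < d'" using that z \<delta> by linarith
        then show "axis 3 (of_real t) + z \<in> A" using d'(2) by (auto simp: dist_norm)
        show "axis 3 (of_real t) \<in> A" using that \<delta> d'(2) nax[of t] by (auto simp: dist_norm)
      qed
      have bound: "norm (\<Psi> (axis 3 (of_real t) + z)) \<le> C * norm z ^ 2" if t: "\<bar>t\<bar> < \<delta>" for t
      proof -
        have 0: "\<Psi> (axis 3 (of_real t)) = 0" unfolding \<Psi>_def by (rule dd0[OF inA(1)[OF t]])
        \<comment> \<open>\<open>dd z \<Phi>\<close> is zero on the whole axis, hence so is its
          derivative along the axis; exchanging the derivatives gives the claim for
          \<open>\<Psi>\<close>.\<close>
        have "dd ?e (dd z \<Phi>) (axis 3 (of_real t)) = 0"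
          by (rule axis_curve) (auto intro!: ranalytic_differentiable ranalytic_dd \<phi>_ranalytic inA t dd0)
        then have 1: "dd z \<Psi> (axis 3 (of_real t)) = 0"
          unfolding \<Psi>_def using ranalytic_dd_commute[OF \<phi>_ranalytic[OF inA(1)[OF t]]] by metis
        have "{..<2} = {0, 1 :: nat}" by auto
        then show ?thesis
          using C(3)[of "axis 3 (of_real t)" z] t z \<delta> False 0 1 nax[of t] by simp
      qed
      have ax: "axis 3 (of_real t) = t *\<^sub>R ?e" for t
        by (simp add: vec_eq_iff axis_def scaleR_conv_of_real[where 'a=complex])
      have der: "((\<lambda>t. \<phi> (axis 3 (of_real t) + z)) has_field_derivative Re (\<Psi> (axis 3 (of_real t) + z))) (at t within {-\<delta><..<\<delta>})"
        if t: "t \<in> {-\<delta><..<\<delta>}" for t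
      proof -
        have "\<bar>t\<bar> < \<delta>" using t by auto
        note A = inA(2)[OF this]
        have 1: "((\<lambda>t. axis 3 (of_real t) + z) has_derivative (\<lambda>h. h *\<^sub>R ?e)) (at t)"
          unfolding ax by (auto intro!: derivative_eq_intros)
        have "((\<lambda>t. \<Phi> (axis 3 (of_real t) + z)) has_derivative (\<lambda>h. dd (h *\<^sub>R ?e) \<Phi> (axis 3 (of_real t) + z))) (at t)"
          by (rule has_derivative_compose[OF 1 ranalytic_has_derivative[OF \<phi>_ranalytic[OF A]]])
        then have "((\<lambda>t. \<Phi> (axis 3 (of_real t) + z)) has_derivative (\<lambda>h. of_real h * \<Psi> (axis 3 (of_real t) + z))) (at t)"
          unfolding \<Psi>_def by (simp only: dd_linear(2)[OF ranalytic_differentiable[OF \<phi>_ranalytic[OF A]]])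
        then have "((\<lambda>t. \<phi> (axis 3 (of_real t) + z)) has_derivative (\<lambda>h. Re (of_real h * \<Psi> (axis 3 (of_real t) + z)))) (at t)"
          by (rule has_derivative_of_real_iff(1))
        then show ?thesis
          by (intro has_derivative_imp_has_field_derivative[OF has_derivative_at_withinI]) auto
      qed
      have "norm (\<phi> (axis 3 (of_real s) + z) - \<phi> (axis 3 (of_real 0) + z)) \<le> C * norm z ^ 2 * norm (s - 0)"
      proof (rule field_differentiable_bound[where f="\<lambda>t. \<phi> (axis 3 (of_real t) + z)" and S="{-\<delta><..<\<delta>}"
            and f'="\<lambda>t. Re (\<Psi> (axis 3 (of_real t) + z))" and B="C * norm z ^ 2", OF _ der])
        show "norm (Re (\<Psi> (axis 3 (of_real t) + z))) \<le> C * norm z ^ 2" if "t \<in> {-\<delta><..<\<delta>}" for t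
        proof -
          have "\<bar>t\<bar> < \<delta>" using that by auto
          from bound[OF this] abs_Re_le_cmod[of "\<Psi> (axis 3 (of_real t) + z)"]
          show ?thesis unfolding real_norm_def by (rule order_trans[rotated])
        qed
      qed (use s \<delta> in auto)
      then show ?thesis by (simp add: axis_zero mult_ac)
    qed
  qed
qed

end

section \<open>The normal form\<close>

text \<open>A Landau bound on the fixed unit ball. It will be applied to polynomials in
  \<open>x\<close>, \<open>y\<close> and their conjugates, for which one ball serves all bounds;
  orders add under products and may be lowered.\<close>

definition vanish :: "nat \<Rightarrow> (complex \<Rightarrow> complex \<Rightarrow> complex) \<Rightarrow> bool" where
  "vanish k f \<longleftrightarrow> (\<exists>C\<ge>0. \<forall>x y. norm (x, y) \<le> 1 \<longrightarrow> norm (f x y) \<le> C * norm (x, y) ^ k)"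

lemma vanishI: "C \<ge> 0 \<Longrightarrow> (\<And>x y. norm (x, y) \<le> 1 \<Longrightarrow> norm (f x y) \<le> C * norm (x, y) ^ k) \<Longrightarrow> vanish k f"
  unfolding vanish_def by blast

lemma vanishE:
  assumes "vanish k f"
  obtains C where "C \<ge> 0" "\<And>x y. norm (x, y) \<le> 1 \<Longrightarrow> norm (f x y) \<le> C * norm (x, y) ^ k"
  using assms unfolding vanish_def by blast

lemma vanish_const: "vanish 0 (\<lambda>_ _. c)"
  by (rule vanishI[of "norm c"]) auto

lemma vanish_zero: "vanish k (\<lambda>_ _. 0)"
  by (rule vanishI[of 0]) auto

lemma vanish_fst: "vanish 1 (\<lambda>x y. x)"
proof (rule vanishI[of 1])
  show "norm x \<le> 1 * norm (x, y) ^ 1" for x y :: complex using norm_fst_le[of x y] by simp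
qed simp

lemma vanish_snd: "vanish 1 (\<lambda>x y. y)"
proof (rule vanishI[of 1])
  show "norm y \<le> 1 * norm (x, y) ^ 1" for x y :: complex using norm_snd_le[of y x] by simp
qed simp

lemma vanish_cnj: "vanish k f \<Longrightarrow> vanish k (\<lambda>x y. cnj (f x y))"
  unfolding vanish_def by simp

lemma vanish_add:
  assumes "vanish k f" "vanish k g" shows "vanish k (\<lambda>x y. f x y + g x y)"
proof -
  obtain C where C: "C \<ge> 0" "\<And>x y. norm (x, y) \<le> 1 \<Longrightarrow> norm (f x y) \<le> C * norm (x, y) ^ k"
    by (rule vanishE[OF assms(1)]) (rule that)
  obtain D where D: "D \<ge> 0" "\<And>x y. norm (x, y) \<le> 1 \<Longrightarrow> norm (g x y) \<le> D * norm (x, y) ^ k"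
    by (rule vanishE[OF assms(2)]) (rule that)
  show ?thesis
  proof (rule vanishI[of "C + D"])
    fix x y :: complex assume "norm (x, y) \<le> 1"
    from norm_triangle_le[OF add_mono[OF C(2)[OF this] D(2)[OF this]]]
    show "norm (f x y + g x y) \<le> (C + D) * norm (x, y) ^ k" by (simp add: algebra_simps)
  qed (use C D in simp)
qed

lemma vanish_mult:
  assumes "vanish j f" "vanish k g" shows "vanish (j + k) (\<lambda>x y. f x y * g x y)"
proof -
  obtain C where C: "C \<ge> 0" "\<And>x y. norm (x, y) \<le> 1 \<Longrightarrow> norm (f x y) \<le> C * norm (x, y) ^ j"
    by (rule vanishE[OF assms(1)]) (rule that)
  obtain D where D: "D \<ge> 0" "\<And>x y. norm (x, y) \<le> 1 \<Longrightarrow> norm (g x y) \<le> D * norm (x, y) ^ k"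
    by (rule vanishE[OF assms(2)]) (rule that)
  show ?thesis
  proof (rule vanishI[of "C * D"])
    fix x y :: complex assume "norm (x, y) \<le> 1"
    from mult_mono[OF C(2)[OF this] D(2)[OF this]] C(1)
    show "norm (f x y * g x y) \<le> C * D * norm (x, y) ^ (j + k)" by (simp add: norm_mult power_add mult_ac)
  qed (use C D in simp)
qed

lemma vanish_cmult: "vanish k f \<Longrightarrow> vanish k (\<lambda>x y. c * f x y)"
  using vanish_mult[OF vanish_const] by simp

lemma vanish_sum: "(\<And>i. i \<in> I \<Longrightarrow> vanish k (f i)) \<Longrightarrow> vanish k (\<lambda>x y. \<Sum>i\<in>I. f i x y)"
  by (induction I rule: infinite_finite_induct) (auto intro: vanish_zero vanish_add)

lemma vanish_mono:
  assumes "vanish k f" "j \<le> k" shows "vanish j f"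
proof -
  obtain C where C: "C \<ge> 0" "\<And>x y. norm (x, y) \<le> 1 \<Longrightarrow> norm (f x y) \<le> C * norm (x, y) ^ k"
    by (rule vanishE[OF assms(1)]) (rule that)
  show ?thesis
  proof (rule vanishI[OF C(1)])
    fix x y :: complex assume 1: "norm (x, y) \<le> 1"
    have "C * norm (x, y) ^ k \<le> C * norm (x, y) ^ j"
      by (rule mult_left_mono[OF power_decreasing[OF assms(2) _ 1] C(1)]) simp
    with C(2)[OF 1] show "norm (f x y) \<le> C * norm (x, y) ^ j" by linarith
  qed
qed

lemma norm_pair_le:
  fixes Z :: "complex^3" shows "norm (Z $ 1, Z $ 2) \<le> norm Z"
  by (simp add: norm_Pair norm_vec_def L2_set_def sum_3 real_sqrt_le_mono)

lemma vanish_has_derivative: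
  assumes "vanish 2 f"
  shows "((\<lambda>Z::complex^3. f (Z $ 1) (Z $ 2)) has_derivative (\<lambda>_. 0)) (at 0)"
proof -
  obtain C where C: "C \<ge> 0" "\<And>x y. norm (x, y) \<le> 1 \<Longrightarrow> norm (f x y) \<le> C * norm (x, y) ^ 2"
    by (rule vanishE[OF assms]) (rule that)
  have f0: "f 0 0 = 0" using C(2)[of 0 0] by simp
  have lim: "((\<lambda>Z::complex^3. C * norm Z) \<longlongrightarrow> 0) (at 0)"
    by (rule tendsto_eq_intros refl | simp)+
  have "((\<lambda>Z::complex^3. norm (f (Z $ 1) (Z $ 2)) / norm Z) \<longlongrightarrow> 0) (at 0)"
  proof (rule Lim_null_comparison[OF _ lim])
    have "eventually (\<lambda>Z::complex^3. Z \<in> ball 0 1 \<and> Z \<noteq> 0) (at 0)"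
      using eventually_at_in_open'[OF open_ball, of 0 0 1] eventually_neq_at_within[of 0 0 UNIV]
      by (auto elim: eventually_elim2)
    then show "eventually (\<lambda>Z::complex^3. norm (norm (f (Z $ 1) (Z $ 2)) / norm Z) \<le> C * norm Z) (at 0)"
    proof (rule eventually_mono)
      fix Z :: "complex^3" assume "Z \<in> ball 0 1 \<and> Z \<noteq> 0"
      then have Z: "norm Z \<le> 1" "norm Z > 0" by auto
      have "norm (f (Z $ 1) (Z $ 2)) \<le> C * norm (Z $ 1, Z $ 2) ^ 2"
        by (rule C(2)) (use norm_pair_le[of Z] Z in linarith)
      also have "\<dots> \<le> C * norm Z ^ 2" by (intro mult_left_mono power_mono norm_pair_le C) simp
      finally show "norm (norm (f (Z $ 1) (Z $ 2)) / norm Z) \<le> C * norm Z"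
        using Z by (simp add: divide_le_eq power2_eq_square mult_ac)
    qed
  qed
  then show ?thesis unfolding has_derivative_at by (simp add: f0)
qed

text \<open>Primed letters stand for conjugates, treated as independent so that the identity is
  polynomial. With \<open>X = - e * k / 2\<close> the cross terms of \<open>z * z'\<close> cancel
  the cubic terms in \<open>x * k'\<close> and \<open>x' * k\<close>; what is left are differences
  between values at \<open>z\<close> and at \<open>x\<close>, and \<open>X * X'\<close>.\<close>

lemma shift_identity:
  fixes e X X' k k' x x' y y' l l' :: complex
  assumes e: "e * e = 1" and X: "2 * X = - e * k" "2 * X' = - e * k'"
  defines "z \<equiv> x + X" and "z' \<equiv> x' + X'"
  shows "e * ((e * (z * z') + e * (z' * z)) / 2
      + ((z * l' + 2 * e * (y * (z' * z'))) + (z' * l + 2 * e * (y' * (z * z)))) / 2) - x * x' - (x * x * y' + x' * x' * y)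
    = X * X' + (e / 2) * ((z * l' - x * k') + (z' * l - x' * k))
      + ((y * (z' * z') - y * (x' * x')) + (y' * (z * z) - y' * (x * x)))"
proof -
  have "e = 1 \<or> e = -1" using e by (simp add: square_eq_1_iff)
  then show ?thesis
  proof
    assume 1: "e = 1"
    then have "k = - 2 * X" "k' = - 2 * X'" using X by (simp_all add: algebra_simps)
    then show ?thesis unfolding 1 z_def z'_def by (simp add: field_simps)
  next
    assume 1: "e = -1"
    then have "k = 2 * X" "k' = 2 * X'" using X by simp_all
    then show ?thesis unfolding 1 z_def z'_def by (simp add: field_simps)
  qed
qed

lemma frechet_derivative_nonzero_iff:
  fixes f :: "complex^'n \<Rightarrow> real"
  assumes f: "ranalytic (\<lambda>Z. complex_of_real (f Z)) Z"
  shows "frechet_derivative f (at Z) \<noteq> (\<lambda>_. 0) \<longleftrightarrow> (\<exists>l. d_hol l (\<lambda>Z. complex_of_real (f Z)) Z \<noteq> 0)"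
proof -
  note d = has_derivative_of_real_iff[OF ranalytic_has_derivative[OF f]]
  have fd: "frechet_derivative f (at Z) = (\<lambda>v. Re (dd v (\<lambda>Z. complex_of_real (f Z)) Z))"
    using frechet_derivative_at[OF d(1)] by simp
  have "\<exists>l. d_hol l (\<lambda>Z. complex_of_real (f Z)) Z \<noteq> 0" if "frechet_derivative f (at Z) \<noteq> (\<lambda>_. 0)"
  proof (rule ccontr)
    assume "\<not> ?thesis"
    then have "Re (dd v (\<lambda>Z. complex_of_real (f Z)) Z) = 0" for v
      by (simp add: ranalytic_real_part_dd[OF ranalytic_differentiable[OF f]] hol_dd_def)
    then show False using that by (simp add: fd)
  qed
  moreover have "d_hol l (\<lambda>Z. complex_of_real (f Z)) Z = 0" if "frechet_derivative f (at Z) = (\<lambda>_. 0)" for l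
  proof -
    have "Re (dd v (\<lambda>Z. complex_of_real (f Z)) Z) = 0" for v using that by (metis fd)
    then have "dd v (\<lambda>Z. complex_of_real (f Z)) Z = 0" for v using d(2)[of v] by simp
    then show ?thesis by (simp add: d_hol_dd)
  qed
  ultimately show ?thesis by blast
qed

section \<open>The final change of coordinates\<close>

locale normalized = adapted +
  fixes \<epsilon> :: real and v1 v2 u1 u2 :: complex
  assumes \<epsilon>: "\<epsilon> = 1 \<or> \<epsilon> = -1" and indep: "v1 * u2 - v2 * u1 \<noteq> 0"
    and null: "u1 * Q 1 1 + u2 * Q 2 1 = 0" "u1 * Q 1 2 + u2 * Q 2 2 = 0"
    and unit: "v1 * cnj v1 * Q 1 1 + v1 * cnj v2 * Q 1 2 + v2 * cnj v1 * Q 2 1 + v2 * cnj v2 * Q 2 2 = of_real \<epsilon>"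
    and flat: "u1 * cnj u1 * c3 1 1 1 + u1 * cnj u2 * c3 1 1 2 + u2 * cnj u1 * c3 2 1 1 + u2 * cnj u2 * c3 2 1 2 = 0"
      "u1 * cnj u1 * c3 1 1 2 + u1 * cnj u2 * c3 1 2 2 + u2 * cnj u1 * c3 2 1 2 + u2 * cnj u2 * c3 2 2 2 = 0"
    and cubic: "(u1 * c3 1 1 1 + u2 * c3 2 1 1) * (cnj v1)\<^sup>2 + 2 * (u1 * c3 1 1 2 + u2 * c3 2 1 2) * cnj v1 * cnj v2
      + (u1 * c3 1 2 2 + u2 * c3 2 2 2) * (cnj v2)\<^sup>2 = 2 * of_real \<epsilon>"
begin

text \<open>The trilinear form with coefficients \<open>c3\<close> on the \<open>z\<close>-plane,
  with the symmetry of the last two indices built in. The last two vectors are to be passed already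
  conjugated.\<close>

definition T :: "complex \<Rightarrow> complex \<Rightarrow> complex \<Rightarrow> complex \<Rightarrow> complex \<Rightarrow> complex \<Rightarrow> complex" where
  "T a1 a2 b1 b2 d1 d2 = a1 * (b1 * d1 * c3 1 1 1 + (b1 * d2 + b2 * d1) * c3 1 1 2 + b2 * d2 * c3 1 2 2)
     + a2 * (b1 * d1 * c3 2 1 1 + (b1 * d2 + b2 * d1) * c3 2 1 2 + b2 * d2 * c3 2 2 2)"

definition "\<kappa>1 = T v1 v2 (cnj v1) (cnj v2) (cnj v1) (cnj v2)"
definition "\<kappa>2 = T v1 v2 (cnj v1) (cnj v2) (cnj u1) (cnj u2)"
definition "\<kappa>3 = T v1 v2 (cnj u1) (cnj u2) (cnj u1) (cnj u2)"

text \<open>Arranged so that \<open>z * cnj (K z y)\<close> collects the terms of the cubic form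
  whose (1,0) argument lies along \<open>v\<close>.\<close>

definition K :: "complex \<Rightarrow> complex \<Rightarrow> complex" where
  "K x y = cnj \<kappa>1 * (x * x) + 2 * cnj \<kappa>2 * (x * y) + cnj \<kappa>3 * (y * y)"

text \<open>The shift \<open>m\<close> removes the cubic terms \<open>Re (x * cnj (K x y))\<close>.\<close>
definition m :: "complex \<Rightarrow> complex \<Rightarrow> complex" where "m x y = - (of_real \<epsilon> / 2) * K x y"
definition \<zeta> :: "complex \<Rightarrow> complex \<Rightarrow> complex" where "\<zeta> x y = x + m x y"
definition Bv :: "complex \<Rightarrow> complex \<Rightarrow> complex^3" where
  "Bv x y = vector [\<zeta> x y * v1 + y * u1, \<zeta> x y * v2 + y * u2, 0]"
text \<open>As Im (i q) = Re q, subtracting \<open>Im P\<close> removes exactly the pure terms of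
  order two and three of the Taylor polynomial at \<open>Bv x y\<close>.\<close>

definition P :: "complex \<Rightarrow> complex \<Rightarrow> complex" where
  "P x y = \<i> * (q2 (Bv x y) + q3 (Bv x y) / 3)"
definition G2 :: "complex^3 \<Rightarrow> complex^3" where
  "G2 Z = Bv (Z $ 1) (Z $ 2) + axis 3 (of_real \<epsilon> * Z $ 3 + P (Z $ 1) (Z $ 2))"
text \<open>The graph equation in the coordinates \<open>G2\<close> solved for \<open>Im w\<close>:
  its left side is \<epsilon> Im w + Im P, and \<epsilon> is its own inverse.\<close>

definition \<phi>2 :: "complex^3 \<Rightarrow> real" where
  "\<phi>2 Z = \<epsilon> * (\<phi> (G2 Z) - Im (P (Z $ 1) (Z $ 2)))"

lemma \<epsilon>2: "\<epsilon> * \<epsilon> = 1" "complex_of_real \<epsilon> * complex_of_real \<epsilon> = 1" "\<bar>\<epsilon>\<bar> = 1"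
  using \<epsilon> by auto

lemma Bv_nth: "Bv x y $ 1 = \<zeta> x y * v1 + y * u1" "Bv x y $ 2 = \<zeta> x y * v2 + y * u2" "Bv x y $ 3 = 0"
  by (simp_all add: Bv_def)

lemma G2_nth: "G2 Z $ 1 = Bv (Z $ 1) (Z $ 2) $ 1" "G2 Z $ 2 = Bv (Z $ 1) (Z $ 2) $ 2"
  "G2 Z $ 3 = of_real \<epsilon> * Z $ 3 + P (Z $ 1) (Z $ 2)"
  by (simp_all add: G2_def axis_def Bv_nth)

lemma Herm_Bv: "Herm (Bv x y) = of_real \<epsilon> * (\<zeta> x y * cnj (\<zeta> x y))"
proof -
  define z where "z = \<zeta> x y"
  have n: "cnj u1 * Q 1 1 + cnj u2 * Q 1 2 = 0" "cnj u1 * Q 2 1 + cnj u2 * Q 2 2 = 0"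
  proof -
    have "cnj (u1 * Q 1 1 + u2 * Q 2 1) = 0" "cnj (u1 * Q 1 2 + u2 * Q 2 2) = 0" by (simp_all add: null)
    then show "cnj u1 * Q 1 1 + cnj u2 * Q 1 2 = 0" "cnj u1 * Q 2 1 + cnj u2 * Q 2 2 = 0"
      by (simp_all add: Q_herm[symmetric])
  qed
  have "Herm (Bv x y) = z * cnj z * (v1 * cnj v1 * Q 1 1 + v1 * cnj v2 * Q 1 2 + v2 * cnj v1 * Q 2 1 + v2 * cnj v2 * Q 2 2)
      + y * cnj z * (cnj v1 * (u1 * Q 1 1 + u2 * Q 2 1) + cnj v2 * (u1 * Q 1 2 + u2 * Q 2 2))
      + z * cnj y * (v1 * (cnj u1 * Q 1 1 + cnj u2 * Q 1 2) + v2 * (cnj u1 * Q 2 1 + cnj u2 * Q 2 2))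
      + y * cnj y * (cnj u1 * (u1 * Q 1 1 + u2 * Q 2 1) + cnj u2 * (u1 * Q 1 2 + u2 * Q 2 2))"
    by (simp add: Herm_def sum_3 Bv_nth z_def[symmetric] algebra_simps)
  then show ?thesis unfolding n null unit by (simp add: z_def mult_ac)
qed

text \<open>Expanded in the basis \<open>v\<close>, \<open>u\<close>, the terms containing
  \<open>y * cnj y\<close> vanish by \<open>flat\<close> and the coefficient of
  \<open>y * (cnj z)\<^sup>2\<close> is given by \<open>cubic\<close>. All other terms contain the
  unconjugated \<open>z\<close>, and \<open>K\<close> collects them.\<close>

lemma Y_Bv: "Y (Bv x y) = \<zeta> x y * cnj (K (\<zeta> x y) y) + 2 * of_real \<epsilon> * (y * (cnj (\<zeta> x y) * cnj (\<zeta> x y)))"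
proof -
  define z where "z = \<zeta> x y"
  let ?F1 = "u1 * cnj u1 * c3 1 1 1 + u1 * cnj u2 * c3 1 1 2 + u2 * cnj u1 * c3 2 1 1 + u2 * cnj u2 * c3 2 1 2"
  let ?F2 = "u1 * cnj u1 * c3 1 1 2 + u1 * cnj u2 * c3 1 2 2 + u2 * cnj u1 * c3 2 1 2 + u2 * cnj u2 * c3 2 2 2"
  have sym: "c3 l 2 1 = c3 l 1 2" for l by (rule c3_sym)
  have "Y (Bv x y) = T (Bv x y $ 1) (Bv x y $ 2) (cnj (Bv x y $ 1)) (cnj (Bv x y $ 2)) (cnj (Bv x y $ 1)) (cnj (Bv x y $ 2))"
    by (simp add: Y_def T_def sum_3 sym Bv_nth(3) algebra_simps)
  also have "\<dots> = z * (\<kappa>1 * (cnj z * cnj z) + 2 * \<kappa>2 * (cnj z * cnj y) + \<kappa>3 * (cnj y * cnj y))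
     + y * (cnj z * cnj z) * ((u1 * c3 1 1 1 + u2 * c3 2 1 1) * (cnj v1)\<^sup>2
         + 2 * (u1 * c3 1 1 2 + u2 * c3 2 1 2) * cnj v1 * cnj v2 + (u1 * c3 1 2 2 + u2 * c3 2 2 2) * (cnj v2)\<^sup>2)
     + 2 * y * cnj z * cnj y * (cnj v1 * ?F1 + cnj v2 * ?F2) + y * cnj y * cnj y * (cnj u1 * ?F1 + cnj u2 * ?F2)"
    by (simp add: T_def \<kappa>1_def \<kappa>2_def \<kappa>3_def Bv_nth z_def[symmetric] algebra_simps power2_eq_square)
  also have "\<dots> = z * cnj (K z y) + 2 * of_real \<epsilon> * (y * (cnj z * cnj z))"
    unfolding flat cubic by (simp add: K_def mult_ac)
  finally show ?thesis by (simp add: z_def)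
qed

lemma vanish_K: "vanish 2 K"
proof -
  have "vanish (1 + 1) (\<lambda>x y. x * x)" "vanish (1 + 1) (\<lambda>x y. x * y)" "vanish (1 + 1) (\<lambda>x y. y * y)"
    by (intro vanish_mult vanish_fst vanish_snd)+
  then have "vanish 2 (\<lambda>x y. K x y)" unfolding K_def one_add_one
    by (intro vanish_add vanish_cmult)
  then show ?thesis by simp
qed

lemma vanish_m: "vanish 2 m"
proof -
  have "vanish 2 (\<lambda>x y. m x y)" unfolding m_def by (intro vanish_cmult vanish_K)
  then show ?thesis by simp
qed

lemma vanish_\<zeta>: "vanish 1 \<zeta>"
proof -
  have "vanish 1 (\<lambda>x y. \<zeta> x y)" unfolding \<zeta>_def
    by (intro vanish_add vanish_fst vanish_mono[OF vanish_m]) simp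
  then show ?thesis by simp
qed

lemma vanish_Bv: "vanish 1 (\<lambda>x y. Bv x y $ k)"
proof -
  have 1: "vanish (1 + 0) (\<lambda>x y. \<zeta> x y * c + y * d)" for c d
    by (intro vanish_add vanish_mult vanish_const vanish_snd) (rule vanish_\<zeta>)
  consider "k = 1" | "k = 2" | "k = 3" using exhaust_3 by blast
  then show ?thesis
    by cases (use 1 in \<open>simp_all add: Bv_nth vanish_zero\<close>)
qed

lemma vanish_P: "vanish 2 P"
proof -
  have "vanish (1 + (1 + 0)) (\<lambda>x y. q2 (Bv x y))" unfolding q2_def
    by (intro vanish_sum vanish_mult vanish_Bv vanish_const)
  moreover have "vanish (1 + (1 + (1 + 0))) (\<lambda>x y. q3 (Bv x y))" unfolding q3_def
    by (intro vanish_sum vanish_mult vanish_Bv vanish_const)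
  then have "vanish 2 (\<lambda>x y. q3 (Bv x y))" by (rule vanish_mono) simp
  ultimately have "vanish 2 (\<lambda>x y. \<i> * (q2 (Bv x y) + 1 / 3 * q3 (Bv x y)))"
    by (intro vanish_cmult vanish_add) (simp_all add: numeral_2_eq_2)
  then show ?thesis by (simp add: P_def[abs_def])
qed

lemma vanish_imp_0: "vanish (Suc k) f \<Longrightarrow> f 0 0 = 0"
  by (erule vanishE) (metis mult_zero_right norm_le_zero_iff norm_zero power_0_Suc zero_le_one zero_prod_def)

text \<open>The quadratic and cubic terms cancel through \<open>shift_identity\<close>. Replacing
  \<open>x\<close> by \<open>\<zeta> x y\<close>, which differs from it by order two, changes a
  cubic term only at order four.\<close>

lemma quartic: "vanish 4 (\<lambda>x y. of_real (\<epsilon> * (Re (Herm (Bv x y)) + Re (Y (Bv x y))) - (cmod x)\<^sup>2 - 2 * Re (x\<^sup>2 * cnj y)))"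
proof -
  \<comment> \<open>The difference of \<open>z * cnj (K z y)\<close> at
    \<open>z = \<zeta> x y\<close> and at \<open>z = x\<close>, written with a factor
    \<open>m\<close> in every term so that the order four is visible. \<open>\<Theta>\<close> below
    treats \<open>y * (cnj z)\<^sup>2\<close> in the same way.\<close>
  define \<Delta> where "\<Delta> x y = \<kappa>1 * (m x y * cnj (\<zeta> x y) * cnj (\<zeta> x y) + x * cnj (m x y) * (cnj (\<zeta> x y) + cnj x))
     + (2 * \<kappa>2) * (cnj y * (m x y * cnj (\<zeta> x y) + x * cnj (m x y))) + \<kappa>3 * (cnj y * cnj y * m x y)" for x y
  define \<Theta> where "\<Theta> x y = y * cnj (m x y) * (cnj (\<zeta> x y) + cnj x)" for x y
  note v = vanish_fst vanish_snd vanish_m vanish_\<zeta> vanish_cnj[OF vanish_fst] vanish_cnj[OF vanish_snd] vanish_cnj[OF vanish_m] vanish_cnj[OF vanish_\<zeta>]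
  have 1: "vanish (2 + 1 + 1) (\<lambda>x y. m x y * cnj (\<zeta> x y) * cnj (\<zeta> x y))" by (intro vanish_mult v)
  have 2: "vanish (1 + 2 + 1) (\<lambda>x y. x * cnj (m x y) * (cnj (\<zeta> x y) + cnj x))" by (intro vanish_mult vanish_add v)
  have 3: "vanish (2 + 1) (\<lambda>x y. m x y * cnj (\<zeta> x y))" by (intro vanish_mult v)
  have 4: "vanish (1 + 2) (\<lambda>x y. x * cnj (m x y))" by (intro vanish_mult v)
  have 5: "vanish 3 (\<lambda>x y. m x y * cnj (\<zeta> x y) + x * cnj (m x y))" using 3 4 by (intro vanish_add) (simp_all add: eval_nat_numeral)
  have 6: "vanish (1 + 3) (\<lambda>x y. cnj y * (m x y * cnj (\<zeta> x y) + x * cnj (m x y)))" by (rule vanish_mult[OF v(6) 5])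
  have 7: "vanish (1 + 1 + 2) (\<lambda>x y. cnj y * cnj y * m x y)" by (intro vanish_mult v)
  have \<Delta>: "vanish 4 \<Delta>"
  proof -
    have "vanish 4 (\<lambda>x y. \<Delta> x y)" unfolding \<Delta>_def
      by (intro vanish_add vanish_cmult) (use 1 2 6 7 in \<open>simp_all add: eval_nat_numeral\<close>)
    then show ?thesis by simp
  qed
  have \<Theta>: "vanish 4 \<Theta>"
  proof -
    have "vanish (1 + 2 + 1) (\<lambda>x y. \<Theta> x y)" unfolding \<Theta>_def by (intro vanish_mult vanish_add v)
    then show ?thesis by (simp add: eval_nat_numeral)
  qed
  have mm: "vanish 4 (\<lambda>x y. m x y * cnj (m x y))" using vanish_mult[OF v(3) v(7)] by simp
  have eq: "complex_of_real (\<epsilon> * (Re (Herm (Bv x y)) + Re (Y (Bv x y))) - (cmod x)\<^sup>2 - 2 * Re (x\<^sup>2 * cnj y))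
      = m x y * cnj (m x y) + (of_real \<epsilon> / 2) * (\<Delta> x y + cnj (\<Delta> x y)) + (\<Theta> x y + cnj (\<Theta> x y))" for x y
  proof -
    define e where "e = complex_of_real \<epsilon>"
    have e: "e * e = 1" "cnj e = e" using \<epsilon>2 by (simp_all add: e_def)
    define z where "z = \<zeta> x y"
    have z: "z = x + m x y" by (simp add: z_def \<zeta>_def)
    have half: "complex_of_real (Re w) = (w + cnj w) / 2" for w by (simp add: complex_add_cnj)
    have \<Delta>_eq: "\<Delta> x y = z * cnj (K z y) - x * cnj (K x y)"
      unfolding \<Delta>_def z_def[symmetric] K_def z by (simp add: algebra_simps)
    have \<Theta>_eq: "\<Theta> x y = y * (cnj z * cnj z) - y * (cnj x * cnj x)"
      unfolding \<Theta>_def z_def[symmetric] z by (simp add: algebra_simps)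
    have m2: "2 * m x y = - e * K x y" by (simp add: m_def e_def)
    have "cnj (2 * m x y) = cnj (- e * K x y)" by (simp only: m2)
    then have m2': "2 * cnj (m x y) = - e * cnj (K x y)" by (simp add: e(2))
    have "complex_of_real (\<epsilon> * (Re (Herm (Bv x y)) + Re (Y (Bv x y))) - (cmod x)\<^sup>2 - 2 * Re (x\<^sup>2 * cnj y))
        = e * ((e * (z * cnj z) + cnj (e * (z * cnj z))) / 2
            + ((z * cnj (K z y) + 2 * e * (y * (cnj z * cnj z))) + cnj (z * cnj (K z y) + 2 * e * (y * (cnj z * cnj z)))) / 2)
          - x * cnj x - (x\<^sup>2 * cnj y + cnj (x\<^sup>2 * cnj y))"
      by (simp only: of_real_diff of_real_mult of_real_add half Herm_Bv Y_Bv e_def[symmetric] z_def[symmetric]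
          complex_norm_square of_real_numeral nonzero_mult_div_cancel_left) (simp add: add_divide_distrib algebra_simps)
    also have "\<dots> = m x y * cnj (m x y) + (e / 2) * (\<Delta> x y + cnj (\<Delta> x y)) + (\<Theta> x y + cnj (\<Theta> x y))"
      unfolding \<Delta>_eq \<Theta>_eq using shift_identity[OF e(1) m2 m2', where x=x and x'="cnj x" and l="K z y" and l'="cnj (K z y)" and y=y and y'="cnj y"]
      by (simp add: e(2) power2_eq_square z)
    finally show ?thesis by (simp add: e_def)
  qed
  show ?thesis unfolding eq
    by (intro vanish_add vanish_cmult mm \<Delta> \<Theta> vanish_cnj[OF \<Delta>] vanish_cnj[OF \<Theta>])
qed

lemma jhol_Bv: "jhol vi (\<lambda>Z::complex^3. Bv (Z $ 1) (Z $ 2) $ k) UNIV"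
proof -
  have 1: "jhol vi (\<lambda>Z::complex^3. \<zeta> (Z $ 1) (Z $ 2) * c + Z $ 2 * d) UNIV" for c d
    unfolding \<zeta>_def m_def K_def by (intro jhol_add jhol_mult jhol_const jhol_coord_id)
  consider "k = 1" | "k = 2" | "k = 3" using exhaust_3 by blast
  then show ?thesis
    by cases (use 1 in \<open>simp_all add: Bv_nth jhol_const\<close>)
qed

lemma jhol_P: "jhol vi (\<lambda>Z::complex^3. P (Z $ 1) (Z $ 2)) UNIV"
proof -
  have "jhol vi (\<lambda>Z::complex^3. \<i> * (q2 (Bv (Z $ 1) (Z $ 2)) + q3 (Bv (Z $ 1) (Z $ 2)) * (1/3))) UNIV"
    unfolding q2_def q3_def sum_3 by (intro jhol_add jhol_mult jhol_const jhol_Bv)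
  then show ?thesis by (simp add: P_def)
qed

lemma holomorphic_G2: "holomorphic_map_on G2 UNIV"
  unfolding holomorphic_map_on_iff_jhol
proof
  fix l :: 3
  have 3: "jhol vi (\<lambda>Z::complex^3. of_real \<epsilon> * Z $ 3 + P (Z $ 1) (Z $ 2)) UNIV"
    by (intro jhol_add jhol_mult jhol_const jhol_coord_id jhol_P)
  consider "l = 1" | "l = 2" | "l = 3" using exhaust_3 by blast
  then show "jhol vi (\<lambda>Z. G2 Z $ l) UNIV"
    by cases (use 3 jhol_Bv in \<open>simp_all add: G2_nth\<close>)
qed

lemma G2_0: "G2 0 = 0"
proof -
  have "m 0 0 = 0" "P 0 0 = 0" using vanish_m vanish_P vanish_imp_0[of 1] by (simp_all add: numeral_2_eq_2)
  then show ?thesis by (simp add: vec_eq_iff forall_3 G2_nth Bv_nth \<zeta>_def)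
qed

text \<open>The shift \<open>m\<close> and the term \<open>P\<close> are of order two and disappear
  from the derivative at 0. What remains is the basis change to \<open>v\<close>, \<open>u\<close>,
  invertible by \<open>indep\<close>, and the factor \<epsilon> in \<open>w\<close>.\<close>

lemma hD_G2_injective: assumes "hD G2 0 V = 0" shows "V = 0"
proof -
  have nth: "((\<lambda>Z::complex^3. Z $ k) has_derivative (\<lambda>V. V $ k)) (at 0)" for k
    by (rule bounded_linear_imp_has_derivative[OF bounded_linear_vec_nth])
  have \<zeta>: "((\<lambda>Z::complex^3. \<zeta> (Z $ 1) (Z $ 2)) has_derivative (\<lambda>V. V $ 1 + 0)) (at 0)"
    unfolding \<zeta>_def by (intro has_derivative_add nth vanish_has_derivative vanish_m)
  have B: "((\<lambda>Z::complex^3. \<zeta> (Z $ 1) (Z $ 2) * c + Z $ 2 * d) has_derivative (\<lambda>V. (V $ 1 + 0) * c + V $ 2 * d)) (at 0)" for c d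
    by (intro has_derivative_add has_derivative_mult_left \<zeta> nth)
  have 3: "((\<lambda>Z::complex^3. of_real \<epsilon> * Z $ 3 + P (Z $ 1) (Z $ 2)) has_derivative (\<lambda>V. of_real \<epsilon> * V $ 3 + 0)) (at 0)"
    by (intro has_derivative_add has_derivative_mult_right nth vanish_has_derivative vanish_P)
  have "hD G2 0 V $ 1 = V $ 1 * v1 + V $ 2 * u1" "hD G2 0 V $ 2 = V $ 1 * v2 + V $ 2 * u2"
    "hD G2 0 V $ 3 = of_real \<epsilon> * V $ 3"
    using dd_eqI[OF B] dd_eqI[OF 3] by (simp_all add: hD_def G2_nth Bv_nth)
  then have h: "V $ 1 * v1 + V $ 2 * u1 = 0" "V $ 1 * v2 + V $ 2 * u2 = 0" "V $ 3 = 0"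
    using assms \<epsilon> by auto
  have "V $ 1 * (v1 * u2 - v2 * u1) = 0" "V $ 2 * (v1 * u2 - v2 * u1) = 0"
    using h(1,2) by algebra+
  then show ?thesis using indep h(3) by (simp add: vec_eq_iff forall_3)
qed

section \<open>The normalized hypersurface and its remainder\<close>

definition A2 :: "(complex^3) set" where "A2 = {Z. G2 Z \<in> A}"

lemma open_A2: "open A2"
proof -
  have "continuous_on UNIV G2"
    by (simp add: continuous_on_eq_continuous_at holomorphic_map_isCont[OF holomorphic_G2])
  then show ?thesis using open_vimage[OF open_A, of G2] by (simp add: A2_def vimage_def)
qed

lemma A2_0: "0 \<in> A2" by (simp add: A2_def G2_0 A0)

lemma ranalytic_\<phi>2: assumes "Z \<in> A2" shows "ranalytic (\<lambda>Z. complex_of_real (\<phi>2 Z)) Z"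
proof -
  have "ranalytic (\<lambda>Z. complex_of_real \<epsilon> * (complex_of_real (\<phi> (G2 Z)) - complex_of_real (Im (P (Z $ 1) (Z $ 2))))) Z"
    using assms jhol_vi_ranalytic[OF jhol_P open_UNIV]
    by (intro ranalytic_mult ranalytic_diff ranalytic_const ranalytic_of_real_Im ranalytic_compose_holomorphic[OF \<phi>_ranalytic holomorphic_G2])
      (auto simp: A2_def)
  then show ?thesis by (simp add: \<phi>2_def)
qed

lemma \<phi>_embed_eq:
  assumes "Z $ 1 = Z' $ 1" "Z $ 2 = Z' $ 2" "Re (Z $ 3) = Re (Z' $ 3)" shows "\<phi> Z = \<phi> Z'"
proof -
  have "embed3 Z 0 = embed3 Z' 0" using assms by (simp add: embed3_def vec_eq_iff forall_3)
  then show ?thesis using \<phi>_inv by metis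
qed

lemma \<phi>2_embed_eq:
  assumes "Z $ 1 = Z' $ 1" "Z $ 2 = Z' $ 2" "Re (Z $ 3) = Re (Z' $ 3)" shows "\<phi>2 Z = \<phi>2 Z'"
proof -
  have "\<phi> (G2 Z) = \<phi> (G2 Z')" by (rule \<phi>_embed_eq) (simp_all add: G2_nth assms)
  then show ?thesis by (simp add: \<phi>2_def assms)
qed

lemma \<phi>2_inv: "\<phi>2 (embed3 Z 0) = \<phi>2 Z"
  by (rule \<phi>2_embed_eq) (simp_all add: embed3_def)

lemma \<rho>_zero_iff: "Z \<in> A2 \<Longrightarrow> \<rho> (G (G2 Z)) = 0 \<longleftrightarrow> Im (Z $ 3) = \<phi>2 Z"
  using \<epsilon> by (auto simp: A2_def iff G2_nth \<phi>2_def)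

definition M' :: "(complex^3) set" where "M' = {Z \<in> A2. Im (Z $ 3) = \<phi>2 Z}"

lemma hypersurface_M': "real_analytic_hypersurface M'"
  unfolding real_analytic_hypersurface_def local_defining_function_def real_analytic_on_def
proof (intro ballI exI conjI)
  fix Z p assume "p \<in> M'" "Z \<in> A2"
  have r: "ranalytic (\<lambda>Z. complex_of_real (\<phi>2 Z - Im (Z $ 3))) Z" by (rule ranalytic_graph[OF ranalytic_\<phi>2[OF \<open>Z \<in> A2\<close>]])
  show "real_analytic_at (\<lambda>Z. \<phi>2 Z - Im (Z $ 3)) Z" by (rule ranalytic_imp_real_analytic_at[OF r])
  show "frechet_derivative (\<lambda>Z. \<phi>2 Z - Im (Z $ 3)) (at Z) \<noteq> (\<lambda>_. 0)"
    unfolding frechet_derivative_nonzero_iff[OF r]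
    using d_hol_3_graph_nonzero[OF ranalytic_\<phi>2[OF \<open>Z \<in> A2\<close>] \<phi>2_inv] by blast
next
  fix p assume "p \<in> M'"
  then show "p \<in> A2" "M' \<inter> A2 = {Z \<in> A2. \<phi>2 Z - Im (Z $ 3) = 0}" by (auto simp: M'_def)
qed (rule open_A2)

text \<open>As \<open>\<phi>2\<close> ignores \<open>Im w\<close>, the real number \<open>s\<close>
  can stand for the third coordinate.\<close>

definition R :: "complex \<times> complex \<times> real \<Rightarrow> real" where
  "R = (\<lambda>(x, y, s). \<phi>2 (vector [x, y, of_real s]) - (cmod x)\<^sup>2 - 2 * Re (x\<^sup>2 * cnj y))"

lemma M'_eq:
  "M' \<inter> A2 = {Z \<in> A2. let z1 = Z $ 1; z2 = Z $ 2; w = Z $ 3 in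
     complex_of_real (Im w) = complex_of_real ((cmod z1)\<^sup>2) + (z1\<^sup>2 * cnj z2 + (cnj z1)\<^sup>2 * z2)
       + complex_of_real (R (z1, z2, Re w))}"
proof -
  have "complex_of_real (Im (Z $ 3)) = complex_of_real ((cmod (Z $ 1))\<^sup>2)
      + ((Z $ 1)\<^sup>2 * cnj (Z $ 2) + (cnj (Z $ 1))\<^sup>2 * Z $ 2) + complex_of_real (R (Z $ 1, Z $ 2, Re (Z $ 3)))
    \<longleftrightarrow> Im (Z $ 3) = \<phi>2 Z" for Z
  proof -
    have 1: "\<phi>2 (vector [Z $ 1, Z $ 2, of_real (Re (Z $ 3))]) = \<phi>2 Z"
      by (rule \<phi>2_embed_eq) simp_all
    have 2: "(Z $ 1)\<^sup>2 * cnj (Z $ 2) + (cnj (Z $ 1))\<^sup>2 * Z $ 2 = complex_of_real (2 * Re ((Z $ 1)\<^sup>2 * cnj (Z $ 2)))"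
      unfolding complex_add_cnj[symmetric] by simp
    show ?thesis unfolding 2 of_real_add[symmetric] of_real_eq_iff by (auto simp: R_def 1)
  qed
  then show ?thesis by (auto simp: M'_def Let_def)
qed

lemma real_analytic_R: "real_analytic_at R (0, 0, 0)"
proof (rule ranalytic_imp_real_analytic_at)
  let ?p = "(0, 0, 0) :: complex \<times> complex \<times> real"
  have x: "ranalytic (\<lambda>p :: complex \<times> complex \<times> real. fst p) ?p" by (rule ranalytic_bounded_linear[OF bounded_linear_fst])
  have y: "ranalytic (\<lambda>p :: complex \<times> complex \<times> real. fst (snd p)) ?p"
    by (rule ranalytic_bounded_linear[OF bounded_linear_compose[OF bounded_linear_fst bounded_linear_snd]])
  have s: "ranalytic (\<lambda>p :: complex \<times> complex \<times> real. complex_of_real (snd (snd p))) ?p"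
    by (rule ranalytic_bounded_linear[OF bounded_linear_compose[OF bounded_linear_of_real
        bounded_linear_compose[OF bounded_linear_snd bounded_linear_snd]]])
  let ?h = "\<lambda>p. vector [fst p, fst (snd p), of_real (snd (snd p))] :: complex^3"
  have h0: "?h ?p = 0" by (simp add: vec_eq_iff forall_3)
  have "ranalytic (\<lambda>p. complex_of_real (\<phi>2 (?h p))) ?p"
  proof (rule ranalytic_compose_vec[where h="?h" and f="\<lambda>Z. complex_of_real (\<phi>2 Z)"])
    show "ranalytic (\<lambda>Z. complex_of_real (\<phi>2 Z)) (?h ?p)" unfolding h0 by (rule ranalytic_\<phi>2[OF A2_0])
    fix l :: 3
    consider "l = 1" | "l = 2" | "l = 3" using exhaust_3 by blast
    then show "ranalytic (\<lambda>p. ?h p $ l) ?p" by cases (use x y s in simp_all)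
  qed
  then have "ranalytic (\<lambda>p. complex_of_real (\<phi>2 (?h p)) - fst p * cnj (fst p)
      - 2 * complex_of_real (Re (fst p ^ 2 * cnj (fst (snd p))))) ?p"
    by (intro ranalytic_diff ranalytic_mult ranalytic_const ranalytic_of_real_Re ranalytic_cnj ranalytic_power x y)
  moreover have "complex_of_real (R p) = complex_of_real (\<phi>2 (?h p)) - fst p * cnj (fst p)
      - 2 * complex_of_real (Re (fst p ^ 2 * cnj (fst (snd p))))" for p
    by (simp add: R_def split_beta complex_norm_square[symmetric])
  ultimately show "ranalytic (\<lambda>p. complex_of_real (R p)) ?p" by presburger
qed

lemma R_bigo: "R \<in> O[nhds (0, 0, 0)](\<lambda>(z1, z2, s). norm (z1, z2) ^ 4 + \<bar>s\<bar> * norm (z1, z2) ^ 2)"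
proof -
  obtain C d where C: "d > 0" "C \<ge> 0"
    "\<And>z. norm z < d \<Longrightarrow> \<bar>\<phi> z - (Re (q2 z) + Re (Herm z) + Re (q3 z) / 3 + Re (Y z))\<bar> \<le> C * norm z ^ 4"
    by (rule taylor_at_0) (rule that)
  obtain D d' where D: "d' > 0" "D \<ge> 0" "\<And>z s. norm z < d' \<Longrightarrow> \<bar>s\<bar> < d' \<Longrightarrow> z $ 3 = 0 \<Longrightarrow>
      \<bar>\<phi> (axis 3 (of_real s) + z) - \<phi> z\<bar> \<le> D * \<bar>s\<bar> * norm z ^ 2"
    by (rule transversal_estimate) (rule that)
  obtain a where a: "a \<ge> 0" "\<And>x y. norm (x, y) \<le> 1 \<Longrightarrow> norm (P x y) \<le> a * norm (x, y) ^ 2"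
    by (rule vanishE[OF vanish_P]) (rule that)
  obtain b where b: "b \<ge> 0" "\<And>x y. norm (x, y) \<le> 1 \<Longrightarrow> norm (Bv x y) \<le> b * norm (x, y)"
  proof -
    obtain b1 where b1: "b1 \<ge> 0" "\<And>x y. norm (x, y) \<le> 1 \<Longrightarrow> norm (Bv x y $ 1) \<le> b1 * norm (x, y) ^ 1"
      by (rule vanishE[OF vanish_Bv]) (rule that)
    obtain b2 where b2: "b2 \<ge> 0" "\<And>x y. norm (x, y) \<le> 1 \<Longrightarrow> norm (Bv x y $ 2) \<le> b2 * norm (x, y) ^ 1"
      by (rule vanishE[OF vanish_Bv]) (rule that)
    show ?thesis
    proof (rule that[of "b1 + b2"])
      fix x y :: complex assume xy: "norm (x, y) \<le> 1"
      have "norm (Bv x y) \<le> (\<Sum>k\<in>UNIV. norm (Bv x y $ k))"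
        unfolding norm_vec_def by (rule L2_set_le_sum) simp
      then show "norm (Bv x y) \<le> (b1 + b2) * norm (x, y)"
        using b1(2)[OF xy] b2(2)[OF xy] by (simp add: sum_3 Bv_nth(3) algebra_simps)
    qed (use b1 b2 in simp)
  qed
  obtain c where c: "c \<ge> 0" "\<And>x y. norm (x, y) \<le> 1 \<Longrightarrow>
      norm (complex_of_real (\<epsilon> * (Re (Herm (Bv x y)) + Re (Y (Bv x y))) - (cmod x)\<^sup>2 - 2 * Re (x\<^sup>2 * cnj y))) \<le> c * norm (x, y) ^ 4"
    by (rule vanishE[OF quartic]) (rule that)
  \<comment> \<open>The bounds ensure that \<open>Bv x y\<close> lies within the radii of both
    estimates and that |s'|, which is at most \<open>(a + 1) * \<delta>\<close>, stays below
    \<open>d'\<close>. Adding 1 to \<open>a\<close> and \<open>b\<close> keeps the denominators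
    positive.\<close>
  define \<delta> where "\<delta> = min (min 1 (d / (b + 1))) (min (d' / (b + 1)) (d' / (2 * (a + 1))))"
  have pos: "0 < b + 1" "0 < 2 * (a + 1)" using a b by simp_all
  have "0 < d / (b + 1)" "0 < d' / (b + 1)" "0 < d' / (2 * (a + 1))"
    using C(1) D(1) pos by (simp_all only: divide_pos_pos)
  then have \<delta>: "\<delta> > 0" "\<delta> \<le> 1" unfolding \<delta>_def by (simp_all only: min_less_iff_conj zero_less_one min_le_iff_disj order_refl simp_thms)
  have "\<delta> \<le> d / (b + 1)" "\<delta> \<le> d' / (b + 1)" "\<delta> \<le> d' / (2 * (a + 1))"
    unfolding \<delta>_def by (simp_all only: min_le_iff_disj order_refl simp_thms)
  then have \<delta>': "\<delta> * (b + 1) \<le> d" "\<delta> * (b + 1) \<le> d'" "\<delta> * (2 * (a + 1)) \<le> d'"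
    by (simp_all only: pos_le_divide_eq pos)
  note \<delta> = \<delta> \<delta>'
  define L where "L = D * b ^ 2 * (1 + a) + C * b ^ 4 + c"
  have "eventually (\<lambda>p. p \<in> ball (0, 0, 0) \<delta>) (nhds (0, 0, 0 :: real))"
    using \<delta>(1) by (intro eventually_nhds_in_open) auto
  then have "eventually (\<lambda>p. norm (R p) \<le> L * norm ((\<lambda>(z1, z2, s). norm (z1, z2) ^ 4 + \<bar>s\<bar> * norm (z1, z2) ^ 2) p))
     (nhds (0, 0, 0))"
  proof (rule eventually_mono)
    fix p :: "complex \<times> complex \<times> real" assume p: "p \<in> ball (0, 0, 0) \<delta>"
    obtain x y s where pxy: "p = (x, y, s)" by (cases p) auto
    define t where "t = norm (x, y)"
    have "norm p < \<delta>" using p by (simp add: zero_prod_def[symmetric])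
    have s: "\<bar>s\<bar> < \<delta>"
      using norm_snd_le[of s y] norm_snd_le[of "(y, s)" x] \<open>norm p < \<delta>\<close> by (simp add: pxy)
    have "t \<le> norm p" unfolding t_def pxy by (simp add: norm_Pair real_sqrt_le_mono)
    then have t: "0 \<le> t" "t < \<delta>" "t \<le> 1" using \<open>norm p < \<delta>\<close> \<delta>(2) by (auto simp: t_def)
    have t1: "norm (x, y) \<le> 1" using t by (simp add: t_def)
    let ?B = "Bv x y"
    have B: "norm ?B \<le> b * t" using b(2)[OF t1] by (simp add: t_def)
    have "b * t \<le> (b + 1) * t" using t by (simp add: algebra_simps)
    also have "\<dots> < (b + 1) * \<delta>" using t b by simp
    finally have B_small: "norm ?B < d" "norm ?B < d'" using B \<delta>(3,4) by (simp_all add: mult.commute)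
    \<comment> \<open>The real part of the third coordinate of \<open>G2\<close>. The shift by
      \<open>Re (P x y)\<close> is O(t^2), so after multiplication by \<open>norm ?B ^ 2\<close> it
      costs only O(t^4).\<close>
    define s' where "s' = \<epsilon> * s + Re (P x y)"
    have PR: "norm (P x y) \<le> a * t ^ 2" using a(2)[OF t1] by (simp add: t_def)
    have "\<bar>s'\<bar> \<le> \<bar>\<epsilon> * s\<bar> + \<bar>Re (P x y)\<bar>" unfolding s'_def by (rule abs_triangle_ineq)
    then have s': "\<bar>s'\<bar> \<le> \<bar>s\<bar> + a * t ^ 2"
      using PR abs_Re_le_cmod[of "P x y"] by (simp add: abs_mult \<epsilon>2)
    have "t ^ 2 \<le> t" using t by (simp add: power2_eq_square mult_left_le)
    then have "a * t ^ 2 \<le> a * \<delta>" using t a by (intro mult_left_mono) auto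
    then have s'_small: "\<bar>s'\<bar> < d'" using s' s \<delta>(1,5) a by (simp add: algebra_simps)
    have 1: "\<bar>\<phi> (axis 3 (of_real s') + ?B) - \<phi> ?B\<bar> \<le> D * \<bar>s'\<bar> * norm ?B ^ 2"
      by (rule D(3)[OF B_small(2) s'_small]) (simp add: Bv_nth)
    have G2: "\<phi> (G2 (vector [x, y, of_real s])) = \<phi> (axis 3 (of_real s') + ?B)"
      by (rule \<phi>_embed_eq) (simp_all add: G2_nth Bv_nth s'_def axis_def)
    \<comment> \<open>Three errors: moving along the axis (\<open>transversal_estimate\<close>),
      Taylor's formula at \<open>Re w = 0\<close> (\<open>taylor_at_0\<close>), and the algebraic
      remainder (\<open>quartic\<close>). The terms \<open>q2\<close> and \<open>q3\<close> cancel
      against \<open>Im P\<close>.\<close>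
    have "R p = \<epsilon> * (\<phi> (axis 3 (of_real s') + ?B) - \<phi> ?B)
        + \<epsilon> * (\<phi> ?B - (Re (q2 ?B) + Re (Herm ?B) + Re (q3 ?B) / 3 + Re (Y ?B)))
        + (\<epsilon> * (Re (Herm ?B) + Re (Y ?B)) - (cmod x)\<^sup>2 - 2 * Re (x\<^sup>2 * cnj y))"
      by (simp add: R_def pxy \<phi>2_def G2 P_def algebra_simps)
    then have "\<bar>R p\<bar> \<le> \<bar>\<epsilon> * (\<phi> (axis 3 (of_real s') + ?B) - \<phi> ?B)\<bar>
        + \<bar>\<epsilon> * (\<phi> ?B - (Re (q2 ?B) + Re (Herm ?B) + Re (q3 ?B) / 3 + Re (Y ?B)))\<bar>
        + \<bar>\<epsilon> * (Re (Herm ?B) + Re (Y ?B)) - (cmod x)\<^sup>2 - 2 * Re (x\<^sup>2 * cnj y)\<bar>"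
      by (simp only: order_trans[OF abs_triangle_ineq add_right_mono[OF abs_triangle_ineq]])
    also have "\<dots> = \<bar>\<phi> (axis 3 (of_real s') + ?B) - \<phi> ?B\<bar>
        + \<bar>\<phi> ?B - (Re (q2 ?B) + Re (Herm ?B) + Re (q3 ?B) / 3 + Re (Y ?B))\<bar>
        + \<bar>\<epsilon> * (Re (Herm ?B) + Re (Y ?B)) - (cmod x)\<^sup>2 - 2 * Re (x\<^sup>2 * cnj y)\<bar>"
      by (simp only: abs_mult \<epsilon>2 mult_1)
    also have "\<dots> \<le> D * \<bar>s'\<bar> * norm ?B ^ 2 + C * norm ?B ^ 4 + c * t ^ 4"
      using 1 C(3)[OF B_small(1)] c(2)[OF t1] unfolding norm_of_real t_def by (intro add_mono)
    also have "\<dots> \<le> D * (\<bar>s\<bar> + a * t ^ 2) * (b * t) ^ 2 + C * (b * t) ^ 4 + c * t ^ 4"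
      using s' B D C a by (intro add_mono mult_mono power_mono order_refl) auto
    also have "\<dots> = D * b ^ 2 * (\<bar>s\<bar> * t ^ 2) + (D * b ^ 2 * a + C * b ^ 4 + c) * t ^ 4"
      by (simp add: algebra_simps power_mult_distrib power_add[symmetric])
    also have "\<dots> \<le> L * (\<bar>s\<bar> * t ^ 2) + L * t ^ 4"
      using C D a c by (intro add_mono mult_right_mono) (auto simp: L_def algebra_simps)
    also have "\<dots> = L * (t ^ 4 + \<bar>s\<bar> * t ^ 2)" by (simp add: algebra_simps)
    finally show "norm (R p) \<le> L * norm ((\<lambda>(z1, z2, s). norm (z1, z2) ^ 4 + \<bar>s\<bar> * norm (z1, z2) ^ 2) p)"
      using t by (simp add: pxy t_def[symmetric])
  qed
  then show ?thesis by (rule bigoI)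
qed

text \<open>The change of coordinates built so far, \<open>G\<close> after \<open>G2\<close>, leads
  from the new coordinates to the old ones; its local inverse is the required germ.\<close>

lemma equivalent_M':
  assumes U: "open U" "p0 \<in> U" "M \<inter> U = {p \<in> U. \<rho> p = 0}"
  shows "biholomorphically_equivalent M p0 M' 0"
proof -
  define F where "F Z = G (G2 Z)" for Z
  have holF: "holomorphic_map_on F A2"
    unfolding F_def
    by (rule holomorphic_map_compose[OF holomorphic_map_subset[OF holomorphic_G2] holG]) (auto simp: A2_def)
  have F0: "F 0 = p0" by (simp add: F_def G2_0 G0)
  define W where "W = A2 \<inter> F -` U"
  have "continuous_on A2 F"
    by (intro continuous_at_imp_continuous_on ballI holomorphic_map_isCont[OF holF])
  then have W: "open W" "0 \<in> W" "W \<subseteq> A2"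
    using continuous_on_open_vimage[OF open_A2] U(1,2) A2_0 F0 unfolding W_def by (auto simp: Int_commute)
  have inj: "V = 0" if "hD F 0 V = 0" for V
  proof -
    have "hD F 0 V = hD G (G2 0) (hD G2 0 V)"
      unfolding F_def by (rule hD_compose[OF holomorphic_G2 _ holG]) (simp_all add: G2_0 A0)
    then have "hD G 0 (hD G2 0 V) = 0" using that by (simp add: G2_0)
    then have "hD G2 0 V = hD H (G 0) 0" using hD_inverse(1)[OF A0] by metis
    also have "\<dots> = 0"
      using hD_bounded_linear[OF holH] HG(2)[OF A0] linear_0 bounded_linear.linear by blast
    finally show ?thesis by (rule hD_G2_injective)
  qed
  obtain U' V E where E: "open U'" "0 \<in> U'" "U' \<subseteq> W" "open V" "homeomorphism U' V F E" "holomorphic_map_on E V"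
    by (rule holomorphic_local_inverse[OF holomorphic_map_subset[OF holF W(3)] W(1,2) inj]) (assumption | rule that)+
  have FE: "E (F Z) = Z" "F Z \<in> V" if "Z \<in> U'" for Z using E(5) that by (auto simp: homeomorphism_def)
  have EF: "F (E p) = p" "E p \<in> U'" if "p \<in> V" for p using E(5) that by (auto simp: homeomorphism_def)
  show ?thesis
    unfolding biholomorphically_equivalent_def
  proof (intro exI conjI)
    show "p0 \<in> V" "E p0 = 0" using FE[OF E(2)] by (simp_all add: F0)
    show "homeomorphism V U' E F" using E(5) by (rule homeomorphism_symD)
    show "holomorphic_map_on F U'" by (rule holomorphic_map_subset[OF holF]) (use E W in auto)
    show "E ` (M \<inter> V) \<subseteq> M'"
    proof
      fix Z assume "Z \<in> E ` (M \<inter> V)"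
      then obtain p where p: "p \<in> M" "p \<in> V" "Z = E p" by auto
      have Z: "Z \<in> W" "F Z = p" using EF[OF p(2)] p(3) E(3) by auto
      then have "p \<in> U" "Z \<in> A2" by (auto simp: W_def)
      then show "Z \<in> M'" using \<rho>_zero_iff[of Z] U(3) p(1) Z(2) by (auto simp: M'_def F_def)
    qed
  qed (fact E)+
qed

end

text \<open>Reads the jets at 0 as the data of \<open>degenerate_cubic_algebra\<close>, with vectors
  of zero third component. Its nondegeneracy hypothesis is the contrapositive of
  \<open>nondegenerate_jets\<close>.\<close>

lemma (in adapted) normal_vectors:
  assumes ldf: "local_defining_function M p0 U \<rho>" and basis: "cr_basis_near M p0 \<rho> L"
    and span: "gradients_span \<rho> L p0 2"
    and deg: "open W" "p0 \<in> W" "\<And>p. p \<in> M \<inter> W \<Longrightarrow> levi_degenerate_at M p"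
  obtains \<epsilon> v1 v2 u1 u2 where "normalized \<rho> p0 A B G H \<phi> \<epsilon> v1 v2 u1 u2"
proof -
  have U: "open U" "p0 \<in> U" "\<And>p. p \<in> U \<Longrightarrow> \<rho> p = 0 \<Longrightarrow> p \<in> M"
    using ldf unfolding local_defining_function_def by auto
  have jets: "Q 1 1 * Q 2 2 = Q 1 2 * Q 2 1"
      "Q 1 1 * \<Lambda> 2 2 z + \<Lambda> 1 1 z * Q 2 2 = Q 1 2 * \<Lambda> 2 1 z + \<Lambda> 1 2 z * Q 2 1"
      "Q 1 1 = 0 \<longrightarrow> Q 1 2 = 0 \<longrightarrow> Q 2 1 = 0 \<longrightarrow> Q 2 2 = 0 \<longrightarrow> \<Lambda> 1 1 z * \<Lambda> 2 2 z = \<Lambda> 1 2 z * \<Lambda> 2 1 z"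
    if "z $ 3 = 0" for z
  proof -
    note rules = levi_degenerate_jets[where W=W and U=U and z=z and M=M]
    show "Q 1 1 * Q 2 2 = Q 1 2 * Q 2 1" by (rule rules(1)) (use deg U that in auto)
    show "Q 1 1 * \<Lambda> 2 2 z + \<Lambda> 1 1 z * Q 2 2 = Q 1 2 * \<Lambda> 2 1 z + \<Lambda> 1 2 z * Q 2 1"
      by (rule rules(2)) (use deg U that in auto)
    show "Q 1 1 = 0 \<longrightarrow> Q 1 2 = 0 \<longrightarrow> Q 2 1 = 0 \<longrightarrow> Q 2 2 = 0 \<longrightarrow> \<Lambda> 1 1 z * \<Lambda> 2 2 z = \<Lambda> 1 2 z * \<Lambda> 2 1 z"
      by (intro impI, rule rules(3)) (use deg U that in auto)
  qed
  have real: "Q k k = of_real (Re (Q k k))" for k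
    using Q_herm[of k k] by (metis Reals_cnj_iff of_real_Re)
  have sym: "c3 l 2 1 = c3 l 1 2" for l by (rule c3_sym)
  let ?z = "\<lambda>z w. vector [z, w, 0] :: complex^3"
  have Q21: "Q 2 1 = cnj (Q 1 2)" by (rule Q_herm)
  have \<Lambda>: "\<Lambda> 1 1 (?z z w) = z * cnj (c3 1 1 1) + w * cnj (c3 1 1 2) + cnj z * c3 1 1 1 + cnj w * c3 1 1 2"
    "\<Lambda> 1 2 (?z z w) = z * cnj (c3 2 1 1) + w * cnj (c3 2 1 2) + cnj z * c3 1 1 2 + cnj w * c3 1 2 2"
    "\<Lambda> 2 1 (?z z w) = z * cnj (c3 1 1 2) + w * cnj (c3 1 2 2) + cnj z * c3 2 1 1 + cnj w * c3 2 1 2"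
    "\<Lambda> 2 2 (?z z w) = z * cnj (c3 2 1 2) + w * cnj (c3 2 2 2) + cnj z * c3 2 1 2 + cnj w * c3 2 2 2" for z w
    by (simp_all add: \<Lambda>_c3 sum_3 sym)
  have z3: "?z z w $ 3 = 0" for z w by simp
  have "\<exists>\<epsilon> v1 v2 u1 u2. normalized_axioms \<phi> \<epsilon> v1 v2 u1 u2"
  proof (rule degenerate_cubic_algebra[where a="Re (Q 1 1)" and d="Re (Q 2 2)" and b="Q 1 2"
        and p="c3 1 1 1" and q="c3 1 1 2" and s="c3 1 2 2" and p'="c3 2 1 1" and q'="c3 2 1 2" and s'="c3 2 2 2"], goal_cases)
    case 1
    then show ?case using jets(1)[OF z3] by (simp add: real[symmetric] Q21)
  next
    case (2 z w)
    then show ?case using jets(2)[OF z3[of z w]] by (simp add: real[symmetric] Q21 \<Lambda>)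
  next
    case (3 z w)
    then have "Q 1 1 = 0" "Q 1 2 = 0" "Q 2 1 = 0" "Q 2 2 = 0" using real[of 1] real[of 2] Q21 by auto
    then show ?case using jets(3)[OF z3[of z w]] by (simp add: \<Lambda>)
  next
    case (4 a1 a2)
    let ?u = "?z a1 a2"
    show ?case
    proof (rule ccontr)
      assume "\<not> ?case"
      then have c: "a1 * c3 1 1 1 + a2 * c3 2 1 1 = 0" "a1 * c3 1 1 2 + a2 * c3 2 1 2 = 0" "a1 * c3 1 2 2 + a2 * c3 2 2 2 = 0"
        by auto
      show False
      proof (rule nondegenerate_jets[OF ldf basis span z3])
        show "?u \<noteq> 0" using 4(1) by (auto simp: vec_eq_iff forall_3)
        show "?u $ 1 * Q 1 k + ?u $ 2 * Q 2 k = 0" if "k \<noteq> 3" for k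
          using 4(2,3) that exhaust_3[of k] by (auto simp: real[symmetric] Q21)
        show "d_bar j (d_bar k (hol_dd ?u \<Phi>)) 0 = 0" if "j \<noteq> 3" "k \<noteq> 3" for j k
          using c that exhaust_3[of j] exhaust_3[of k] by (auto simp: d_bar_d_bar_hol_dd sum_3 sym)
      qed
    qed
  next
    case (5 \<epsilon> v1 v2 u1 u2)
    then show ?case
      by (intro exI[of _ \<epsilon>] exI[of _ v1] exI[of _ v2] exI[of _ u1] exI[of _ u2] normalized_axioms.intro)
        (simp_all add: real[symmetric] Q21)
  qed
  then show ?thesis using that adapted_axioms normalized.intro by blast
qed

theorem theorem4p2p8:
  fixes M :: "(complex^3) set" and p0 :: "complex^3"
  assumes "real_analytic_hypersurface M"
    and "p0 \<in> M"
    and "\<exists>V. open V \<and> p0 \<in> V \<and> (\<forall>p\<in>M \<inter> V. levi_degenerate_at M p)"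
    and "nondegenerate_at 2 M p0"
  shows "\<exists>M' :: (complex^3) set.
    real_analytic_hypersurface M' \<and>
    (\<exists>U (R :: complex \<times> complex \<times> real \<Rightarrow> real).
       open U \<and> 0 \<in> U \<and>
       real_analytic_at R (0, 0, 0) \<and>
       R \<in> O[nhds (0, 0, 0)](\<lambda>(z1, z2, s). norm (z1, z2) ^ 4 + \<bar>s\<bar> * norm (z1, z2) ^ 2) \<and>
       M' \<inter> U = {Z\<in>U. let z1 = Z $ 1; z2 = Z $ 2; w = Z $ 3 in
         complex_of_real (Im w) =
           complex_of_real ((cmod z1)\<^sup>2) + (z1\<^sup>2 * cnj z2 + (cnj z1)\<^sup>2 * z2)
           + complex_of_real (R (z1, z2, Re w))}) \<and>
    biholomorphically_equivalent M p0 M' 0"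
proof -
  obtain W where W: "open W" "p0 \<in> W" "\<And>p. p \<in> M \<inter> W \<Longrightarrow> levi_degenerate_at M p" using assms(3) by blast
  \<comment> \<open>The chart is built from the defining function that witnesses 2-nondegeneracy, so
    only the Levi degeneracy calls for a comparison of defining functions.\<close>
  obtain U \<rho> L where ldf: "local_defining_function M p0 U \<rho>" and basis: "cr_basis_near M p0 \<rho> L"
    and span: "gradients_span \<rho> L p0 2"
    using assms(4) unfolding nondegenerate_at_def by blast
  have U: "open U" "p0 \<in> U" "M \<inter> U = {p \<in> U. \<rho> p = 0}" "real_analytic_at \<rho> p0" "frechet_derivative \<rho> (at p0) \<noteq> (\<lambda>_. 0)"
    using ldf unfolding local_defining_function_def real_analytic_on_def by auto
  have \<rho>: "ranalytic (\<lambda>Z. complex_of_real (\<rho> Z)) p0" by (rule real_analytic_at_imp_ranalytic[OF U(4) bounded_linear_of_real])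
  have \<rho>0: "\<rho> p0 = 0" using U(2,3) assms(2) by blast
  obtain l where l: "d_hol l (\<lambda>Z. complex_of_real (\<rho> Z)) p0 \<noteq> 0"
    using U(5) frechet_derivative_nonzero_iff[OF \<rho>] by blast
  obtain A B G H \<phi> where "adapted \<rho> p0 A B G H \<phi>"
    by (rule adapted_chart[OF \<rho> \<rho>0 l]) (rule that, rule adapted.intro)
  then interpret adapted \<rho> p0 A B G H \<phi> .
  obtain \<epsilon> v1 v2 u1 u2 where "normalized \<rho> p0 A B G H \<phi> \<epsilon> v1 v2 u1 u2"
    by (rule normal_vectors[OF ldf basis span W]) (assumption | rule that)+
  then interpret normalized \<rho> p0 A B G H \<phi> \<epsilon> v1 v2 u1 u2 .
  show ?thesis
    using hypersurface_M' open_A2 A2_0 real_analytic_R R_bigo M'_eq equivalent_M'[OF U(1-3)] by blast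
qed

end
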